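(* Let $C$ be an octonion algebra over a unital commutative ring $R$, with norm $q_C$. The map $$F:\mathbf{Spin}(q_C)\to\mathbf{RT}'(C),$$ defined, for each $R$-ring $S$ and each $u\in\mathbf{Spin}(q_C)(S)$, by $$F_S(u)=(u_1(S),u_2(S),u_3(S)),$$ is an isomorphism of affine group schemes.
   Context: An $R$-ring is a unital commutative associative $R$-algebra. An octonion algebra over $R$ is a unital (not necessarily associative) $R$-algebra $C$ whose underlying module is projective of constant rank 8, endowed with a regular multiplicative quadratic form $q=q_C$ (regular: the polar form $b_q(x,y)=q(x+y)-q(x)-q(y)$ induces an isomorphism $C\to\mathrm{Hom}_R(C,R)$). Its natural involution is $\kappa:x\mapsto\overline{x}=b_q(x,1)1-x$. $C_S=C\otimes_RS$; $L_x$ denotes left multiplication by $x$. $\mathrm{Cl}(C,q)$ is the Clifford algebra with multiplication $\cdot$, $\mathrm{Cl}_0(C,q)$ its even part, and $\sigma$ its main involution (the anti-automorphism which is the identity on $C$). One identifies $\mathrm{Cl}(C_S,q_S)$ with $\mathrm{Cl}(C,q)\otimes_RS$. The group schemes are defined by $$\mathbf{Spin}(q)(S)=\{u\in\mathrm{Cl}_0(C,q)_S^*\mid u\cdot C_S\cdot u^{-1}=C_S,\ u\sigma(u)=1\},$$ $$\mathbf{RT}'(C)(S)=\{(t_1,t_2,t_3)\in\mathbf{O}(q)(S)^3\mid t_1(xy)=\overline{t_2(\overline{x})}\;\overline{t_3(\overline{y})}\ \ \forall x,y\in C_S\}.$$ The linear map $\alpha:C_S\to\mathrm{End}_S(C_S\oplus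 C_S)$, $x\mapsto\begin{pmatrix}0&L_{\overline{x}}\kappa\\ \kappa L_x&0\end{pmatrix}$, satisfies $\alpha(x)^2=q(x)\mathrm{Id}$ and induces an isomorphism of algebras $\alpha':\mathrm{Cl}(C_S,q)\to\mathrm{End}_S(C_S\oplus C_S)$, which maps $\mathrm{Cl}_0$ onto the block-diagonal endomorphisms. For $u\in\mathbf{Spin}(q)(S)$, define $u_1=u_1(S):C_S\to C_S$ by $u_1(x)=u\cdot x\cdot u^{-1}$, and $u_2=u_2(S)$, $u_3=u_3(S)\in\mathrm{End}_S(C_S)$ by $\alpha'(u)=\begin{pmatrix}u_3&0\\0&u_2\end{pmatrix}$. *)

theory Defs
  imports "HOL-Algebra.Algebra"
begin

section \<open>Modules and algebras over a commutative ring\<close>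

text \<open>
  Functions between structures are \<^term>\<open>extensional\<close>, so that equality of maps is equality of HOL
  functions.  The multiplicative fields of the record \<^typ>\<open>('r, 'm) module\<close> are meaningful
  only when the record represents an algebra; where a mere module is built they are dummies.
\<close>

definition lin_hom ::
  "('r, 'z) ring_scheme \<Rightarrow> ('r, 'm) module \<Rightarrow> ('r, 'n) module \<Rightarrow> ('m \<Rightarrow> 'n) set" where
  "lin_hom R M N = {f \<in> carrier M \<rightarrow>\<^sub>E carrier N.
     (\<forall>x\<in>carrier M. \<forall>y\<in>carrier M. f (x \<oplus>\<^bsub>M\<^esub> y) = f x \<oplus>\<^bsub>N\<^esub> f y) \<and>
     (\<forall>r\<in>carrier R. \<forall>x\<in>carrier M. f (r \<odot>\<^bsub>M\<^esub> x) = r \<odot>\<^bsub>N\<^esub> f x)}"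

definition alg_hom ::
  "('r, 'z) ring_scheme \<Rightarrow> ('r, 'a) module \<Rightarrow> ('r, 'b) module \<Rightarrow> ('a \<Rightarrow> 'b) set" where
  "alg_hom R A B = {f \<in> ring_hom A B \<inter> extensional (carrier A).
     \<forall>r\<in>carrier R. \<forall>x\<in>carrier A. f (r \<odot>\<^bsub>A\<^esub> x) = r \<odot>\<^bsub>B\<^esub> f x}"

definition self_module :: "('r, 'z) ring_scheme \<Rightarrow> ('r, 'r) module" where
  "self_module R = \<lparr>carrier = carrier R, monoid.mult = monoid.mult R, one = \<one>\<^bsub>R\<^esub>, ring.zero = \<zero>\<^bsub>R\<^esub>, ring.add = ring.add R,
     smult = monoid.mult R\<rparr>"

definition free_module :: "('r, 'z) ring_scheme \<Rightarrow> nat \<Rightarrow> ('r, nat \<Rightarrow> 'r) module" where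
  "free_module R n = \<lparr>carrier = {..<n} \<rightarrow>\<^sub>E carrier R,
     monoid.mult = (\<lambda>v w. undefined), one = undefined,
     ring.zero = (\<lambda>i\<in>{..<n}. \<zero>\<^bsub>R\<^esub>),
     ring.add = (\<lambda>v w. \<lambda>i\<in>{..<n}. v i \<oplus>\<^bsub>R\<^esub> w i),
     smult = (\<lambda>r v. \<lambda>i\<in>{..<n}. r \<otimes>\<^bsub>R\<^esub> v i)\<rparr>"

definition direct_sum :: "('r, 'm) module \<Rightarrow> ('r, 'n) module \<Rightarrow> ('r, 'm \<times> 'n) module" where
  "direct_sum M N = \<lparr>carrier = carrier M \<times> carrier N,
     monoid.mult = (\<lambda>v w. undefined), one = undefined,
     ring.zero = (\<zero>\<^bsub>M\<^esub>, \<zero>\<^bsub>N\<^esub>),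
     ring.add = (\<lambda>v w. (fst v \<oplus>\<^bsub>M\<^esub> fst w, snd v \<oplus>\<^bsub>N\<^esub> snd w)),
     smult = (\<lambda>r v. (r \<odot>\<^bsub>M\<^esub> fst v, r \<odot>\<^bsub>N\<^esub> snd v))\<rparr>"

definition End_alg :: "('r, 'z) ring_scheme \<Rightarrow> ('r, 'm) module \<Rightarrow> ('r, 'm \<Rightarrow> 'm) module" where
  "End_alg R M = \<lparr>carrier = lin_hom R M M,
     monoid.mult = compose (carrier M), one = (\<lambda>x\<in>carrier M. x),
     ring.zero = (\<lambda>x\<in>carrier M. \<zero>\<^bsub>M\<^esub>),
     ring.add = (\<lambda>f g. \<lambda>x\<in>carrier M. f x \<oplus>\<^bsub>M\<^esub> g x),
     smult = (\<lambda>r f. \<lambda>x\<in>carrier M. r \<odot>\<^bsub>M\<^esub> f x)\<rparr>"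

text \<open>Finitely generated projective: a direct summand (retract) of a finite free module.\<close>

definition fg_projective :: "('r, 'z) ring_scheme \<Rightarrow> ('r, 'm) module \<Rightarrow> bool" where
  "fg_projective R M \<longleftrightarrow> (\<exists>n. \<exists>i \<in> lin_hom R M (free_module R n). \<exists>p \<in> lin_hom R (free_module R n) M.
     \<forall>x\<in>carrier M. p (i x) = x)"

definition free_of_rank :: "('r, 'z) ring_scheme \<Rightarrow> ('r, 'm) module \<Rightarrow> nat \<Rightarrow> bool" where
  "free_of_rank R M n \<longleftrightarrow>
     (\<exists>f \<in> lin_hom R (free_module R n) M. bij_betw f (carrier (free_module R n)) (carrier M))"


section \<open>Base change\<close>

text \<open>
  \<open>M \<otimes>\<^sub>R S\<close> as the free abelian group on pairs \<open>(x, s)\<close> modulo the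
  subgroup generated by the bilinearity relations; elements are cosets.
\<close>

type_synonym ('m, 's) tens = "(('m \<times> 's) \<Rightarrow>\<^sub>0 int) set"

definition tensor_relations ::
  "('r, 'z) ring_scheme \<Rightarrow> ('r, 'm) module \<Rightarrow> ('r, 's) module \<Rightarrow> (('m \<times> 's) \<Rightarrow>\<^sub>0 int) set" where
  "tensor_relations R M S =
     {frag_of (x \<oplus>\<^bsub>M\<^esub> y, s) - frag_of (x, s) - frag_of (y, s) | x y s.
        x \<in> carrier M \<and> y \<in> carrier M \<and> s \<in> carrier S} \<union>
     {frag_of (x, s \<oplus>\<^bsub>S\<^esub> t) - frag_of (x, s) - frag_of (x, t) | x s t.
        x \<in> carrier M \<and> s \<in> carrier S \<and> t \<in> carrier S} \<union>
     {frag_of (r \<odot>\<^bsub>M\<^esub> x, s) - frag_of (x, r \<odot>\<^bsub>S\<^esub> s) | r x s.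
        r \<in> carrier R \<and> x \<in> carrier M \<and> s \<in> carrier S}"

abbreviation pair_group :: "('r, 'm) module \<Rightarrow> ('r, 's) module \<Rightarrow> (('m \<times> 's) \<Rightarrow>\<^sub>0 int) monoid" where
  "pair_group M S \<equiv> free_Abelian_group (carrier M \<times> carrier S)"

definition tensor_kernel ::
  "('r, 'z) ring_scheme \<Rightarrow> ('r, 'm) module \<Rightarrow> ('r, 's) module \<Rightarrow> (('m \<times> 's) \<Rightarrow>\<^sub>0 int) set" where
  "tensor_kernel R M S = generate (pair_group M S) (tensor_relations R M S)"

definition tensor_class ::
  "('r, 'z) ring_scheme \<Rightarrow> ('r, 'm) module \<Rightarrow> ('r, 's) module \<Rightarrow> (('m \<times> 's) \<Rightarrow>\<^sub>0 int)
     \<Rightarrow> ('m, 's) tens" where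
  "tensor_class R M S a = tensor_kernel R M S #>\<^bsub>pair_group M S\<^esub> a"

definition tensor ::
  "('r, 'z) ring_scheme \<Rightarrow> ('r, 'm) module \<Rightarrow> ('r, 's) module \<Rightarrow> 'm \<Rightarrow> 's
     \<Rightarrow> ('m, 's) tens" where
  "tensor R M S x s = tensor_class R M S (frag_of (x, s))"

definition rep :: "'a set \<Rightarrow> 'a" where
  "rep A = (SOME a. a \<in> A)"

text \<open>
  The result is an \<open>S\<close>-module, and an \<open>S\<close>-algebra if \<open>M\<close> is an \<open>R\<close>-algebra:
  \<open>(x \<otimes> s)(y \<otimes> t) = xy \<otimes> st\<close> and \<open>t (x \<otimes> s) = x \<otimes> ts\<close>.
\<close>

definition base_change ::
  "('r, 'z) ring_scheme \<Rightarrow> ('r, 'm) module \<Rightarrow> ('r, 's) module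
     \<Rightarrow> ('s, ('m, 's) tens) module" where
  "base_change R M S = \<lparr>
     carrier = carrier (pair_group M S Mod tensor_kernel R M S),
     monoid.mult = (\<lambda>A B. tensor_class R M S
       (frag_extend (\<lambda>(x, s). frag_extend (\<lambda>(y, t). frag_of (x \<otimes>\<^bsub>M\<^esub> y, s \<otimes>\<^bsub>S\<^esub> t)) (rep B)) (rep A))),
     one = tensor R M S \<one>\<^bsub>M\<^esub> \<one>\<^bsub>S\<^esub>,
     ring.zero = \<one>\<^bsub>pair_group M S Mod tensor_kernel R M S\<^esub>,
     ring.add = monoid.mult (pair_group M S Mod tensor_kernel R M S),
     smult = (\<lambda>t A. tensor_class R M S (frag_extend (\<lambda>(x, s). frag_of (x, t \<otimes>\<^bsub>S\<^esub> s)) (rep A)))\<rparr>"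

definition base_change_map ::
  "('r, 'z) ring_scheme \<Rightarrow> ('r, 'm) module \<Rightarrow> ('r, 's) module \<Rightarrow> ('r, 't) module \<Rightarrow> ('s \<Rightarrow> 't)
     \<Rightarrow> ('m, 's) tens \<Rightarrow> ('m, 't) tens" where
  "base_change_map R M S T h = (\<lambda>A\<in>carrier (base_change R M S).
     tensor_class R M T (frag_extend (\<lambda>(x, s). frag_of (x, h s)) (rep A)))"


section \<open>Localization and constant rank\<close>

definition loc_class :: "('r, 'z) ring_scheme \<Rightarrow> 'r set \<Rightarrow> 'r \<Rightarrow> 'r \<Rightarrow> ('r \<times> 'r) set" where
  "loc_class R p a s = {(b, t). b \<in> carrier R \<and> t \<in> carrier R - p \<and>
     (\<exists>u \<in> carrier R - p. u \<otimes>\<^bsub>R\<^esub> (a \<otimes>\<^bsub>R\<^esub> t \<ominus>\<^bsub>R\<^esub> b \<otimes>\<^bsub>R\<^esub> s) = \<zero>\<^bsub>R\<^esub>)}"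

definition localization :: "('r, 'z) ring_scheme \<Rightarrow> 'r set \<Rightarrow> ('r, ('r \<times> 'r) set) module" where
  "localization R p = \<lparr>
     carrier = {loc_class R p a s | a s. a \<in> carrier R \<and> s \<in> carrier R - p},
     monoid.mult = (\<lambda>A B. loc_class R p (fst (rep A) \<otimes>\<^bsub>R\<^esub> fst (rep B)) (snd (rep A) \<otimes>\<^bsub>R\<^esub> snd (rep B))),
     one = loc_class R p \<one>\<^bsub>R\<^esub> \<one>\<^bsub>R\<^esub>,
     ring.zero = loc_class R p \<zero>\<^bsub>R\<^esub> \<one>\<^bsub>R\<^esub>,
     ring.add = (\<lambda>A B. loc_class R p
       (fst (rep A) \<otimes>\<^bsub>R\<^esub> snd (rep B) \<oplus>\<^bsub>R\<^esub> fst (rep B) \<otimes>\<^bsub>R\<^esub> snd (rep A))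
       (snd (rep A) \<otimes>\<^bsub>R\<^esub> snd (rep B))),
     smult = (\<lambda>r A. loc_class R p (r \<otimes>\<^bsub>R\<^esub> fst (rep A)) (snd (rep A)))\<rparr>"

definition constant_rank :: "('r, 'z) ring_scheme \<Rightarrow> ('r, 'm) module \<Rightarrow> nat \<Rightarrow> bool" where
  "constant_rank R M n \<longleftrightarrow> (\<forall>p. primeideal p R \<longrightarrow>
     free_of_rank (localization R p) (base_change R M (localization R p)) n)"


section \<open>Quadratic forms\<close>

definition polar ::
  "('r, 'z) ring_scheme \<Rightarrow> ('r, 'm) module \<Rightarrow> ('m \<Rightarrow> 'r) \<Rightarrow> 'm \<Rightarrow> 'm \<Rightarrow> 'r" where
  "polar R M q x y = q (x \<oplus>\<^bsub>M\<^esub> y) \<ominus>\<^bsub>R\<^esub> q x \<ominus>\<^bsub>R\<^esub> q y"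

text \<open>Bilinearity of the polar form is linearity in one argument, since it is symmetric.\<close>

definition quadratic_form ::
  "('r, 'z) ring_scheme \<Rightarrow> ('r, 'm) module \<Rightarrow> ('m \<Rightarrow> 'r) \<Rightarrow> bool" where
  "quadratic_form R M q \<longleftrightarrow> q \<in> carrier M \<rightarrow> carrier R \<and>
     (\<forall>r\<in>carrier R. \<forall>x\<in>carrier M. q (r \<odot>\<^bsub>M\<^esub> x) = r \<otimes>\<^bsub>R\<^esub> r \<otimes>\<^bsub>R\<^esub> q x) \<and>
     (\<forall>x\<in>carrier M. (\<lambda>y\<in>carrier M. polar R M q x y) \<in> lin_hom R M (self_module R))"

definition regular_form ::
  "('r, 'z) ring_scheme \<Rightarrow> ('r, 'm) module \<Rightarrow> ('m \<Rightarrow> 'r) \<Rightarrow> bool" where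
  "regular_form R M q \<longleftrightarrow> bij_betw (\<lambda>x. \<lambda>y\<in>carrier M. polar R M q x y)
     (carrier M) (lin_hom R M (self_module R))"

text \<open>The scalar extension of \<open>q\<close> is the unique quadratic form on \<open>M \<otimes>\<^sub>R S\<close> extending \<open>q\<close>.\<close>

definition base_change_form ::
  "('r, 'z) ring_scheme \<Rightarrow> ('r, 'm) module \<Rightarrow> ('m \<Rightarrow> 'r) \<Rightarrow> ('r, 's) module
     \<Rightarrow> ('m, 's) tens \<Rightarrow> 's" where
  "base_change_form R M q S = (THE Q. Q \<in> extensional (carrier (base_change R M S)) \<and>
     quadratic_form S (base_change R M S) Q \<and>
     (\<forall>x\<in>carrier M. Q (tensor R M S x \<one>\<^bsub>S\<^esub>) = q x \<odot>\<^bsub>S\<^esub> \<one>\<^bsub>S\<^esub>))"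


section \<open>Octonion algebras\<close>

locale unital_nonassoc_algebra = module R C for R (structure) and C (structure) +
  assumes one_closed: "\<one>\<^bsub>C\<^esub> \<in> carrier C"
    and mult_closed: "\<lbrakk>x \<in> carrier C; y \<in> carrier C\<rbrakk> \<Longrightarrow> x \<otimes>\<^bsub>C\<^esub> y \<in> carrier C"
    and mult_one_left: "x \<in> carrier C \<Longrightarrow> \<one>\<^bsub>C\<^esub> \<otimes>\<^bsub>C\<^esub> x = x"
    and mult_one_right: "x \<in> carrier C \<Longrightarrow> x \<otimes>\<^bsub>C\<^esub> \<one>\<^bsub>C\<^esub> = x"
    and mult_add_left: "\<lbrakk>x \<in> carrier C; y \<in> carrier C; z \<in> carrier C\<rbrakk>
      \<Longrightarrow> (x \<oplus>\<^bsub>C\<^esub> y) \<otimes>\<^bsub>C\<^esub> z = x \<otimes>\<^bsub>C\<^esub> z \<oplus>\<^bsub>C\<^esub> y \<otimes>\<^bsub>C\<^esub> z"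
    and mult_add_right: "\<lbrakk>x \<in> carrier C; y \<in> carrier C; z \<in> carrier C\<rbrakk>
      \<Longrightarrow> x \<otimes>\<^bsub>C\<^esub> (y \<oplus>\<^bsub>C\<^esub> z) = x \<otimes>\<^bsub>C\<^esub> y \<oplus>\<^bsub>C\<^esub> x \<otimes>\<^bsub>C\<^esub> z"
    and mult_smult_left: "\<lbrakk>r \<in> carrier R; x \<in> carrier C; y \<in> carrier C\<rbrakk>
      \<Longrightarrow> (r \<odot>\<^bsub>C\<^esub> x) \<otimes>\<^bsub>C\<^esub> y = r \<odot>\<^bsub>C\<^esub> (x \<otimes>\<^bsub>C\<^esub> y)"
    and mult_smult_right: "\<lbrakk>r \<in> carrier R; x \<in> carrier C; y \<in> carrier C\<rbrakk>
      \<Longrightarrow> x \<otimes>\<^bsub>C\<^esub> (r \<odot>\<^bsub>C\<^esub> y) = r \<odot>\<^bsub>C\<^esub> (x \<otimes>\<^bsub>C\<^esub> y)"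

locale octonion_algebra = unital_nonassoc_algebra R C
  for R :: "('r, 'z) ring_scheme" (structure) and C :: "('r, 'c) module" (structure)
    and q :: "'c \<Rightarrow> 'r" +
  assumes projective: "fg_projective R C"
    and rank_8: "constant_rank R C 8"
    and quadratic: "quadratic_form R C q"
    and regular: "regular_form R C q"
    and multiplicative: "\<lbrakk>x \<in> carrier C; y \<in> carrier C\<rbrakk> \<Longrightarrow> q (x \<otimes>\<^bsub>C\<^esub> y) = q x \<otimes>\<^bsub>R\<^esub> q y"

text \<open>The involution \<open>\<kappa>\<close>.\<close>

definition conjugate ::
  "('r, 'z) ring_scheme \<Rightarrow> ('r, 'c) module \<Rightarrow> ('c \<Rightarrow> 'r) \<Rightarrow> 'c \<Rightarrow> 'c" where
  "conjugate R C q x = (polar R C q x \<one>\<^bsub>C\<^esub> \<odot>\<^bsub>C\<^esub> \<one>\<^bsub>C\<^esub>) \<ominus>\<^bsub>C\<^esub> x"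


section \<open>Clifford algebras\<close>

text \<open>
  The free (unital associative) \<open>R\<close>-algebra on a set \<open>V\<close>: finitely supported
  \<open>R\<close>-valued functions on words over \<open>V\<close>, with convolution along concatenation.
\<close>

definition free_alg :: "('r, 'z) ring_scheme \<Rightarrow> 'x set \<Rightarrow> ('r, 'x list \<Rightarrow> 'r) module" where
  "free_alg R V = \<lparr>
     carrier = {f. (\<forall>w. f w \<in> carrier R) \<and> (\<forall>w. w \<notin> lists V \<longrightarrow> f w = \<zero>\<^bsub>R\<^esub>) \<and>
       finite {w. f w \<noteq> \<zero>\<^bsub>R\<^esub>}},
     monoid.mult = (\<lambda>f g w. \<Oplus>\<^bsub>R\<^esub>i\<in>{..length w}. f (take i w) \<otimes>\<^bsub>R\<^esub> g (drop i w)),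
     one = (\<lambda>w. if w = [] then \<one>\<^bsub>R\<^esub> else \<zero>\<^bsub>R\<^esub>),
     ring.zero = (\<lambda>w. \<zero>\<^bsub>R\<^esub>),
     ring.add = (\<lambda>f g w. f w \<oplus>\<^bsub>R\<^esub> g w),
     smult = (\<lambda>r f w. r \<otimes>\<^bsub>R\<^esub> f w)\<rparr>"

definition gen :: "('r, 'z) ring_scheme \<Rightarrow> 'x \<Rightarrow> 'x list \<Rightarrow> 'r" where
  "gen R x = (\<lambda>w. if w = [x] then \<one>\<^bsub>R\<^esub> else \<zero>\<^bsub>R\<^esub>)"

text \<open>
  The first two families of relations turn the free algebra on the set underlying \<open>M\<close> into the
  tensor algebra of the module \<open>M\<close>; the third is \<open>x \<cdot> x = q(x) 1\<close>.
\<close>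

definition Cl_relations ::
  "('r, 'z) ring_scheme \<Rightarrow> ('r, 'm) module \<Rightarrow> ('m \<Rightarrow> 'r) \<Rightarrow> ('m list \<Rightarrow> 'r) set" where
  "Cl_relations R M q = (let T = free_alg R (carrier M) in
     {gen R (x \<oplus>\<^bsub>M\<^esub> y) \<ominus>\<^bsub>T\<^esub> gen R x \<ominus>\<^bsub>T\<^esub> gen R y | x y. x \<in> carrier M \<and> y \<in> carrier M} \<union>
     {gen R (r \<odot>\<^bsub>M\<^esub> x) \<ominus>\<^bsub>T\<^esub> (r \<odot>\<^bsub>T\<^esub> gen R x) | r x. r \<in> carrier R \<and> x \<in> carrier M} \<union>
     {(gen R x \<otimes>\<^bsub>T\<^esub> gen R x) \<ominus>\<^bsub>T\<^esub> (q x \<odot>\<^bsub>T\<^esub> \<one>\<^bsub>T\<^esub>) | x. x \<in> carrier M})"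

definition Cl_ideal ::
  "('r, 'z) ring_scheme \<Rightarrow> ('r, 'm) module \<Rightarrow> ('m \<Rightarrow> 'r) \<Rightarrow> ('m list \<Rightarrow> 'r) set" where
  "Cl_ideal R M q = Idl\<^bsub>free_alg R (carrier M)\<^esub> (Cl_relations R M q)"

definition Cl_class ::
  "('r, 'z) ring_scheme \<Rightarrow> ('r, 'm) module \<Rightarrow> ('m \<Rightarrow> 'r) \<Rightarrow> ('m list \<Rightarrow> 'r) \<Rightarrow> ('m list \<Rightarrow> 'r) set" where
  "Cl_class R M q f = Cl_ideal R M q +>\<^bsub>free_alg R (carrier M)\<^esub> f"

definition Cl ::
  "('r, 'z) ring_scheme \<Rightarrow> ('r, 'm) module \<Rightarrow> ('m \<Rightarrow> 'r) \<Rightarrow> ('r, ('m list \<Rightarrow> 'r) set) module" where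
  "Cl R M q = ring.extend (free_alg R (carrier M) Quot Cl_ideal R M q)
     (module.fields (\<lambda>r A. Cl_class R M q (r \<odot>\<^bsub>free_alg R (carrier M)\<^esub> rep A)))"

definition Cl_incl ::
  "('r, 'z) ring_scheme \<Rightarrow> ('r, 'm) module \<Rightarrow> ('m \<Rightarrow> 'r) \<Rightarrow> 'm \<Rightarrow> ('m list \<Rightarrow> 'r) set" where
  "Cl_incl R M q x = Cl_class R M q (gen R x)"

text \<open>The even part: classes of combinations of products of evenly many vectors.\<close>

definition Cl_even ::
  "('r, 'z) ring_scheme \<Rightarrow> ('r, 'm) module \<Rightarrow> ('m \<Rightarrow> 'r) \<Rightarrow> ('r, ('m list \<Rightarrow> 'r) set) module" where
  "Cl_even R M q = (Cl R M q)\<lparr>carrier :=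
     {Cl_class R M q f | f. f \<in> carrier (free_alg R (carrier M)) \<and>
        (\<forall>w. odd (length w) \<longrightarrow> f w = \<zero>\<^bsub>R\<^esub>)}\<rparr>"

text \<open>
  The main involution is induced by the reversal of words, which preserves the defining ideal.
\<close>

definition Cl_inv :: "('m list \<Rightarrow> 'r) set \<Rightarrow> ('m list \<Rightarrow> 'r) set" where
  "Cl_inv A = (\<lambda>f. f \<circ> rev) ` A"


section \<open>Group schemes as functors of points\<close>

text \<open>
  An \<open>R\<close>-ring is a structure \<open>S\<close> with \<^prop>\<open>algebra R S\<close>.  Functors are
  considered on the \<open>R\<close>-rings whose carrier lies in a type \<open>'s\<close>, which remains an
  arbitrary type variable.
\<close>

record ('r, 's, 'g) group_functor =
  points :: "('r, 's) module \<Rightarrow> 'g monoid"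
  action :: "('r, 's) module \<Rightarrow> ('r, 's) module \<Rightarrow> ('s \<Rightarrow> 's) \<Rightarrow> 'g \<Rightarrow> 'g"

definition is_group_functor :: "('r, 'z) ring_scheme \<Rightarrow> ('r, 's, 'g) group_functor \<Rightarrow> bool" where
  "is_group_functor R G \<longleftrightarrow>
     (\<forall>S. algebra R S \<longrightarrow> group (points G S)) \<and>
     (\<forall>S T. algebra R S \<and> algebra R T \<longrightarrow>
        (\<forall>h \<in> alg_hom R S T. action G S T h \<in> hom (points G S) (points G T))) \<and>
     (\<forall>S. algebra R S \<longrightarrow> (\<forall>g \<in> carrier (points G S). action G S S (\<lambda>s\<in>carrier S. s) g = g)) \<and>
     (\<forall>S T U. algebra R S \<and> algebra R T \<and> algebra R U \<longrightarrow>
        (\<forall>h \<in> alg_hom R S T. \<forall>k \<in> alg_hom R T U. \<forall>g \<in> carrier (points G S).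
           action G S U (compose (carrier S) k h) g = action G T U k (action G S T h g)))"

text \<open>
  Affine: representable by an \<open>R\<close>-ring \<open>A\<close>.  The first argument only names the type
  in which the representing ring is to be found.
\<close>

definition affine_group_scheme ::
  "'a itself \<Rightarrow> ('r, 'z) ring_scheme \<Rightarrow> ('r, 's, 'g) group_functor \<Rightarrow> bool" where
  "affine_group_scheme ty R G \<longleftrightarrow> is_group_functor R G \<and>
     (\<exists>(A :: ('r, 'a) module) \<theta>. algebra R A \<and>
        (\<forall>S. algebra R S \<longrightarrow> bij_betw (\<theta> S) (alg_hom R A S) (carrier (points G S))) \<and>
        (\<forall>S T. algebra R S \<and> algebra R T \<longrightarrow>
           (\<forall>h \<in> alg_hom R S T. \<forall>\<phi> \<in> alg_hom R A S.
              \<theta> T (compose (carrier A) h \<phi>) = action G S T h (\<theta> S \<phi>))))"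

definition affine_group_scheme_iso ::
  "'a itself \<Rightarrow> ('r, 'z) ring_scheme \<Rightarrow> ('r, 's, 'g) group_functor \<Rightarrow> ('r, 's, 'h) group_functor
     \<Rightarrow> (('r, 's) module \<Rightarrow> 'g \<Rightarrow> 'h) \<Rightarrow> bool" where
  "affine_group_scheme_iso ty R G H F \<longleftrightarrow>
     affine_group_scheme ty R G \<and> affine_group_scheme ty R H \<and>
     (\<forall>S. algebra R S \<longrightarrow> F S \<in> iso (points G S) (points H S)) \<and>
     (\<forall>S T. algebra R S \<and> algebra R T \<longrightarrow>
        (\<forall>h \<in> alg_hom R S T. \<forall>g \<in> carrier (points G S).
           F T (action G S T h g) = action H S T h (F S g)))"


section \<open>The group schemes Spin(q) and RT'(C)\<close>

text \<open>
  Everything over \<open>S\<close> is formed with \<open>C\<^sub>S\<close> and \<open>q\<^sub>S\<close>; in particular \<open>Cl(C, q) \<otimes>\<^sub>R S\<close> is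
  identified with \<open>Cl(C\<^sub>S, q\<^sub>S)\<close>.
\<close>

type_synonym ('c, 's) cliff = "(('c, 's) tens list \<Rightarrow> 's) set"

type_synonym ('c, 's) endo = "('c, 's) tens \<Rightarrow> ('c, 's) tens"

context
  fixes R :: "('r, 'z) ring_scheme" and C :: "('r, 'c) module" and q :: "'c \<Rightarrow> 'r"
begin

abbreviation C_at :: "('r, 's) module \<Rightarrow> ('s, ('c, 's) tens) module" where
  "C_at S \<equiv> base_change R C S"

abbreviation q_at :: "('r, 's) module \<Rightarrow> ('c, 's) tens \<Rightarrow> 's" where
  "q_at S \<equiv> base_change_form R C q S"

abbreviation Cl_at ::
  "('r, 's) module \<Rightarrow> ('s, ('c, 's) cliff) module" where
  "Cl_at S \<equiv> Cl S (C_at S) (q_at S)"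

abbreviation incl_at ::
  "('r, 's) module \<Rightarrow> ('c, 's) tens \<Rightarrow> ('c, 's) cliff" where
  "incl_at S \<equiv> Cl_incl S (C_at S) (q_at S)"

abbreviation conj_at ::
  "('r, 's) module \<Rightarrow> ('c, 's) tens \<Rightarrow> ('c, 's) tens" where
  "conj_at S \<equiv> conjugate S (C_at S) (q_at S)"

definition Spin_points ::
  "('r, 's) module \<Rightarrow> ('c, 's) cliff monoid" where
  "Spin_points S = \<lparr>carrier = {u \<in> Units (Cl_even S (C_at S) (q_at S)).
       {u \<otimes>\<^bsub>Cl_at S\<^esub> incl_at S x \<otimes>\<^bsub>Cl_at S\<^esub> inv\<^bsub>Cl_at S\<^esub> u | x. x \<in> carrier (C_at S)}
         = incl_at S ` carrier (C_at S) \<and>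
       u \<otimes>\<^bsub>Cl_at S\<^esub> Cl_inv u = \<one>\<^bsub>Cl_at S\<^esub>},
     monoid.mult = monoid.mult (Cl_at S), one = \<one>\<^bsub>Cl_at S\<^esub>\<rparr>"

text \<open>
  The map of Clifford algebras induced by \<open>h : S \<rightarrow> T\<close>, which corresponds to \<open>id \<otimes> h\<close> on
  \<open>Cl(C, q) \<otimes>\<^sub>R S\<close>.
\<close>

definition Cl_map ::
  "('r, 's) module \<Rightarrow> ('r, 't) module \<Rightarrow> ('s \<Rightarrow> 't)
     \<Rightarrow> ('c, 's) cliff \<Rightarrow> ('c, 't) cliff" where
  "Cl_map S T h = (THE g. g \<in> ring_hom (Cl_at S) (Cl_at T) \<inter> extensional (carrier (Cl_at S)) \<and>
     (\<forall>s\<in>carrier S. g (s \<odot>\<^bsub>Cl_at S\<^esub> \<one>\<^bsub>Cl_at S\<^esub>) = h s \<odot>\<^bsub>Cl_at T\<^esub> \<one>\<^bsub>Cl_at T\<^esub>) \<and>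
     (\<forall>x\<in>carrier (C_at S). g (incl_at S x) = incl_at T (base_change_map R C S T h x)))"

definition Spin ::
  "('r, 's, ('c, 's) cliff) group_functor" where
  "Spin = \<lparr>points = Spin_points, action = Cl_map\<rparr>"

definition O_points ::
  "('r, 's) module \<Rightarrow> ('c, 's) endo set" where
  "O_points S = {t \<in> lin_hom S (C_at S) (C_at S).
     bij_betw t (carrier (C_at S)) (carrier (C_at S)) \<and>
     (\<forall>x\<in>carrier (C_at S). q_at S (t x) = q_at S x)}"

definition RT_points ::
  "('r, 's) module \<Rightarrow> (('c, 's) endo \<times> ('c, 's) endo \<times> ('c, 's) endo) monoid" where
  "RT_points S = \<lparr>carrier = {(t1, t2, t3). t1 \<in> O_points S \<and> t2 \<in> O_points S \<and> t3 \<in> O_points S \<and>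
       (\<forall>x\<in>carrier (C_at S). \<forall>y\<in>carrier (C_at S).
          t1 (x \<otimes>\<^bsub>C_at S\<^esub> y) =
            conj_at S (t2 (conj_at S x)) \<otimes>\<^bsub>C_at S\<^esub> conj_at S (t3 (conj_at S y)))},
     monoid.mult = (\<lambda>(t1, t2, t3) (t1', t2', t3'). (compose (carrier (C_at S)) t1 t1',
       compose (carrier (C_at S)) t2 t2', compose (carrier (C_at S)) t3 t3')),
     one = (\<lambda>x\<in>carrier (C_at S). x, \<lambda>x\<in>carrier (C_at S). x, \<lambda>x\<in>carrier (C_at S). x)\<rparr>"

text \<open>The base change along \<open>h : S \<rightarrow> T\<close> of an endomorphism of \<open>C\<^sub>S\<close>.\<close>

definition End_map ::
  "('r, 's) module \<Rightarrow> ('r, 't) module \<Rightarrow> ('s \<Rightarrow> 't)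
     \<Rightarrow> ('c, 's) endo
     \<Rightarrow> ('c, 't) endo" where
  "End_map S T h t = (THE t'. t' \<in> lin_hom T (C_at T) (C_at T) \<and>
     (\<forall>x\<in>carrier (C_at S). t' (base_change_map R C S T h x) = base_change_map R C S T h (t x)))"

definition RT' ::
  "('r, 's, ('c, 's) endo \<times> ('c, 's) endo \<times> ('c, 's) endo) group_functor" where
  "RT' = \<lparr>points = RT_points,
     action = (\<lambda>S T h (t1, t2, t3). (End_map S T h t1, End_map S T h t2, End_map S T h t3))\<rparr>"


section \<open>The map F\<close>

definition alpha ::
  "('r, 's) module \<Rightarrow> ('c, 's) tens
     \<Rightarrow> ('c, 's) tens \<times> ('c, 's) tens
     \<Rightarrow> ('c, 's) tens \<times> ('c, 's) tens" where
  "alpha S x = (\<lambda>(a, b)\<in>carrier (direct_sum (C_at S) (C_at S)).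
     (conj_at S x \<otimes>\<^bsub>C_at S\<^esub> conj_at S b, conj_at S (x \<otimes>\<^bsub>C_at S\<^esub> a)))"

definition alpha' ::
  "('r, 's) module \<Rightarrow> ('c, 's) cliff
     \<Rightarrow> ('c, 's) tens \<times> ('c, 's) tens
     \<Rightarrow> ('c, 's) tens \<times> ('c, 's) tens" where
  "alpha' S = (THE f. f \<in> alg_hom S (Cl_at S) (End_alg S (direct_sum (C_at S) (C_at S))) \<and>
     (\<forall>x\<in>carrier (C_at S). f (incl_at S x) = alpha S x))"

definition block_diag ::
  "('r, 's) module \<Rightarrow> ('c, 's) endo
     \<Rightarrow> ('c, 's) endo
     \<Rightarrow> ('c, 's) tens \<times> ('c, 's) tens
     \<Rightarrow> ('c, 's) tens \<times> ('c, 's) tens" where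
  "block_diag S v w = (\<lambda>(a, b)\<in>carrier (direct_sum (C_at S) (C_at S)). (v a, w b))"

text \<open>\<open>u\<^sub>1(x) = u \<cdot> x \<cdot> u\<^sup>-\<^sup>1\<close>, read back in \<open>C\<^sub>S\<close> along the embedding into the Clifford algebra.\<close>

definition u1 ::
  "('r, 's) module \<Rightarrow> ('c, 's) cliff
     \<Rightarrow> ('c, 's) tens \<Rightarrow> ('c, 's) tens" where
  "u1 S u = (\<lambda>x\<in>carrier (C_at S). the_inv_into (carrier (C_at S)) (incl_at S)
     (u \<otimes>\<^bsub>Cl_at S\<^esub> incl_at S x \<otimes>\<^bsub>Cl_at S\<^esub> inv\<^bsub>Cl_at S\<^esub> u))"

definition u2 ::
  "('r, 's) module \<Rightarrow> ('c, 's) cliff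
     \<Rightarrow> ('c, 's) tens \<Rightarrow> ('c, 's) tens" where
  "u2 S u = (THE w. w \<in> lin_hom S (C_at S) (C_at S) \<and>
     (\<exists>v \<in> lin_hom S (C_at S) (C_at S). alpha' S u = block_diag S v w))"

definition u3 ::
  "('r, 's) module \<Rightarrow> ('c, 's) cliff
     \<Rightarrow> ('c, 's) tens \<Rightarrow> ('c, 's) tens" where
  "u3 S u = (THE v. v \<in> lin_hom S (C_at S) (C_at S) \<and>
     (\<exists>w \<in> lin_hom S (C_at S) (C_at S). alpha' S u = block_diag S v w))"

definition F_map ::
  "('r, 's) module \<Rightarrow> ('c, 's) cliff
     \<Rightarrow> ('c, 's) endo \<times> ('c, 's) endo \<times> ('c, 's) endo" where
  "F_map S u = (u1 S u, u2 S u, u3 S u)"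

end

end

theory Submission
  imports Defs
begin

text \<open>
  The representation \<open>\<alpha>'\<close> of the Clifford algebra on \<open>C \<oplus> C\<close> is bijective: the contractions
  \<open>z \<mapsto> \<alpha>(y) z - \<gamma>(z) \<alpha>(y)\<close>, where \<open>\<gamma>\<close> is the grading automorphism, make sense on
  both sides and are intertwined by \<open>\<alpha>'\<close>, and locally at a prime a Koszul homotopy reduces
  injectivity and surjectivity to elements killed by all contractions.  In the Clifford algebra these
  are scalars by the normal form of its elements; in \<open>End(C \<oplus> C)\<close> they are given by
  elements \<open>n\<close> and \<open>c\<close> of \<open>C\<close> with \<open>(xy)n = x(yn)\<close> and \<open>(xy)c = y(xc)\<close>, and non-associativity
  of \<open>C\<close> at every prime forces \<open>n\<close> to be a scalar and \<open>c\<close> to vanish.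

  Even elements correspond to block-diagonal matrices, the main involution to the adjoint for
  \<open>b \<oplus> b\<close>, and the relation \<open>u x = u\<^sub>1(x) u\<close> to \<open>\<kappa>(u\<^sub>2(\<kappa>(xa))) = u\<^sub>1(x) u\<^sub>3(a)\<close> together with its mirror image,
  which is equivalent to the defining relation of \<open>RT'(C)\<close> by linearizing \<open>q\<close>.  Hence \<open>F\<close> is
  bijective on points, and \<open>Spin(q)\<close> inherits representability from \<open>RT'(C)\<close>, whose points are cut
  out by polynomial equations in the coordinates given by a pair of dual systems of \<open>C\<close>.
\<close>

text \<open>\<open>C\<close> need be neither free nor split, so bijectivity of \<open>alp\<close>
  cannot be read off from a matrix model or a count of dimensions. Localization is used once, to
  produce vectors and functionals over the base ring itself that pair to \<open>d\<close> or to
  zero, with \<open>d\<close> outside the prime; every later local statement holds "after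
  multiplication by a scalar outside p", and the scalars for which it holds then fill the unit
  ideal. The arguments run over every \<open>S\<close>, so the class of algebras must be stable
  under base change: what is transported is a dual pair and, at each prime, a frame and an
  associator with norm outside the prime, primes of \<open>S\<close> being pulled back to
  \<open>R\<close>. Residue characteristic two is allowed; it causes the case distinction in the
  search for an associator and makes alternativity more than skew symmetry. For representability the
  conditions on a triple have to be polynomial in matrix entries, including the bijectivity of an
  isometry, which is expressed by the equation saying that its adjoint is a right inverse.\<close>

abbreviation (input) elem_of :: "'a => ('a, 'm) partial_object_scheme => bool" (infix "el" 50)
  where "x el G \<equiv> x \<in> carrier G"
abbreviation (input) mult_in :: "'a => ('a, 'm) monoid_scheme => 'a => 'a" ("(_ *[_]/ _)" [70, 0, 71] 70)
  where "x *[G] y \<equiv> monoid.mult G x y"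
abbreviation (input) add_in :: "'a => ('a, 'm) ring_scheme => 'a => 'a" ("(_ +[_]/ _)" [65, 0, 66] 65)
  where "x +[G] y \<equiv> ring.add G x y"
abbreviation (input) minus_in :: "'a => ('a, 'm) ring_scheme => 'a => 'a" ("(_ -[_]/ _)" [65, 0, 66] 65)
  where "x -[G] y \<equiv> a_minus G x y"
abbreviation (input) neg_in :: "('a, 'm) ring_scheme => 'a => 'a" ("(-[_] _)" [0, 81] 80)
  where "-[G] x \<equiv> a_inv G x"
abbreviation (input) smult_in :: "'r => ('r, 'a, 'm) module_scheme => 'a => 'a" ("(_ .[_]/ _)" [76, 0, 75] 75)
  where "r .[G] x \<equiv> smult G r x"
abbreviation (input) zero_in :: "('a, 'm) ring_scheme => 'a" ("\<zero>[_]")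
  where "\<zero>[G] \<equiv> ring.zero G"
abbreviation (input) one_in :: "('a, 'm) monoid_scheme => 'a" ("\<one>[_]")
  where "\<one>[G] \<equiv> one G"

section \<open>Additive maps\<close>

text \<open>Only the additive group of either record enters, so one notion covers linear maps,
  functionals, single slots of bilinear forms and of associators, even where the multiplicative
  fields are dummies.\<close>

definition add_hom :: "('a, 'x) ring_scheme => ('b, 'y) ring_scheme => ('a => 'b) set" where
  "add_hom M N = {g \<in> carrier M \<rightarrow> carrier N.
     \<forall>x\<in>carrier M. \<forall>y\<in>carrier M. g (x +[M] y) = g x +[N] g y}"

lemma add_homI:
  "[|\<And>x. x el M ==> g x el N;
    \<And>x y. [|x el M; y el M|] ==> g (x +[M] y) = g x +[N] g y|] ==> g \<in> add_hom M N"
  by (auto simp: add_hom_def)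

lemma add_hom_closed: "[|g \<in> add_hom M N; x el M|] ==> g x el N"
  by (auto simp: add_hom_def)

lemma add_hom_add:
  "[|g \<in> add_hom M N; x el M; y el M|] ==> g (x +[M] y) = g x +[N] g y"
  by (auto simp: add_hom_def)

lemma add_hom_zero:
  assumes "abelian_group M" "abelian_group N" "g \<in> add_hom M N"
  shows "g \<zero>[M] = \<zero>[N]"
proof -
  interpret M: abelian_group M by fact
  interpret N: abelian_group N by fact
  have "g \<zero>[M] +[N] g \<zero>[M] = g \<zero>[M]" "g \<zero>[M] el N"
    using add_hom_add[OF assms(3), of "\<zero>[M]" "\<zero>[M]"] add_hom_closed[OF assms(3)] by auto
  then show ?thesis by (metis N.add.r_cancel_one)
qed

lemma add_hom_neg:
  assumes "abelian_group M" "abelian_group N" "g \<in> add_hom M N" "x el M"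
  shows "g (-[M] x) = -[N] g x"
proof -
  interpret M: abelian_group M by fact
  interpret N: abelian_group N by fact
  have "g (-[M] x) +[N] g x = \<zero>[N]"
    using add_hom_add[OF assms(3), of "-[M] x" x] assms(4) add_hom_zero[OF assms(1-3)] M.l_neg by simp
  then show ?thesis using N.minus_equality add_hom_closed[OF assms(3)] assms(4) by (metis M.a_inv_closed)
qed

lemma add_hom_minus:
  assumes "abelian_group M" "abelian_group N" "g \<in> add_hom M N" "x el M" "y el M"
  shows "g (x -[M] y) = g x -[N] g y"
proof -
  interpret M: abelian_group M by fact
  show ?thesis
  using assms add_hom_add[OF assms(3), of x "-[M] y"] add_hom_neg[OF assms(1-3), of y]
  by (simp add: a_minus_def)
qed

lemma add_hom_finsum:
  assumes "abelian_group M" "abelian_group N" "g \<in> add_hom M N" "finite I" "f \<in> I \<rightarrow> carrier M"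
  shows "g (finsum M f I) = (\<Oplus>\<^bsub>N\<^esub>i\<in>I. g (f i))"
proof -
  interpret M: abelian_group M by fact
  interpret N: abelian_group N by fact
  show ?thesis using assms(4,5)
  proof (induction rule: finite_induct)
    case empty then show ?case using add_hom_zero[OF assms(1-3)] by simp
  next
    case (insert i I)
    then have "finsum M f I el M" "f i el M" "(\<lambda>i. g (f i)) \<in> I \<rightarrow> carrier N" "g (f i) el N"
      using add_hom_closed[OF assms(3)] by (auto intro: M.finsum_closed)
    with insert show ?case using add_hom_add[OF assms(3)] by (simp add: Pi_def)
  qed
qed

lemma (in abelian_group) minus_zero': "\<ominus> \<zero> = \<zero>"
  using r_neg[of \<zero>] by simp

lemma (in abelian_group) minus_eq_zeroD: "[|x \<ominus> y = \<zero>; x el G; y el G|] ==> x = y"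
  using minus_equality[of x "\<ominus> y"] by (simp add: a_minus_def minus_minus)

lemma (in abelian_group) add_minus_minus_cancel:
  assumes "x el G" "y el G"
  shows "(x \<oplus> y) \<ominus> x \<ominus> y = \<zero>"
proof -
  have "(x \<oplus> y) \<ominus> x = y" using assms r_neg1[of x y] by (simp add: a_minus_def a_comm[of "x \<oplus> y"])
  then show ?thesis using assms by (simp add: a_minus_def r_neg)
qed

section \<open>Base change: universal property, module and algebra structure, functoriality\<close>

section \<open>Tensor products\<close>

declare carrier_free_Abelian_group_iff [simp del]

locale tensor_product = M: module R M + S: module R S
  for R :: "('r, 'z) ring_scheme" and M :: "('r, 'm) module" and S :: "('r, 's) module"
begin

abbreviation "G \<equiv> pair_group M S"
abbreviation "K \<equiv> tensor_kernel R M S"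
abbreviation "T \<equiv> base_change R M S"
abbreviation "cls \<equiv> tensor_class R M S"
abbreviation "tn \<equiv> tensor R M S"

lemma G_closed: "[|a el G; b el G|] ==> a + b el G"
  "[|a el G; b el G|] ==> a - b el G"
  using group.is_monoid[OF group_free_Abelian_group] monoid.m_closed[of G a b] keys_diff[of a b]
  by (fastforce simp: carrier_free_Abelian_group_iff)+

lemma frag_of_G: "[|x el M; s el S|] ==> frag_of (x, s) el G" by auto

lemma zero_G: "0 el G" by (simp add: carrier_free_Abelian_group_iff)

lemma neg_G: "a el G ==> - a el G" by (simp add: carrier_free_Abelian_group_iff)

lemma relations_closed: "tensor_relations R M S \<subseteq> carrier G"
  unfolding tensor_relations_def
  by (auto intro!: G_closed(2) frag_of_G)

lemma kernel_subgroup: "subgroup K G"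
  unfolding tensor_kernel_def
  by (rule group.generate_is_subgroup[OF group_free_Abelian_group relations_closed])

lemma kernel_normal: "K \<lhd> G"
  by (rule comm_group.subgroup_imp_normal[OF abelian_free_Abelian_group kernel_subgroup])

lemma kernel_closed: "a \<in> K ==> a el G"
  using subgroup.subset[OF kernel_subgroup] by auto

lemma kernel_diff: "[|a \<in> K; b \<in> K|] ==> a - b \<in> K"
  using subgroup.m_closed[OF kernel_subgroup, of a "-b"] subgroup.m_inv_closed[OF kernel_subgroup, of b]
    kernel_closed[of b] by (simp add: carrier_free_Abelian_group_iff)

lemma cls_mem: "b \<in> cls a \<longleftrightarrow> b - a \<in> K"
  by (auto simp: tensor_class_def r_coset_def algebra_simps) (metis add_diff_cancel_left' diff_add_cancel add.commute)

lemma cls_eq: "cls a = cls b \<longleftrightarrow> a - b \<in> K"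
proof
  have "a \<in> cls a" by (simp add: cls_mem subgroup.one_closed[OF kernel_subgroup, simplified])
  then show "cls a = cls b ==> a - b \<in> K" using cls_mem by auto
next
  assume *: "a - b \<in> K"
  have "c - a \<in> K \<longleftrightarrow> c - b \<in> K" for c
    using kernel_diff[of "c - b" "a - b"] kernel_diff[of "c - a" "-(a - b)"] *
      kernel_diff[of 0 "a - b"] subgroup.one_closed[OF kernel_subgroup, simplified] by auto
  then show "cls a = cls b" by (auto simp: cls_mem)
qed

lemma carrier_T: "carrier T = cls ` carrier G"
  by (auto simp: base_change_def FactGroup_def RCOSETS_def tensor_class_def)

text \<open>All operations of \<open>base_change\<close> act on an arbitrary representative; this
  bounds the ambiguity by an element of the kernel.\<close>

lemma rep_cls: "a el G ==> rep (cls a) el G \<and> rep (cls a) - a \<in> K"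
proof -
  assume a: "a el G"
  have "a \<in> cls a" by (simp add: cls_mem subgroup.one_closed[OF kernel_subgroup, simplified])
  then have "rep (cls a) \<in> cls a" unfolding rep_def by (rule someI)
  then have *: "rep (cls a) - a \<in> K" by (simp add: cls_mem)
  with G_closed(1)[OF kernel_closed[OF *] a] show ?thesis by auto
qed

lemma rep_T: "A el T ==> rep A el G \<and> cls (rep A) = A"
  using rep_cls by (force simp: carrier_T simp flip: cls_eq)

lemma add_cls: "[|a el G; b el G|] ==> cls a +[T] cls b = cls (a + b)"
  using normal.rcos_sum[OF kernel_normal, of a b] by (simp add: base_change_def FactGroup_def tensor_class_def)

lemma zero_cls: "\<zero>[T] = cls 0"
  using group.coset_mult_one[OF group_free_Abelian_group subgroup.subset[OF kernel_subgroup]]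
  by (simp add: base_change_def FactGroup_def tensor_class_def)

lemma abelian_group_T: "abelian_group T"
proof (rule abelian_groupI)
  fix x assume "x el T"
  then obtain a where a: "a el G" "x = cls a" by (auto simp: carrier_T)
  then have "-a el G" by (simp add: neg_G)
  then show "\<exists>y\<in>carrier T. y +[T] x = \<zero>[T]"
    using add_cls[of "-a" a] a by (auto simp: carrier_T zero_cls intro!: bexI[of _ "cls (-a)"])
qed (auto simp: carrier_T zero_cls add_cls G_closed zero_G algebra_simps)

sublocale T: abelian_group T by (rule abelian_group_T)

lemma tensor_closed [simp, intro]: "[|x el M; s el S|] ==> tn x s el T"
  unfolding tensor_def carrier_T using frag_of_G by blast

lemma relation_kernel: "a \<in> tensor_relations R M S ==> a \<in> K"
  unfolding tensor_kernel_def by (rule generate.incl)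

lemma tensor_add_left:
  assumes "x el M" "y el M" "s el S"
  shows "tn (x +[M] y) s = tn x s +[T] tn y s"
proof -
  have "frag_of (x +[M] y, s) - frag_of (x, s) - frag_of (y, s) \<in> K"
    by (rule relation_kernel) (use assms in \<open>force simp: tensor_relations_def\<close>)
  then show ?thesis unfolding tensor_def using assms by (simp add: add_cls cls_eq algebra_simps)
qed

lemma tensor_add_right:
  assumes "x el M" "s el S" "t el S"
  shows "tn x (s +[S] t) = tn x s +[T] tn x t"
proof -
  have "frag_of (x, s +[S] t) - frag_of (x, s) - frag_of (x, t) \<in> K"
    by (rule relation_kernel) (use assms in \<open>force simp: tensor_relations_def\<close>)
  then show ?thesis unfolding tensor_def using assms by (simp add: add_cls cls_eq algebra_simps)
qed

lemma tensor_balanced: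
  assumes "x el M" "s el S" "r el R"
  shows "tn (r .[M] x) s = tn x (r .[S] s)"
proof -
  have "frag_of (r .[M] x, s) - frag_of (x, r .[S] s) \<in> K"
    by (rule relation_kernel) (use assms in \<open>force simp: tensor_relations_def\<close>)
  then show ?thesis unfolding tensor_def using assms by (simp add: add_cls cls_eq algebra_simps)
qed

text \<open>The rule \<open>frag_induction\<close> closes under differences. Carrying
  \<open>P\<close> for an element and for its negative turns differences into sums, and the negative
  of a pure tensor is again pure, so users of this rule meet no case for negatives.\<close>

lemma T_induct [consumes 1, case_names tensor add]:
  assumes "z el T"
    and tensor: "\<And>x s. [|x el M; s el S|] ==> P (tn x s)"
    and add: "\<And>z w. [|z el T; w el T; P z; P w|] ==> P (z +[T] w)"
  shows "P z"
proof -
  have neg: "-[T] tn x s = tn (-[M] x) s" if "x el M" "s el S" for x s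
    using add_hom_neg[OF M.abelian_group_axioms T.abelian_group_axioms, of "\<lambda>x. tn x s" x] that
    by (simp add: add_homI tensor_add_left)
  have Z: "tn \<zero>[M] s = \<zero>[T]" if "s el S" for s
    using add_hom_zero[OF M.abelian_group_axioms T.abelian_group_axioms, of "\<lambda>x. tn x s"] that
    by (simp add: add_homI tensor_add_left)
  obtain a where a: "a el G" "z = cls a" using assms(1) by (auto simp: carrier_T)
  have "a el G \<and> P (cls a) \<and> P (-[T] cls a)" if "Poly_Mapping.keys a \<subseteq> carrier M \<times> carrier S" for a
    using that
  proof (induction a rule: frag_induction)
    case zero
    have "P \<zero>[T]" using tensor[OF M.M.zero_closed S.M.zero_closed] Z by simp
    then show ?case by (simp add: zero_G zero_cls[symmetric] T.minus_zero')
  next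
    case (one p)
    then obtain x s where "p = (x, s)" "x el M" "s el S" by auto
    then show ?case using tensor[of x s] tensor[of "-[M] x" s] neg[of x s] by (simp flip: tensor_def)
  next
    case (diff x y)
    then have xy: "x el G" "y el G" "x - y el G" using G_closed(2)[of x y] by auto
    have eq: "cls (x - y) +[T] cls y = cls x" using xy by (simp add: add_cls)
    have c: "cls (x - y) el T" "cls x el T" "cls y el T" using xy carrier_T by blast+
    have e2: "cls (x - y) = cls x +[T] -[T] cls y" using eq c by (metis T.add.inv_solve_right')
    then have e3: "-[T] cls (x - y) = -[T] cls x +[T] cls y" using c by (simp add: T.minus_add)
    show ?case unfolding e3 using diff c e2 xy add by (metis T.a_inv_closed)
  qed
  then show ?thesis using a by (simp add: carrier_free_Abelian_group_iff)
qed

text \<open>An additive map \<open>h\<close> on the free abelian group that respects the relations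
  is constant on cosets, so its value at the arbitrary representative \<open>rep\<close> is well
  defined. The values \<open>f\<close> on generators are kept separate because the relations speak
  only about them.\<close>

lemma hom_descends:
  assumes N: "abelian_group N"
    and cl: "\<And>a. a el G ==> h a el N"
    and ad: "\<And>a b. [|a el G; b el G|] ==> h (a + b) = h a +[N] h b"
    and hf: "\<And>x s. [|x el M; s el S|] ==> h (frag_of (x, s)) = f x s"
    and b1: "\<And>x y s. [|x el M; y el M; s el S|] ==> f (x +[M] y) s = f x s +[N] f y s"
    and b2: "\<And>x s t. [|x el M; s el S; t el S|] ==> f x (s +[S] t) = f x s +[N] f x t"
    and b3: "\<And>r x s. [|r el R; x el M; s el S|] ==> f (r .[M] x) s = f x (r .[S] s)"
  shows "(\<lambda>A. h (rep A)) \<in> add_hom T N"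
    "\<And>x s. [|x el M; s el S|] ==> h (rep (tn x s)) = f x s"
proof -
  interpret N: abelian_group N by fact
  have df: "h (a - b) = h a -[N] h b" if "a el G" "b el G" for a b
  proof -
    have "h a = h (a - b) +[N] h b" using ad[of "a - b" b] G_closed(2)[OF that] that by simp
    then show ?thesis
      using cl G_closed(2)[OF that] that by (metis N.add.inv_solve_right' a_minus_def)
  qed
  have z0: "h 0 = \<zero>[N]" using df[of 0 0] cl[of 0] zero_G by (simp add: N.r_neg a_minus_def)
  have fc: "f x s el N" if "x el M" "s el S" for x s
    using cl[OF frag_of_G[OF that]] hf[OF that] by simp
  have rel: "h a = \<zero>[N]" if "a \<in> tensor_relations R M S" for a
    using that unfolding tensor_relations_def
  proof (elim UnE CollectE exE conjE)
    fix x y s assume a: "a = frag_of (x +[M] y, s) - frag_of (x, s) - frag_of (y, s)" and c: "x el M" "y el M" "s el S"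
    have "h a = (f (x +[M] y) s -[N] f x s) -[N] f y s"
      unfolding a using c G_closed(2)[of "frag_of (x +[M] y, s)" "frag_of (x, s)"]
      by (subst df) (auto simp: df hf)
    then show ?thesis using c b1 fc by (simp add: N.add_minus_minus_cancel)
  next
    fix x s t assume a: "a = frag_of (x, s +[S] t) - frag_of (x, s) - frag_of (x, t)" and c: "x el M" "s el S" "t el S"
    have "h a = (f x (s +[S] t) -[N] f x s) -[N] f x t"
      unfolding a using c G_closed(2)[of "frag_of (x, s +[S] t)" "frag_of (x, s)"]
      by (subst df) (auto simp: df hf)
    then show ?thesis using c b2 fc by (simp add: N.add_minus_minus_cancel)
  next
    fix r x s assume a: "a = frag_of (r .[M] x, s) - frag_of (x, r .[S] s)" and c: "r el R" "x el M" "s el S"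
    have "h a = f (r .[M] x) s -[N] f x (r .[S] s)"
      unfolding a using c by (subst df) (auto simp: df hf)
    then show ?thesis using c b3 fc by (simp add: a_minus_def N.r_neg)
  qed
  \<comment> \<open>Membership in the carrier is carried along because additivity of
    \<open>h\<close> is only assumed there.\<close>
  have "h a = \<zero>[N] \<and> a el G" if "a \<in> K" for a
    using that unfolding tensor_kernel_def
  proof (induction rule: generate.induct)
    case one then show ?case using z0 zero_G by simp
  next
    case (incl a) then show ?case using relations_closed rel by blast
  next
    case (inv a)
    then have a: "a el G" using relations_closed by blast
    then have "inv\<^bsub>G\<^esub> a = 0 - a" by (simp add: carrier_free_Abelian_group_iff)
    then show ?case using df[OF zero_G a] a rel[OF inv] z0 G_closed(2)[OF zero_G a] by (simp add: a_minus_def)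
  next
    case (eng a b) then show ?case using ad[of a b] G_closed(1)[of a b] by simp
  qed
  then have hK: "h a = \<zero>[N]" if "a \<in> K" for a using that by blast
  have hrep: "h (rep (cls a)) = h a" if a: "a el G" for a
  proof -
    note r = rep_cls[OF a]
    have "h (rep (cls a)) -[N] h a = \<zero>[N]" using df[of "rep (cls a)" a] hK r a by metis
    then show ?thesis by (rule N.minus_eq_zeroD) (use r a cl in auto)
  qed
  show "(\<lambda>A. h (rep A)) \<in> add_hom T N"
    by (rule add_homI) (auto simp: carrier_T hrep add_cls G_closed cl ad)
  show "h (rep (tn x s)) = f x s" if "x el M" "s el S" for x s
    unfolding tensor_def using hrep[OF frag_of_G[OF that]] hf[OF that] by simp
qed

lemma universal:
  assumes N: "abelian_group N"
    and cl: "\<And>x s. [|x el M; s el S|] ==> f x s el N"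
    and b1: "\<And>x y s. [|x el M; y el M; s el S|] ==> f (x +[M] y) s = f x s +[N] f y s"
    and b2: "\<And>x s t. [|x el M; s el S; t el S|] ==> f x (s +[S] t) = f x s +[N] f x t"
    and b3: "\<And>r x s. [|r el R; x el M; s el S|] ==> f (r .[M] x) s = f x (r .[S] s)"
  obtains g where "g \<in> add_hom T N" "\<And>x s. [|x el M; s el S|] ==> g (tn x s) = f x s"
proof -
  have "(\<lambda>(x, s). f x s) ` (carrier M \<times> carrier S) \<subseteq> carrier (add_monoid N)" using cl by auto
  from comm_group.free_Abelian_group_universal[OF abelian_group.a_comm_group[OF N] this]
  obtain h where h: "h \<in> hom G (add_monoid N)" "\<And>p. p \<in> carrier M \<times> carrier S ==> h (frag_of p) = (\<lambda>(x, s). f x s) p"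
    by blast
  note hd = hom_descends[of N h f, OF N _ _ _ b1 b2 b3]
  have "(\<lambda>A. h (rep A)) \<in> add_hom T N" "\<And>x s. [|x el M; s el S|] ==> h (rep (tn x s)) = f x s"
    using h hom_mult[OF h(1)] hom_in_carrier[OF h(1)] by (auto intro!: hd)
  then show ?thesis by (rule that)
qed

lemma frag_extend_closed:
  assumes "\<And>p. p \<in> carrier M \<times> carrier S ==> f p el (free_Abelian_group Y)" "a el G"
  shows "frag_extend f a el (free_Abelian_group Y)"
  unfolding carrier_free_Abelian_group_iff
proof (rule order_trans[OF keys_frag_extend], rule UN_least)
  fix p assume "p \<in> Poly_Mapping.keys a"
  then have "p \<in> carrier M \<times> carrier S" using assms(2) by (auto simp: carrier_free_Abelian_group_iff)
  then show "Poly_Mapping.keys (f p) \<subseteq> Y" using assms(1)[of p] by (simp only: carrier_free_Abelian_group_iff)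
qed

end

text \<open>Maps into a second tensor product given on representatives by \<^const>\<open>frag_extend\<close>.\<close>

lemma tensor_map:
  assumes "tensor_product R M S" "tensor_product R' M' S'"
    and cl: "\<And>x s. [|x el M; s el S|] ==> f (x, s) el (pair_group M' S')"
    and F: "\<And>x s. [|x el M; s el S|] ==> tensor_class R' M' S' (f (x, s)) = F x s"
    and b1: "\<And>x y s. [|x el M; y el M; s el S|] ==> F (x +[M] y) s = F x s +[base_change R' M' S'] F y s"
    and b2: "\<And>x s t. [|x el M; s el S; t el S|] ==> F x (s +[S] t) = F x s +[base_change R' M' S'] F x t"
    and b3: "\<And>r x s. [|r el R; x el M; s el S|] ==> F (r .[M] x) s = F x (r .[S] s)"
  shows "(\<lambda>A. tensor_class R' M' S' (frag_extend f (rep A))) \<in> add_hom (base_change R M S) (base_change R' M' S')"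
    "\<And>x s. [|x el M; s el S|] ==> tensor_class R' M' S' (frag_extend f (rep (tensor R M S x s))) = F x s"
proof -
  interpret A: tensor_product R M S by fact
  interpret B: tensor_product R' M' S' by fact
  have fc: "frag_extend f a el B.G" if "a el A.G" for a
    by (rule A.frag_extend_closed[OF _ that]) (use cl in auto)
  note hd = A.hom_descends[of B.T "\<lambda>a. tensor_class R' M' S' (frag_extend f a)" F, OF B.abelian_group_T _ _ _ b1 b2 b3]
  show "(\<lambda>A. tensor_class R' M' S' (frag_extend f (rep A))) \<in> add_hom (base_change R M S) (base_change R' M' S')"
    by (rule hd(1)) (simp_all add: fc F B.carrier_T frag_extend_add B.add_cls)
  show "tensor_class R' M' S' (frag_extend f (rep (tensor R M S x s))) = F x s"
    if "x el M" "s el S" for x s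
    by (rule hd(2)) (simp_all add: that fc F B.carrier_T frag_extend_add B.add_cls)
qed

locale scalar_extension = M: module R M + S: algebra R S
  for R :: "('r, 'z) ring_scheme" and M :: "('r, 'm) module" and S :: "('r, 's) module"
begin

sublocale tensor_product R M S ..

text \<open>\<open>hS\<close> is the structure map from \<open>R\<close> to \<open>S\<close>, and
  \<open>ii\<close> below is the canonical map from \<open>M\<close> to its base change.\<close>

definition "hS r = r .[S] \<one>[S]"
definition "ii x = tn x \<one>[S]"

lemma hS_closed [simp, intro]: "r el R ==> hS r el S" by (simp add: hS_def)

lemma hS_hom: "hS \<in> ring_hom R S"
  by (rule ring_hom_memI) (auto simp: hS_def S.smult_l_distr S.smult_assoc1 S.smult_assoc2)

lemma ii_closed [simp, intro]: "x el M ==> ii x el T" by (simp add: ii_def)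

lemma smult_tensor_facts:
  assumes "t el S"
  shows "(\<lambda>A. t .[T] A) \<in> add_hom T T"
    "\<And>x s. [|x el M; s el S|] ==> t .[T] tn x s = tn x (t *[S] s)"
proof -
  have tp: "tensor_product R M S" ..
  have sm: "smult T = (\<lambda>t A. cls (frag_extend (\<lambda>(x, s). frag_of (x, t *[S] s)) (rep A)))"
    by (simp add: base_change_def)
  have c: "t *[S] (r .[S] s) = r .[S] (t *[S] s)" if "r el R" "s el S" for r s
    using S.smult_assoc2[of r s t] that assms by (simp add: S.m_comm)
  note tm = tensor_map[OF tp tp, of "\<lambda>(x, s). frag_of (x, t *[S] s)" "\<lambda>x s. tn x (t *[S] s)"]
  show "(\<lambda>A. t .[T] A) \<in> add_hom T T"
    unfolding sm by (rule tm(1)) (use assms c in \<open>auto simp: tensor_def[symmetric] tensor_add_left tensor_add_right tensor_balanced S.r_distr\<close>)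
  show "\<And>x s. [|x el M; s el S|] ==> t .[T] tn x s = tn x (t *[S] s)"
    unfolding sm by (rule tm(2)) (use assms c in \<open>auto simp: tensor_def[symmetric] tensor_add_left tensor_add_right tensor_balanced S.r_distr\<close>)
qed

lemma smult_tensor: "[|t el S; x el M; s el S|] ==> t .[T] tn x s = tn x (t *[S] s)"
  by (rule smult_tensor_facts)

lemma smultT_closed: "[|t el S; z el T|] ==> t .[T] z el T"
  using add_hom_closed[OF smult_tensor_facts(1)] by blast

lemma smultT_add: "[|t el S; z el T; w el T|] ==> t .[T] (z +[T] w) = t .[T] z +[T] t .[T] w"
  using add_hom_add[OF smult_tensor_facts(1)] by blast

lemma module_T: "module S T"
proof (rule moduleI)
  show "cring S" "abelian_group T" by (rule S.M_cring, rule abelian_group_T)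
  fix a b x assume c: "a el S" "b el S" "x el T"
  show "(a +[S] b) .[T] x = a .[T] x +[T] b .[T] x" using c(3)
    by (induction x rule: T_induct)
      (use c in \<open>simp_all add: smult_tensor S.l_distr tensor_add_right smultT_add smultT_closed T.a_ac\<close>)
  show "(a *[S] b) .[T] x = a .[T] (b .[T] x)" using c(3)
    by (induction x rule: T_induct)
      (use c in \<open>simp_all add: smult_tensor S.m_assoc smultT_add smultT_closed\<close>)
next
  fix x assume "x el T"
  then show "\<one>[S] .[T] x = x"
    by (induction x rule: T_induct) (simp_all add: smult_tensor smultT_add)
qed (auto simp: smultT_closed smultT_add)

lemma tensor_ii: "[|x el M; s el S|] ==> tn x s = s .[T] ii x"
  by (simp add: ii_def smult_tensor)

lemma ii_add: "[|x el M; y el M|] ==> ii (x +[M] y) = ii x +[T] ii y"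
  by (simp add: ii_def tensor_add_left)

lemma ii_smult: "[|r el R; x el M|] ==> ii (r .[M] x) = hS r .[T] ii x"
  by (simp add: ii_def tensor_balanced smult_tensor hS_def)

lemma ii_hom: "ii \<in> add_hom M T" by (rule add_homI) (auto simp: ii_add)

lemma T_induct' [consumes 1, case_names smult add]:
  assumes "z el T"
    and "\<And>x s. [|x el M; s el S|] ==> P (s .[T] ii x)"
    and "\<And>z w. [|z el T; w el T; P z; P w|] ==> P (z +[T] w)"
  shows "P z"
  using assms by (induction rule: T_induct) (auto simp: tensor_ii)

text \<open>This is \<open>\<phi>\<close> tensored with the identity, followed by the action of
  \<open>R\<close> on \<open>S\<close>. Linear functionals survive base change without a basis:
  torsion tests and quadratic forms are pushed through them.\<close>

lemma functional_extends:
  assumes \<phi>: "\<phi> \<in> lin_hom R M (self_module R)"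
  obtains \<Phi> where "\<Phi> \<in> lin_hom S T (self_module S)" "\<And>x. x el M ==> \<Phi> (ii x) = hS (\<phi> x)"
proof -
  have p: "\<phi> x el R" "\<phi> (x +[M] y) = \<phi> x +[R] \<phi> y" "r el R ==> \<phi> (r .[M] x) = r *[R] \<phi> x"
    if "x el M" "y el M" for x y r
    using \<phi> that by (auto simp: lin_hom_def self_module_def)
  have sc: "a .[S] (b .[S] s) = b .[S] (a .[S] s)"
    if "a el R" "b el R" "s el S" for a b s
    using that S.smult_assoc1[of a b s] S.smult_assoc1[of b a s] M.R.m_comm[of a b] by simp
  obtain g where g: "g \<in> add_hom T S" "\<And>x s. [|x el M; s el S|] ==> g (tn x s) = \<phi> x .[S] s"
    by (rule universal[of S "\<lambda>x s. \<phi> x .[S] s"])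
      (simp_all add: p S.smult_l_distr S.smult_r_distr S.abelian_group_axioms S.smult_assoc1 sc)
  have lin: "g (t .[T] z) = t *[S] g z" if "t el S" "z el T" for t z
    using that(2)
  proof (induction z rule: T_induct)
    case (tensor x s)
    then show ?case using that(1) p[of x x] S.smult_assoc2[of "\<phi> x" s t]
      by (simp add: smult_tensor g(2) S.m_comm)
  next
    case (add z w)
    then show ?case using that(1) by (simp add: smultT_add add_hom_add[OF g(1)] smultT_closed S.r_distr add_hom_closed[OF g(1)])
  qed
  show ?thesis
  proof (rule that[of "restrict g (carrier T)"])
    show "restrict g (carrier T) \<in> lin_hom S T (self_module S)"
      using add_hom_closed[OF g(1)] add_hom_add[OF g(1)] lin by (auto simp: lin_hom_def self_module_def smultT_closed)
    show "\<And>x. x el M ==> restrict g (carrier T) (ii x) = hS (\<phi> x)"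
      by (simp add: ii_def g(2) hS_def)
  qed
qed

end

locale algebra_extension = M: unital_nonassoc_algebra R M + S: algebra R S
  for R :: "('r, 'z) ring_scheme" and M :: "('r, 'm) module" and S :: "('r, 's) module"
begin

sublocale scalar_extension R M S ..

text \<open>The product chooses representatives of both factors. The choice on the right is removed
  first, with a pure tensor on the left (\<open>F\<close>), and then the one on the left, for a
  fixed right factor; additivity on the right for a general left factor follows by induction on the
  latter.\<close>

lemma mult_facts:
  shows "\<And>A. A el T ==> (\<lambda>B. A *[T] B) \<in> add_hom T T"
    "\<And>B. B el T ==> (\<lambda>A. A *[T] B) \<in> add_hom T T"
    "\<And>x s y t. [|x el M; s el S; y el M; t el S|]
      ==> tn x s *[T] tn y t = tn (x *[M] y) (s *[S] t)"
proof -
  have tp: "tensor_product R M S" ..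
  define f where "f B = (\<lambda>(x, s). frag_extend (\<lambda>(y, t). frag_of (x *[M] y, s *[S] t)) (rep B))" for B
  have mu: "monoid.mult T = (\<lambda>A B. cls (frag_extend (f B) (rep A)))"
    by (simp add: base_change_def f_def)
  note [simp] = M.mult_closed M.mult_add_left M.mult_add_right M.mult_smult_left M.mult_smult_right
  have c: "t *[S] (r .[S] s) = r .[S] (t *[S] s)" if "r el R" "s el S" "t el S" for r s t
    using S.smult_assoc2[of r s t] that by (simp add: S.m_comm)
  define F where "F x s B = cls (f B (x, s))" for x s B
  have F: "F x s \<in> add_hom T T" "\<And>y t. [|y el M; t el S|] ==> F x s (tn y t) = tn (x *[M] y) (s *[S] t)"
    if xs: "x el M" "s el S" for x s
  proof -
    note tm = tensor_map[OF tp tp, of "\<lambda>(y, t). frag_of (x *[M] y, s *[S] t)" "\<lambda>y t. tn (x *[M] y) (s *[S] t)"]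
    show "F x s \<in> add_hom T T"
      unfolding F_def f_def prod.case by (rule tm(1)) (use xs c in \<open>auto simp: tensor_def[symmetric] tensor_add_left tensor_add_right tensor_balanced S.r_distr\<close>)
    show "\<And>y t. [|y el M; t el S|] ==> F x s (tn y t) = tn (x *[M] y) (s *[S] t)"
      unfolding F_def f_def prod.case by (rule tm(2)) (use xs c in \<open>auto simp: tensor_def[symmetric] tensor_add_left tensor_add_right tensor_balanced S.r_distr\<close>)
  qed
  have Fc: "F x s B el T" if "x el M" "s el S" "B el T" for x s B
    using add_hom_closed[OF F(1)] that by blast
  have fc: "f B (x, s) el G" if "x el M" "s el S" "B el T" for x s B
    unfolding f_def prod.case using rep_T[OF that(3)] that by (intro frag_extend_closed) auto
  have B1: "F (x +[M] y) s B = F x s B +[T] F y s B" if "x el M" "y el M" "s el S" "B el T" for x y s B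
    using that(4) by (induction B rule: T_induct) (use that in \<open>simp_all add: F tensor_add_left add_hom_add[OF F(1)] Fc T.a_ac\<close>)
  have B2: "F x (s +[S] t) B = F x s B +[T] F x t B" if "x el M" "t el S" "s el S" "B el T" for x t s B
    using that(4) by (induction B rule: T_induct) (use that in \<open>simp_all add: F tensor_add_right S.l_distr add_hom_add[OF F(1)] Fc T.a_ac\<close>)
  have B3: "F (r .[M] x) s B = F x (r .[S] s) B" if "x el M" "r el R" "s el S" "B el T" for x r s B
    using that(4) by (induction B rule: T_induct) (use that in \<open>simp_all add: F tensor_balanced S.smult_assoc2 add_hom_add[OF F(1)] Fc\<close>)
  have R: "(\<lambda>A. A *[T] B) \<in> add_hom T T" "\<And>x s. [|x el M; s el S|] ==> tn x s *[T] B = F x s B"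
    if B: "B el T" for B
  proof -
    note tm = tensor_map[OF tp tp, of "f B" "\<lambda>x s. F x s B"]
    show "(\<lambda>A. A *[T] B) \<in> add_hom T T"
      unfolding mu by (rule tm(1)) (use B fc in \<open>auto simp: F_def[symmetric] B1 B2 B3\<close>)
    show "\<And>x s. [|x el M; s el S|] ==> tn x s *[T] B = F x s B"
      unfolding mu by (rule tm(2)) (use B fc in \<open>auto simp: F_def[symmetric] B1 B2 B3\<close>)
  qed
  then show "\<And>B. B el T ==> (\<lambda>A. A *[T] B) \<in> add_hom T T" by blast
  show "tn x s *[T] tn y t = tn (x *[M] y) (s *[S] t)"
    if "x el M" "s el S" "y el M" "t el S" for x s y t
    using that R(2)[of "tn y t" x s] F(2) by simp
  have ad: "A *[T] (B +[T] B') = A *[T] B +[T] A *[T] B'" if "A el T" "B el T" "B' el T" for A B B'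
    using that(1)
  proof (induction A rule: T_induct)
    case (tensor x s) then show ?case using that by (simp add: R add_hom_add[OF F(1)])
  next
    case (add z w) then show ?case using that
      by (simp add: add_hom_add[OF R(1)] add_hom_closed[OF R(1)] T.a_ac)
  qed
  show "(\<lambda>B. A *[T] B) \<in> add_hom T T" if "A el T" for A
    by (rule add_homI) (use that ad add_hom_closed[OF R(1)] in auto)
qed

lemma multT_closed: "[|A el T; B el T|] ==> A *[T] B el T"
  using add_hom_closed[OF mult_facts(1)] by blast

lemma ii_mult: "[|x el M; y el M|] ==> ii (x *[M] y) = ii x *[T] ii y"
  by (simp add: ii_def mult_facts(3))

lemma ii_one: "\<one>[T] = ii \<one>[M]"
  by (simp add: ii_def base_change_def)

lemma nonassoc_algebra_T: "unital_nonassoc_algebra S T"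
proof -
  interpret T': module S T by (rule module_T)
  note [simp] = add_hom_add[OF mult_facts(1)] add_hom_add[OF mult_facts(2)] multT_closed smult_tensor
    mult_facts(3) smultT_closed smultT_add M.mult_closed M.one_closed M.mult_one_left M.mult_one_right
  have one: "\<one>[T] = tn \<one>[M] \<one>[S]" by (simp add: base_change_def)
  show ?thesis
  proof (unfold_locales)
    fix x assume x: "x el T"
    show "\<one>[T] *[T] x = x" using x by (induction x rule: T_induct) (simp_all add: one)
    show "x *[T] \<one>[T] = x" using x by (induction x rule: T_induct) (simp_all add: one)
    fix r y assume r: "r el S" and y: "y el T"
    have 1: "(r .[T] tn a s) *[T] y = r .[T] (tn a s *[T] y)" "tn a s *[T] (r .[T] y) = r .[T] (tn a s *[T] y)"
      if "a el M" "s el S" for a s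
      using y by (induction y rule: T_induct) (use that r in \<open>simp_all add: S.m_ac S.m_assoc\<close>)
    show "(r .[T] x) *[T] y = r .[T] (x *[T] y)" using x
      by (induction x rule: T_induct) (use r y 1 in \<open>simp_all del: smult_tensor\<close>)
    show "x *[T] (r .[T] y) = r .[T] (x *[T] y)" using x
      by (induction x rule: T_induct) (use r y 1 in \<open>simp_all del: smult_tensor\<close>)
  qed (auto simp: one)
qed

end

lemma base_change_map_facts:
  assumes "module R M" "algebra R S" "algebra R T" "h \<in> alg_hom R S T"
  shows "base_change_map R M S T h \<in> add_hom (base_change R M S) (base_change R M T)"
    "\<And>x s. [|x el M; s el S|] ==> base_change_map R M S T h (tensor R M S x s) = tensor R M T x (h s)"
    "\<And>z s. [|z el (base_change R M S); s el S|] ==>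
      base_change_map R M S T h (s .[base_change R M S] z) = h s .[base_change R M T] base_change_map R M S T h z"
proof -
  interpret A: scalar_extension R M S using assms by (simp add: scalar_extension_def)
  interpret B: scalar_extension R M T using assms by (simp add: scalar_extension_def)
  have tp: "tensor_product R M S" "tensor_product R M T" ..
  have h: "h s el T" "h (s +[S] t) = h s +[T] h t" "h (s *[S] t) = h s *[T] h t" "r el R ==> h (r .[S] s) = r .[T] h s"
    if "s el S" "t el S" for r s t
    using assms(4) that by (auto simp: alg_hom_def ring_hom_def)
  note tm = tensor_map[OF tp, of "\<lambda>(x, s). frag_of (x, h s)" "\<lambda>x s. tensor R M T x (h s)"]
  have 1: "(\<lambda>A. tensor_class R M T (frag_extend (\<lambda>(x, s). frag_of (x, h s)) (rep A))) \<in> add_hom (base_change R M S) (base_change R M T)"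
    by (rule tm(1)) (use h in \<open>auto simp: tensor_def[symmetric] B.tensor_add_left B.tensor_add_right B.tensor_balanced\<close>)
  have 2: "tensor_class R M T (frag_extend (\<lambda>(x, s). frag_of (x, h s)) (rep (tensor R M S x s))) = tensor R M T x (h s)"
    if "x el M" "s el S" for x s using that
    by (rule tm(2)[rotated -2]) (use h in \<open>auto simp: tensor_def[symmetric] B.tensor_add_left B.tensor_add_right B.tensor_balanced\<close>)
  show 3: "base_change_map R M S T h \<in> add_hom (base_change R M S) (base_change R M T)"
    by (rule add_homI) (auto simp: base_change_map_def add_hom_closed[OF 1] add_hom_add[OF 1])
  show 4: "\<And>x s. [|x el M; s el S|] ==> base_change_map R M S T h (tensor R M S x s) = tensor R M T x (h s)"
    using 2 by (simp add: base_change_map_def)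
  show "base_change_map R M S T h (s .[base_change R M S] z) = h s .[base_change R M T] base_change_map R M S T h z"
    if "z el (base_change R M S)" "s el S" for z s
    using that(1) by (induction z rule: A.T_induct)
      (use that h in \<open>simp_all add: A.smult_tensor B.smult_tensor 4 A.smultT_add A.smultT_closed add_hom_add[OF 3] B.smultT_add add_hom_closed[OF 3]\<close>)
qed

section \<open>Dual bases of finitely generated projective modules\<close>

section \<open>Finite free modules and dual systems\<close>

lemma (in cring) module_free_module: "module R (free_module R n)"
proof (rule moduleI)
  show "cring R" ..
  show "abelian_group (free_module R n)"
  proof (rule abelian_groupI)
    fix v assume v: "v el (free_module R n)"
    show "\<exists>w\<in>carrier (free_module R n). w +[free_module R n] v = \<zero>[free_module R n]"
      by (rule bexI[of _ "\<lambda>i\<in>{..<n}. \<ominus> v i"])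
        (use v in \<open>auto simp: free_module_def PiE_iff l_neg intro!: restrict_ext\<close>)
  qed (auto simp: free_module_def PiE_iff a_ac extensional_def intro!: restrict_ext)
qed (auto simp: free_module_def PiE_iff l_distr r_distr m_assoc extensional_def intro!: restrict_ext)

definition unit_vec :: "('r, 'z) ring_scheme => nat => nat => nat => 'r" where
  "unit_vec R n i = (\<lambda>j\<in>{..<n}. if i = j then \<one>[R] else \<zero>[R])"

lemma (in cring) unit_vec_closed [simp]: "unit_vec R n i el (free_module R n)"
  by (auto simp: unit_vec_def free_module_def)

lemma (in cring) free_module_expansion:
  assumes v: "v el (free_module R n)"
  shows "v = (\<Oplus>\<^bsub>free_module R n\<^esub>i\<in>{..<n}. v i .[free_module R n] unit_vec R n i)" (is "v = ?w")
proof -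
  interpret F: module R "free_module R n" by (rule module_free_module)
  have vi: "v i el R" if "i < n" for i using v that by (auto simp: free_module_def)
  have cl: "(\<lambda>i. v i .[free_module R n] unit_vec R n i) \<in> {..<n} \<rightarrow> carrier (free_module R n)"
    using vi by auto
  have "?w el (free_module R n)" using cl by (rule F.M.finsum_closed)
  moreover have "v j = ?w j" if j: "j < n" for j
  proof -
    have ev: "(\<lambda>w. w j) \<in> add_hom (free_module R n) R"
      by (rule add_homI) (use j in \<open>auto simp: free_module_def\<close>)
    have "?w j = (\<Oplus>i\<in>{..<n}. (v i .[free_module R n] unit_vec R n i) j)"
      by (rule add_hom_finsum[OF F.M.abelian_group_axioms abelian_group_axioms ev _ cl]) simp
    also have "\<dots> = (\<Oplus>i\<in>{..<n}. if j = i then v i else \<zero>)"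
      by (rule finsum_cong') (use vi j in \<open>auto simp: free_module_def unit_vec_def\<close>)
    also have "\<dots> = v j" using finsum_singleton[of j "{..<n}" v] vi j by simp
    finally show ?thesis by simp
  qed
  ultimately show ?thesis using v by (intro PiE_ext[of v "{..<n}" "\<lambda>_. carrier R"]) (auto simp: free_module_def)
qed

lemma lin_homD:
  assumes "f \<in> lin_hom R M N"
  shows "x el M ==> f x el N"
    "[|x el M; y el M|] ==> f (x +[M] y) = f x +[N] f y"
    "[|r el R; x el M|] ==> f (r .[M] x) = r .[N] f x"
    "f \<in> add_hom M N" "f \<in> extensional (carrier M)"
  using assms by (auto simp: lin_hom_def add_hom_def PiE_def)

lemma lin_homI:
  assumes "f \<in> extensional (carrier M)" "\<And>x. x el M ==> f x el N"
    "\<And>x y. [|x el M; y el M|] ==> f (x +[M] y) = f x +[N] f y"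
    "\<And>r x. [|r el R; x el M|] ==> f (r .[M] x) = r .[N] f x"
  shows "f \<in> lin_hom R M N"
  using assms by (auto simp: lin_hom_def PiE_def)

lemma lin_hom_eqI:
  "[|f \<in> lin_hom R M N; g \<in> lin_hom R M N; \<And>x. x el M ==> f x = g x|] ==> f = g"
  by (rule extensionalityI[of _ "carrier M"]) (auto dest: lin_homD(5))

lemma functionalD:
  assumes "f \<in> lin_hom R M (self_module R)"
  shows "x el M ==> f x el R"
    "[|x el M; y el M|] ==> f (x +[M] y) = f x +[R] f y"
    "[|r el R; x el M|] ==> f (r .[M] x) = r *[R] f x"
    "f \<in> add_hom M R"
  using assms by (auto simp: lin_hom_def self_module_def add_hom_def)

text \<open>The data of the dual basis lemma: \<open>e\<close> generates, with coordinate
  functionals \<open>\<phi>\<close>, but the values \<open>\<phi> k (e l)\<close> are unrestricted.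
  It replaces a basis where \<open>M\<close> is only projective.\<close>

definition dual_system ::
  "('r, 'z) ring_scheme => ('r, 'm) module => nat => (nat => 'm) => (nat => 'm => 'r) => bool" where
  "dual_system R M n e \<phi> \<longleftrightarrow> (\<forall>k<n. e k el M \<and> \<phi> k \<in> lin_hom R M (self_module R)) \<and>
     (\<forall>x\<in>carrier M. x = (\<Oplus>\<^bsub>M\<^esub>k\<in>{..<n}. \<phi> k x .[M] e k))"

lemma dual_systemD:
  assumes "dual_system R M n e \<phi>"
  shows "k < n ==> e k el M" "k < n ==> \<phi> k \<in> lin_hom R M (self_module R)"
    "x el M ==> x = (\<Oplus>\<^bsub>M\<^esub>k\<in>{..<n}. \<phi> k x .[M] e k)"
  using assms unfolding dual_system_def by blast+

text \<open>The retraction sends the unit vectors to the generators, and the section supplies the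
  coordinates.\<close>

lemma exists_dual_system:
  assumes M: "module R M" and proj: "fg_projective R M"
  shows "\<exists>n e \<phi>. dual_system R M n e \<phi>"
proof -
  obtain n i p where i: "i \<in> lin_hom R M (free_module R n)" and p: "p \<in> lin_hom R (free_module R n) M"
    and pi: "\<And>x. x el M ==> p (i x) = x"
    using proj unfolding fg_projective_def by blast
  interpret module R M by fact
  interpret F: module R "free_module R n" by (rule R.module_free_module)
  have ik: "i x k el R" if "x el M" "k < n" for x k
    using lin_homD(1)[OF i that(1)] that(2) by (auto simp: free_module_def)
  have "dual_system R M n (\<lambda>k. p (unit_vec R n k)) (\<lambda>k. \<lambda>x\<in>carrier M. i x k)"
    unfolding dual_system_def
  proof (intro allI impI ballI conjI)
    show "p (unit_vec R n k) el M" for k using lin_homD(1)[OF p] by simp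
    show "(\<lambda>x\<in>carrier M. i x k) \<in> lin_hom R M (self_module R)" if "k < n" for k
      by (rule lin_homI) (use ik that lin_homD(2,3)[OF i] in \<open>auto simp: self_module_def\<close>, auto simp: free_module_def)
    fix x assume x: "x el M"
    have cl: "(\<lambda>k. i x k .[free_module R n] unit_vec R n k) \<in> {..<n} \<rightarrow> carrier (free_module R n)"
      using ik x by auto
    have "x = p (\<Oplus>\<^bsub>free_module R n\<^esub>k\<in>{..<n}. i x k .[free_module R n] unit_vec R n k)"
      using R.free_module_expansion[OF lin_homD(1)[OF i x]] pi[OF x] by simp
    also have "\<dots> = (\<Oplus>\<^bsub>M\<^esub>k\<in>{..<n}. p (i x k .[free_module R n] unit_vec R n k))"
      by (rule add_hom_finsum[OF F.M.abelian_group_axioms M.abelian_group_axioms lin_homD(4)[OF p] _ cl]) simp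
    also have "\<dots> = (\<Oplus>\<^bsub>M\<^esub>k\<in>{..<n}. (\<lambda>x\<in>carrier M. i x k) x .[M] p (unit_vec R n k))"
      by (rule M.finsum_cong') (use lin_homD(1,3)[OF p] ik x in auto)
    finally show "x = (\<Oplus>\<^bsub>M\<^esub>k\<in>{..<n}. (\<lambda>x\<in>carrier M. i x k) x .[M] p (unit_vec R n k))" .
  qed
  then show ?thesis by blast
qed

section \<open>Localization at a prime ideal and bases with cleared denominators\<close>

section \<open>Localization at a prime\<close>

context primeideal begin

abbreviation "P \<equiv> carrier R - I"
abbreviation "L \<equiv> localization R I"
abbreviation "lc \<equiv> loc_class R I"

lemma P_one: "\<one> \<in> P" using I_notcarr one_imp_carrier by auto

lemma P_mult: "[|s \<in> P; t \<in> P|] ==> s \<otimes> t \<in> P" using I_prime by auto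

lemma lc_mem:
  assumes "a el R" "s \<in> P"
  shows "(b, t) \<in> lc a s \<longleftrightarrow> b el R \<and> t \<in> P \<and> (\<exists>u\<in>P. u \<otimes> (a \<otimes> t) = u \<otimes> (b \<otimes> s))"
proof -
  have "u \<otimes> (a \<otimes> t \<ominus> b \<otimes> s) = \<zero> \<longleftrightarrow> u \<otimes> (a \<otimes> t) = u \<otimes> (b \<otimes> s)"
    if "b el R" "t el R" "u el R" for u b t
  proof -
    have "u \<otimes> (a \<otimes> t \<ominus> b \<otimes> s) = u \<otimes> (a \<otimes> t) \<ominus> u \<otimes> (b \<otimes> s)"
      using that assms by (simp add: a_minus_def r_distr r_minus)
    then show ?thesis using that assms minus_eq_zeroD[of "u \<otimes> (a \<otimes> t)" "u \<otimes> (b \<otimes> s)"] by (auto simp: a_minus_def r_neg)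
  qed
  then show ?thesis unfolding loc_class_def by auto
qed

lemma lc_eq:
  assumes c: "a el R" "b el R" "s \<in> P" "t \<in> P"
  shows "lc a s = lc b t \<longleftrightarrow> (\<exists>u\<in>P. u \<otimes> (a \<otimes> t) = u \<otimes> (b \<otimes> s))"
proof
  assume "lc a s = lc b t"
  moreover have "(b, t) \<in> lc b t" using c P_one by (auto simp: lc_mem simp del: Diff_iff)
  ultimately show "\<exists>u\<in>P. u \<otimes> (a \<otimes> t) = u \<otimes> (b \<otimes> s)" using c lc_mem[of a s b t] by blast
next
  have tr: "(c, r) \<in> lc a s" if "u \<in> P" "u \<otimes> (a \<otimes> t) = u \<otimes> (b \<otimes> s)" "(c, r) \<in> lc b t"
     "a el R" "b el R" "s \<in> P" "t \<in> P" for a b s t u c r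
  proof -
    from that obtain v where v: "c el R" "r \<in> P" "v \<in> P" "v \<otimes> (b \<otimes> r) = v \<otimes> (c \<otimes> t)"
      using lc_mem[of b t c r] by blast
    have cc: "a el R" "b el R" "s el R" "t el R" "u el R" "c el R" "r el R" "v el R"
      using v that by auto
    \<comment> \<open>The middle denominator \<open>t\<close> cannot be cancelled, so it becomes
      part of the multiplier.\<close>
    have "(u \<otimes> v \<otimes> t) \<otimes> (a \<otimes> r) = v \<otimes> r \<otimes> (u \<otimes> (a \<otimes> t))" using cc by algebra
    also have "\<dots> = u \<otimes> s \<otimes> (v \<otimes> (b \<otimes> r))" unfolding that(2) using cc by algebra
    also have "\<dots> = (u \<otimes> v \<otimes> t) \<otimes> (c \<otimes> s)" unfolding v(4) using cc by algebra
    finally show ?thesis using lc_mem[of a s c r] v that P_mult by blast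
  qed
  assume "\<exists>u\<in>P. u \<otimes> (a \<otimes> t) = u \<otimes> (b \<otimes> s)"
  then obtain u where u: "u \<in> P" "u \<otimes> (a \<otimes> t) = u \<otimes> (b \<otimes> s)" by blast
  show "lc a s = lc b t"
  proof (rule Set.set_eqI)
    fix z :: "'a \<times> 'a"
    obtain d r where z: "z = (d, r)" by (cases z)
    show "z \<in> lc a s \<longleftrightarrow> z \<in> lc b t" unfolding z
      using tr[OF u _ c] tr[OF u(1) u(2)[symmetric] _ c(2,1,4,3)] by blast
  qed
qed

lemma lc_eqI: "[|a el R; b el R; s \<in> P; t \<in> P; a \<otimes> t = b \<otimes> s|] ==> lc a s = lc b t"
  using lc_eq P_one by metis

lemma rep_lc: "[|a el R; s \<in> P|] ==> \<exists>b t. rep (lc a s) = (b, t) \<and> b el R \<and> t \<in> P \<and> (\<exists>u\<in>P. u \<otimes> (a \<otimes> t) = u \<otimes> (b \<otimes> s))"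
proof -
  assume c: "a el R" "s \<in> P"
  then have "(a, s) \<in> lc a s" using P_one by (auto simp: lc_mem simp del: Diff_iff)
  then have "rep (lc a s) \<in> lc a s" unfolding rep_def by (rule someI)
  then show ?thesis using lc_mem[OF c] by (cases "rep (lc a s)") auto
qed

lemma carrier_L: "carrier L = {lc a s | a s. a el R \<and> s \<in> P}" by (simp add: localization_def)

lemma lc_closed [simp, intro]: "[|a el R; s \<in> P|] ==> lc a s el L" unfolding carrier_L by blast

lemma L_cases: assumes "x el L" obtains a s where "a el R" "s \<in> P" "x = lc a s"
  using assms unfolding carrier_L by blast

lemma L_ops:
  assumes c: "a el R" "s \<in> P" "b el R" "t \<in> P"
  shows "lc a s +[L] lc b t = lc (a \<otimes> t \<oplus> b \<otimes> s) (s \<otimes> t)" "lc a s *[L] lc b t = lc (a \<otimes> b) (s \<otimes> t)"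
proof -
  obtain a' s' u where 1: "rep (lc a s) = (a', s')" "a' el R" "s' \<in> P" "u \<in> P" "u \<otimes> (a \<otimes> s') = u \<otimes> (a' \<otimes> s)"
    using rep_lc c by meson
  obtain b' t' v where 2: "rep (lc b t) = (b', t')" "b' el R" "t' \<in> P" "v \<in> P" "v \<otimes> (b \<otimes> t') = v \<otimes> (b' \<otimes> t)"
    using rep_lc c by meson
  have cc: "a el R" "s el R" "b el R" "t el R" "a' el R" "s' el R" "u el R"
    "b' el R" "t' el R" "v el R" using 1 2 c by auto
  have st: "s \<otimes> t \<in> P" "s' \<otimes> t' \<in> P" "u \<otimes> v \<in> P" using P_mult c 1 2 by blast+
  have "lc a s +[L] lc b t = lc (a' \<otimes> t' \<oplus> b' \<otimes> s') (s' \<otimes> t')" by (simp add: localization_def 1 2)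
  also have "\<dots> = lc (a \<otimes> t \<oplus> b \<otimes> s) (s \<otimes> t)"
  proof (subst lc_eq)
    have "(u \<otimes> v) \<otimes> ((a' \<otimes> t' \<oplus> b' \<otimes> s') \<otimes> (s \<otimes> t)) = v \<otimes> t \<otimes> t' \<otimes> (u \<otimes> (a' \<otimes> s)) \<oplus> u \<otimes> s \<otimes> s' \<otimes> (v \<otimes> (b' \<otimes> t))"
      using cc by algebra
    also have "\<dots> = v \<otimes> t \<otimes> t' \<otimes> (u \<otimes> (a \<otimes> s')) \<oplus> u \<otimes> s \<otimes> s' \<otimes> (v \<otimes> (b \<otimes> t'))"
      by (simp only: 1(5) 2(5))
    also have "\<dots> = (u \<otimes> v) \<otimes> ((a \<otimes> t \<oplus> b \<otimes> s) \<otimes> (s' \<otimes> t'))" using cc by algebra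
    finally show "\<exists>u\<in>P. u \<otimes> ((a' \<otimes> t' \<oplus> b' \<otimes> s') \<otimes> (s \<otimes> t)) = u \<otimes> ((a \<otimes> t \<oplus> b \<otimes> s) \<otimes> (s' \<otimes> t'))"
      using st by blast
  qed (use cc st in auto)
  finally show "lc a s +[L] lc b t = lc (a \<otimes> t \<oplus> b \<otimes> s) (s \<otimes> t)" .
  have "lc a s *[L] lc b t = lc (a' \<otimes> b') (s' \<otimes> t')" by (simp add: localization_def 1 2)
  also have "\<dots> = lc (a \<otimes> b) (s \<otimes> t)"
  proof (subst lc_eq)
    have "(u \<otimes> v) \<otimes> ((a' \<otimes> b') \<otimes> (s \<otimes> t)) = (u \<otimes> (a' \<otimes> s)) \<otimes> (v \<otimes> (b' \<otimes> t))"
      using cc by algebra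
    also have "\<dots> = (u \<otimes> (a \<otimes> s')) \<otimes> (v \<otimes> (b \<otimes> t'))"
      by (simp only: 1(5) 2(5))
    also have "\<dots> = (u \<otimes> v) \<otimes> ((a \<otimes> b) \<otimes> (s' \<otimes> t'))" using cc by algebra
    finally show "\<exists>u\<in>P. u \<otimes> ((a' \<otimes> b') \<otimes> (s \<otimes> t)) = u \<otimes> ((a \<otimes> b) \<otimes> (s' \<otimes> t'))"
      using st by blast
  qed (use cc st in auto)
  finally show "lc a s *[L] lc b t = lc (a \<otimes> b) (s \<otimes> t)" .
qed

lemma L_smult:
  assumes c: "a el R" "s \<in> P" "r el R"
  shows "r .[L] lc a s = lc (r \<otimes> a) s"
proof -
  obtain a' s' u where 1: "rep (lc a s) = (a', s')" "a' el R" "s' \<in> P" "u \<in> P" "u \<otimes> (a \<otimes> s') = u \<otimes> (a' \<otimes> s)"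
    using rep_lc c by meson
  have cc: "a el R" "s el R" "r el R" "a' el R" "s' el R" "u el R"
    using 1 c by auto
  have "u \<otimes> ((r \<otimes> a') \<otimes> s) = r \<otimes> (u \<otimes> (a' \<otimes> s))" using cc by algebra
  also have "\<dots> = r \<otimes> (u \<otimes> (a \<otimes> s'))" by (simp only: 1(5))
  also have "\<dots> = u \<otimes> ((r \<otimes> a) \<otimes> s')" using cc by algebra
  finally have "lc (r \<otimes> a') s' = lc (r \<otimes> a) s" using lc_eq[of "r \<otimes> a'" "r \<otimes> a" s' s] c 1 by auto
  then show ?thesis by (simp add: localization_def 1)
qed

lemma L_consts: "\<one>[L] = lc \<one> \<one>" "\<zero>[L] = lc \<zero> \<one>" by (simp_all add: localization_def)

lemma algebra_L: "algebra R L"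
proof -
  note [simp] = L_ops L_smult L_consts P_mult[simplified] P_one[simplified]
  have lc0: "lc \<zero> s = lc \<zero> \<one>" if "s \<in> P" for s
    by (rule lc_eqI) (use that P_one in auto)
  have ag: "abelian_group L"
  proof (rule abelian_groupI)
    fix x assume "x el L"
    then obtain a s where a: "a el R" "s \<in> P" "x = lc a s" by (rule L_cases)
    then show "\<exists>y\<in>carrier L. y +[L] x = \<zero>[L]"
      by (intro bexI[of _ "lc (\<ominus> a) s"]) (simp_all add: l_minus l_neg lc0[of "s \<otimes> s"])
    show "\<zero>[L] +[L] x = x" using a by (auto intro!: lc_eqI)
    fix y assume "y el L"
    then obtain b t where b: "b el R" "t \<in> P" "y = lc b t" by (rule L_cases)
    then show "x +[L] y el L" using a by auto
    show "x +[L] y = y +[L] x" using a b by (auto intro!: lc_eqI simp: m_comm a_comm)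
    fix z assume "z el L"
    then obtain c r where c: "c el R" "r \<in> P" "z = lc c r" by (rule L_cases)
    have cc: "a el R" "s el R" "b el R" "t el R" "c el R" "r el R" using a b c by auto
    have "((a \<otimes> t \<oplus> b \<otimes> s) \<otimes> r \<oplus> c \<otimes> (s \<otimes> t)) \<otimes> (s \<otimes> (t \<otimes> r)) = (a \<otimes> (t \<otimes> r) \<oplus> (b \<otimes> r \<oplus> c \<otimes> t) \<otimes> s) \<otimes> ((s \<otimes> t) \<otimes> r)"
      using cc by algebra
    then show "x +[L] y +[L] z = x +[L] (y +[L] z)" using a b c by (simp, intro lc_eqI) auto
  qed auto
  have cm: "comm_monoid L"
  proof (rule comm_monoidI)
    fix x assume "x el L"
    then obtain a s where a: "a el R" "s \<in> P" "x = lc a s" by (rule L_cases)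
    show "\<one>[L] *[L] x = x" using a by (auto intro!: lc_eqI)
    fix y assume "y el L"
    then obtain b t where b: "b el R" "t \<in> P" "y = lc b t" by (rule L_cases)
    then show "x *[L] y el L" using a by auto
    show "x *[L] y = y *[L] x" using a b by (auto simp: m_comm)
    fix z assume "z el L"
    then obtain c r where c: "c el R" "r \<in> P" "z = lc c r" by (rule L_cases)
    show "x *[L] y *[L] z = x *[L] (y *[L] z)" using a b c by (auto simp: m_assoc)
  qed auto
  show ?thesis
  proof (rule algebraI)
    show "cring R" ..
    show "cring L"
    proof (rule cringI[OF ag cm])
      fix x y z assume "x el L" "y el L" "z el L"
      then obtain a s b t c r where a: "a el R" "s \<in> P" "x = lc a s" "b el R" "t \<in> P" "y = lc b t"
        and c: "c el R" "r \<in> P" "z = lc c r" by (elim L_cases)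
      have cc: "a el R" "s el R" "b el R" "t el R" "c el R" "r el R" using a c by auto
      have "((a \<otimes> t \<oplus> b \<otimes> s) \<otimes> c) \<otimes> ((s \<otimes> r) \<otimes> (t \<otimes> r)) = (a \<otimes> c \<otimes> (t \<otimes> r) \<oplus> b \<otimes> c \<otimes> (s \<otimes> r)) \<otimes> (s \<otimes> t \<otimes> r)"
        using cc by algebra
      then show "(x +[L] y) *[L] z = x *[L] z +[L] y *[L] z" using a c by (simp, intro lc_eqI) auto
    qed
    fix r x assume r: "r el R" and "x el L"
    then obtain a s where a: "a el R" "s \<in> P" "x = lc a s"
      by (elim L_cases)
    show "r .[L] x el L" using a r by auto
    fix y assume "y el L"
    then obtain b t where b: "b el R" "t \<in> P" "y = lc b t"
      by (elim L_cases)
    have cc: "a el R" "s el R" "b el R" "t el R" using a b by auto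
    have "(r \<otimes> (a \<otimes> t \<oplus> b \<otimes> s)) \<otimes> (s \<otimes> t) = (r \<otimes> a \<otimes> t \<oplus> r \<otimes> b \<otimes> s) \<otimes> (s \<otimes> t)" using cc r by algebra
    then show "r .[L] (x +[L] y) = r .[L] x +[L] r .[L] y" using a b r by (simp, intro lc_eqI) auto
    show "(r .[L] x) *[L] y = r .[L] (x *[L] y)" using a b r by (simp add: m_assoc)
  next
    fix r r' x assume r: "r el R" "r' el R" and "x el L"
    then obtain a s where a: "a el R" "s \<in> P" "x = lc a s"
      by (elim L_cases)
    have cc: "a el R" "s el R" using a by auto
    show "(r \<otimes> r') .[L] x = r .[L] (r' .[L] x)" using a r by (simp add: m_assoc)
    have "((r \<oplus> r') \<otimes> a) \<otimes> (s \<otimes> s) = (r \<otimes> a \<otimes> s \<oplus> r' \<otimes> a \<otimes> s) \<otimes> s" using cc r by algebra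
    then show "(r \<oplus> r') .[L] x = r .[L] x +[L] r' .[L] x" using a r by (simp, intro lc_eqI) auto
  next
    fix x assume "x el L"
    then obtain a s where a: "a el R" "s \<in> P" "x = lc a s"
      by (elim L_cases)
    then show "\<one> .[L] x = x" by auto
  qed
qed

text \<open>The product of the individual witnesses works for all finitely many conditions, since
  each condition survives multiplication by elements outside the prime. This is the device for
  common denominators and for common annihilators.\<close>

lemma common_multiple:
  assumes "finite A" "\<And>x. x \<in> A ==> \<exists>t\<in>P. Q t x"
    "\<And>r t x. [|r \<in> P; t \<in> P; x \<in> A; Q t x|] ==> Q (r \<otimes> t) x"
  shows "\<exists>t\<in>P. \<forall>x\<in>A. Q t x"
  using assms
proof (induction A rule: finite_induct)
  case empty then show ?case using P_one by blast
next
  case (insert x A)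
  from insert obtain t where t: "t \<in> P" "\<forall>x\<in>A. Q t x" by (metis insertCI)
  from insert obtain t' where t': "t' \<in> P" "Q t' x" by blast
  have "Q (t' \<otimes> t) y" if "y \<in> A" for y using insert.prems(2)[of t' t y] t t' that by blast
  moreover have "Q (t' \<otimes> t) x" using insert.prems(2)[of t t' x] t t' m_comm[of t t'] by auto
  ultimately show ?case using P_mult t t' by blast
qed

end

text \<open>A basis of the localized module has finitely many coordinates on finitely many
  generators; clearing denominators turns it into vectors and functionals over \<open>R\<close>
  itself. The single factor \<open>d\<close> outside \<open>p\<close> records what was inverted, so
  that later arguments stay over \<open>R\<close>. The dual system reduces all error terms to
  finitely many.\<close>

lemma local_basis:
  fixes R :: "('r, 'z) ring_scheme" (structure) and M :: "('r, 'm) module"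
  assumes M: "module R M" and proj: "fg_projective R M" and rank: "constant_rank R M m" and p: "primeideal p R"
  shows "\<exists>g \<psi> d. d \<in> carrier R - p \<and> (\<forall>i<m. g i el M) \<and> (\<forall>i<m. \<psi> i \<in> lin_hom R M (self_module R)) \<and>
    (\<forall>i<m. \<forall>j<m. \<psi> i (g j) = (if i = j then d else \<zero>[R])) \<and>
    (\<forall>x\<in>carrier M. d .[M] x = (\<Oplus>\<^bsub>M\<^esub>i\<in>{..<m}. \<psi> i x .[M] g i))"
proof -
  interpret module R M by fact
  interpret primeideal p R by fact
  interpret L: algebra R L by (rule algebra_L)
  interpret E: scalar_extension R M L ..
  obtain n e \<phi> where "dual_system R M n e \<phi>" using exists_dual_system[OF M proj] by blast
  note e = dual_systemD(1)[OF this] and \<phi> = dual_systemD(2)[OF this] and e\<phi> = dual_systemD(3)[OF this]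
  note \<phi>D = functionalD[OF \<phi>]
  obtain F where F: "F \<in> lin_hom L (free_module L m) E.T" and bij: "bij_betw F (carrier (free_module L m)) (carrier E.T)"
    using rank p unfolding constant_rank_def free_of_rank_def by blast
  interpret FM: module L "free_module L m" by (rule L.module_free_module)
  interpret T: module L E.T by (rule E.module_T)
  have hSlc: "E.hS r = lc r \<one>" if "r el R" for r
    using that P_one by (simp add: E.hS_def L_consts(1) L_smult)
  have hS0: "\<exists>t\<in>P. t \<otimes> r = \<zero>[R]" if "E.hS r = \<zero>[L]" "r el R" for r
    using that P_one by (auto simp: hSlc L_consts(2) lc_eq)
  have inv1: "E.hS s *[L] lc a s = E.hS a" if "s \<in> P" "a el R" for s a
  proof -
    have "E.hS s *[L] lc a s = lc (s \<otimes> a) (\<one> \<otimes> s)" using that P_one by (simp add: hSlc L_ops)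
    also have "\<dots> = lc a \<one>" by (rule lc_eqI) (use that P_one in \<open>auto simp: m_ac\<close>)
    finally show ?thesis using that by (simp add: hSlc)
  qed
  \<comment> \<open>Fractions in a sum are brought to a common denominator, so one pure tensor
    suffices.\<close>
  have frac: "\<exists>x\<in>carrier M. \<exists>s\<in>P. z = E.tn x (lc \<one> s)" if "z el E.T" for z
    using that
  proof (induction z rule: E.T_induct)
    case (tensor x l)
    then obtain a s where a: "a el R" "s \<in> P" "l = lc a s" by (elim L_cases)
    then have "l = a .[L] lc \<one> s" by (simp add: L_smult)
    then have "E.tn x l = E.tn (a .[M] x) (lc \<one> s)" using a tensor by (simp add: E.tensor_balanced)
    then show ?case using a tensor by blast
  next
    case (add z w)
    then obtain x s y t where xy: "x el M" "s \<in> P" "z = E.tn x (lc \<one> s)" "y el M" "t \<in> P" "w = E.tn y (lc \<one> t)" by blast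
    have st: "s \<otimes> t \<in> P" "s el R" "t el R" using xy P_mult by auto
    have "lc \<one> s = t .[L] lc \<one> (s \<otimes> t)" "lc \<one> t = s .[L] lc \<one> (s \<otimes> t)"
      using st xy by (simp_all add: L_smult) (rule lc_eqI; auto simp: m_ac)+
    then have "z +[E.T] w = E.tn (t .[M] x +[M] s .[M] y) (lc \<one> (s \<otimes> t))"
      using xy st by (simp add: E.tensor_add_left E.tensor_balanced)
    then show ?case using xy st by blast
  qed
  have "\<forall>i. \<exists>x s. x el M \<and> s \<in> P \<and> F (unit_vec L m i) = E.tn x (lc \<one> s)"
    using frac[OF lin_homD(1)[OF F L.unit_vec_closed]] by blast
  then obtain g s where g: "\<And>i. g i el M" and s: "\<And>i. s i \<in> P"
    and Fg: "\<And>i. F (unit_vec L m i) = E.tn (g i) (lc \<one> (s i))" by metis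
  have Fu: "F (unit_vec L m i) = lc \<one> (s i) .[E.T] E.ii (g i)" for i
    using Fg g s by (simp add: E.tensor_ii)
  \<comment> \<open>The coordinates of \<open>x\<close> in the given basis of the
    localization.\<close>
  define v where "v x = the_inv_into (carrier (free_module L m)) F (E.ii x)" for x
  have v: "v x el (free_module L m)" "F (v x) = E.ii x" if "x el M" for x
    using bij that f_the_inv_into_f_bij_betw[OF bij, of "E.ii x"] bij_betwE[OF bij_betw_the_inv_into[OF bij]] by (auto simp: v_def)
  have vI: "v x = w" if "w el (free_module L m)" "F w = E.ii x" for x w
    unfolding v_def that(2)[symmetric] by (rule the_inv_into_f_f) (use bij that in \<open>auto simp: bij_betw_def\<close>)
  have v_add: "v (x +[M] y) = v x +[free_module L m] v y" if "x el M" "y el M" for x y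
    by (rule vI) (use that v lin_homD(2)[OF F] in \<open>auto simp: E.ii_add\<close>)
  have v_smult: "v (r .[M] x) = E.hS r .[free_module L m] v x" if "x el M" "r el R" for x r
    by (rule vI) (use that v lin_homD(3)[OF F] in \<open>auto simp: E.ii_smult\<close>)
  have v_g: "v (g i) = E.hS (s i) .[free_module L m] unit_vec L m i" for i
  proof (rule vI)
    show "E.hS (s i) .[free_module L m] unit_vec L m i el (free_module L m)" using s[of i] by auto
    have "F (E.hS (s i) .[free_module L m] unit_vec L m i) = (E.hS (s i) *[L] lc \<one> (s i)) .[E.T] E.ii (g i)"
      using s[of i] g[of i] lin_homD(3)[OF F] by (simp add: Fu T.smult_assoc1)
    then show "F (E.hS (s i) .[free_module L m] unit_vec L m i) = E.ii (g i)"
      using inv1[OF s[of i], of \<one>] g[of i] P_one by (simp add: hSlc L_consts(1)[symmetric])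
  qed
  \<comment> \<open>Coordinates with respect to the numerators \<open>g i\<close> instead of the
    basis vectors \<open>F (unit_vec L m i)\<close>, hence the factor with denominator
    \<open>s i\<close>.\<close>
  define c where "c i x = lc \<one> (s i) *[L] v x i" for i x
  have vi: "v x i el L" if "x el M" "i < m" for x i
    using v(1)[OF that(1)] that(2) by (auto simp: free_module_def)
  have c_closed: "c i x el L" if "x el M" "i < m" for x i
    using vi[OF that] s[of i] by (auto simp: c_def)
  have c_add: "c i (x +[M] y) = c i x +[L] c i y" if "x el M" "y el M" "i < m" for x y i
    using that vi s[of i] by (simp add: c_def v_add) (simp add: free_module_def L.r_distr)
  have c_smult: "c i (r .[M] x) = E.hS r *[L] c i x" if "x el M" "r el R" "i < m" for x r i
    using that vi s[of i] by (simp add: c_def v_smult) (simp add: free_module_def L.m_ac)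
  have c_g: "c i (g j) = (if i = j then \<one>[L] else \<zero>[L])" if "i < m" for i j
    using that s[of j] s[of i] inv1[of "s i" \<one>] P_one
    by (simp add: c_def v_g) (auto simp add: free_module_def unit_vec_def L.m_comm L_consts(1)[symmetric] hSlc)
  have expand: "E.ii x = (\<Oplus>\<^bsub>E.T\<^esub>i\<in>{..<m}. c i x .[E.T] E.ii (g i))" if x: "x el M" for x
  proof -
    have cl: "(\<lambda>i. v x i .[free_module L m] unit_vec L m i) \<in> {..<m} \<rightarrow> carrier (free_module L m)" using vi[OF x] by auto
    have "E.ii x = F (\<Oplus>\<^bsub>free_module L m\<^esub>i\<in>{..<m}. v x i .[free_module L m] unit_vec L m i)"
      using L.free_module_expansion[OF v(1)[OF x]] v(2)[OF x] by simp
    also have "\<dots> = (\<Oplus>\<^bsub>E.T\<^esub>i\<in>{..<m}. F (v x i .[free_module L m] unit_vec L m i))"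
      by (rule add_hom_finsum[OF FM.M.abelian_group_axioms E.T.abelian_group_axioms lin_homD(4)[OF F] _ cl]) simp
    also have "\<dots> = (\<Oplus>\<^bsub>E.T\<^esub>i\<in>{..<m}. c i x .[E.T] E.ii (g i))"
    proof (rule E.T.finsum_cong')
      fix i assume i: "i \<in> {..<m}"
      show "F (v x i .[free_module L m] unit_vec L m i) = c i x .[E.T] E.ii (g i)"
        using vi[OF x, of i] i lin_homD(3)[OF F, of "v x i" "unit_vec L m i"] s[of i] g[of i]
        by (simp add: Fu c_def T.smult_assoc1[symmetric] L.m_comm)
    qed (use c_closed[OF x] g in auto)
    finally show ?thesis .
  qed
  \<comment> \<open>A common denominator for the coordinates of the finitely many generators
    \<open>e k\<close>.\<close>
  have "\<exists>d\<in>P. \<forall>ik\<in>{..<m} \<times> {..<n}. \<exists>a\<in>carrier R. E.hS d *[L] c (fst ik) (e (snd ik)) = E.hS a"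
  proof (rule common_multiple)
    fix ik assume "ik \<in> {..<m} \<times> {..<n}"
    then have "c (fst ik) (e (snd ik)) el L" using c_closed e by auto
    then obtain a s where "a el R" "s \<in> P" "c (fst ik) (e (snd ik)) = lc a s" by (rule L_cases)
    then show "\<exists>d\<in>P. \<exists>a\<in>carrier R. E.hS d *[L] c (fst ik) (e (snd ik)) = E.hS a"
      using inv1[of s a] by (intro bexI[of _ s] bexI[of _ a]) simp_all
  next
    fix r t ik assume a: "r \<in> P" "t \<in> P" "ik \<in> {..<m} \<times> {..<n}"
      "\<exists>a\<in>carrier R. E.hS t *[L] c (fst ik) (e (snd ik)) = E.hS a"
    then obtain a where a': "a el R" "E.hS t *[L] c (fst ik) (e (snd ik)) = E.hS a" by blast
    have "c (fst ik) (e (snd ik)) el L" using a c_closed e by auto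
    then have "E.hS (r \<otimes> t) *[L] c (fst ik) (e (snd ik)) = E.hS (r \<otimes> a)"
      using a a' ring_hom_mult[OF E.hS_hom] by (simp add: L.m_assoc)
    then show "\<exists>a\<in>carrier R. E.hS (r \<otimes> t) *[L] c (fst ik) (e (snd ik)) = E.hS a" using a a' by blast
  qed simp
  then obtain d where d: "d \<in> P" "\<And>i k. [|i < m; k < n|] ==> \<exists>a\<in>carrier R. E.hS d *[L] c i (e k) = E.hS a" by fastforce
  then have "\<forall>i k. \<exists>a. i < m --> k < n --> a el R \<and> E.hS d *[L] c i (e k) = E.hS a" by blast
  then obtain a where a: "\<And>i k. [|i < m; k < n|] ==> a i k el R"
    "\<And>i k. [|i < m; k < n|] ==> E.hS d *[L] c i (e k) = E.hS (a i k)" by metis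
  \<comment> \<open>Over \<open>R\<close> the functional is assembled from the numerators
    \<open>a\<close> through the coordinates \<open>\<phi>\<close>; its agreement with
    \<open>d\<close> times the coordinate \<open>c\<close> is asserted only in the
    localization.\<close>
  define \<psi> where "\<psi> i = (\<lambda>x\<in>carrier M. \<Oplus>k\<in>{..<n}. \<phi> k x \<otimes> a i k)" for i
  have \<phi>a: "(\<lambda>k. \<phi> k x \<otimes> a i k) \<in> {..<n} \<rightarrow> carrier R" if "x el M" "i < m" for x i
    using \<phi>D(1) that a by auto
  have \<psi>: "\<psi> i \<in> lin_hom R M (self_module R)" if i: "i < m" for i
  proof (rule lin_homI)
    fix x y assume xy: "x el M" "y el M"
    have "(\<Oplus>k\<in>{..<n}. \<phi> k (x +[M] y) \<otimes> a i k) = (\<Oplus>k\<in>{..<n}. \<phi> k x \<otimes> a i k \<oplus> \<phi> k y \<otimes> a i k)"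
      by (rule R.finsum_cong') (use xy \<phi>D a i in \<open>auto simp: l_distr\<close>)
    then show "\<psi> i (x +[M] y) = \<psi> i x +[self_module R] \<psi> i y"
      using xy R.finsum_addf[OF \<phi>a[OF xy(1) i] \<phi>a[OF xy(2) i]] by (simp add: \<psi>_def self_module_def)
  next
    fix r x assume x: "r el R" "x el M"
    have "(\<Oplus>k\<in>{..<n}. \<phi> k (r .[M] x) \<otimes> a i k) = (\<Oplus>k\<in>{..<n}. r \<otimes> (\<phi> k x \<otimes> a i k))"
      by (rule R.finsum_cong') (use x \<phi>D a i in \<open>auto simp: m_assoc\<close>)
    then show "\<psi> i (r .[M] x) = r .[self_module R] \<psi> i x"
      using x finsum_rdistr[OF _ x(1) \<phi>a[OF x(2) i]] by (simp add: \<psi>_def self_module_def)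
  qed (use \<phi>a[OF _ i] in \<open>auto simp: \<psi>_def self_module_def intro!: R.finsum_closed\<close>)
  note \<psi>D = functionalD[OF \<psi>]
  have hS_add: "E.hS \<in> add_hom R L" using E.hS_hom by (auto simp: add_hom_def ring_hom_def)
  have c_hom: "c i \<in> add_hom M L" if "i < m" for i
    by (rule add_homI) (use that c_closed c_add in auto)
  have hS\<psi>: "E.hS (\<psi> i x) = E.hS d *[L] c i x" if x: "x el M" and i: "i < m" for i x
  proof -
    have cl: "(\<lambda>k. \<phi> k x .[M] e k) \<in> {..<n} \<rightarrow> carrier M" using \<phi>D(1) x e by auto
    have "c i x = (\<Oplus>\<^bsub>L\<^esub>k\<in>{..<n}. c i (\<phi> k x .[M] e k))"
      by (subst e\<phi>[OF x], rule add_hom_finsum[OF M.abelian_group_axioms L.abelian_group_axioms c_hom[OF i] _ cl]) simp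
    then have "E.hS d *[L] c i x = (\<Oplus>\<^bsub>L\<^esub>k\<in>{..<n}. E.hS d *[L] c i (\<phi> k x .[M] e k))"
      using L.finsum_rdistr[of "{..<n}" "E.hS d" "\<lambda>k. c i (\<phi> k x .[M] e k)"] d cl c_closed i by (simp add: Pi_def)
    also have "\<dots> = (\<Oplus>\<^bsub>L\<^esub>k\<in>{..<n}. E.hS (\<phi> k x \<otimes> a i k))"
    proof (rule L.finsum_cong')
      fix k assume k: "k \<in> {..<n}"
      have "E.hS (\<phi> k x \<otimes> a i k) = E.hS (\<phi> k x) *[L] (E.hS d *[L] c i (e k))"
        using k i x a \<phi>D(1) ring_hom_mult[OF E.hS_hom] by simp
      then show "E.hS d *[L] c i (\<phi> k x .[M] e k) = E.hS (\<phi> k x \<otimes> a i k)"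
        using k i x e \<phi>D(1) c_closed d(1) by (simp add: c_smult L.m_ac)
    qed (use \<phi>a[OF x i] in auto)
    also have "\<dots> = E.hS (\<psi> i x)"
      using add_hom_finsum[OF R.abelian_group_axioms L.abelian_group_axioms hS_add _ \<phi>a[OF x i]] x by (simp add: \<psi>_def)
    finally show ?thesis by simp
  qed
  \<comment> \<open>The error of the desired expansion; it dies in the localization and is therefore
    killed by elements outside \<open>p\<close>.\<close>
  define D where "D x = d .[M] x -[M] (\<Oplus>\<^bsub>M\<^esub>i\<in>{..<m}. \<psi> i x .[M] g i)" for x
  have \<psi>g: "(\<lambda>i. \<psi> i x .[M] g i) \<in> {..<m} \<rightarrow> carrier M" if "x el M" for x using \<psi>D(1) that g by auto
  have dR: "d el R" using d by auto
  have D_closed: "D x el M" if "x el M" for x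
    using \<psi>g[OF that] dR that by (auto simp: D_def intro!: M.finsum_closed)
  have iiD: "E.ii (D x) = \<zero>[E.T]" if x: "x el M" for x
  proof -
    have "E.ii (\<Oplus>\<^bsub>M\<^esub>i\<in>{..<m}. \<psi> i x .[M] g i) = (\<Oplus>\<^bsub>E.T\<^esub>i\<in>{..<m}. E.ii (\<psi> i x .[M] g i))"
      by (rule add_hom_finsum[OF M.abelian_group_axioms E.T.abelian_group_axioms E.ii_hom _ \<psi>g[OF x]]) simp
    also have "\<dots> = (\<Oplus>\<^bsub>E.T\<^esub>i\<in>{..<m}. E.hS d .[E.T] (c i x .[E.T] E.ii (g i)))"
      by (rule E.T.finsum_cong') (use \<psi>D(1) x g dR c_closed[OF x] in \<open>auto simp: E.ii_smult hS\<psi> T.smult_assoc1\<close>)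
    also have "\<dots> = E.hS d .[E.T] E.ii x"
      unfolding expand[OF x] by (rule T.finsum_smult_ldistr[symmetric]) (use dR c_closed[OF x] g in auto)
    finally show ?thesis
      unfolding D_def using add_hom_minus[OF M.abelian_group_axioms E.T.abelian_group_axioms E.ii_hom, of "d .[M] x"] x dR
        M.finsum_closed[OF \<psi>g[OF x]] by (simp add: E.ii_smult a_minus_def E.T.r_neg)
  qed
  \<comment> \<open>The coordinate functionals extend to the localization, so all coordinates of
    \<open>x\<close> vanish there; killing these finitely many ring elements kills
    \<open>x\<close>.\<close>
  have tors: "\<exists>t\<in>P. t .[M] x = \<zero>[M]" if x: "x el M" and 0: "E.ii x = \<zero>[E.T]" for x
  proof -
    have "\<exists>t\<in>P. \<forall>k\<in>{..<n}. t \<otimes> \<phi> k x = \<zero>[R]"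
    proof (rule common_multiple)
      fix k assume k: "k \<in> {..<n}"
      obtain \<Phi> where \<Phi>: "\<Phi> \<in> lin_hom L E.T (self_module L)" "\<And>x. x el M ==> \<Phi> (E.ii x) = E.hS (\<phi> k x)"
        using E.functional_extends[OF \<phi>] k by blast
      have "E.hS (\<phi> k x) = \<zero>[L]"
        using \<Phi>(2)[OF x] 0 add_hom_zero[OF E.T.abelian_group_axioms L.abelian_group_axioms functionalD(4)[OF \<Phi>(1)]] by simp
      then show "\<exists>t\<in>P. t \<otimes> \<phi> k x = \<zero>[R]" using hS0 \<phi>D(1) k x by blast
    qed (use \<phi>D(1) x in \<open>auto simp: m_assoc\<close>)
    then obtain t where t: "t \<in> P" "\<forall>k\<in>{..<n}. t \<otimes> \<phi> k x = \<zero>[R]" by blast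
    have cl: "(\<lambda>k. \<phi> k x .[M] e k) \<in> {..<n} \<rightarrow> carrier M" using \<phi>D(1) x e by auto
    have "t .[M] x = (\<Oplus>\<^bsub>M\<^esub>k\<in>{..<n}. t .[M] (\<phi> k x .[M] e k))"
      by (subst e\<phi>[OF x], rule finsum_smult_ldistr) (use t cl in auto)
    also have "\<dots> = (\<Oplus>\<^bsub>M\<^esub>k\<in>{..<n}. \<zero>[M])"
      by (rule M.finsum_cong') (use t \<phi>D(1) x e in \<open>auto simp: smult_assoc1[symmetric]\<close>)
    finally show ?thesis using t by auto
  qed
  have "\<exists>t\<in>P. \<forall>k\<in>{..<n}. t .[M] D (e k) = \<zero>[M]"
  proof (rule common_multiple)
    show "\<exists>t\<in>P. t .[M] D (e k) = \<zero>[M]" if "k \<in> {..<n}" for k using that e D_closed iiD tors by auto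
  qed (use e D_closed in \<open>auto simp: smult_assoc1\<close>)
  then obtain t1 where t1: "t1 \<in> P" "\<And>k. k < n ==> t1 .[M] D (e k) = \<zero>[M]" by blast
  \<comment> \<open>The dual relations hold so far only in the localization; the multiplier
    \<open>t2\<close> makes them hold over \<open>R\<close>.\<close>
  have "\<exists>t\<in>P. \<forall>ij\<in>{..<m} \<times> {..<m}. t \<otimes> \<psi> (fst ij) (g (snd ij)) = (if fst ij = snd ij then t \<otimes> d else \<zero>[R])"
  proof (rule common_multiple)
    fix ij assume ij: "ij \<in> {..<m} \<times> {..<m}"
    let ?d = "if fst ij = snd ij then d else \<zero>[R]"
    let ?x = "\<psi> (fst ij) (g (snd ij))"
    have xc: "?x el R" using ij \<psi>D(1) g by auto
    have "E.hS ?x = E.hS d *[L] (if fst ij = snd ij then \<one>[L] else \<zero>[L])"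
      using ij by (subst hS\<psi>) (auto simp: g c_g)
    then have "E.hS ?x = E.hS ?d"
      using dR add_hom_zero[OF R.abelian_group_axioms L.abelian_group_axioms hS_add] by (simp split: if_splits)
    then have "E.hS (?x \<ominus> ?d) = \<zero>[L]"
      using add_hom_minus[OF R.abelian_group_axioms L.abelian_group_axioms hS_add, of ?x ?d] xc dR by (simp add: a_minus_def L.r_neg)
    then obtain t where t: "t \<in> P" "t \<otimes> (?x \<ominus> ?d) = \<zero>[R]" using hS0[of "?x \<ominus> ?d"] xc dR by auto
    then have "t \<otimes> ?x \<ominus> t \<otimes> ?d = \<zero>[R]" using xc dR by (simp add: a_minus_def r_distr r_minus)
    then have "t \<otimes> ?x = t \<otimes> ?d" by (rule R.minus_eq_zeroD) (use t xc dR in auto)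
    then show "\<exists>t\<in>P. t \<otimes> ?x = (if fst ij = snd ij then t \<otimes> d else \<zero>[R])" using t by (auto split: if_splits)
  qed (use \<psi>D(1) g dR in \<open>auto simp: m_assoc split: if_splits\<close>)
  then obtain t2 where t2: "t2 \<in> P" "\<And>i j. [|i < m; j < m|] ==> t2 \<otimes> \<psi> i (g j) = (if i = j then t2 \<otimes> d else \<zero>[R])" by fastforce
  have tR: "t1 el R" "t2 el R" using t1 t2 by auto
  have D_hom: "(\<lambda>x. t1 .[M] D x) \<in> add_hom M M" and D_smult: "\<And>r x. [|r el R; x el M|] ==> D (r .[M] x) = r .[M] D x"
  proof -
    have 1: "D (x +[M] y) = D x +[M] D y" if xy: "x el M" "y el M" for x y
    proof -
      have "(\<Oplus>\<^bsub>M\<^esub>i\<in>{..<m}. \<psi> i (x +[M] y) .[M] g i) = (\<Oplus>\<^bsub>M\<^esub>i\<in>{..<m}. \<psi> i x .[M] g i +[M] \<psi> i y .[M] g i)"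
        by (rule M.finsum_cong') (use xy \<psi>D g in \<open>auto simp: smult_l_distr\<close>)
      then show ?thesis
        using xy dR M.finsum_addf[OF \<psi>g[OF xy(1)] \<psi>g[OF xy(2)]] M.finsum_closed[OF \<psi>g[OF xy(1)]] M.finsum_closed[OF \<psi>g[OF xy(2)]]
        by (simp add: D_def smult_r_distr a_minus_def M.minus_add M.a_ac)
    qed
    show "(\<lambda>x. t1 .[M] D x) \<in> add_hom M M"
      by (rule add_homI) (use tR D_closed 1 in \<open>auto simp: smult_r_distr\<close>)
    fix r x assume x: "r el R" "x el M"
    have "(\<Oplus>\<^bsub>M\<^esub>i\<in>{..<m}. \<psi> i (r .[M] x) .[M] g i) = (\<Oplus>\<^bsub>M\<^esub>i\<in>{..<m}. r .[M] (\<psi> i x .[M] g i))"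
      by (rule M.finsum_cong') (use x \<psi>D g in \<open>auto simp: smult_assoc1\<close>)
    also have "\<dots> = r .[M] (\<Oplus>\<^bsub>M\<^esub>i\<in>{..<m}. \<psi> i x .[M] g i)"
      by (rule finsum_smult_ldistr[symmetric]) (use x \<psi>g in auto)
    finally show "D (r .[M] x) = r .[M] D x"
      using x dR M.finsum_closed[OF \<psi>g[OF x(2)]]
      by (simp add: D_def a_minus_def smult_r_distr smult_r_minus smult_assoc1[symmetric] m_comm)
  qed
  have tD: "t1 .[M] D x = \<zero>[M]" if x: "x el M" for x
  proof -
    have cl: "(\<lambda>k. \<phi> k x .[M] e k) \<in> {..<n} \<rightarrow> carrier M" using \<phi>D(1) x e by auto
    have "t1 .[M] D x = (\<Oplus>\<^bsub>M\<^esub>k\<in>{..<n}. t1 .[M] D (\<phi> k x .[M] e k))"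
      by (subst e\<phi>[OF x], rule add_hom_finsum[OF M.abelian_group_axioms M.abelian_group_axioms D_hom _ cl]) simp
    also have "\<dots> = (\<Oplus>\<^bsub>M\<^esub>k\<in>{..<n}. \<zero>[M])"
    proof (rule M.finsum_cong')
      fix k assume k: "k \<in> {..<n}"
      then have "t1 .[M] D (\<phi> k x .[M] e k) = \<phi> k x .[M] (t1 .[M] D (e k))"
        using \<phi>D(1) x e D_closed tR by (simp add: D_smult smult_assoc1[symmetric] m_comm)
      then show "t1 .[M] D (\<phi> k x .[M] e k) = \<zero>[M]" using k t1 \<phi>D(1) x by simp
    qed auto
    finally show ?thesis by auto
  qed
  let ?t = "t1 \<otimes> t2"
  have tP: "?t \<in> P" using P_mult t1 t2 by blast
  show ?thesis
  proof (rule exI[of _ g], rule exI[of _ "\<lambda>i. \<lambda>x\<in>carrier M. ?t \<otimes> \<psi> i x"], rule exI[of _ "?t \<otimes> d"], intro conjI allI impI ballI)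
    show "?t \<otimes> d \<in> P" using P_mult tP d by blast
    show "g i el M" for i using g .
    show "(\<lambda>x\<in>carrier M. ?t \<otimes> \<psi> i x) \<in> lin_hom R M (self_module R)" if "i < m" for i
      by (rule lin_homI) (use that tR \<psi>D in \<open>auto simp: self_module_def r_distr m_ac\<close>)
    show "(\<lambda>x\<in>carrier M. ?t \<otimes> \<psi> i x) (g j) = (if i = j then ?t \<otimes> d else \<zero>[R])" if "i < m" "j < m" for i j
      using t2(2)[OF that] g[of j] tR dR \<psi>D(1)[OF that(1) g] by (auto simp: m_assoc split: if_splits)
    fix x assume x: "x el M"
    let ?s = "\<Oplus>\<^bsub>M\<^esub>i\<in>{..<m}. \<psi> i x .[M] g i"
    have sc: "?s el M" using M.finsum_closed[OF \<psi>g[OF x]] .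
    have "t1 .[M] (d .[M] x) -[M] t1 .[M] ?s = \<zero>[M]"
      using tD[OF x] tR dR x sc by (simp add: D_def a_minus_def smult_r_distr smult_r_minus)
    then have "t1 .[M] (d .[M] x) = t1 .[M] ?s" by (rule M.minus_eq_zeroD) (use tR dR x sc in auto)
    then have "t2 .[M] (t1 .[M] (d .[M] x)) = t2 .[M] (t1 .[M] ?s)" by simp
    then have "(?t \<otimes> d) .[M] x = ?t .[M] ?s"
      using tR dR x sc by (simp add: smult_assoc1[symmetric] m_assoc[symmetric] m_comm[of t2 t1])
    also have "\<dots> = (\<Oplus>\<^bsub>M\<^esub>i\<in>{..<m}. ?t .[M] (\<psi> i x .[M] g i))"
      by (rule finsum_smult_ldistr) (use tR \<psi>g[OF x] in auto)
    also have "\<dots> = (\<Oplus>\<^bsub>M\<^esub>i\<in>{..<m}. (\<lambda>x\<in>carrier M. ?t \<otimes> \<psi> i x) x .[M] g i)"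
      by (rule M.finsum_cong') (use tR \<psi>D(1) x g in \<open>auto simp: smult_assoc1\<close>)
    finally show "(?t \<otimes> d) .[M] x = (\<Oplus>\<^bsub>M\<^esub>i\<in>{..<m}. (\<lambda>x\<in>carrier M. ?t \<otimes> \<psi> i x) x .[M] g i)" .
  qed
qed

section \<open>Identities in composition algebras over a ring, and their nuclei\<close>

section \<open>Composition algebras\<close>

lemma (in abelian_group) add_solve:
  assumes "u \<oplus> v = w" "u el G" "v el G" shows "u = w \<ominus> v"
proof -
  have "u = (u \<oplus> v) \<ominus> v" using assms(2,3) by (simp add: a_minus_def a_assoc r_neg)
  then show ?thesis by (simp only: assms(1))
qed

lemma (in abelian_group) minus_self: "x el G ==> x \<ominus> x = \<zero>"
  by (simp add: a_minus_def r_neg)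

lemma (in abelian_group) neg_inj: "[|\<ominus> x = \<ominus> y; x el G; y el G|] ==> x = y"
  by (metis minus_minus)

text \<open>Registers the additive group of the module with the \<open>algebra\<close> method. Later
  proofs state a generic identity for free variables, let the method prove it and instantiate the
  variables by products or scalar multiples.\<close>

lemmas (in module) module_group_simprules
  [algebra abelian_group "ring.zero M" "ring.add M" "a_inv M" "a_minus M"] =
  M.a_closed M.zero_closed M.a_inv_closed M.minus_closed
  M.a_assoc M.l_zero M.l_neg M.a_comm M.minus_eq
  M.r_zero M.r_neg M.r_neg2 M.r_neg1 M.minus_add M.minus_minus M.minus_zero' M.a_lcomm

locale quadratic_space = module R C
  for R :: "('r, 'z) ring_scheme" (structure) and C :: "('r, 'c) module" (structure) and q :: "'c => 'r" +
  assumes quadratic: "quadratic_form R C q"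
begin

abbreviation add_C (infixl \<open>\<^bold>+\<close> 65) where "x \<^bold>+ y \<equiv> x +[C] y"
abbreviation minus_C (infixl \<open>\<^bold>-\<close> 65) where "x \<^bold>- y \<equiv> x -[C] y"
abbreviation smult_C (infixr \<open>\<bullet>\<close> 75) where "r \<bullet> x \<equiv> r .[C] x"
abbreviation b where "b x y \<equiv> polar R C q x y"

lemma q_closed [simp, intro]: "x el C ==> q x el R"
  using quadratic by (auto simp: quadratic_form_def)

lemma b_closed [simp, intro]: "[|x el C; y el C|] ==> b x y el R"
  by (simp add: polar_def)

lemma q_smult: "[|r el R; x el C|] ==> q (r \<bullet> x) = r *[R] r *[R] q x"
  using quadratic by (auto simp: quadratic_form_def)

lemma b_lin: assumes "x el C" shows "(\<lambda>y\<in>carrier C. b x y) \<in> lin_hom R C (self_module R)"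
  using quadratic assms by (auto simp: quadratic_form_def)

lemma b_add_right: "[|x el C; y el C; z el C|] ==> b x (y \<^bold>+ z) = b x y +[R] b x z"
  using b_lin[of x] unfolding lin_hom_def self_module_def by auto

lemma b_smult_right: "[|x el C; y el C; r el R|] ==> b x (r \<bullet> y) = r *[R] b x y"
  using b_lin[of x] unfolding lin_hom_def self_module_def by auto

lemma b_sym: "[|x el C; y el C|] ==> b x y = b y x"
  by (simp add: polar_def M.a_comm[of x y] a_minus_def R.a_assoc R.a_comm[of "-[R] q x"])

lemma b_add_left: "[|x el C; y el C; z el C|] ==> b (y \<^bold>+ z) x = b y x +[R] b z x"
  using b_add_right[of x y z] by (simp add: b_sym[of _ x])

lemma b_smult_left: "[|x el C; y el C; r el R|] ==> b (r \<bullet> y) x = r *[R] b y x"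
  using b_smult_right[of x y r] by (simp add: b_sym[of _ x])

lemma b_add_hom: "x el C ==> b x \<in> add_hom C R" "x el C ==> (\<lambda>y. b y x) \<in> add_hom C R"
  by (auto intro!: add_homI simp: b_add_right b_add_left)

lemmas C_ag = M.abelian_group_axioms and R_ag = R.abelian_group_axioms

lemma b_neg: "[|x el C; y el C|] ==> b x (-[C] y) = -[R] b x y"
  "[|x el C; y el C|] ==> b (-[C] y) x = -[R] b y x"
  using add_hom_neg[OF C_ag R_ag b_add_hom(1)] add_hom_neg[OF C_ag R_ag b_add_hom(2)] by auto

lemma b_minus: "[|x el C; y el C; z el C|] ==> b x (y \<^bold>- z) = b x y -[R] b x z"
  "[|x el C; y el C; z el C|] ==> b (y \<^bold>- z) x = b y x -[R] b z x"
  by (simp_all add: a_minus_def b_add_right b_add_left b_neg)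

lemma b_zero [simp]: "x el C ==> b x \<zero>[C] = \<zero>[R]" "x el C ==> b \<zero>[C] x = \<zero>[R]"
  using add_hom_zero[OF C_ag R_ag b_add_hom(1)] add_hom_zero[OF C_ag R_ag b_add_hom(2)] by auto

lemma q_add: "[|x el C; y el C|] ==> q (x \<^bold>+ y) = q x +[R] q y +[R] b x y"
proof -
  assume c: "x el C" "y el C"
  have *: "w = u +[R] v +[R] (w -[R] u -[R] v)" if "u el R" "v el R" "w el R" for u v w
    using that by algebra
  show ?thesis unfolding polar_def by (rule *) (use c in auto)
qed

lemma q_neg: "x el C ==> q (-[C] x) = q x"
proof -
  assume x: "x el C"
  have "-[C] x = (-[R] \<one>[R]) \<bullet> x" using x by (simp add: smult_l_minus)
  moreover have "(-[R] \<one>[R]) *[R] (-[R] \<one>[R]) = \<one>[R]" by (simp add: R.l_minus R.r_minus)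
  ultimately show ?thesis using x q_smult[of "-[R] \<one>[R]" x] by simp
qed

lemma b_self: "x el C ==> b x x = q x +[R] q x"
proof -
  assume x: "x el C"
  have "b x (-[C] x) = q (x \<^bold>+ -[C] x) -[R] q x -[R] q x" using x by (simp add: polar_def q_neg)
  moreover have "q \<zero>[C] = \<zero>[R]" using q_smult[of "\<zero>[R]" x] x by simp
  ultimately have "-[R] b x x = -[R] (q x +[R] q x)" using x by (simp add: b_neg M.r_neg a_minus_def R.minus_add)
  then show ?thesis by (rule R.neg_inj) (use x in auto)
qed

end

text \<open>Nondegeneracy is the injective half of regularity, the half that proves identities by
  testing against all vectors. Finiteness is added in \<open>octonionic\<close>, so that these
  identities serve \<open>C\<close> and each of its base changes alike.\<close>

locale composition_algebra = unital_nonassoc_algebra R C + quadratic_space R C q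
  for R :: "('r, 'z) ring_scheme" (structure) and C :: "('r, 'c) module" (structure) and q :: "'c => 'r" +
  assumes multiplicative: "[|x el C; y el C|] ==> q (x *[C] y) = q x *[R] q y"
    and nondegenerate: "[|x el C; \<And>y. y el C ==> polar R C q x y = \<zero>[R]|] ==> x = \<zero>[C]"
    and q_one: "q \<one>[C] = \<one>[R]"
begin

abbreviation mult_C (infixl \<open>\<star>\<close> 70) where "x \<star> y \<equiv> x *[C] y"
abbreviation tr where "tr x \<equiv> b x \<one>[C]"
abbreviation cj where "cj x \<equiv> conjugate R C q x"

declare one_closed [simp, intro] mult_closed [simp, intro] mult_one_left [simp] mult_one_right [simp]

lemma eqI: "[|x el C; y el C; \<And>z. z el C ==> b x z = b y z|] ==> x = y"
  using nondegenerate[of "x \<^bold>- y"] M.minus_eq_zeroD[of x y] by (simp add: b_minus R.minus_self)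

lemma mult_minus: "[|x el C; y el C; z el C|] ==> x \<star> (y \<^bold>- z) = x \<star> y \<^bold>- x \<star> z"
  "[|x el C; y el C; z el C|] ==> (y \<^bold>- z) \<star> x = y \<star> x \<^bold>- z \<star> x"
  using add_hom_minus[OF C_ag C_ag, of "\<lambda>y. x \<star> y"] add_hom_minus[OF C_ag C_ag, of "\<lambda>y. y \<star> x"]
  by (simp_all add: add_homI mult_add_left mult_add_right)

lemma mult_neg: "[|x el C; y el C|] ==> x \<star> (-[C] y) = -[C] (x \<star> y)"
  "[|x el C; y el C|] ==> (-[C] y) \<star> x = -[C] (y \<star> x)"
  using add_hom_neg[OF C_ag C_ag, of "\<lambda>y. x \<star> y"] add_hom_neg[OF C_ag C_ag, of "\<lambda>y. y \<star> x"]
  by (simp_all add: add_homI mult_add_left mult_add_right)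

lemma mult_zero [simp]: "x el C ==> x \<star> \<zero>[C] = \<zero>[C]" "x el C ==> \<zero>[C] \<star> x = \<zero>[C]"
  using add_hom_zero[OF C_ag C_ag, of "\<lambda>y. x \<star> y"] add_hom_zero[OF C_ag C_ag, of "\<lambda>y. y \<star> x"]
  by (simp_all add: add_homI mult_add_left mult_add_right)

lemma smult_minus: "[|r el R; y el C; z el C|] ==> r \<bullet> (y \<^bold>- z) = r \<bullet> y \<^bold>- r \<bullet> z"
  by (simp add: a_minus_def smult_r_distr smult_r_minus)

lemma b_mult_left_same: "[|x el C; y el C; z el C|] ==> b (x \<star> y) (x \<star> z) = q x *[R] b y z"
  by (simp add: polar_def mult_add_right[symmetric] multiplicative a_minus_def R.r_distr R.r_minus)

lemma b_mult_right_same: "[|x el C; y el C; z el C|] ==> b (y \<star> x) (z \<star> x) = b y z *[R] q x"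
  by (simp add: polar_def mult_add_left[symmetric] multiplicative a_minus_def R.l_distr R.l_minus)

text \<open>Multiplicativity of \<open>q\<close> polarized in both factors. Adjoints of
  multiplications and the linearized cancellation rules below rest on it.\<close>

lemma b_exchange:
  assumes "x el C" "y el C" "z el C" "w el C"
  shows "b (x \<star> y) (z \<star> w) +[R] b (z \<star> y) (x \<star> w) = b x z *[R] b y w"
proof -
  have "b ((x \<^bold>+ z) \<star> y) ((x \<^bold>+ z) \<star> w) = q (x \<^bold>+ z) *[R] b y w"
    using assms by (intro b_mult_left_same) auto
  then have *: "q x *[R] b y w +[R] b (z \<star> y) (x \<star> w) +[R] (b (x \<star> y) (z \<star> w) +[R] q z *[R] b y w)
    = q x *[R] b y w +[R] q z *[R] b y w +[R] b x z *[R] b y w"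
    using assms by (simp add: mult_add_left b_add_left b_add_right b_mult_left_same q_add R.l_distr)
  have g: "v +[R] u = e" if "a +[R] u +[R] (v +[R] d) = a +[R] d +[R] e"
    "a el R" "u el R" "v el R" "d el R" "e el R" for a u v d e
  proof -
    have "a +[R] d +[R] (v +[R] u) = a +[R] d +[R] e" using that by (simp add: R.a_ac)
    then show ?thesis using that by (simp only: R.add.l_cancel R.a_closed)
  qed
  show ?thesis by (rule g[OF *]) (use assms in auto)
qed

lemma cj_closed [simp, intro]: "x el C ==> cj x el C"
  by (simp add: conjugate_def)

text \<open>\<open>b_exchange\<close> with third argument \<open>1\<close>: the factor
  \<open>b x 1\<close> is the trace that completes \<open>- x\<close> to the conjugate.\<close>

lemma b_adj_left: "[|x el C; y el C; z el C|] ==> b (x \<star> y) z = b y (cj x \<star> z)"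
  using R.add_solve[OF b_exchange[of x y "\<one>[C]" z]]
  by (simp add: conjugate_def mult_minus mult_smult_left b_minus b_smult_right)

lemma b_adj_right: "[|x el C; y el C; z el C|] ==> b (x \<star> y) z = b x (z \<star> cj y)"
  using R.add_solve[OF b_exchange[of x y z "\<one>[C]"]] b_sym[of "z \<star> y" x]
  by (simp add: conjugate_def mult_minus mult_smult_right b_minus b_smult_right R.m_comm)

lemma cj_add: "[|x el C; y el C|] ==> cj (x \<^bold>+ y) = cj x \<^bold>+ cj y"
proof -
  assume c: "x el C" "y el C"
  have "(u \<^bold>+ v) \<^bold>- (x \<^bold>+ y) = (u \<^bold>- x) \<^bold>+ (v \<^bold>- y)" if "u el C" "v el C" for u v
    using that c by algebra
  then show ?thesis using c by (simp add: conjugate_def b_add_left smult_l_distr)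
qed

lemma cj_smult: "[|r el R; x el C|] ==> cj (r \<bullet> x) = r \<bullet> cj x"
  by (simp add: conjugate_def smult_minus b_smult_left smult_assoc1)

lemma cj_hom: "cj \<in> add_hom C C" by (rule add_homI) (auto simp: cj_add)

lemma cj_neg: "x el C ==> cj (-[C] x) = -[C] cj x"
  using add_hom_neg[OF C_ag C_ag cj_hom] .

lemma cj_minus: "[|x el C; y el C|] ==> cj (x \<^bold>- y) = cj x \<^bold>- cj y"
  using add_hom_minus[OF C_ag C_ag cj_hom] .

lemma tr_one: "tr \<one>[C] = \<one>[R] +[R] \<one>[R]" by (simp add: b_self q_one)

lemma tr_cj: "x el C ==> tr (cj x) = tr x"
proof -
  assume x: "x el C"
  have "u *[R] (\<one>[R] +[R] \<one>[R]) -[R] u = u" if "u el R" for u using that by algebra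
  then show ?thesis using x by (simp add: conjugate_def b_minus b_smult_left tr_one)
qed

lemma cj_cj [simp]: "x el C ==> cj (cj x) = x"
proof -
  assume x: "x el C"
  have "u \<^bold>- (u \<^bold>- x) = x" if "u el C" for u using that x by algebra
  moreover have "cj (cj x) = tr (cj x) \<bullet> \<one>[C] \<^bold>- cj x" by (simp only: conjugate_def[of R C q "cj x"])
  ultimately show ?thesis using x by (simp add: tr_cj) (simp add: conjugate_def)
qed

lemma cj_one [simp]: "cj \<one>[C] = \<one>[C]"
proof -
  have "(u \<^bold>+ u) \<^bold>- u = u" if "u el C" for u using that by algebra
  then show ?thesis by (simp add: conjugate_def tr_one smult_l_distr)
qed

lemma q_cj [simp]: "x el C ==> q (cj x) = q x"
proof -
  assume x: "x el C"
  have *: "u *[R] u +[R] v +[R] -[R] (u *[R] u) = v" if "u el R" "v el R" for u v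
    using that by algebra
  have "q (cj x) = q (tr x \<bullet> \<one>[C] \<^bold>+ -[C] x)" by (simp add: conjugate_def a_minus_def)
  also have "\<dots> = tr x *[R] tr x +[R] q x +[R] -[R] (tr x *[R] tr x)"
    using x by (simp add: q_add q_smult q_one q_neg b_neg b_smult_left b_sym[of "\<one>[C]" x])
  finally show ?thesis using * x by simp
qed

lemma b_cj_cj: "[|x el C; y el C|] ==> b (cj x) (cj y) = b x y"
  by (simp add: polar_def cj_add[symmetric])

lemma b_cj: "[|x el C; y el C|] ==> b (cj x) y = b x (cj y)"
  using b_cj_cj[of x "cj y"] by simp

text \<open>Moving the conjugate across \<open>b\<close> leaves
  \<open>b (x \<star> y) (x \<star> z)\<close>, which multiplicativity of \<open>q\<close>
  evaluates.\<close>

lemma cj_mult_cancel_left: "[|x el C; y el C|] ==> cj x \<star> (x \<star> y) = q x \<bullet> y"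
  by (rule eqI) (simp_all add: b_adj_left[of "cj x"] b_mult_left_same b_smult_left)

lemma cj_mult_cancel_right: "[|x el C; y el C|] ==> (y \<star> x) \<star> cj x = q x \<bullet> y"
  by (rule eqI) (simp_all add: b_adj_right[of _ "cj x"] b_mult_right_same b_smult_left R.m_comm)

lemma mult_cj_cancel_left: "[|x el C; y el C|] ==> x \<star> (cj x \<star> y) = q x \<bullet> y"
  using cj_mult_cancel_left[of "cj x" y] by simp

lemma cj_mult_lin_left:
  "[|x el C; y el C; z el C|] ==> cj x \<star> (z \<star> y) \<^bold>+ cj z \<star> (x \<star> y) = b x z \<bullet> y"
  by (rule eqI) (simp_all add: b_add_left b_adj_left[of "cj _"] b_smult_left b_exchange b_sym[of x z])

lemma cj_mult_lin_right:
  "[|x el C; y el C; z el C|] ==> (y \<star> x) \<star> cj z \<^bold>+ (y \<star> z) \<star> cj x = b x z \<bullet> y"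
proof (rule eqI)
  fix w assume c: "x el C" "y el C" "z el C" "w el C"
  then show "b ((y \<star> x) \<star> cj z \<^bold>+ (y \<star> z) \<star> cj x) w = b (b x z \<bullet> y) w"
    using b_exchange[of y x w z] b_sym[of "y \<star> z" "w \<star> x"]
    by (simp add: b_add_left b_adj_right[of _ "cj _"] b_smult_left R.m_comm)
qed auto

text \<open>Both sides are tested against \<open>z\<close>; adjunctions alone carry the factors from
  one side of \<open>b\<close> to the other, without reassociating any product.\<close>

lemma cj_mult: "[|x el C; y el C|] ==> cj (x \<star> y) = cj y \<star> cj x"
proof (rule eqI)
  fix z assume c: "x el C" "y el C" "z el C"
  have "b (cj (x \<star> y)) z = b y (cj x \<star> cj z)" using c by (simp add: b_cj b_adj_left)
  also have "\<dots> = b (cj x) (y \<star> z)" using c b_adj_right[of "cj x" "cj z" y] by (simp add: b_sym[of y])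
  also have "\<dots> = b (cj y \<star> cj x) z" using c b_adj_left[of "cj y" "cj x" z] by simp
  finally show "b (cj (x \<star> y)) z = b (cj y \<star> cj x) z" .
qed auto

lemma add_cj: "x el C ==> x \<^bold>+ cj x = tr x \<bullet> \<one>[C]"
proof -
  assume x: "x el C"
  have "x \<^bold>+ (u \<^bold>- x) = u" if "u el C" for u using that x by algebra
  then show ?thesis using x by (simp add: conjugate_def)
qed

text \<open>Linearized left alternativity: \<open>cj_mult_lin_left\<close> at \<open>z\<close> is
  compared with the same identity at \<open>1\<close> multiplied by \<open>z\<close>, and the trace
  terms cancel.\<close>

lemma skew_left:
  assumes "x el C" "y el C" "z el C"
  shows "(x \<star> y) \<star> z \<^bold>+ (y \<star> x) \<star> z = x \<star> (y \<star> z) \<^bold>+ y \<star> (x \<star> z)"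
proof -
  have "(cj x \<star> y \<^bold>+ cj y \<star> x) \<star> z = cj x \<star> (y \<star> z) \<^bold>+ cj y \<star> (x \<star> z)"
    using assms cj_mult_lin_left[of x "\<one>[C]" y] cj_mult_lin_left[of x z y] by (simp add: mult_smult_left)
  then have *: "(tr x \<bullet> (y \<star> z) \<^bold>- (x \<star> y) \<star> z) \<^bold>+ (tr y \<bullet> (x \<star> z) \<^bold>- (y \<star> x) \<star> z)
     = (tr x \<bullet> (y \<star> z) \<^bold>- x \<star> (y \<star> z)) \<^bold>+ (tr y \<bullet> (x \<star> z) \<^bold>- y \<star> (x \<star> z))"
    using assms by (simp add: conjugate_def mult_minus mult_smult_left mult_add_left)
  have g: "a' \<^bold>+ b' = a \<^bold>+ d" if "(u \<^bold>- a') \<^bold>+ (v \<^bold>- b') = (u \<^bold>- a) \<^bold>+ (v \<^bold>- d)"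
     "u el C" "v el C" "a el C" "d el C" "a' el C" "b' el C" for u v a d a' b'
  proof -
    have "a' \<^bold>+ b' = (u \<^bold>+ v) \<^bold>- ((u \<^bold>- a') \<^bold>+ (v \<^bold>- b'))" using that(2-) by algebra
    also have "\<dots> = (u \<^bold>+ v) \<^bold>- ((u \<^bold>- a) \<^bold>+ (v \<^bold>- d))" by (simp only: that(1))
    also have "\<dots> = a \<^bold>+ d" using that(2-) by algebra
    finally show ?thesis .
  qed
  show ?thesis by (rule g[OF *]) (use assms in auto)
qed

lemma skew_right:
  assumes "x el C" "y el C" "z el C"
  shows "(z \<star> x) \<star> y \<^bold>+ (z \<star> y) \<star> x = z \<star> (x \<star> y) \<^bold>+ z \<star> (y \<star> x)"
proof -
  have "cj ((cj y \<star> cj x) \<star> cj z \<^bold>+ (cj x \<star> cj y) \<star> cj z) = cj (cj y \<star> (cj x \<star> cj z) \<^bold>+ cj x \<star> (cj y \<star> cj z))"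
    using skew_left[of "cj y" "cj x" "cj z"] assms by simp
  then have "z \<star> (x \<star> y) \<^bold>+ z \<star> (y \<star> x) = (z \<star> x) \<star> y \<^bold>+ (z \<star> y) \<star> x"
    using assms by (simp add: cj_add cj_mult)
  then show ?thesis by simp
qed

lemma anticommutator:
  assumes "x el C" "y el C"
  shows "x \<star> y \<^bold>+ y \<star> x = tr x \<bullet> y \<^bold>+ tr y \<bullet> x \<^bold>- b x y \<bullet> \<one>[C]"
proof -
  have "cj x \<star> y \<^bold>+ cj y \<star> x = b x y \<bullet> \<one>[C]" using cj_mult_lin_left[of x "\<one>[C]" y] assms by simp
  then have *: "(tr x \<bullet> y \<^bold>- x \<star> y) \<^bold>+ (tr y \<bullet> x \<^bold>- y \<star> x) = b x y \<bullet> \<one>[C]"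
    using assms by (simp add: conjugate_def mult_minus mult_smult_left)
  have g: "a \<^bold>+ d = (u \<^bold>+ v) \<^bold>- ((u \<^bold>- a) \<^bold>+ (v \<^bold>- d))" if
     "u el C" "v el C" "a el C" "d el C" for u v a d
    using that by algebra
  show ?thesis using g[of "tr x \<bullet> y" "tr y \<bullet> x" "x \<star> y" "y \<star> x"] assms by (simp add: *)
qed

subsection \<open>Associators\<close>

definition assoc where "assoc x y z = (x \<star> y) \<star> z \<^bold>- x \<star> (y \<star> z)"

lemma assoc_closed [simp, intro]: "[|x el C; y el C; z el C|] ==> assoc x y z el C"
  by (simp add: assoc_def)

lemma C_skew: "[|a \<^bold>+ a' = d \<^bold>+ d'; a el C; a' el C; d el C; d' el C|]
   ==> a \<^bold>- d = -[C] (a' \<^bold>- d')"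
proof -
  assume h: "a \<^bold>+ a' = d \<^bold>+ d'" and c: "a el C" "a' el C" "d el C" "d' el C"
  have "a \<^bold>- d = -[C] (a' \<^bold>- d') \<^bold>+ ((a \<^bold>+ a') \<^bold>- (d \<^bold>+ d'))" using c by algebra
  then show ?thesis using c by (simp add: h a_minus_def M.r_neg)
qed

lemma assoc_swap12: "[|x el C; y el C; z el C|] ==> assoc x y z = -[C] assoc y x z"
  unfolding assoc_def by (rule C_skew[OF skew_left]) auto

lemma assoc_swap23: "[|x el C; y el C; z el C|] ==> assoc x y z = -[C] assoc x z y"
  unfolding assoc_def by (rule C_skew[OF skew_right]) auto

lemma assoc_cycle: "[|x el C; y el C; z el C|] ==> assoc x y z = assoc y z x"
  using assoc_swap12[of x y z] assoc_swap23[of y x z] by simp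

lemma assoc_swap13: "[|x el C; y el C; z el C|] ==> assoc x y z = -[C] assoc z y x"
  using assoc_cycle[of x y z] assoc_swap12[of y z x] by simp

text \<open>Skew symmetry would only make twice the associator vanish, which is too weak in
  characteristic two; hence the separate derivation from the cancellation rule.\<close>

lemma assoc_same12 [simp]: "[|x el C; y el C|] ==> assoc x x y = \<zero>[C]"
proof -
  assume c: "x el C" "y el C"
  have "cj x \<star> x = q x \<bullet> \<one>[C]" using cj_mult_cancel_left[of x "\<one>[C]"] c by simp
  then have "(cj x \<star> x) \<star> y = cj x \<star> (x \<star> y)" using c by (simp add: cj_mult_cancel_left mult_smult_left)
  then have *: "tr x \<bullet> (x \<star> y) \<^bold>- (x \<star> x) \<star> y = tr x \<bullet> (x \<star> y) \<^bold>- x \<star> (x \<star> y)"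
    using c by (simp add: conjugate_def mult_minus mult_smult_left)
  have "a \<^bold>- d = (u \<^bold>- d) \<^bold>- (u \<^bold>- a)" if "u el C" "a el C" "d el C" for u a d
    using that by algebra
  from this[of "tr x \<bullet> (x \<star> y)" "(x \<star> x) \<star> y" "x \<star> (x \<star> y)"]
  show ?thesis unfolding assoc_def using c by (simp add: *) (simp add: a_minus_def M.r_neg)
qed

lemma assoc_same23 [simp]: "[|x el C; y el C|] ==> assoc y x x = \<zero>[C]"
  using assoc_cycle[of y x x] by simp

lemma assoc_same13 [simp]: "[|x el C; y el C|] ==> assoc x y x = \<zero>[C]"
  using assoc_cycle[of x y x] by simp

lemma assoc_add1: "[|x el C; x' el C; y el C; z el C|]
  ==> assoc (x \<^bold>+ x') y z = assoc x y z \<^bold>+ assoc x' y z"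
proof -
  have "(a \<^bold>+ a') \<^bold>- (d \<^bold>+ d') = (a \<^bold>- d) \<^bold>+ (a' \<^bold>- d')"
    if "a el C" "a' el C" "d el C" "d' el C" for a a' d d'
    using that by algebra
  then show "[|x el C; x' el C; y el C; z el C|]
    ==> assoc (x \<^bold>+ x') y z = assoc x y z \<^bold>+ assoc x' y z"
    by (simp add: assoc_def mult_add_left)
qed

lemma assoc_hom1: "[|y el C; z el C|] ==> (\<lambda>x. assoc x y z) \<in> add_hom C C"
  by (rule add_homI) (auto simp: assoc_add1)

lemma assoc_hom2: "[|y el C; z el C|] ==> (\<lambda>x. assoc y x z) \<in> add_hom C C"
  using assoc_hom1[of z y] by (auto simp: add_hom_def assoc_cycle[of y _ z])

lemma assoc_smult1: "[|r el R; x el C; y el C; z el C|] ==> assoc (r \<bullet> x) y z = r \<bullet> assoc x y z"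
  by (simp add: assoc_def mult_smult_left smult_minus)

lemma assoc_smult2: "[|r el R; x el C; y el C; z el C|] ==> assoc y (r \<bullet> x) z = r \<bullet> assoc y x z"
  by (simp add: assoc_def mult_smult_left mult_smult_right smult_minus)

lemma assoc_one1 [simp]: "[|y el C; z el C|] ==> assoc \<one>[C] y z = \<zero>[C]"
  by (simp add: assoc_def a_minus_def M.r_neg)

lemma assoc_cj1: "[|x el C; y el C; z el C|] ==> assoc (cj x) y z = -[C] assoc x y z"
  using add_hom_minus[OF C_ag C_ag assoc_hom1[of y z], of "tr x \<bullet> \<one>[C]" x]
  by (simp add: conjugate_def assoc_smult1 a_minus_def)

text \<open>Five signs: one from reversing the bracketing, three from the conjugated entries, one
  from exchanging the outer entries.\<close>

lemma cj_assoc: "[|x el C; y el C; z el C|] ==> cj (assoc x y z) = -[C] assoc x y z"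
proof -
  assume c: "x el C" "y el C" "z el C"
  have "cj (assoc x y z) = cj z \<star> (cj y \<star> cj x) \<^bold>- (cj z \<star> cj y) \<star> cj x"
    using c by (simp add: assoc_def cj_minus cj_mult)
  also have "\<dots> = -[C] assoc (cj z) (cj y) (cj x)"
  proof -
    have *: "a \<^bold>- d = -[C] (d \<^bold>- a)" if "a el C" "d el C" for a d using that by algebra
    show ?thesis unfolding assoc_def by (rule *) (use c in auto)
  qed
  also have "assoc (cj z) (cj y) (cj x) = -[C] assoc z y x"
  proof -
    have "assoc (cj z) (cj y) (cj x) = -[C] assoc (cj y) (cj x) z"
      using c assoc_cycle[of z "cj y" "cj x"] by (simp add: assoc_cj1)
    also have "\<dots> = assoc (cj x) z y"
      using c assoc_cycle[of y "cj x" z] by (simp add: assoc_cj1)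
    also have "\<dots> = -[C] assoc z y x"
      using c assoc_cycle[of x z y] by (simp add: assoc_cj1)
    finally show ?thesis .
  qed
  finally show ?thesis using c assoc_swap13[of x y z] by simp
qed

text \<open>The Teichmueller identity of nonassociative rings, obtained by expanding into the five
  bracketings of four factors.\<close>

lemma teichmueller:
  assumes "x el C" "y el C" "z el C" "w el C"
  shows "x \<star> assoc y z w \<^bold>+ assoc x y z \<star> w = assoc (x \<star> y) z w \<^bold>- assoc x (y \<star> z) w \<^bold>+ assoc x y (z \<star> w)"
proof -
  have *: "(a \<^bold>- d) \<^bold>+ (e \<^bold>- f) = (e \<^bold>- g) \<^bold>- (f \<^bold>- a) \<^bold>+ (g \<^bold>- d)"
    if "a el C" "d el C" "e el C" "f el C" "g el C" for a d e f g
    using that by algebra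
  show ?thesis using assms *[of "x \<star> ((y \<star> z) \<star> w)" "x \<star> (y \<star> (z \<star> w))" "((x \<star> y) \<star> z) \<star> w"
      "(x \<star> (y \<star> z)) \<star> w" "(x \<star> y) \<star> (z \<star> w)"]
    by (simp add: assoc_def mult_minus)
qed

text \<open>The substitute for division by \<open>a\<close>: once the norm of an associator lies
  outside a prime, being annihilated by it means vanishing up to a scalar outside that
  prime.\<close>

lemma cancel_left: "[|a el C; x el C; a \<star> x = \<zero>[C]|] ==> q a \<bullet> x = \<zero>[C]"
  using cj_mult_cancel_left[of a x] by simp

text \<open>Cyclic symmetry of the associator moves \<open>n\<close> from the last slot to the
  others, so \<open>n\<close> lies in the whole nucleus. It can then be pulled through the slots of
  an associator, and pulling it around once gives commutation with associators.\<close>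

lemma nucleus_assoc:
  assumes n: "n el C" and nuc: "\<forall>x\<in>carrier C. \<forall>y\<in>carrier C. (x \<star> y) \<star> n = x \<star> (y \<star> n)"
    and c: "x el C" "y el C" "z el C"
  shows "(n \<star> x) \<star> y = n \<star> (x \<star> y)" "(x \<star> n) \<star> y = x \<star> (n \<star> y)"
    "n \<star> assoc x y z = assoc (n \<star> x) y z" "n \<star> assoc x y z = assoc x y z \<star> n"
proof -
  have a3: "assoc a d n = \<zero>[C]" if "a el C" "d el C" for a d
    using nuc that n by (simp add: assoc_def a_minus_def M.r_neg)
  have L: "(n \<star> a) \<star> d = n \<star> (a \<star> d)" "(a \<star> n) \<star> d = a \<star> (n \<star> d)" if "a el C" "d el C" for a d
    using a3[of a d] a3[of d a] assoc_cycle[of n a d] assoc_cycle[of a n d] assoc_cycle[of n d a] that n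
    by (simp_all add: assoc_def M.minus_eq_zeroD)
  then show "(n \<star> x) \<star> y = n \<star> (x \<star> y)" "(x \<star> n) \<star> y = x \<star> (n \<star> y)" using c by blast+
  have 3: "n \<star> assoc x y z = assoc (n \<star> x) y z" if "x el C" "y el C" "z el C" for x y z
    using that n by (simp add: assoc_def mult_minus L)
  then show "n \<star> assoc x y z = assoc (n \<star> x) y z" using c by blast
  have "assoc x y z \<star> n = assoc x y (z \<star> n)" using c n by (simp add: assoc_def mult_minus nuc)
  also have "\<dots> = assoc (z \<star> n) x y" using c n assoc_cycle[of "z \<star> n" x y] by simp
  also have "\<dots> = assoc z (n \<star> x) y" using c n by (simp add: assoc_def L)
  also have "\<dots> = assoc (n \<star> x) y z" using c n assoc_cycle[of z "n \<star> x" y] by simp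
  finally show "n \<star> assoc x y z = assoc x y z \<star> n" using 3[OF c] by simp
qed

text \<open>Elements of the right nucleus are scalars away from the zeros of the norm of an associator.\<close>

lemma nucleus_scalar:
  assumes n: "n el C" and nuc: "\<forall>x\<in>carrier C. \<forall>y\<in>carrier C. (x \<star> y) \<star> n = x \<star> (y \<star> n)"
    and c: "u el C" "v el C" "w el C" "y el C" and y: "tr y = \<one>[R]"
    and a: "a = q (assoc u v w)"
  shows "(a *[R] a) \<bullet> n = (a *[R] a *[R] tr (y \<star> n)) \<bullet> \<one>[C]"
proof -
  note N = nucleus_assoc[OF n nuc]
  let ?A = "assoc u v w"
  have ac: "a el R" using a c by simp
  \<comment> \<open>\<open>n \<star> ?A\<close> is again an associator, hence negated by
    conjugation; comparison with \<open>cj_mult\<close> shows that \<open>n\<close> is fixed by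
    conjugation up to the factor \<open>a\<close>.\<close>
  have "cj (n \<star> ?A) = -[C] (n \<star> ?A)" using cj_assoc[of "n \<star> u" v w] c n N(3) by simp
  moreover have "cj (n \<star> ?A) = cj ?A \<star> cj n" using c n by (intro cj_mult) auto
  ultimately have "-[C] (?A \<star> cj n) = -[C] (?A \<star> n)"
    using c n N(4)[OF c(1-3)] by (simp add: cj_assoc mult_neg)
  then have "?A \<star> cj n = ?A \<star> n" using c n by (metis M.minus_minus assoc_closed cj_closed mult_closed)
  then have "?A \<star> (cj n \<^bold>- n) = \<zero>[C]" using c n by (simp add: mult_minus M.minus_self)
  then have "a \<bullet> (cj n \<^bold>- n) = \<zero>[C]" unfolding a by (intro cancel_left) (use c n in auto)
  then have "a \<bullet> cj n \<^bold>- a \<bullet> n = \<zero>[C]" using ac n by (simp add: smult_minus)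
  then have cjn: "a \<bullet> cj n = a \<bullet> n" by (rule M.minus_eq_zeroD) (use ac n in auto)
  \<comment> \<open>By the Teichmueller identity \<open>?B \<star> z\<close> is a signed sum of
    associators and so commutes with \<open>n\<close>; as \<open>?B\<close> commutes with
    \<open>n\<close> too, it annihilates the commutator of \<open>n\<close> and
    \<open>z\<close>.\<close>
  have comm: "assoc x z x' \<star> (n \<star> z \<^bold>- z \<star> n) = \<zero>[C]"
    if "x el C" "z el C" "x' el C" for x z x'
  proof -
    let ?B = "assoc x z x'"
    have B: "?B \<star> z = assoc (x \<star> z) x' z \<^bold>- assoc x (z \<star> x') z \<^bold>+ assoc x z (x' \<star> z)"
      using teichmueller[of x z x' z] that by simp
    have "n \<star> (?B \<star> z) = (?B \<star> z) \<star> n"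
      unfolding B using that n by (simp add: mult_add_left mult_add_right mult_minus N(4))
    moreover have "n \<star> (?B \<star> z) = ?B \<star> (n \<star> z)"
      using N(1)[of ?B z ?B] N(2)[of ?B z ?B] N(4)[of x z x'] that by simp
    moreover have "(?B \<star> z) \<star> n = ?B \<star> (z \<star> n)" using nuc that by simp
    ultimately show ?thesis using that n by (simp add: mult_minus M.minus_self)
  qed
  let ?D = "\<lambda>z. n \<star> z \<^bold>- z \<star> n"
  have Dc: "?D z el C" if "z el C" for z using that n by simp
  have Dadd: "?D (v \<^bold>+ y) = ?D v \<^bold>+ ?D y"
  proof -
    have "(p \<^bold>+ p') \<^bold>- (r \<^bold>+ r') = (p \<^bold>- r) \<^bold>+ (p' \<^bold>- r')"
      if "p el C" "p' el C" "r el C" "r' el C" for p p' r r'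
      using that by algebra
    then show ?thesis using c n by (simp add: mult_add_left mult_add_right)
  qed
  have Dv: "a \<bullet> ?D v = \<zero>[C]" unfolding a by (rule cancel_left) (use comm[of u v w] c Dc in auto)
  \<comment> \<open>Polarization from \<open>v\<close> to the sum of \<open>v\<close> and
    \<open>y\<close> transfers the vanishing of the commutator from \<open>v\<close> to the
    unrelated \<open>y\<close> of trace one; the price is a second factor \<open>a\<close>.\<close>
  have "assoc u (v \<^bold>+ y) w \<star> ?D (v \<^bold>+ y) = \<zero>[C]" using comm[of u "v \<^bold>+ y" w] c by simp
  then have "(?A \<^bold>+ assoc u y w) \<star> (?D v \<^bold>+ ?D y) = \<zero>[C]"
    using Dadd add_hom_add[OF assoc_hom2[of u w], of v y] c by simp
  then have 1: "?A \<star> ?D y \<^bold>+ assoc u y w \<star> ?D v = \<zero>[C]"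
    using comm[of u v w] comm[of u y w] c Dc by (simp add: mult_add_left mult_add_right M.a_comm)
  have 2: "a \<bullet> (assoc u y w \<star> ?D v) = \<zero>[C]"
    using mult_smult_right[of a "assoc u y w" "?D v"] Dv ac c Dc by simp
  have "a \<bullet> (?A \<star> ?D y \<^bold>+ assoc u y w \<star> ?D v) = \<zero>[C]" using 1 ac by simp
  then have "a \<bullet> (?A \<star> ?D y) = \<zero>[C]" using 2 ac c Dc by (simp add: smult_r_distr)
  then have "?A \<star> (a \<bullet> ?D y) = \<zero>[C]" using ac c Dc by (simp add: mult_smult_right)
  then have "a \<bullet> (a \<bullet> ?D y) = \<zero>[C]" unfolding a[symmetric] using cancel_left[of ?A "a \<bullet> ?D y"] ac c Dc a by simp
  then have "(a *[R] a) \<bullet> (n \<star> y) \<^bold>- (a *[R] a) \<bullet> (y \<star> n) = \<zero>[C]"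
    using ac c n by (simp add: smult_minus smult_assoc1)
  then have ny: "(a *[R] a) \<bullet> (n \<star> y) = (a *[R] a) \<bullet> (y \<star> n)"
    by (rule M.minus_eq_zeroD) (use ac c n in auto)
  have cjn': "(a *[R] a) \<bullet> (cj n \<star> cj y) = (a *[R] a) \<bullet> (n \<star> cj y)"
  proof -
    have "a \<bullet> (cj n \<star> cj y) = a \<bullet> (n \<star> cj y)"
      using cjn mult_smult_left[of a "cj n" "cj y"] mult_smult_left[of a n "cj y"] ac c n by simp
    then show ?thesis using ac c n by (simp add: smult_assoc1)
  qed
  \<comment> \<open>The scalar \<open>tr (y \<star> n)\<close> is \<open>y \<star> n\<close> plus
    its conjugate. With \<open>n\<close> fixed by conjugation and commuting with \<open>y\<close>,
    both up to the square of \<open>a\<close>, this is \<open>n\<close> times the sum of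
    \<open>y\<close> and \<open>cj y\<close>, that is \<open>n\<close>.\<close>
  have "(a *[R] a *[R] tr (y \<star> n)) \<bullet> \<one>[C] = (a *[R] a) \<bullet> (y \<star> n \<^bold>+ cj n \<star> cj y)"
    using ac c n add_cj[of "y \<star> n"] by (simp add: smult_assoc1[of "a *[R] a"] cj_mult)
  also have "\<dots> = (a *[R] a) \<bullet> (n \<star> y) \<^bold>+ (a *[R] a) \<bullet> (n \<star> cj y)"
    using ac c n by (simp add: smult_r_distr ny cjn')
  also have "\<dots> = (a *[R] a) \<bullet> (n \<star> (y \<^bold>+ cj y))" using ac c n by (simp add: smult_r_distr mult_add_right)
  also have "y \<^bold>+ cj y = \<one>[C]" using add_cj[of y] c y by simp
  finally show ?thesis using n by simp
qed

text \<open>Right skew symmetry with left factor \<open>x\<close>, in which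
  \<open>(x \<star> y) \<star> n\<close> is replaced by \<open>y \<star> (x \<star> n)\<close>,
  equates an anticommutator with \<open>x\<close> times an anticommutator. On expansion the terms
  with \<open>tr y\<close> cancel, and a product comes out as a linear expression.\<close>

lemma antinucleus_relation:
  assumes n: "n el C" and nuc: "\<forall>x\<in>carrier C. \<forall>y\<in>carrier C. (x \<star> y) \<star> n = y \<star> (x \<star> n)"
    and c: "x el C" "y el C"
  shows "tr n \<bullet> (x \<star> y) = b y n \<bullet> x \<^bold>+ tr (x \<star> n) \<bullet> y \<^bold>- b y (x \<star> n) \<bullet> \<one>[C]"
proof -
  have "y \<star> (x \<star> n) \<^bold>+ (x \<star> n) \<star> y = x \<star> (y \<star> n \<^bold>+ n \<star> y)"
    using skew_right[of y n x] nuc n c by (simp add: mult_add_right)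
  then have *: "tr y \<bullet> (x \<star> n) \<^bold>+ tr (x \<star> n) \<bullet> y \<^bold>- b y (x \<star> n) \<bullet> \<one>[C]
      = tr y \<bullet> (x \<star> n) \<^bold>+ tr n \<bullet> (x \<star> y) \<^bold>- b y n \<bullet> x"
    using anticommutator[of y "x \<star> n"] anticommutator[of y n] n c
    by (simp add: mult_add_right mult_minus mult_smult_right)
  have g: "e = f \<^bold>+ g' \<^bold>- h" if "d \<^bold>+ g' \<^bold>- h = d \<^bold>+ e \<^bold>- f" "d el C" "g' el C" "h el C"
    "e el C" "f el C" for d g' h e f
  proof -
    have "e = (d \<^bold>+ e \<^bold>- f) \<^bold>+ f \<^bold>- d" using that(2-) by algebra
    also have "\<dots> = (d \<^bold>+ g' \<^bold>- h) \<^bold>+ f \<^bold>- d" by (simp only: that(1))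
    also have "\<dots> = f \<^bold>+ g' \<^bold>- h" using that(2-) by algebra
    finally show ?thesis .
  qed
  show ?thesis by (rule g[OF *]) (use n c in auto)
qed

lemma smult_one_zeroD: "[|y el C; tr y = \<one>[R]; s el R; s \<bullet> \<one>[C] = \<zero>[C]|] ==> s = \<zero>[R]"
  using b_smult_left[of y "\<one>[C]" s] b_sym[of y "\<one>[C]"] by simp

text \<open>Multiplying by the conjugate of \<open>x\<close> moves the annihilator onto
  \<open>1\<close>, where the element of trace one detects it.\<close>

lemma smult_zeroD:
  "[|y el C; tr y = \<one>[R]; s el R; x el C; s \<bullet> x = \<zero>[C]|] ==> s *[R] q x = \<zero>[R]"
proof -
  assume y: "y el C" "tr y = \<one>[R]" and c: "s el R" "x el C" "s \<bullet> x = \<zero>[C]"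
  have "(s *[R] q x) \<bullet> \<one>[C] = s \<bullet> (cj x \<star> x)" using c cj_mult_cancel_left[of x "\<one>[C]"] by (simp add: smult_assoc1)
  also have "\<dots> = \<zero>[C]" using c mult_smult_right[of s "cj x" x] by simp
  finally show ?thesis using smult_one_zeroD[OF y] c by simp
qed

text \<open>\<open>antinucleus_relation\<close> expresses \<open>tr n\<close> times a product by its
  factors, so associators with a product among their entries become computable (\<open>Q\<close>).
  Together with the Teichmueller identity this forces the square of \<open>a\<close> to kill
  \<open>tr n\<close>. The multiple \<open>m\<close> of \<open>n\<close> has trace zero, which
  strips the relation of its left side; a repeated entry then kills \<open>tr (u \<star> m)\<close>,
  afterwards all \<open>b x m\<close> vanish up to the square of \<open>a\<close>, and nondegeneracy
  applies.\<close>

lemma antinucleus_zero: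
  assumes n: "n el C" and nuc: "\<forall>x\<in>carrier C. \<forall>y\<in>carrier C. (x \<star> y) \<star> n = y \<star> (x \<star> n)"
    and c: "u el C" "v el C" "w el C" "y el C" and y: "tr y = \<one>[R]"
    and a: "a = q (assoc u v w)"
  shows "(a *[R] a) \<bullet> ((a *[R] a) \<bullet> n) = \<zero>[C]"
proof -
  let ?A = "assoc u v w"
  have ac: "a el R" using a c by simp
  let ?l = "\<lambda>x. b x n"
  have Q: "tr n \<bullet> assoc (x \<star> x') z z' = ?l x' \<bullet> assoc x z z' \<^bold>+ tr (x \<star> n) \<bullet> assoc x' z z'"
    if "x el C" "x' el C" "z el C" "z' el C" for x x' z z'
  proof -
    have "tr n \<bullet> assoc (x \<star> x') z z' = assoc (tr n \<bullet> (x \<star> x')) z z'" using that n by (simp add: assoc_smult1)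
    also have "\<dots> = assoc (?l x' \<bullet> x) z z' \<^bold>+ assoc (tr (x \<star> n) \<bullet> x') z z' \<^bold>- assoc (b x' (x \<star> n) \<bullet> \<one>[C]) z z'"
    proof -
      have e: "tr n \<bullet> (x \<star> x') = ?l x' \<bullet> x \<^bold>+ tr (x \<star> n) \<bullet> x' \<^bold>- b x' (x \<star> n) \<bullet> \<one>[C]"
        using antinucleus_relation[OF n nuc that(1,2)] .
      show ?thesis unfolding e using that n
        by (simp add: add_hom_minus[OF C_ag C_ag assoc_hom1] assoc_add1)
    qed
    finally show ?thesis using that n by (simp add: assoc_smult1 a_minus_def)
  qed
  have tl: "tr (x \<star> n) = tr x *[R] tr n -[R] ?l x" if "x el C" for x
    using b_adj_left[of x n "\<one>[C]"] that n
    by (simp add: conjugate_def b_minus b_smult_right b_sym[of n])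
  have K: "assoc x z x' \<star> (tr n \<bullet> z \<^bold>- tr (z \<star> n) \<bullet> \<one>[C]) = \<zero>[C]"
    if d: "x el C" "z el C" "x' el C" for x z x'
  proof -
    let ?B = "assoc x z x'"
    have "?B \<star> (tr n \<bullet> z) = tr n \<bullet> (?B \<star> z)" using d n by (simp add: mult_smult_right)
    also have "?B \<star> z = assoc (x \<star> z) x' z \<^bold>- assoc (z \<star> x') z x \<^bold>+ assoc (x' \<star> z) x z"
      using teichmueller[of x z x' z] assoc_cycle[of x "z \<star> x'" z] assoc_cycle[of "x' \<star> z" x z] d by simp
    also have "tr n \<bullet> \<dots> = (?l z \<bullet> assoc x x' z \<^bold>+ tr (x \<star> n) \<bullet> assoc z x' z)
        \<^bold>- (?l x' \<bullet> assoc z z x \<^bold>+ tr (z \<star> n) \<bullet> assoc x' z x)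
        \<^bold>+ (?l z \<bullet> assoc x' x z \<^bold>+ tr (x' \<star> n) \<bullet> assoc z x z)"
      using d n by (simp add: smult_r_distr smult_minus Q)
    also have "\<dots> = tr (z \<star> n) \<bullet> ?B"
    proof -
      have 1: "assoc x' z x = -[C] ?B" "assoc x x' z = -[C] ?B" "assoc x' x z = ?B"
        using assoc_swap13[of x' z x] assoc_swap23[of x x' z] assoc_cycle[of x' x z] d by auto
      have "-[C] P \<^bold>- -[C] T \<^bold>+ P = T" if "P el C" "T el C" for P T
        using that by algebra
      then show ?thesis using d n by (simp add: 1 smult_r_minus)
    qed
    finally show ?thesis using d n by (simp add: mult_minus mult_smult_right M.minus_self)
  qed
  have t0: "a *[R] a *[R] tr n = \<zero>[R]"
  proof -
    have "a \<bullet> (tr n \<bullet> v \<^bold>- tr (v \<star> n) \<bullet> \<one>[C]) = \<zero>[C]"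
      unfolding a by (rule cancel_left[OF _ _ K]) (use c n in auto)
    \<comment> \<open>Inserted in the middle slot, the multiple of \<open>1\<close> disappears and
      only \<open>tr n\<close> times the associator remains.\<close>
    then have "assoc u (a \<bullet> (tr n \<bullet> v \<^bold>- tr (v \<star> n) \<bullet> \<one>[C])) w = \<zero>[C]"
      using add_hom_zero[OF C_ag C_ag assoc_hom2[of u w]] c by simp
    then have "(a *[R] tr n) \<bullet> ?A = \<zero>[C]"
      using c n ac assoc_cycle[of u "\<one>[C]" w] add_hom_minus[OF C_ag C_ag assoc_hom2[of u w]]
      by (simp add: assoc_smult2 smult_assoc1 a_minus_def M.minus_zero')
    then have "a *[R] tr n *[R] a = \<zero>[R]" unfolding a using smult_zeroD[OF c(4) y] c n ac a by simp
    then show ?thesis using ac n by (simp add: R.m_ac R.m_assoc)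
  qed
  define m where "m = (a *[R] a) \<bullet> n"
  have m: "m el C" using ac n by (simp add: m_def)
  have tm: "tr m = \<zero>[R]" using t0 ac n by (simp add: m_def b_smult_left)
  have Qm: "\<zero>[C] = b x' m \<bullet> assoc x z z' \<^bold>+ tr (x \<star> m) \<bullet> assoc x' z z'"
    if "x el C" "x' el C" "z el C" "z' el C" for x x' z z'
  proof -
    have "\<zero>[C] = (a *[R] a) \<bullet> (tr n \<bullet> assoc (x \<star> x') z z')"
      using t0 ac n that by (simp add: smult_assoc1[symmetric])
    then show ?thesis using that n ac
      by (simp add: Q smult_r_distr m_def b_smult_left b_smult_right mult_smult_right smult_assoc1)
  qed
  \<comment> \<open>Repeating \<open>u\<close> among the entries removes the term with
    \<open>b v m\<close>.\<close>
  have 1: "a *[R] tr (u \<star> m) = \<zero>[R]"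
  proof -
    have "tr (u \<star> m) \<bullet> assoc v u w = \<zero>[C]" using Qm[of u v u w] c m by simp
    then have "-[C] (tr (u \<star> m) \<bullet> ?A) = \<zero>[C]" using assoc_swap12[of v u w] c m by (simp add: smult_r_minus)
    then have "tr (u \<star> m) \<bullet> ?A = \<zero>[C]" using c m by (metis M.minus_minus M.minus_zero' assoc_closed smult_closed b_closed mult_closed one_closed)
    then show ?thesis unfolding a using smult_zeroD[OF c(4) y, of "tr (u \<star> m)" ?A] c m by (simp add: R.m_comm)
  qed
  have 2: "a *[R] a *[R] b x m = \<zero>[R]" if "x el C" for x
  proof -
    have "\<zero>[C] = a \<bullet> (b x m \<bullet> ?A \<^bold>+ tr (u \<star> m) \<bullet> assoc x v w)" using Qm[of u x v w, symmetric] c m that ac by simp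
    also have "\<dots> = (a *[R] b x m) \<bullet> ?A \<^bold>+ (a *[R] tr (u \<star> m)) \<bullet> assoc x v w"
      using c m that ac by (simp add: smult_r_distr smult_assoc1)
    finally have "(a *[R] b x m) \<bullet> ?A = \<zero>[C]" using 1 c m that ac by simp
    then have "a *[R] b x m *[R] a = \<zero>[R]" using smult_zeroD[OF c(4) y, of "a *[R] b x m" ?A] c m ac that a by simp
    then show ?thesis using ac m that by (simp add: R.m_ac R.m_assoc)
  qed
  have "(a *[R] a) \<bullet> m = \<zero>[C]"
    by (rule nondegenerate) (use ac m 2 in \<open>auto simp: b_smult_left b_sym[of m]\<close>)
  then show ?thesis by (simp add: m_def)
qed

end

section \<open>Ideals contained in no prime\<close>

section \<open>Passing from local to global\<close>

lemma (in cring) exists_prime: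
  assumes J: "ideal J R" and one: "\<one> \<notin> J"
  obtains p where "primeideal p R" "J \<subseteq> p"
proof -
  let ?A = "{I. ideal I R \<and> J \<subseteq> I \<and> \<one> \<notin> I}"
  have "\<exists>M\<in>?A. \<forall>I\<in>?A. M \<subseteq> I --> I = M"
  proof (rule subset_Zorn_nonempty)
    show "?A \<noteq> {}" using J one by blast
    fix \<C> assume ne: "\<C> \<noteq> {}" and ch: "subset.chain ?A \<C>"
    then have "subset.chain {I. ideal I R} \<C>" by (auto simp: subset.chain_def)
    from chain_Union_is_ideal[OF this] ne have i: "ideal (\<Union>\<C>) R" by simp
    have m: "J \<subseteq> I \<and> \<one> \<notin> I" if "I \<in> \<C>" for I using ch that unfolding subset.chain_def by blast
    obtain I where "I \<in> \<C>" using ne by blast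
    with m have "J \<subseteq> \<Union>\<C>" by blast
    moreover have "\<one> \<notin> \<Union>\<C>" using m by blast
    ultimately show "\<Union>\<C> \<in> ?A" using i by simp
  qed
  then obtain M where MA: "M \<in> ?A" and mx: "\<forall>I\<in>?A. M \<subseteq> I --> I = M" by (elim bexE)
  from MA have M: "ideal M R" "J \<subseteq> M" "\<one> \<notin> M" by simp_all
  have max: "I = M" if "ideal I R" "J \<subseteq> I" "\<one> \<notin> I" "M \<subseteq> I" for I
    using mx that by simp
  have "maximalideal M R"
  proof (rule maximalidealI[OF M(1)])
    show "carrier R \<noteq> M" using M(3) by blast
    fix I assume I: "ideal I R" "M \<subseteq> I" "I \<subseteq> carrier R"
    show "I = M \<or> I = carrier R"
    proof (cases "\<one> \<in> I")
      case True then show ?thesis using ideal.one_imp_carrier[OF I(1)] by blast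
    next
      case False then show ?thesis using max[OF I(1) _ False I(2)] M(2) I(2) by blast
    qed
  qed
  then have "primeideal M R" by (rule maximalideal_prime)
  then show ?thesis using that M(2) by blast
qed

text \<open>For a condition on scalars that is stable under sums and multiples it is enough to meet
  the complement of each prime. This serves for the norm of \<open>1\<close>, for the surjectivity
  of the trace and for membership in submodules.\<close>

lemma (in cring) one_memI:
  assumes sub: "J \<subseteq> carrier R" and zero: "\<zero> \<in> J" and add: "\<And>a b. [|a \<in> J; b \<in> J|] ==> a \<oplus> b \<in> J"
    and mult: "\<And>r a. [|r el R; a \<in> J|] ==> r \<otimes> a \<in> J"
    and prime: "\<And>p. primeideal p R ==> \<exists>d\<in>J. d \<notin> p"
  shows "\<one> \<in> J"
proof (rule ccontr)
  assume n: "\<one> \<notin> J"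
  have inv: "\<ominus> a \<in> J" if "a \<in> J" for a using mult[of "\<ominus> \<one>" a] that sub by (auto simp: l_minus)
  have "ideal J R"
  proof (rule idealI)
    show "ring R" ..
    show "subgroup J (add_monoid R)"
      by (rule subgroup.intro) (use sub zero add inv in \<open>auto simp: a_inv_def\<close>)
    show "\<And>a x. [|a \<in> J; x el R|] ==> x \<otimes> a \<in> J" using mult by blast
    show "\<And>a x. [|a \<in> J; x el R|] ==> a \<otimes> x \<in> J" using mult sub m_comm by (metis subsetD)
  qed
  then obtain p where "primeideal p R" "J \<subseteq> p" using exists_prime n by blast
  then show False using prime by blast
qed

section \<open>Frames\<close>

text \<open>A basis of a localization and its dual basis for \<open>b\<close>, cleared of
  denominators: \<open>d\<close> takes the place of a unit.\<close>

definition (in quadratic_space) is_frame :: "nat => (nat => 'c) => (nat => 'c) => 'r => bool" where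
  "is_frame n e f d \<longleftrightarrow> d el R \<and> (\<forall>i<n. e i el C \<and> f i el C) \<and>
     (\<forall>i<n. \<forall>j<n. b (e i) (f j) = (if i = j then d else \<zero>)) \<and>
     (\<forall>x\<in>carrier C. d \<bullet> x = (\<Oplus>\<^bsub>C\<^esub>i\<in>{..<n}. b x (f i) \<bullet> e i))"

text \<open>A dual system whose functionals are represented through \<open>b\<close>; unlike a frame
  it is global and carries no orthogonality.\<close>

definition (in quadratic_space) dual_pair :: "nat => (nat => 'c) => (nat => 'c) => bool" where
  "dual_pair n e f \<longleftrightarrow> (\<forall>k<n. e k el C \<and> f k el C) \<and>
     (\<forall>x\<in>carrier C. x = (\<Oplus>\<^bsub>C\<^esub>k\<in>{..<n}. b x (f k) \<bullet> e k))"

context quadratic_space begin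

lemma frameD:
  assumes "is_frame n e f d"
  shows "d el R" "i < n ==> e i el C" "i < n ==> f i el C"
    "[|i < n; j < n|] ==> b (e i) (f j) = (if i = j then d else \<zero>)"
    "x el C ==> d \<bullet> x = (\<Oplus>\<^bsub>C\<^esub>i\<in>{..<n}. b x (f i) \<bullet> e i)"
  using assms unfolding is_frame_def by blast+

lemma dual_pairD:
  assumes "dual_pair n e f"
  shows "k < n ==> e k el C" "k < n ==> f k el C"
    "x el C ==> x = (\<Oplus>\<^bsub>C\<^esub>k\<in>{..<n}. b x (f k) \<bullet> e k)"
  using assms unfolding dual_pair_def by blast+

lemma dual_pair_nondegenerate:
  assumes "dual_pair n e f" "x el C" "\<And>y. y el C ==> b x y = \<zero>"
  shows "x = \<zero>[C]"
proof -
  have "x = (\<Oplus>\<^bsub>C\<^esub>k\<in>{..<n}. b x (f k) \<bullet> e k)" by (rule dual_pairD(3)[OF assms(1,2)])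
  also have "\<dots> = (\<Oplus>\<^bsub>C\<^esub>k\<in>{..<n}. \<zero>[C])"
    by (rule M.finsum_cong') (use dual_pairD(1,2)[OF assms(1)] assms(3) in auto)
  finally show ?thesis by simp
qed

text \<open>Gaussian elimination on the left halves of a frame, one linear condition at a time.\<close>

lemma orthogonal_mod_prime:
  assumes p: "primeideal p R" and fr: "is_frame n e f d" and d: "d \<notin> p"
    and T: "set T \<subseteq> carrier C" "length T < n"
  shows "\<exists>x\<in>carrier C. \<exists>y\<in>carrier C. (\<forall>t\<in>set T. b x t \<in> p) \<and> b x y \<notin> p"
proof -
  interpret p: primeideal p R by fact
  note F = frameD[OF fr]
  \<comment> \<open>Each condition costs one index, so fewer than \<open>n\<close> conditions leave
    a vector; its pairing with the matching \<open>f\<close> keeps it from degenerating modulo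
    \<open>p\<close>.\<close>
  have "\<exists>I x d'. I \<subseteq> {..<n} \<and> card I = n - length T \<and> d' el R \<and> d' \<notin> p \<and>
      (\<forall>i\<in>I. x i el C \<and> (\<forall>t\<in>set T. b (x i) t \<in> p) \<and> (\<forall>j\<in>I. b (x i) (f j) = (if i = j then d' else \<zero>)))"
    using T
  proof (induction T)
    case Nil
    show ?case by (intro exI[of _ "{..<n}"] exI[of _ e] exI[of _ d]) (use F d in auto)
  next
    case (Cons t T)
    then have "set T \<subseteq> carrier C" "length T < n" by auto
    with Cons.IH obtain I x d' where I: "I \<subseteq> {..<n}" "card I = n - length T" "d' el R" "d' \<notin> p"
      and x: "\<And>i. i \<in> I ==> x i el C" "\<And>i t. [|i \<in> I; t \<in> set T|] ==> b (x i) t \<in> p"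
        "\<And>i j. [|i \<in> I; j \<in> I|] ==> b (x i) (f j) = (if i = j then d' else \<zero>)" by blast
    have fI: "finite I" using I(1) finite_subset by blast
    have t: "t el C" and Tc: "set T \<subseteq> carrier C" using Cons.prems by auto
    show ?case
    proof (cases "\<exists>k\<in>I. b (x k) t \<notin> p")
      case True
      then obtain k where k: "k \<in> I" "b (x k) t \<notin> p" by blast
      let ?a = "b (x k) t"
      have a: "?a el R" using x k t by auto
      \<comment> \<open>Elimination without division: \<open>k\<close> is the pivot, and the dual
        scalar grows by the factor \<open>?a\<close>, which lies outside \<open>p\<close>.\<close>
      define x' where "x' i = ?a \<bullet> x i \<^bold>- b (x i) t \<bullet> x k" for i
      have x'c: "x' i el C" if "i \<in> I" for i using x(1) k that t by (simp add: x'_def)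
      have bx': "b (x' i) z = ?a \<otimes> b (x i) z \<ominus> b (x i) t \<otimes> b (x k) z" if "i \<in> I" "z el C" for i z
        using x(1) k that t by (simp add: x'_def b_minus b_smult_left)
      have "b (x' i) s \<in> p" if "i \<in> I" "s \<in> set (t # T)" for i s
      proof (cases "s = t")
        case True
        have "b (x' i) t = \<zero>" using bx'[OF that(1) t] x(1)[OF that(1)] x(1)[OF k(1)] t
          by (simp add: R.m_comm R.minus_self)
        then show ?thesis using True p.zero_closed by (simp add: additive_subgroup.zero_closed[OF p.additive_subgroup_axioms])
      next
        case False
        then have s: "s \<in> set T" "s el C" using that Tc by auto
        have "?a \<otimes> b (x i) s \<in> p" "b (x i) t \<otimes> b (x k) s \<in> p"
          using x(2)[OF that(1) s(1)] x(2)[OF k(1) s(1)] a x(1)[OF that(1)] t by (auto intro: p.I_l_closed)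
        then show ?thesis unfolding bx'[OF that(1) s(2)] a_minus_def
          by (intro additive_subgroup.a_closed[OF p.additive_subgroup_axioms] additive_subgroup.a_inv_closed[OF p.additive_subgroup_axioms])
      qed
      moreover have "b (x' i) (f j) = (if i = j then ?a \<otimes> d' else \<zero>)" if "i \<in> I - {k}" "j \<in> I - {k}" for i j
      proof -
        have "f j el C" using F(3) that I(1) by blast
        then show ?thesis using bx'[of i "f j"] x(3)[of i j] x(3)[of k j] that k a I(3) x(1) t
          by (auto simp: a_minus_def R.minus_zero')
      qed
      moreover have "?a \<otimes> d' \<notin> p" using p.I_prime[OF a I(3)] k(2) I(4) by blast
      ultimately show ?thesis using I k x'c a fI
        by (intro exI[of _ "I - {k}"] exI[of _ x'] exI[of _ "?a \<otimes> d'"]) auto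
    next
      case False
      have "I \<noteq> {}" using I(2) Cons.prems(2) by auto
      then obtain k where "k \<in> I" by blast
      then show ?thesis using I x fI False
        by (intro exI[of _ "I - {k}"] exI[of _ x] exI[of _ d']) auto
    qed
  qed
  then obtain I x d' where I: "I \<subseteq> {..<n}" "card I = n - length T" "d' \<notin> p"
    and x0: "\<forall>i\<in>I. x i el C \<and> (\<forall>t\<in>set T. b (x i) t \<in> p) \<and> (\<forall>j\<in>I. b (x i) (f j) = (if i = j then d' else \<zero>))"
    by blast
  from x0 have x: "x i el C \<and> (\<forall>t\<in>set T. b (x i) t \<in> p) \<and> b (x i) (f i) = d'" if "i \<in> I" for i
    using that by auto
  have "I \<noteq> {}" using I(2) T(2) by auto
  then obtain k where "k \<in> I" by blast
  then show ?thesis using x I F(3) by (intro bexI[of _ "x k"] bexI[of _ "f k"]) auto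
qed

end

section \<open>Cayley-Dickson doubling up to scalars outside a prime\<close>

section \<open>Non-associativity at every prime\<close>

context composition_algebra begin

text \<open>The Gram determinant of \<open>1\<close> and \<open>u\<close> with respect to
  \<open>b\<close>, where \<open>b\<close> takes the value two at the pair \<open>1\<close>,
  \<open>1\<close>.\<close>

definition disc where "disc u = (b u u \<oplus> b u u) \<ominus> tr u \<otimes> tr u"

text \<open>\<open>disc u\<close> times the projection along the span of \<open>1\<close> and
  \<open>u\<close> to its orthogonal complement; the coefficients come from Cramer's rule.\<close>

definition proj where "proj u x = disc u \<bullet> x \<^bold>-
   ((b u u \<otimes> tr x \<ominus> tr u \<otimes> b x u) \<bullet> \<one>[C] \<^bold>+ (b x u \<oplus> b x u \<ominus> tr u \<otimes> tr x) \<bullet> u)"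

text \<open>The same for the span of \<open>1\<close>, \<open>u\<close>, \<open>v\<close> and
  \<open>u \<star> v\<close> when \<open>v\<close> is orthogonal to \<open>1\<close> and
  \<open>u\<close>: the Gram matrix of \<open>v\<close> and \<open>u \<star> v\<close> is
  \<open>q v\<close> times that of \<open>1\<close> and \<open>u\<close>, whence the factor
  \<open>q v\<close>.\<close>

definition proj2 where "proj2 u v x = q v \<bullet> proj u x \<^bold>-
   ((b u u \<otimes> b x v \<ominus> tr u \<otimes> b x (u \<star> v)) \<bullet> v \<^bold>+ (b x (u \<star> v) \<oplus> b x (u \<star> v) \<ominus> tr u \<otimes> b x v) \<bullet> (u \<star> v))"

lemma disc_closed [simp]: "u el C ==> disc u el R" by (simp add: disc_def)
lemma proj_closed [simp]: "[|u el C; x el C|] ==> proj u x el C" by (simp add: proj_def)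
lemma proj2_closed [simp]: "[|u el C; v el C; x el C|] ==> proj2 u v x el C"
  by (simp add: proj2_def)

lemma b_proj:
  "[|u el C; x el C; z el C|] ==> b (proj u x) z = disc u \<otimes> b x z \<ominus>
   ((b u u \<otimes> tr x \<ominus> tr u \<otimes> b x u) \<otimes> b \<one>[C] z \<oplus> (b x u \<oplus> b x u \<ominus> tr u \<otimes> tr x) \<otimes> b u z)"
  by (simp add: proj_def b_minus b_add_left b_smult_left)

lemma b_proj2:
  "[|u el C; v el C; x el C; z el C|] ==> b (proj2 u v x) z = q v \<otimes> b (proj u x) z \<ominus>
   ((b u u \<otimes> b x v \<ominus> tr u \<otimes> b x (u \<star> v)) \<otimes> b v z \<oplus> (b x (u \<star> v) \<oplus> b x (u \<star> v) \<ominus> tr u \<otimes> b x v) \<otimes> b (u \<star> v) z)"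
  by (simp add: proj2_def b_minus b_add_left b_smult_left)

lemma proj_orth:
  assumes c: "u el C" "x el C"
  shows "tr (proj u x) = \<zero>" "b (proj u x) u = \<zero>"
proof -
  have 1: "(s \<oplus> s \<ominus> t \<otimes> t) \<otimes> a \<ominus> ((s \<otimes> a \<ominus> t \<otimes> d) \<otimes> (\<one> \<oplus> \<one>) \<oplus> (d \<oplus> d \<ominus> t \<otimes> a) \<otimes> t) = \<zero>"
    "(s \<oplus> s \<ominus> t \<otimes> t) \<otimes> d \<ominus> ((s \<otimes> a \<ominus> t \<otimes> d) \<otimes> t \<oplus> (d \<oplus> d \<ominus> t \<otimes> a) \<otimes> s) = \<zero>"
    if "s el R" "t el R" "a el R" "d el R" for s t a d
    using that by algebra+
  show "tr (proj u x) = \<zero>" using 1(1)[of "b u u" "tr u" "tr x" "b x u"] c by (simp add: b_proj disc_def tr_one)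
  show "b (proj u x) u = \<zero>" using 1(2)[of "b u u" "tr u" "tr x" "b x u"] c
    by (simp add: b_proj disc_def b_sym[of "\<one>[C]" u])
qed

lemma proj2_orth:
  assumes c: "u el C" "v el C" "x el C" and v: "tr v = \<zero>" "b v u = \<zero>"
  shows "tr (proj2 u v x) = \<zero>" "b (proj2 u v x) u = \<zero>" "b (proj2 u v x) v = \<zero>" "b (proj2 u v x) (u \<star> v) = \<zero>"
proof -
  have uv: "tr (u \<star> v) = \<zero>" "b (u \<star> v) u = \<zero>" "b (u \<star> v) (u \<star> v) = b u u \<otimes> q v" "b v (u \<star> v) = tr u \<otimes> q v" "b (u \<star> v) v = tr u \<otimes> q v"
  proof -
    show "tr (u \<star> v) = \<zero>" using b_adj_left[of u v "\<one>[C]"] c v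
      by (simp add: conjugate_def b_minus b_smult_right R.minus_self)
    show "b (u \<star> v) u = \<zero>" using b_mult_left_same[of u v "\<one>[C]"] c v by simp
    show "b (u \<star> v) (u \<star> v) = b u u \<otimes> q v" using b_mult_right_same[of v u u] c by simp
    show "b (u \<star> v) v = tr u \<otimes> q v" using b_mult_right_same[of v u "\<one>[C]"] c by simp
    then show "b v (u \<star> v) = tr u \<otimes> q v" using b_sym[of v "u \<star> v"] c by simp
  qed
  have sym: "b \<one>[C] v = \<zero>" "b u v = \<zero>" "b \<one>[C] (u \<star> v) = \<zero>" "b u (u \<star> v) = \<zero>" "b v \<one>[C] = \<zero>"
    using b_sym[of v "\<one>[C]"] b_sym[of v u] b_sym[of "u \<star> v" "\<one>[C]"] b_sym[of "u \<star> v" u] c v uv by auto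
  show "tr (proj2 u v x) = \<zero>" "b (proj2 u v x) u = \<zero>"
    using proj_orth[OF c(1,3)] c v uv by (simp_all add: b_proj2 R.minus_self R.minus_zero' a_minus_def)
  have 1: "r \<otimes> ((s \<oplus> s \<ominus> t \<otimes> t) \<otimes> a) \<ominus> ((s \<otimes> a \<ominus> t \<otimes> d) \<otimes> (r \<oplus> r) \<oplus> (d \<oplus> d \<ominus> t \<otimes> a) \<otimes> (t \<otimes> r)) = \<zero>"
    "r \<otimes> ((s \<oplus> s \<ominus> t \<otimes> t) \<otimes> d) \<ominus> ((s \<otimes> a \<ominus> t \<otimes> d) \<otimes> (t \<otimes> r) \<oplus> (d \<oplus> d \<ominus> t \<otimes> a) \<otimes> (s \<otimes> r)) = \<zero>"
    if "s el R" "t el R" "a el R" "d el R" "r el R" for s t a d r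
    using that by algebra+
  have pv: "b (proj u x) v = disc u \<otimes> b x v" "b (proj u x) (u \<star> v) = disc u \<otimes> b x (u \<star> v)"
    using c sym by (simp_all add: b_proj a_minus_def R.minus_zero')
  show "b (proj2 u v x) v = \<zero>"
    using 1(1)[of "b u u" "tr u" "b x v" "b x (u \<star> v)" "q v"] c by (simp add: b_proj2 pv uv b_self[of v] disc_def)
  show "b (proj2 u v x) (u \<star> v) = \<zero>"
    using 1(2)[of "b u u" "tr u" "b x v" "b x (u \<star> v)" "q v"] c by (simp add: b_proj2 pv uv disc_def)
qed

text \<open>In the Cayley-Dickson picture \<open>v\<close> and \<open>w\<close> are successive
  doubling elements. Anticommutation of orthogonal vectors turns
  \<open>u \<star> (v \<star> w)\<close> into \<open>(v \<star> u) \<star> w\<close>, so the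
  associator is the commutator of \<open>u\<close> and \<open>v\<close> times \<open>w\<close>, and
  multiplicativity leaves the norm of that commutator.\<close>

lemma q_assoc:
  assumes c: "u el C" "v el C" "w el C"
    and v: "tr v = \<zero>" "b v u = \<zero>" and w: "tr w = \<zero>" "b w u = \<zero>" "b w v = \<zero>" "b w (u \<star> v) = \<zero>"
  shows "q (assoc u v w) = disc u \<otimes> q v \<otimes> q w"
proof -
  have cv: "cj v = -[C] v" and cw: "cj w = -[C] w" using c v w by (simp_all add: conjugate_def a_minus_def)
  have neg: "z = y" if "z \<^bold>+ -[C] y = \<zero>[C]" "z el C" "y el C" for z y
    using that M.minus_eq_zeroD[of z y] by (simp add: a_minus_def)
  have vu: "v \<star> u = cj u \<star> v"
    by (rule neg[symmetric]) (use cj_mult_lin_left[of u "\<one>[C]" v] c v b_sym[of u v] in \<open>auto simp: cv mult_neg\<close>)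
  have vw: "v \<star> w = -[C] (w \<star> v)"
  proof -
    have "-[C] (v \<star> w) \<^bold>+ -[C] (w \<star> v) = \<zero>[C]"
      using cj_mult_lin_left[of v "\<one>[C]" w] c w b_sym[of v w] by (simp add: cv cw mult_neg)
    from neg[OF this] have "-[C] (v \<star> w) = w \<star> v" using c by simp
    then show ?thesis using c by (metis M.minus_minus mult_closed)
  qed
  have 1: "(v \<star> w) \<star> cj u = (v \<star> u) \<star> w"
    by (rule neg) (use cj_mult_lin_right[of w v u] c w in \<open>auto simp: cw mult_neg\<close>)
  have bvu: "b (v \<star> u) w = \<zero>"
    using c v w b_sym[of v w] b_sym[of "u \<star> v" w] by (simp add: vu conjugate_def mult_minus mult_smult_left b_minus b_smult_left R.minus_self)
  have 2: "(v \<star> u) \<star> w = w \<star> cj (v \<star> u)"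
  proof (rule neg)
    have "b (cj (v \<star> u)) w = \<zero>" using bvu c b_cj[of "v \<star> u" w] by (simp add: cw b_neg R.minus_zero')
    then show "(v \<star> u) \<star> w \<^bold>+ -[C] (w \<star> cj (v \<star> u)) = \<zero>[C]"
      using cj_mult_lin_left[of "cj (v \<star> u)" "\<one>[C]" w] c by (simp add: cw mult_neg)
  qed (use c in auto)
  have "cj ((v \<star> w) \<star> cj u) = cj ((v \<star> u) \<star> w)" by (simp only: 1)
  then have "u \<star> (w \<star> v) = -[C] (w \<star> cj (v \<star> u))"
    using c cj_mult[of "v \<star> w" "cj u"] cj_mult[of v w] cj_mult[of "v \<star> u" w] by (simp add: cv cw mult_neg)
  then have 3: "u \<star> (v \<star> w) = (v \<star> u) \<star> w" using c by (simp add: vw mult_neg 2)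
  have A: "assoc u v w = (u \<star> v \<^bold>- v \<star> u) \<star> w" using c by (simp add: assoc_def 3 mult_minus)
  have "b u (cj u) = tr u \<otimes> tr u \<ominus> b u u" using c by (simp add: conjugate_def b_minus b_smult_right)
  then have 4: "b (u \<star> v) (v \<star> u) = (tr u \<otimes> tr u \<ominus> b u u) \<otimes> q v"
    using b_mult_right_same[of v u "cj u"] c by (simp add: vu)
  have g: "s \<otimes> r \<oplus> r \<otimes> s \<ominus> (t \<ominus> (s \<oplus> s)) \<otimes> r = (s \<oplus> s \<oplus> (s \<oplus> s) \<ominus> t) \<otimes> r"
    if "s el R" "t el R" "r el R" for s t r
    using that by algebra
  have "q (u \<star> v \<^bold>- v \<star> u) = q (u \<star> v) \<oplus> q (v \<star> u) \<ominus> b (u \<star> v) (v \<star> u)"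
    using c by (simp add: a_minus_def q_add q_neg b_neg)
  also have "\<dots> = disc u \<otimes> q v"
    using g[of "q u" "tr u \<otimes> tr u" "q v"] c by (simp add: 4 multiplicative b_self[of u] disc_def)
  finally show ?thesis using c by (simp add: A multiplicative)
qed

text \<open>The last vector \<open>w\<close> has to meet four orthogonality conditions, for
  \<open>1\<close>, \<open>u\<close>, \<open>v\<close> and \<open>u \<star> v\<close>, which
  explains the bound five. Vectors are found orthogonal modulo \<open>p\<close> only and then
  projected to be orthogonal exactly; if all norms on the complement lay in \<open>p\<close>, so
  would all values of \<open>b\<close> there.\<close>

lemma exists_assoc:
  assumes p: "primeideal p R" and fr: "is_frame n e f d" and d: "d \<notin> p" and n: "5 \<le> n"
  shows "\<exists>u\<in>carrier C. \<exists>v\<in>carrier C. \<exists>w\<in>carrier C. q (assoc u v w) \<notin> p"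
proof -
  interpret p: primeideal p R by fact
  note orth = orthogonal_mod_prime[OF p fr d]
  note pz = additive_subgroup.zero_closed[OF p.additive_subgroup_axioms]
  note pa = additive_subgroup.a_closed[OF p.additive_subgroup_axioms]
  note pn = additive_subgroup.a_inv_closed[OF p.additive_subgroup_axioms]
  have pm: "a \<ominus> c \<in> p" if "a \<in> p" "c \<in> p" for a c using that by (simp add: a_minus_def pa pn)
  have pp: "a \<otimes> c \<notin> p" if "a el R" "c el R" "a \<notin> p" "c \<notin> p" for a c
    using p.I_prime that by blast
  have polar: "b x y \<in> p" if "x el C" "y el C" "q x \<in> p" "q y \<in> p" "q (x \<^bold>+ y) \<in> p" for x y
    unfolding polar_def using that pm by blast
  have "\<exists>u\<in>carrier C. disc u \<notin> p"
  proof (rule ccontr)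
    assume neg: "\<not> ?thesis"
    obtain x y where xy: "x el C" "y el C" "tr x \<in> p" "b x y \<notin> p"
      using orth[of "[\<one>[C]]"] n by auto
    let ?two = "\<one> \<oplus> \<one>"
    show False
    proof (cases "?two \<in> p")
      \<comment> \<open>With two outside \<open>p\<close>, the second difference of the quadratic
        function \<open>disc\<close> at \<open>x\<close> and \<open>y\<close> is four times
        \<open>b x y\<close>, up to a multiple of \<open>tr x\<close>, which lies in
        \<open>p\<close>.\<close>
      case False
      have D: "disc x \<in> p" "disc y \<in> p" "disc (x \<^bold>+ y) \<in> p" using neg xy by auto
      have g1: "(tx \<oplus> ty) \<otimes> (tx \<oplus> ty) = tx \<otimes> tx \<oplus> tx \<otimes> (ty \<oplus> ty) \<oplus> ty \<otimes> ty"
        if "tx el R" "ty el R" for tx ty using that by algebra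
      have g2: "(\<one> \<oplus> \<one>) \<otimes> ((\<one> \<oplus> \<one>) \<otimes> c) = (c \<oplus> c) \<oplus> (c \<oplus> c)" if "c el R" for c
        using that by algebra
      have g3: "(sx \<oplus> c \<oplus> (c \<oplus> sy)) \<oplus> (sx \<oplus> c \<oplus> (c \<oplus> sy)) = (sx \<oplus> sx) \<oplus> (sy \<oplus> sy) \<oplus> ((c \<oplus> c) \<oplus> (c \<oplus> c))"
        if "sx el R" "sy el R" "c el R" for sx sy c
        using that by (simp add: R.a_ac)
      have g4: "(m \<oplus> r \<oplus> k) \<ominus> (w \<oplus> h \<oplus> z) \<ominus> (m \<ominus> w) \<ominus> (r \<ominus> z) \<oplus> h = k"
        if "m el R" "r el R" "k el R" "w el R" "h el R" "z el R" for m r k w h z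
        using that by algebra
      have "b (x \<^bold>+ y) (x \<^bold>+ y) = b x x \<oplus> b x y \<oplus> (b x y \<oplus> b y y)"
        using xy by (simp add: b_add_left b_add_right b_sym[of y x])
      then have "disc (x \<^bold>+ y) \<ominus> disc x \<ominus> disc y \<oplus> tr x \<otimes> (tr y \<oplus> tr y) = ?two \<otimes> (?two \<otimes> b x y)"
        unfolding disc_def using xy by (simp only: b_add_left one_closed g1 g2 g3 g4 b_closed R.a_closed R.m_closed)
      moreover have "disc (x \<^bold>+ y) \<ominus> disc x \<ominus> disc y \<oplus> tr x \<otimes> (tr y \<oplus> tr y) \<in> p"
        using D pm pa p.I_r_closed[OF xy(3), of "tr y \<oplus> tr y"] xy by auto
      moreover have "?two \<otimes> (?two \<otimes> b x y) \<notin> p" using False xy by (intro pp) auto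
      ultimately show False by simp
    next
      \<comment> \<open>With two in \<open>p\<close>, \<open>disc\<close> is minus the square of the
        trace modulo \<open>p\<close>; traces all in \<open>p\<close> contradict the choice of
        \<open>x\<close> and \<open>y\<close>, because \<open>b x y\<close> is itself a
        trace.\<close>
      case True
      have tr0: "tr z \<in> p" if z: "z el C" for z
      proof -
        have "(\<one> \<oplus> \<one>) \<otimes> s \<ominus> (s \<oplus> s \<ominus> t) = t" if "s el R" "t el R" for s t using that by algebra
        from this[of "b z z" "tr z \<otimes> tr z"] have "?two \<otimes> b z z \<ominus> disc z = tr z \<otimes> tr z" unfolding disc_def using z by simp
        moreover have "?two \<otimes> b z z \<ominus> disc z \<in> p" using pm p.I_r_closed[OF True, of "b z z"] neg z by auto
        ultimately have "tr z \<otimes> tr z \<in> p" by simp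
        then show ?thesis using p.I_prime[of "tr z" "tr z"] z by auto
      qed
      have "b x y = tr (cj x \<star> y)" using b_adj_left[of x "\<one>[C]" y] b_sym[of "\<one>[C]" "cj x \<star> y"] xy by simp
      then show False using tr0[of "cj x \<star> y"] xy by simp
    qed
  qed
  then obtain u where u: "u el C" "disc u \<notin> p" by blast
  have "\<exists>v\<in>carrier C. tr v = \<zero> \<and> b v u = \<zero> \<and> q v \<notin> p"
  proof (rule ccontr)
    assume neg: "\<not> ?thesis"
    obtain x y where xy: "x el C" "y el C" "tr x \<in> p" "b x u \<in> p" "b x y \<notin> p"
      using orth[of "[\<one>[C], u]"] u n by auto
    note o = proj_orth[OF u(1) xy(1)] proj_orth[OF u(1) xy(2)]
    have "b (proj u x) (proj u y) \<in> p"
      by (rule polar) (use neg o u xy in \<open>auto simp: b_add_left\<close>)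
    moreover have "b (proj u x) (proj u y) = disc u \<otimes> b (proj u x) y"
      using o u xy b_proj[of u y "proj u x"] b_sym[of "proj u x" "proj u y"] b_sym[of "\<one>[C]" "proj u x"] b_sym[of u "proj u x"] b_sym[of y "proj u x"]
      by (simp add: a_minus_def R.minus_zero')
    \<comment> \<open>\<open>x\<close> is orthogonal to \<open>1\<close> and \<open>u\<close> modulo
      \<open>p\<close>, so modulo \<open>p\<close> the projection merely multiplies it by
      \<open>disc u\<close>.\<close>
    moreover have "b (proj u x) y \<notin> p"
    proof
      assume *: "b (proj u x) y \<in> p"
      let ?r = "(b u u \<otimes> tr x \<ominus> tr u \<otimes> b x u) \<otimes> b \<one>[C] y \<oplus> (b x u \<oplus> b x u \<ominus> tr u \<otimes> tr x) \<otimes> b u y"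
      have r: "?r \<in> p" using xy u by (intro pa p.I_r_closed pm p.I_l_closed) auto
      have "disc u \<otimes> b x y = b (proj u x) y \<oplus> ?r"
      proof -
        have "a = (a \<ominus> c) \<oplus> c" if "a el R" "c el R" for a c using that by algebra
        from this[of "disc u \<otimes> b x y" ?r] show ?thesis using xy u by (simp add: b_proj)
      qed
      then have "disc u \<otimes> b x y \<in> p" using pa[OF * r] by simp
      then show False using pp[of "disc u" "b x y"] u xy by simp
    qed
    ultimately show False using pp[of "disc u" "b (proj u x) y"] u xy by simp
  qed
  then obtain v where v: "v el C" "tr v = \<zero>" "b v u = \<zero>" "q v \<notin> p" by blast
  have "\<exists>w\<in>carrier C. tr w = \<zero> \<and> b w u = \<zero> \<and> b w v = \<zero> \<and> b w (u \<star> v) = \<zero> \<and> q w \<notin> p"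
  proof (rule ccontr)
    assume neg: "\<not> ?thesis"
    obtain x y where xy: "x el C" "y el C" "tr x \<in> p" "b x u \<in> p" "b x v \<in> p" "b x (u \<star> v) \<in> p" "b x y \<notin> p"
      using orth[of "[\<one>[C], u, v, u \<star> v]"] u v n by auto
    note o = proj2_orth[OF u(1) v(1) xy(1) v(2,3)] proj2_orth[OF u(1) v(1) xy(2) v(2,3)]
    let ?x = "proj2 u v x"
    have "b ?x (proj2 u v y) \<in> p"
      by (rule polar) (use neg o u v xy in \<open>auto simp: b_add_left\<close>)
    moreover have "b ?x (proj2 u v y) = (q v \<otimes> disc u) \<otimes> b ?x y"
      using o u v xy b_proj[of u y ?x] b_proj2[of u v y ?x] b_sym[of ?x "proj2 u v y"] b_sym[of "\<one>[C]" ?x] b_sym[of u ?x] b_sym[of y ?x]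
        b_sym[of v ?x] b_sym[of "u \<star> v" ?x]
      by (simp add: a_minus_def R.minus_zero' R.m_assoc)
    moreover have "b ?x y \<notin> p"
    proof
      assume *: "b ?x y \<in> p"
      let ?r = "(b u u \<otimes> tr x \<ominus> tr u \<otimes> b x u) \<otimes> b \<one>[C] y \<oplus> (b x u \<oplus> b x u \<ominus> tr u \<otimes> tr x) \<otimes> b u y"
      let ?s = "(b u u \<otimes> b x v \<ominus> tr u \<otimes> b x (u \<star> v)) \<otimes> b v y \<oplus> (b x (u \<star> v) \<oplus> b x (u \<star> v) \<ominus> tr u \<otimes> b x v) \<otimes> b (u \<star> v) y"
      have "?r \<in> p" using xy u v by (intro pa p.I_r_closed pm p.I_l_closed) auto
      moreover have "?s \<in> p" using xy u v by (intro pa p.I_r_closed pm p.I_l_closed) auto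
      ultimately have r: "q v \<otimes> ?r \<oplus> ?s \<in> p" using pa[OF p.I_l_closed, of ?r "q v" ?s] v by simp
      have "(q v \<otimes> disc u) \<otimes> b x y = b ?x y \<oplus> (q v \<otimes> ?r \<oplus> ?s)"
      proof -
        have "(k \<otimes> m) \<otimes> a = (k \<otimes> (m \<otimes> a \<ominus> c) \<ominus> c') \<oplus> (k \<otimes> c \<oplus> c')"
          if "a el R" "c el R" "c' el R" "k el R" "m el R" for a c c' k m using that by algebra
        from this[of "b x y" ?r ?s "q v" "disc u"] show ?thesis using xy u v by (simp add: b_proj b_proj2)
      qed
      then have "(q v \<otimes> disc u) \<otimes> b x y \<in> p" using pa[OF * r] by simp
      then show False using pp[of "q v \<otimes> disc u" "b x y"] pp[of "q v" "disc u"] u v xy by simp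
    qed
    ultimately show False using pp[of "q v \<otimes> disc u" "b ?x y"] pp[of "q v" "disc u"] u v xy by simp
  qed
  then obtain w where w: "w el C" "tr w = \<zero>" "b w u = \<zero>" "b w v = \<zero>" "b w (u \<star> v) = \<zero>" "q w \<notin> p" by blast
  have "q (assoc u v w) \<notin> p"
    unfolding q_assoc[OF u(1) v(1) w(1) v(2,3) w(2-5)] using u v w by (intro pp) auto
  then show ?thesis using u v w by blast
qed

end

section \<open>Data of octonion algebras that survive base change\<close>

section \<open>Octonion algebras are composition algebras\<close>

context octonion_algebra begin

lemma quadratic_space: "quadratic_space R C q"
  by (intro quadratic_space.intro quadratic_space_axioms.intro module_axioms quadratic)

sublocale Q: quadratic_space R C q by (rule quadratic_space)

text \<open>Surjectivity of the polar map turns coordinate functionals into vectors; dual pairs and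
  frames are obtained in this way.\<close>

lemma riesz:
  assumes "\<psi> \<in> lin_hom R C (self_module R)"
  shows "\<exists>f\<in>carrier C. \<forall>x\<in>carrier C. polar R C q x f = \<psi> x"
proof -
  have "\<psi> \<in> (\<lambda>x. \<lambda>y\<in>carrier C. polar R C q x y) ` carrier C"
    using regular assms by (simp add: regular_form_def bij_betw_def)
  then obtain f where f: "f el C" "\<psi> = (\<lambda>y\<in>carrier C. polar R C q f y)" by (elim imageE)
  show ?thesis by (rule bexI[of _ f]) (use f Q.b_sym in auto)
qed

lemma exists_dual_pair: "\<exists>n e f. Q.dual_pair n e f"
proof -
  obtain n e \<phi> where d: "dual_system R C n e \<phi>" using exists_dual_system[OF module_axioms projective] by blast
  have "\<forall>k. \<exists>f. k < n --> f el C \<and> (\<forall>x\<in>carrier C. polar R C q x f = \<phi> k x)"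
    using riesz dual_systemD(2)[OF d] by blast
  then obtain f where f: "\<And>k. k < n ==> f k el C \<and> (\<forall>x\<in>carrier C. polar R C q x (f k) = \<phi> k x)" by metis
  have "x = (\<Oplus>\<^bsub>C\<^esub>k\<in>{..<n}. polar R C q x (f k) .[C] e k)" if x: "x el C" for x
  proof -
    have "x = (\<Oplus>\<^bsub>C\<^esub>k\<in>{..<n}. \<phi> k x .[C] e k)" using dual_systemD(3)[OF d x] .
    also have "\<dots> = (\<Oplus>\<^bsub>C\<^esub>k\<in>{..<n}. polar R C q x (f k) .[C] e k)"
      by (rule M.finsum_cong') (use f x dual_systemD(1)[OF d] in auto)
    finally show ?thesis .
  qed
  then show ?thesis using f dual_systemD(1)[OF d] unfolding Q.dual_pair_def by blast
qed

lemma exists_frame: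
  assumes p: "primeideal p R"
  shows "\<exists>e f d. Q.is_frame 8 e f d \<and> d \<notin> p"
proof -
  obtain g \<psi> d where B: "d \<in> carrier R - p \<and> (\<forall>i<8. g i el C) \<and> (\<forall>i<8. \<psi> i \<in> lin_hom R C (self_module R)) \<and>
    (\<forall>i<8. \<forall>j<8. \<psi> i (g j) = (if i = j then d else \<zero>)) \<and>
    (\<forall>x\<in>carrier C. d .[C] x = (\<Oplus>\<^bsub>C\<^esub>i\<in>{..<8::nat}. \<psi> i x .[C] g i))"
    using local_basis[OF module_axioms projective rank_8 p] by (elim exE)
  then have d: "d \<in> carrier R - p" and g: "\<And>i. i < 8 ==> g i el C"
    and \<psi>: "\<And>i. i < 8 ==> \<psi> i \<in> lin_hom R C (self_module R)"
    and dual: "\<And>i j. [|i < 8; j < 8|] ==> \<psi> i (g j) = (if i = j then d else \<zero>)"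
    and ex: "\<And>x. x el C ==> d .[C] x = (\<Oplus>\<^bsub>C\<^esub>i\<in>{..<8}. \<psi> i x .[C] g i)"
    by blast+
  have "\<forall>k. \<exists>f. k < 8 --> f el C \<and> (\<forall>x\<in>carrier C. polar R C q x f = \<psi> k x)"
    using riesz \<psi> by blast
  then obtain f where f: "\<And>k. k < 8 ==> f k el C \<and> (\<forall>x\<in>carrier C. polar R C q x (f k) = \<psi> k x)" by metis
  have "d .[C] x = (\<Oplus>\<^bsub>C\<^esub>k\<in>{..<8}. polar R C q x (f k) .[C] g k)" if x: "x el C" for x
    unfolding ex[OF x] by (rule M.finsum_cong') (use f x g in auto)
  moreover have "polar R C q (g i) (f j) = (if i = j then d else \<zero>)" if "i < 8" "j < 8" for i j
    using f[OF that(2)] g[OF that(1)] dual[OF that(2,1)] by auto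
  ultimately show ?thesis using d g f unfolding Q.is_frame_def by (intro exI[of _ g] exI[of _ f] exI[of _ d]) auto
qed

text \<open>Multiplicativity shows at once only that the norm of \<open>1\<close> fixes all values
  of \<open>q\<close>, hence all values of \<open>b\<close>. At each prime a frame puts the scalar
  \<open>d\<close> outside the prime among these values, so \<open>one_memI\<close> applies to the
  fixed scalars.\<close>

lemma q_one: "q \<one>[C] = \<one>"
proof -
  let ?e = "q \<one>[C]"
  have e: "?e el R" using one_closed by (rule Q.q_closed)
  let ?J = "{r \<in> carrier R. ?e \<otimes> r = r}"
  have "\<one> \<in> ?J"
  proof (rule R.one_memI)
    fix p assume p: "primeideal p R"
    obtain e' f d where fr: "Q.is_frame 8 e' f d" "d \<notin> p" using exists_frame[OF p] by blast
    \<comment> \<open>The index \<open>0\<close> exists because the rank is positive.\<close>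
    have c: "e' 0 el C" "f 0 el C" and d: "d el R" "polar R C q (e' 0) (f 0) = d"
      using Q.frameD[OF fr(1)] by auto
    have mq: "q x = ?e \<otimes> q x" if "x el C" for x
      using multiplicative[OF one_closed that] mult_one_left[OF that] by simp
    have "polar R C q (e' 0) (f 0) = ?e \<otimes> polar R C q (e' 0) (f 0)"
    proof -
      have "?e \<otimes> polar R C q (e' 0) (f 0) = ?e \<otimes> q (e' 0 +[C] f 0) \<ominus> ?e \<otimes> q (e' 0) \<ominus> ?e \<otimes> q (f 0)"
        using c e by (simp add: polar_def a_minus_def R.r_distr R.r_minus)
      also have "\<dots> = polar R C q (e' 0) (f 0)"
        using c mq[symmetric] by (simp add: polar_def)
      finally show ?thesis by simp
    qed
    then show "\<exists>d\<in>?J. d \<notin> p" using d fr(2) by auto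
  qed (use e in \<open>auto simp: R.r_distr R.m_lcomm\<close>)
  then show ?thesis using e by simp
qed

lemma composition_algebra: "composition_algebra R C q"
proof -
  obtain n e f where "Q.dual_pair n e f" using exists_dual_pair by blast
  then show ?thesis
    by (intro composition_algebra.intro composition_algebra_axioms.intro unital_nonassoc_algebra_axioms Q.quadratic_space_axioms)
      (auto intro: multiplicative q_one Q.dual_pair_nondegenerate)
qed

end

text \<open>The interface that is stable under base change. The rank has done its work by providing
  a frame and an associator with norm outside each prime, and it is these data that pass to the base
  changes of \<open>C\<close>.\<close>

locale octonionic = composition_algebra R C q
  for R :: "('r, 'z) ring_scheme" (structure) and C :: "('r, 'c) module" (structure) and q :: "'c => 'r" +
  assumes dual: "\<exists>n e f. dual_pair n e f"
    and local_data: "primeideal p R ==> \<exists>n e f d u v w. is_frame n e f d \<and> d \<notin> p \<and>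
      u el C \<and> v el C \<and> w el C \<and> q (assoc u v w) \<notin> p"
begin

text \<open>The traces form an ideal, and at each prime they include the scalar \<open>d\<close> of
  a frame: it is a value of \<open>b\<close>, and \<open>b x y\<close> is the trace of
  \<open>cj x \<star> y\<close>.\<close>

lemma exists_tr_one: "\<exists>y\<in>carrier C. tr y = \<one>"
proof -
  have "\<one> \<in> tr ` carrier C"
  proof (rule R.one_memI)
    show "\<zero> \<in> tr ` carrier C" using b_zero(2)[of "\<one>[C]"] by force
    show "a \<oplus> c \<in> tr ` carrier C" if "a \<in> tr ` carrier C" "c \<in> tr ` carrier C" for a c
      proof -
      from that obtain x y where "x el C" "a = tr x" "y el C" "c = tr y" by blast
      then show ?thesis by (intro image_eqI[of _ _ "x \<^bold>+ y"]) (auto simp: b_add_left)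
    qed
    show "r \<otimes> a \<in> tr ` carrier C" if "r el R" "a \<in> tr ` carrier C" for r a
      proof -
      from that obtain x where "x el C" "a = tr x" by blast
      then show ?thesis using that by (intro image_eqI[of _ _ "r \<bullet> x"]) (auto simp: b_smult_left)
    qed
    fix p assume p: "primeideal p R"
    interpret p: primeideal p R by fact
    obtain n e f d u v w where fr: "is_frame n e f d" "d \<notin> p" and c: "u el C" "v el C" "w el C" "q (assoc u v w) \<notin> p"
      using local_data[OF p] by blast
    show "\<exists>d\<in>tr ` carrier C. d \<notin> p"
    proof (cases "n = 0")
      \<comment> \<open>An empty frame would make \<open>d\<close> annihilate \<open>1\<close> and
        hence have square zero, although it lies outside a prime.\<close>
      case True
      then have "d \<bullet> \<one>[C] = \<zero>[C]" using frameD(5)[OF fr(1), of "\<one>[C]"] by simp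
      then have "d \<otimes> d = \<zero>" using q_smult[of d "\<one>[C]"] frameD(1)[OF fr(1)] q_one q_smult[of \<zero> "\<one>[C]"] by simp
      then show ?thesis using p.I_prime[of d d] frameD(1)[OF fr(1)] fr(2) additive_subgroup.zero_closed[OF p.additive_subgroup_axioms] by auto
    next
      case False
      then have c: "e 0 el C" "f 0 el C" and d: "b (e 0) (f 0) = d" using frameD[OF fr(1)] by auto
      have "d = tr (cj (e 0) \<star> f 0)" using d b_adj_left[of "e 0" "\<one>[C]" "f 0"] b_sym[of "\<one>[C]" "cj (e 0) \<star> f 0"] c by simp
      then show ?thesis using fr(2) c by blast
    qed
  qed auto
  then show ?thesis by force
qed

end

lemma (in octonion_algebra) octonionic: "octonionic R C q"
proof -
  interpret A: composition_algebra R C q by (rule composition_algebra)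
  show ?thesis
  proof (intro octonionic.intro octonionic_axioms.intro composition_algebra exists_dual_pair)
    fix p assume p: "primeideal p R"
    obtain e f d where fr: "Q.is_frame 8 e f d" "d \<notin> p" using exists_frame[OF p] by blast
    then show "\<exists>n e f d u v w. Q.is_frame n e f d \<and> d \<notin> p \<and>
      u el C \<and> v el C \<and> w el C \<and> q (A.assoc u v w) \<notin> p"
      using A.exists_assoc[OF p fr] by fastforce
  qed
qed

section \<open>Base change of the norm form and of composition algebras\<close>

section \<open>Scalar extension of quadratic forms\<close>

text \<open>A copy of \<open>module\<close> under a separate name, so that base changes and direct
  sums can be attached to a context with prefixes of their own.\<close>

locale rmodule = module R M
  for R :: "('r, 'z) ring_scheme" (structure) and M :: "('r, 'm) module" (structure)

lemma (in rmodule) quadratic_formI: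
  assumes "\<And>x. x el M ==> Q x el R"
    "\<And>r x. [|r el R; x el M|] ==> Q (r .[M] x) = r \<otimes> r \<otimes> Q x"
    "\<And>x y. [|x el M; y el M|] ==> polar R M Q x y = B x y"
    "\<And>x y z. [|x el M; y el M; z el M|] ==> B x (y +[M] z) = B x y \<oplus> B x z"
    "\<And>x y r. [|x el M; y el M; r el R|] ==> B x (r .[M] y) = r \<otimes> B x y"
    "\<And>x y. [|x el M; y el M|] ==> B x y el R"
  shows "quadratic_form R M Q"
  unfolding quadratic_form_def
proof (intro conjI ballI)
  fix x assume x: "x el M"
  show "(\<lambda>y\<in>carrier M. polar R M Q x y) \<in> lin_hom R M (self_module R)"
    by (rule lin_homI) (use assms x in \<open>simp_all add: self_module_def\<close>)
qed (use assms(1,2) in auto)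

lemma (in rmodule) quadratic_form_prod:
  assumes f: "f \<in> lin_hom R M (self_module R)" and g: "g \<in> lin_hom R M (self_module R)"
  shows "quadratic_form R M (\<lambda>x. f x \<otimes> g x)"
proof (rule quadratic_formI[where B = "\<lambda>x y. f x \<otimes> g y \<oplus> f y \<otimes> g x"])
  note [simp] = functionalD(1-3)[OF f] functionalD(1-3)[OF g]
  show "\<And>x. x el M ==> f x \<otimes> g x el R" by simp
  have 1: "(r \<otimes> a) \<otimes> (r \<otimes> c) = r \<otimes> r \<otimes> (a \<otimes> c)" if "r el R" "a el R" "c el R" for r a c
    using that by algebra
  show "f (r .[M] x) \<otimes> g (r .[M] x) = r \<otimes> r \<otimes> (f x \<otimes> g x)" if "r el R" "x el M" for r x
    using that by (simp add: 1)
  have 2: "(a \<oplus> a') \<otimes> (c \<oplus> c') \<ominus> a \<otimes> c \<ominus> a' \<otimes> c' = a \<otimes> c' \<oplus> a' \<otimes> c"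
    if "a el R" "a' el R" "c el R" "c' el R" for a a' c c'
    using that by algebra
  show "polar R M (\<lambda>x. f x \<otimes> g x) x y = f x \<otimes> g y \<oplus> f y \<otimes> g x" if "x el M" "y el M" for x y
    using that by (simp add: polar_def 2)
  have 3: "a \<otimes> (c \<oplus> c') \<oplus> (d \<oplus> d') \<otimes> k = (a \<otimes> c \<oplus> d \<otimes> k) \<oplus> (a \<otimes> c' \<oplus> d' \<otimes> k)"
    if "a el R" "d el R" "c el R" "c' el R" "d' el R" "k el R" for a d c c' d' k
    using that by algebra
  show "f x \<otimes> g (y +[M] z) \<oplus> f (y +[M] z) \<otimes> g x = f x \<otimes> g y \<oplus> f y \<otimes> g x \<oplus> (f x \<otimes> g z \<oplus> f z \<otimes> g x)"
    if "x el M" "y el M" "z el M" for x y z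
    using that by (simp add: 3)
  have 4: "a \<otimes> (r \<otimes> c) \<oplus> (r \<otimes> d) \<otimes> k = r \<otimes> (a \<otimes> c \<oplus> d \<otimes> k)"
    if "a el R" "d el R" "c el R" "r el R" "k el R" for a d c r k
    using that by algebra
  show "f x \<otimes> g (r .[M] y) \<oplus> f (r .[M] y) \<otimes> g x = r \<otimes> (f x \<otimes> g y \<oplus> f y \<otimes> g x)"
    if "x el M" "y el M" "r el R" for x y r
    using that by (simp add: 4)
qed (use functionalD(1)[OF f] functionalD(1)[OF g] in auto)

lemma (in rmodule) quadratic_form_add:
  assumes P: "quadratic_form R M P" and Q: "quadratic_form R M Q"
  shows "quadratic_form R M (\<lambda>x. P x \<oplus> Q x)"
proof -
  interpret P: quadratic_space R M P by (intro quadratic_space.intro quadratic_space_axioms.intro P module_axioms)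
  interpret Q: quadratic_space R M Q by (intro quadratic_space.intro quadratic_space_axioms.intro Q module_axioms)
  have 1: "(a \<oplus> c) \<ominus> (a' \<oplus> c') \<ominus> (a'' \<oplus> c'') = (a \<ominus> a' \<ominus> a'') \<oplus> (c \<ominus> c' \<ominus> c'')"
    if "a el R" "a' el R" "a'' el R" "c el R" "c' el R" "c'' el R" for a a' a'' c c' c''
    using that by algebra
  show ?thesis
    by (rule quadratic_formI[where B = "\<lambda>x y. polar R M P x y \<oplus> polar R M Q x y"])
      (simp_all add: P.q_smult Q.q_smult R.r_distr P.b_add_right Q.b_add_right P.b_smult_right Q.b_smult_right R.a_ac,
        simp add: polar_def 1)
qed

text \<open>Partial sums of the expansion of \<open>x\<close> in a dual pair, recursive so that
  \<open>q\<close> can be expanded one summand at a time.\<close>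

primrec (in quadratic_space) psum :: "(nat => 'c) => (nat => 'c) => nat => 'c => 'c" where
  "psum e f 0 x = \<zero>[C]"
| "psum e f (Suc m) x = b x (f m) \<bullet> e m \<^bold>+ psum e f m x"

lemma (in quadratic_space) psum_facts:
  assumes "\<And>k. k < m ==> e k el C \<and> f k el C" "x el C"
  shows "psum e f m x el C" "psum e f m x = (\<Oplus>\<^bsub>C\<^esub>k\<in>{..<m}. b x (f k) \<bullet> e k)"
    "y el C ==> psum e f m (x \<^bold>+ y) = psum e f m x \<^bold>+ psum e f m y"
    "r el R ==> psum e f m (r \<bullet> x) = r \<bullet> psum e f m x"
proof -
  have "psum e f m x el C \<and> psum e f m x = (\<Oplus>\<^bsub>C\<^esub>k\<in>{..<m}. b x (f k) \<bullet> e k) \<and>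
     (\<forall>y\<in>carrier C. psum e f m y el C \<and> psum e f m (x \<^bold>+ y) = psum e f m x \<^bold>+ psum e f m y) \<and>
     (\<forall>r\<in>carrier R. psum e f m (r \<bullet> x) = r \<bullet> psum e f m x)"
    using assms
  proof (induction m)
    case (Suc m)
    have c: "e m el C" "f m el C" "(\<lambda>k. b x (f k) \<bullet> e k) \<in> {..<m} \<rightarrow> carrier C" using Suc.prems by auto
    then have "(\<Oplus>\<^bsub>C\<^esub>k\<in>{..<Suc m}. b x (f k) \<bullet> e k) = b x (f m) \<bullet> e m \<^bold>+ (\<Oplus>\<^bsub>C\<^esub>k\<in>{..<m}. b x (f k) \<bullet> e k)"
      using Suc.prems by (simp add: lessThan_Suc M.finsum_insert)
    then show ?case using Suc c
      by (auto simp: b_add_left b_smult_left smult_l_distr smult_r_distr M.a_ac smult_assoc1)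
  qed auto
  then show "psum e f m x el C" "psum e f m x = (\<Oplus>\<^bsub>C\<^esub>k\<in>{..<m}. b x (f k) \<bullet> e k)"
    "y el C ==> psum e f m (x \<^bold>+ y) = psum e f m x \<^bold>+ psum e f m y"
    "r el R ==> psum e f m (r \<bullet> x) = r \<bullet> psum e f m x" by blast+
qed

context scalar_extension begin

sublocale Tm: rmodule S T by (rule rmodule.intro) (rule module_T)

text \<open>Agreement on the image of \<open>M\<close> gives agreement of the polar forms there,
  then everywhere by bilinearity, and this controls the cross terms when the forms are compared on
  sums.\<close>

lemma quadratic_form_unique:
  assumes "quadratic_form S T P" "quadratic_form S T Q" "\<And>x. x el M ==> P (ii x) = Q (ii x)" and z: "z el T"
  shows "P z = Q z"
proof -
  interpret P: quadratic_space S T P by (intro quadratic_space.intro quadratic_space_axioms.intro assms Tm.module_axioms)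
  interpret Q: quadratic_space S T Q by (intro quadratic_space.intro quadratic_space_axioms.intro assms Tm.module_axioms)
  have 0: "polar S T P (ii x) (ii y) = polar S T Q (ii x) (ii y)" if "x el M" "y el M" for x y
    using that assms(3) by (simp add: polar_def ii_add[symmetric])
  have 1: "polar S T P (ii x) w = polar S T Q (ii x) w" if "x el M" "w el T" for x w
    using that(2) by (induction w rule: T_induct')
      (use that(1) 0 in \<open>simp_all add: P.b_add_right Q.b_add_right P.b_smult_right Q.b_smult_right\<close>)
  have 2: "polar S T P v w = polar S T Q v w" if "v el T" "w el T" for v w
    using that(1) by (induction v rule: T_induct')
      (use that(2) 1 in \<open>simp_all add: P.b_add_left Q.b_add_left P.b_smult_left Q.b_smult_left\<close>)
  show ?thesis using z
    by (induction z rule: T_induct') (simp_all add: P.q_smult Q.q_smult P.q_add Q.q_add 2 assms(3))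
qed

end

locale octonionic_extension = octonionic R C q + S: algebra R S
  for R :: "('r, 'z) ring_scheme" (structure) and C :: "('r, 'c) module" (structure) and q :: "'c => 'r"
    and S :: "('r, 's) module"
begin

sublocale E: algebra_extension R C S ..

abbreviation "T \<equiv> base_change R C S"
abbreviation "QS \<equiv> base_change_form R C q S"
abbreviation "hS \<equiv> E.hS"
abbreviation "ii \<equiv> E.ii"

lemma hS_simps:
  "[|x el R; y el R|] ==> hS (x \<oplus> y) = hS x +[S] hS y"
  "[|x el R; y el R|] ==> hS (x \<otimes> y) = hS x *[S] hS y"
  "hS \<one> = \<one>[S]" "hS \<zero> = \<zero>[S]"
  "[|x el R; y el R|] ==> hS (x \<ominus> y) = hS x -[S] hS y"
proof -
  have a: "hS \<in> add_hom R S" using E.hS_hom by (auto simp: add_hom_def ring_hom_def)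
  show "[|x el R; y el R|] ==> hS (x \<oplus> y) = hS x +[S] hS y" using add_hom_add[OF a] .
  show "[|x el R; y el R|] ==> hS (x \<otimes> y) = hS x *[S] hS y" using ring_hom_mult[OF E.hS_hom] .
  show "hS \<one> = \<one>[S]" using ring_hom_one[OF E.hS_hom] .
  show "hS \<zero> = \<zero>[S]" using add_hom_zero[OF R.abelian_group_axioms S.abelian_group_axioms a] .
  show "[|x el R; y el R|] ==> hS (x \<ominus> y) = hS x -[S] hS y"
    using add_hom_minus[OF R.abelian_group_axioms S.abelian_group_axioms a] .
qed

text \<open>Without a basis the form is built along a dual pair: passing from one partial sum to the
  next adds a product of two linear functionals to \<open>q (psum e f m x)\<close>, and products of
  extended functionals are quadratic forms.\<close>

lemma exists_form: "\<exists>Q. quadratic_form S T Q \<and> (\<forall>x\<in>carrier C. Q (ii x) = hS (q x))"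
proof -
  obtain n e f where d: "dual_pair n e f" using dual by blast
  have "m \<le> n ==> \<exists>Q. quadratic_form S T Q \<and> (\<forall>x\<in>carrier C. Q (ii x) = hS (q (psum e f m x)))" for m
  proof (induction m)
    case 0
    have z: "(\<lambda>x\<in>carrier T. \<zero>[S]) \<in> lin_hom S T (self_module S)"
      by (rule lin_homI) (auto simp: self_module_def E.smultT_closed)
    have "q \<zero>[C] = \<zero>" using q_smult[of \<zero> "\<one>[C]"] by simp
    then show ?case using E.Tm.quadratic_form_prod[OF z z] by (intro exI conjI) (auto simp: hS_simps)
  next
    case (Suc m)
    then obtain Q where Q: "quadratic_form S T Q" "\<And>x. x el C ==> Q (ii x) = hS (q (psum e f m x))" by auto
    have c: "e k el C \<and> f k el C" if "k < Suc m" for k using dual_pairD[OF d] Suc.prems that by auto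
    then have c': "e k el C \<and> f k el C" if "k < m" for k using that by auto
    note ps = psum_facts[OF c']
    have em: "e m el C" "f m el C" using c by auto
    have 1: "(\<lambda>x\<in>carrier C. b x (f m)) \<in> lin_hom R C (self_module R)"
      by (rule lin_homI) (use em in \<open>auto simp: self_module_def b_add_left b_smult_left\<close>)
    have 2: "(\<lambda>x\<in>carrier C. b x (f m) \<otimes> q (e m) \<oplus> b (psum e f m x) (e m)) \<in> lin_hom R C (self_module R)"
      by (rule lin_homI) (use em in \<open>auto simp: self_module_def b_add_left b_smult_left ps(1,3,4) R.l_distr R.r_distr R.a_ac R.m_assoc\<close>)
    obtain \<Phi> where \<Phi>: "\<Phi> \<in> lin_hom S T (self_module S)" "\<And>x. x el C ==> \<Phi> (ii x) = hS (b x (f m))"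
      by (rule E.functional_extends[OF 1]) simp
    obtain \<Theta> where \<Theta>: "\<Theta> \<in> lin_hom S T (self_module S)"
      "\<And>x. x el C ==> \<Theta> (ii x) = hS (b x (f m) \<otimes> q (e m) \<oplus> b (psum e f m x) (e m))"
      by (rule E.functional_extends[OF 2]) simp
    have "quadratic_form S T (\<lambda>z. Q z +[S] \<Phi> z *[S] \<Theta> z)"
      by (rule E.Tm.quadratic_form_add[OF Q(1) E.Tm.quadratic_form_prod[OF \<Phi>(1) \<Theta>(1)]])
    moreover have "Q (ii x) +[S] \<Phi> (ii x) *[S] \<Theta> (ii x) = hS (q (psum e f (Suc m) x))" if x: "x el C" for x
    proof -
      have g: "k \<otimes> k \<otimes> r \<oplus> s \<oplus> k \<otimes> t = s \<oplus> k \<otimes> (k \<otimes> r \<oplus> t)"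
        if "k el R" "r el R" "s el R" "t el R" for k r s t using that by algebra
      have "q (psum e f (Suc m) x) = q (psum e f m x) \<oplus> b x (f m) \<otimes> (b x (f m) \<otimes> q (e m) \<oplus> b (psum e f m x) (e m))"
        using em x ps[OF _ x] g[of "b x (f m)" "q (e m)" "q (psum e f m x)" "b (psum e f m x) (e m)"]
        by (simp add: q_add q_smult b_smult_left b_sym[of "e m"])
      then show ?thesis using em x ps by (simp add: Q \<Phi> \<Theta> hS_simps)
    qed
    ultimately show ?case by (intro exI conjI) auto
  qed
  from this[of n] obtain Q where Q: "quadratic_form S T Q" "\<And>x. x el C ==> Q (ii x) = hS (q (psum e f n x))" by auto
  have "psum e f n x = x" if "x el C" for x
    using psum_facts(2)[of n e f x] dual_pairD[OF d] that by simp
  with Q show ?thesis by auto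
qed

text \<open>\<open>exists_form\<close> and \<open>quadratic_form_unique\<close> justify the definite
  description; restriction to the carrier makes the form unique as a function.\<close>

lemma QS_facts: "QS \<in> extensional (carrier T)" "quadratic_form S T QS" "x el C ==> QS (ii x) = hS (q x)"
proof -
  let ?P = "\<lambda>Q. Q \<in> extensional (carrier T) \<and> quadratic_form S T Q \<and> (\<forall>x\<in>carrier C. Q (E.tn x \<one>[S]) = q x .[S] \<one>[S])"
  obtain Q where Q: "quadratic_form S T Q" "\<forall>x\<in>carrier C. Q (ii x) = hS (q x)" using exists_form by blast
  interpret Q: quadratic_space S T Q by (intro quadratic_space.intro quadratic_space_axioms.intro Q E.Tm.module_axioms)
  let ?Q = "restrict Q (carrier T)"
  have "quadratic_form S T ?Q"
    by (rule E.Tm.quadratic_formI[where B = "polar S T Q"])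
      (simp_all add: Q.q_smult Q.b_add_right Q.b_smult_right, simp add: polar_def)
  then have 1: "?P ?Q" using Q(2) by (auto simp: E.ii_def E.hS_def)
  have "?P (THE Q. ?P Q)"
  proof (rule theI[of ?P ?Q])
    show "?P ?Q" by (rule 1)
    fix P assume P: "?P P"
    show "P = ?Q"
    proof (rule extensionalityI[of _ "carrier T"])
      have PQ: "P (ii x) = ?Q (ii x)" if x: "x el C" for x
        using bspec[OF conjunct2[OF conjunct2[OF P]] x] bspec[OF conjunct2[OF conjunct2[OF 1]] x]
        unfolding E.ii_def by (rule trans[OF _ sym])
      fix z assume z: "z el T"
      show "P z = ?Q z"
        by (rule E.quadratic_form_unique[OF conjunct1[OF conjunct2[OF P]] conjunct1[OF conjunct2[OF 1]] PQ z])
    next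
      show "P \<in> extensional (carrier T)" by (rule conjunct1[OF P])
    qed simp
  qed
  then have 2: "?P QS" by (simp add: base_change_form_def)
  then show "QS \<in> extensional (carrier T)" "quadratic_form S T QS" by blast+
  show "x el C ==> QS (ii x) = hS (q x)" using 2 by (simp add: E.ii_def E.hS_def)
qed

sublocale Q: quadratic_space S T QS
  by (intro quadratic_space.intro quadratic_space_axioms.intro QS_facts E.Tm.module_axioms)

sublocale A: unital_nonassoc_algebra S T by (rule E.nonassoc_algebra_T)

lemma B_ii: "[|x el C; y el C|] ==> polar S T QS (ii x) (ii y) = hS (b x y)"
  by (simp add: polar_def E.ii_add[symmetric] QS_facts(3) hS_simps)

lemmas T_simps = A.mult_add_left A.mult_add_right A.mult_smult_left A.mult_smult_right A.mult_closed
  Q.b_add_left Q.b_add_right Q.b_smult_left Q.b_smult_right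

lemma S_ring1:
  "[|a el S; a' el S; c el S; c' el S|] ==> (a -[S] c) +[S] (a' -[S] c') = (a +[S] a') -[S] (c +[S] c')"
  by (simp add: a_minus_def S.minus_add S.a_ac)

lemma S_ring2:
  "[|a el S; c el S; s el S|] ==> s *[S] (a -[S] c) = s *[S] a -[S] s *[S] c"
  by (simp add: a_minus_def S.r_distr S.r_minus)

abbreviation B where "B \<equiv> polar S T QS"

text \<open>A multilinear identity passes from \<open>C\<close> to the base change one argument at a
  time.\<close>

lemma B_exchange:
  assumes "v el T" "w el T" "y el T" "z el T"
  shows "B (v *[T] w) (y *[T] z) = B v y *[S] B w z -[S] B (y *[T] w) (v *[T] z)"
proof -
  have 0: "B (ii x *[T] ii x') (ii y *[T] ii y') = B (ii x) (ii y) *[S] B (ii x') (ii y') -[S] B (ii y *[T] ii x') (ii x *[T] ii y')"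
    if "x el C" "x' el C" "y el C" "y' el C" for x x' y y'
    using that R.add_solve[OF b_exchange[of x x' y y']]
    by (simp add: E.ii_mult[symmetric] B_ii hS_simps)
  have 1: "B (ii x *[T] ii x') (ii y *[T] z) = B (ii x) (ii y) *[S] B (ii x') z -[S] B (ii y *[T] ii x') (ii x *[T] z)"
    if "x el C" "x' el C" "y el C" "z el T" for x x' y z
    using that(4)
  proof (induction z rule: E.T_induct')
    case (smult y' s)
    then show ?case using 0[OF that(1-3) smult(1)] that by (simp add: T_simps S_ring2 S.m_lcomm)
  qed (use that in \<open>simp add: T_simps S_ring1 S.r_distr\<close>)
  have 2: "B (ii x *[T] ii x') (y *[T] z) = B (ii x) y *[S] B (ii x') z -[S] B (y *[T] ii x') (ii x *[T] z)"
    if "x el C" "x' el C" "y el T" "z el T" for x x' y z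
    using that(3)
  proof (induction y rule: E.T_induct')
    case (smult y' s)
    then show ?case using 1[OF that(1,2) smult(1) that(4)] that by (simp add: T_simps S_ring2 S.m_assoc)
  qed (use that in \<open>simp add: T_simps S_ring1 S.l_distr\<close>)
  have 3: "B (ii x *[T] w) (y *[T] z) = B (ii x) y *[S] B w z -[S] B (y *[T] w) (ii x *[T] z)"
    if "x el C" "w el T" "y el T" "z el T" for x w y z
    using that(2) by (induction w rule: E.T_induct')
     (use that in \<open>simp_all add: T_simps 2 S_ring1 S_ring2 S.r_distr S.m_lcomm\<close>)
  show ?thesis using assms(1) by (induction v rule: E.T_induct')
     (use assms in \<open>simp_all add: T_simps 3 S_ring1 S_ring2 S.l_distr S.m_assoc\<close>)
qed

lemma B_left_same:
  assumes "x el C" "y el T" "z el T"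
  shows "B (ii x *[T] y) (ii x *[T] z) = hS (q x) *[S] B y z"
proof -
  have 1: "B (ii x *[T] ii y) (ii x *[T] z) = hS (q x) *[S] B (ii y) z" if "y el C" for y
    using assms(3) by (induction z rule: E.T_induct')
     (use assms that in \<open>simp_all add: T_simps E.ii_mult[symmetric] B_ii b_mult_left_same hS_simps S.r_distr S.m_lcomm\<close>)
  show ?thesis using assms(2) by (induction y rule: E.T_induct')
     (use assms 1 in \<open>simp_all add: T_simps S.r_distr S.m_lcomm\<close>)
qed

text \<open>The identity is quadratic in \<open>v\<close>, so a sum produces cross terms; these are
  exactly what \<open>B_exchange\<close> evaluates.\<close>

lemma B_right_same:
  assumes "v el T" "y el T" "z el T"
  shows "B (y *[T] v) (z *[T] v) = B y z *[S] QS v"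
  using assms(1)
proof (induction v rule: E.T_induct')
  case (smult x s)
  have 0: "B (ii y *[T] ii x) (z *[T] ii x) = B (ii y) z *[S] hS (q x)" if "y el C" for y
    using assms(3) by (induction z rule: E.T_induct')
     (use smult that in \<open>simp_all add: T_simps E.ii_mult[symmetric] B_ii b_mult_right_same hS_simps S.l_distr S.m_assoc\<close>)
  have 1: "B (y *[T] ii x) (z *[T] ii x) = B y z *[S] hS (q x)"
    using assms(2) by (induction y rule: E.T_induct')
     (use smult assms 0 in \<open>simp_all add: T_simps S.l_distr S.m_assoc\<close>)
  have "s *[S] (s *[S] (k *[S] l)) = k *[S] (s *[S] s *[S] l)" if "k el S" "l el S" for k l
    using that smult by (simp add: S.m_ac)
  then show ?case using smult assms 1 by (simp add: T_simps Q.q_smult QS_facts(3))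
next
  case (add v w)
  have g: "a +[S] (t -[S] c) +[S] (c +[S] d) = a +[S] d +[S] t"
    if "a el S" "t el S" "c el S" "d el S" for a t c d
    using that by algebra
  have "B (y *[T] (v +[T] w)) (z *[T] (v +[T] w)) =
     B (y *[T] v) (z *[T] v) +[S] B (y *[T] v) (z *[T] w) +[S] (B (z *[T] v) (y *[T] w) +[S] B (y *[T] w) (z *[T] w))"
    using add assms Q.b_sym[of "y *[T] w" "z *[T] v"] by (simp add: T_simps S.a_ac)
  also have "\<dots> = B y z *[S] QS v +[S] B y z *[S] QS w +[S] B y z *[S] B v w"
    unfolding B_exchange[OF assms(2) add(1) assms(3) add(2)] add.IH using add assms by (subst g) (auto simp: A.mult_closed)
  also have "\<dots> = B y z *[S] QS (v +[T] w)" using add assms by (simp add: Q.q_add S.r_distr)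
  finally show ?case .
qed

text \<open>Additive induction in both factors, with \<open>B_right_same\<close> and
  \<open>B_left_same\<close> accounting for the cross terms of the two quadratic
  dependences.\<close>

lemma QS_mult:
  assumes "y el T" "z el T"
  shows "QS (y *[T] z) = QS y *[S] QS z"
  using assms(1)
proof (induction y rule: E.T_induct')
  case (smult x s)
  have "QS (ii x *[T] z) = hS (q x) *[S] QS z" using assms(2)
  proof (induction z rule: E.T_induct')
    case (smult y t)
    then show ?case using \<open>x el C\<close>
      by (simp add: A.mult_smult_right E.ii_mult[symmetric] Q.q_smult QS_facts(3) multiplicative hS_simps S.m_lcomm)
  next
    case (add v w)
    then show ?case using \<open>x el C\<close>
      by (simp add: A.mult_add_right A.mult_closed Q.q_add B_left_same S.r_distr)
  qed
  then show ?case using smult assms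
    by (simp add: A.mult_smult_left A.mult_closed Q.q_smult QS_facts(3) S.m_assoc)
next
  case (add v w)
  then show ?case using assms by (simp add: A.mult_add_left A.mult_closed Q.q_add B_right_same S.l_distr)
qed

lemma expansion_T:
  fixes n :: nat
  assumes d: "d el R" and e: "\<And>k. k < n ==> e k el C \<and> f k el C"
    and ex: "\<And>x. x el C ==> d \<bullet> x = (\<Oplus>\<^bsub>C\<^esub>k\<in>{..<n}. b x (f k) \<bullet> e k)"
    and z: "z el T"
  shows "hS d .[T] z = (\<Oplus>\<^bsub>T\<^esub>k\<in>{..<n}. B z (ii (f k)) .[T] ii (e k))"
  using z
proof (induction z rule: E.T_induct')
  case (smult x s)
  have cl: "(\<lambda>k. b x (f k) \<bullet> e k) \<in> {..<n} \<rightarrow> carrier C" using e smult by auto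
  have "hS d .[T] ii x = ii (d \<bullet> x)" using d smult by (simp add: E.ii_smult)
  also have "\<dots> = (\<Oplus>\<^bsub>T\<^esub>k\<in>{..<n}. ii (b x (f k) \<bullet> e k))"
    unfolding ex[OF smult(1)]
    by (rule add_hom_finsum[OF C_ag E.T.abelian_group_axioms E.ii_hom _ cl]) simp
  finally have "s .[T] (hS d .[T] ii x) = s .[T] (\<Oplus>\<^bsub>T\<^esub>k\<in>{..<n}. ii (b x (f k) \<bullet> e k))"
    by simp
  also have "\<dots> = (\<Oplus>\<^bsub>T\<^esub>k\<in>{..<n}. s .[T] ii (b x (f k) \<bullet> e k))"
    by (rule E.Tm.finsum_smult_ldistr) (use smult cl in \<open>simp_all add: Pi_def\<close>)
  also have "\<dots> = (\<Oplus>\<^bsub>T\<^esub>k\<in>{..<n}. B (s .[T] ii x) (ii (f k)) .[T] ii (e k))"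
    by (rule E.T.finsum_cong') (use e smult in \<open>auto simp: Q.b_smult_left B_ii E.ii_smult E.Tm.smult_assoc1\<close>)
  finally show ?case using smult d
    by (simp add: E.Tm.smult_assoc1[symmetric] S.m_comm)
next
  case (add v w)
  have cl: "(\<lambda>k. B y (ii (f k)) .[T] ii (e k)) \<in> {..<n} \<rightarrow> carrier T" if "y el T" for y using e that by auto
  have "(\<Oplus>\<^bsub>T\<^esub>k\<in>{..<n}. B (v +[T] w) (ii (f k)) .[T] ii (e k)) =
     (\<Oplus>\<^bsub>T\<^esub>k\<in>{..<n}. B v (ii (f k)) .[T] ii (e k) +[T] B w (ii (f k)) .[T] ii (e k))"
    by (rule E.T.finsum_cong') (use e add in \<open>auto simp: Q.b_add_left E.Tm.smult_l_distr\<close>)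
  then show ?case using add d E.T.finsum_addf[OF cl[OF add(1)] cl[OF add(2)]] by (simp add: E.smultT_add)
qed

lemma dual_pair_T: "[|dual_pair n e f|] ==> Q.dual_pair n (\<lambda>k. ii (e k)) (\<lambda>k. ii (f k))"
  using expansion_T[of \<one> n e f] dual_pairD[of n e f] by (simp add: Q.dual_pair_def hS_simps)

lemma frame_T: "is_frame n e f d ==> Q.is_frame n (\<lambda>k. ii (e k)) (\<lambda>k. ii (f k)) (hS d)"
  using expansion_T[of d n e f] frameD[of n e f d] unfolding Q.is_frame_def by (auto simp: B_ii hS_simps)

sublocale CT: composition_algebra S T QS
proof -
  obtain n e f where "dual_pair n e f" using dual by blast
  note d = dual_pair_T[OF this]
  show "composition_algebra S T QS"
    by (intro composition_algebra.intro composition_algebra_axioms.intro A.unital_nonassoc_algebra_axioms Q.quadratic_space_axioms)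
      (simp_all add: QS_mult E.ii_one QS_facts(3) q_one hS_simps Q.dual_pair_nondegenerate[OF d])
qed

lemma assoc_T: "[|u el C; v el C; w el C|] ==> CT.assoc (ii u) (ii v) (ii w) = ii (assoc u v w)"
  using add_hom_minus[OF C_ag E.T.abelian_group_axioms E.ii_hom]
  by (simp add: CT.assoc_def assoc_def E.ii_mult)

text \<open>Frames and associators are given at primes of \<open>R\<close>; a prime of
  \<open>S\<close> is served by those at its preimage, since scalars outside the preimage are
  carried outside the prime by \<open>hS\<close>.\<close>

lemma prime_pullback:
  assumes P: "primeideal P S"
  shows "primeideal {r \<in> carrier R. hS r \<in> P} R"
proof -
  interpret P: primeideal P S by fact
  note z = additive_subgroup.zero_closed[OF P.additive_subgroup_axioms]
    and a = additive_subgroup.a_closed[OF P.additive_subgroup_axioms]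
    and i = additive_subgroup.a_inv_closed[OF P.additive_subgroup_axioms]
  have one: "\<one>[S] \<notin> P" using P.I_notcarr P.one_imp_carrier by auto
  have hm: "hS (\<ominus> r) = -[S] hS r" if "r el R" for r
    using hS_simps(5)[of \<zero> r] that hS_simps(4) by (simp add: a_minus_def)
  show ?thesis
  proof (rule primeidealI)
    show "ideal {r \<in> carrier R. hS r \<in> P} R"
    proof (rule idealI)
      show "subgroup {r \<in> carrier R. hS r \<in> P} (add_monoid R)"
        by (rule subgroup.intro) (use z a i hm in \<open>auto simp: hS_simps a_inv_def[symmetric]\<close>)
    qed (auto simp: hS_simps R.ring_axioms intro: P.I_l_closed P.I_r_closed)
    show "carrier R \<noteq> {r \<in> carrier R. hS r \<in> P}" using one hS_simps(3) R.one_closed by (metis (mono_tags, lifting) mem_Collect_eq)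
    show "a \<in> {r \<in> carrier R. hS r \<in> P} \<or> c \<in> {r \<in> carrier R. hS r \<in> P}"
      if "a el R" "c el R" "a \<otimes> c \<in> {r \<in> carrier R. hS r \<in> P}" for a c
      using that P.I_prime[of "hS a" "hS c"] by (auto simp: hS_simps)
  qed (rule R.cring_axioms)
qed

sublocale OT: octonionic S T QS
proof (intro octonionic.intro octonionic_axioms.intro CT.composition_algebra_axioms)
  show "\<exists>n e f. Q.dual_pair n e f" using dual dual_pair_T by blast
  fix P assume P: "primeideal P S"
  obtain n e f d u v w where fr: "is_frame n e f d" "d \<notin> {r \<in> carrier R. hS r \<in> P}"
    and c: "u el C" "v el C" "w el C" "q (assoc u v w) \<notin> {r \<in> carrier R. hS r \<in> P}"
    using local_data[OF prime_pullback[OF P]] by blast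
  have "hS d \<notin> P" using fr frameD(1)[OF fr(1)] by auto
  moreover have "QS (CT.assoc (ii u) (ii v) (ii w)) \<notin> P" using c by (auto simp: assoc_T QS_facts(3))
  ultimately show "\<exists>n e f d u v w. Q.is_frame n e f d \<and> d \<notin> P \<and> u el T \<and> v el T \<and> w el T \<and> QS (CT.assoc u v w) \<notin> P"
    using frame_T[OF fr(1)] c by blast
qed

end

section \<open>The free associative algebra: monomials, universal property, reversal of
  words\<close>

section \<open>Free algebras\<close>

locale free_algebra = cring R for R :: "('r, 'z) ring_scheme" (structure) + fixes V :: "'x set"
begin

abbreviation "A \<equiv> free_alg R V"

definition mono :: "'x list => 'x list => 'r" where
  "mono v = (\<lambda>w. if w = v then \<one> else \<zero>)"

abbreviation supp :: "('x list => 'r) => 'x list set" where "supp f \<equiv> {w. f w \<noteq> \<zero>}"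

lemma A_mem: "f el A \<longleftrightarrow> (\<forall>w. f w el R) \<and> (\<forall>w. w \<notin> lists V --> f w = \<zero>) \<and> finite (supp f)"
  by (simp add: free_alg_def)

lemma A_ops: "(f +[A] g) w = f w \<oplus> g w" "\<zero>[A] w = \<zero>" "(r .[A] f) w = r \<otimes> f w" "\<one>[A] = mono []"
  "(f *[A] g) w = (\<Oplus>i\<in>{..length w}. f (take i w) \<otimes> g (drop i w))"
  by (simp_all add: free_alg_def mono_def)

lemma gen_mono: "gen R x = mono [x]" by (simp add: gen_def mono_def)

lemma A_val [simp]: "f el A ==> f w el R" by (simp add: A_mem)

lemma A_add_closed: "[|f el A; g el A|] ==> f +[A] g el A"
proof -
  assume a: "f el A" "g el A"
  have "supp (f +[A] g) \<subseteq> supp f \<union> supp g" by (auto simp: A_ops)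
  moreover have "finite (supp f \<union> supp g)" using a by (simp add: A_mem)
  ultimately have "finite (supp (f +[A] g))" by (rule finite_subset)
  then show ?thesis using a by (simp add: A_mem A_ops)
qed

lemma A_smult_closed [simp, intro]: "[|r el R; f el A|] ==> r .[A] f el A"
proof -
  assume a: "r el R" "f el A"
  have "supp (r .[A] f) \<subseteq> supp f" using a by (auto simp: A_ops)
  moreover have "finite (supp f)" using a by (simp add: A_mem)
  ultimately have "finite (supp (r .[A] f))" by (rule finite_subset)
  then show ?thesis using a by (simp add: A_mem A_ops)
qed

lemma A_abelian_group: "abelian_group A"
proof (rule abelian_groupI)
  show "\<zero>[A] el A" by (simp add: A_mem A_ops)
  fix f assume f: "f el A"
  show "\<exists>g\<in>carrier A. g +[A] f = \<zero>[A]"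
    by (rule bexI[of _ "(\<ominus> \<one>) .[A] f"]) (use f in \<open>auto simp: A_ops l_minus l_neg\<close>)
qed (auto simp: A_ops A_add_closed a_ac)

sublocale AA: abelian_group A by (rule A_abelian_group)

lemma mono_closed [simp]: "v \<in> lists V ==> mono v el A"
  by (auto simp: A_mem mono_def)

lemma A_smult_add: "[|r el R; f el A; g el A|] ==> r .[A] (f +[A] g) = r .[A] f +[A] r .[A] g"
  by (rule ext) (simp add: A_ops r_distr)

lemma A_smult_facts:
  "[|r el R; s el R; f el A|] ==> r .[A] (s .[A] f) = (r \<otimes> s) .[A] f"
  "f el A ==> \<one> .[A] f = f" "f el A ==> \<zero> .[A] f = \<zero>[A]"
  "[|r el R; s el R; f el A|] ==> (r \<oplus> s) .[A] f = r .[A] f +[A] s .[A] f"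
  by (rule ext, simp add: A_ops m_assoc l_distr)+

lemma A_induct [consumes 1, case_names mono add]:
  assumes "f el A"
    and mono: "\<And>r v. [|r el R; v \<in> lists V|] ==> P (r .[A] mono v)"
    and add: "\<And>f g. [|f el A; g el A; P f; P g|] ==> P (f +[A] g)"
  shows "P f"
proof -
  have "[|f el A; supp f \<subseteq> W|] ==> P f" if "finite W" for W f
    using that
  proof (induction W arbitrary: f rule: finite_induct)
    case empty
    then have "f = \<zero> .[A] mono []" by (auto simp: A_ops mono_def intro!: ext)
    then show ?case using mono[of \<zero> "[]"] by simp
  next
    case (insert w W)
    let ?f = "\<lambda>v. if v = w then \<zero> else f v"
    have "supp ?f \<subseteq> supp f" by auto
    then have "finite (supp ?f)" by (rule finite_subset) (use insert.prems(1) in \<open>simp add: A_mem\<close>)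
    then have f': "?f el A" using insert.prems(1) by (auto simp: A_mem)
    have "supp ?f \<subseteq> W" using insert.prems(2) by auto
    then have P: "P ?f" using insert.IH f' by blast
    show ?case
    proof (cases "w \<in> lists V")
      case True
      have "f = ?f +[A] f w .[A] mono w" using insert.prems(1) by (auto simp: A_ops mono_def intro!: ext)
      then show ?thesis using add[OF f' _ P mono[of "f w" w]] True insert.prems(1) by auto
    next
      case False
      then have "f w = \<zero>" using insert.prems(1) by (simp add: A_mem)
      then have "f = ?f" by auto
      then show ?thesis using P by simp
    qed
  qed
  then show ?thesis using assms(1) by (auto simp: A_mem)
qed

lemma A_mult_closed:
  assumes f: "f el A" and g: "g el A"
  shows "f *[A] g el A"
proof -
  have z: "(f *[A] g) w = \<zero>" if "\<And>i. i \<le> length w ==> f (take i w) = \<zero> \<or> g (drop i w) = \<zero>" for w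
  proof -
    have "(f *[A] g) w = (\<Oplus>i\<in>{..length w}. \<zero>)"
      unfolding A_ops by (rule finsum_cong') (use that f g in \<open>auto simp del: A_ops dest!: that\<close>)
    then show ?thesis by simp
  qed
  have "supp (f *[A] g) \<subseteq> (\<lambda>(u, v). u @ v) ` (supp f \<times> supp g)"
  proof
    fix w assume "w \<in> supp (f *[A] g)"
    then obtain i where "f (take i w) \<noteq> \<zero>" "g (drop i w) \<noteq> \<zero>" using z by blast
    then show "w \<in> (\<lambda>(u, v). u @ v) ` (supp f \<times> supp g)"
      by (intro image_eqI[of _ _ "(take i w, drop i w)"]) auto
  qed
  moreover have "finite ((\<lambda>(u, v). u @ v) ` (supp f \<times> supp g))" using f g by (simp add: A_mem)
  ultimately have 1: "finite (supp (f *[A] g))" by (rule finite_subset)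
  have 2: "(f *[A] g) w = \<zero>" if w: "w \<notin> lists V" for w
  proof (rule z)
    fix i
    have "take i w \<notin> lists V \<or> drop i w \<notin> lists V"
      using w append_in_lists_conv[of "take i w" "drop i w" V] by simp
    then show "f (take i w) = \<zero> \<or> g (drop i w) = \<zero>" using f g by (auto simp: A_mem)
  qed
  have "(f *[A] g) w el R" for w
    unfolding A_ops by (rule finsum_closed) (use f g in auto)
  with 1 2 show ?thesis by (simp only: A_mem) blast
qed

lemma A_distr_left: "[|f el A; g el A; h el A|] ==> (f +[A] g) *[A] h = f *[A] h +[A] g *[A] h"
  by (rule ext) (simp add: A_ops l_distr finsum_addf Pi_def)

lemma A_distr_right: "[|f el A; g el A; h el A|] ==> h *[A] (f +[A] g) = h *[A] f +[A] h *[A] g"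
  by (rule ext) (simp add: A_ops r_distr finsum_addf Pi_def)

lemma A_smult_left: "[|r el R; f el A; g el A|] ==> (r .[A] f) *[A] g = r .[A] (f *[A] g)"
  by (rule ext) (simp add: A_ops m_assoc finsum_rdistr Pi_def)

lemma A_smult_right: "[|r el R; f el A; g el A|] ==> f *[A] (r .[A] g) = r .[A] (f *[A] g)"
  by (rule ext) (simp add: A_ops m_lcomm finsum_rdistr Pi_def)

lemma mono_mult: "mono v *[A] mono w = mono (v @ w)"
proof (rule ext)
  fix u
  have mc: "mono v z el R" for v z by (simp add: mono_def)
  show "(mono v *[A] mono w) u = mono (v @ w) u"
  proof (cases "u = v @ w")
    case True
    have "(mono v *[A] mono w) u = (\<Oplus>i\<in>{..length u}. if length v = i then \<one> else \<zero>)"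
      unfolding A_ops
    proof (rule finsum_cong')
      fix i assume i: "i \<in> {..length u}"
      show "mono v (take i u) \<otimes> mono w (drop i u) = (if length v = i then \<one> else \<zero>)"
      proof (cases "length v = i")
        case False
        then have "take i u \<noteq> v" using i by auto
        then show ?thesis using False mc by (simp add: mono_def[of v])
      qed (auto simp: True mono_def)
    qed auto
    also have "\<dots> = \<one>" using finsum_singleton[of "length v" "{..length u}" "\<lambda>_. \<one>"] True by simp
    finally show ?thesis by (simp add: mono_def True)
  next
    case False
    have "(mono v *[A] mono w) u = (\<Oplus>i\<in>{..length u}. \<zero>)"
      unfolding A_ops
    proof (rule finsum_cong')
      fix i assume "i \<in> {..length u}"
      show "mono v (take i u) \<otimes> mono w (drop i u) = \<zero>"
        using False append_take_drop_id[of i u] by (auto simp: mono_def)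
    qed auto
    then show ?thesis using False by (simp add: mono_def)
  qed
qed

lemma ring_A: "ring A"
proof (rule ringI[OF A_abelian_group])
  note [simp] = A_mult_closed A_distr_left A_distr_right A_smult_left A_smult_right mono_mult A_add_closed
  show "monoid A"
  proof (rule monoidI)
    fix f assume f: "f el A"
    show "\<one>[A] *[A] f = f" using f by (induction f rule: A_induct) (simp_all add: A_ops(4))
    show "f *[A] \<one>[A] = f" using f by (induction f rule: A_induct) (simp_all add: A_ops(4))
    fix g h assume g: "g el A" and h: "h el A"
    have 1: "(mono u *[A] mono v) *[A] h = mono u *[A] (mono v *[A] h)" if "u \<in> lists V" "v \<in> lists V" for u v
      using h by (induction h rule: A_induct) (use that in simp_all)
    have 2: "(mono u *[A] g) *[A] h = mono u *[A] (g *[A] h)" if "u \<in> lists V" for u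
      using g by (induction g rule: A_induct) (use h that 1 in \<open>simp_all del: mono_mult\<close>)
    show "(f *[A] g) *[A] h = f *[A] (g *[A] h)"
      using f by (induction f rule: A_induct) (use g h 2 in simp_all)
  qed (auto simp: A_ops(4))
qed (auto simp: A_distr_left A_distr_right)

sublocale RA: ring A by (rule ring_A)

text \<open>The target is a ring with a central map \<open>\<rho>\<close> from \<open>R\<close>
  instead of an algebra record over \<open>R\<close>, so that the same statement also yields maps
  into Clifford algebras over another ring of scalars.\<close>

lemma A_lift:
  assumes B: "ring B" and \<rho>: "\<rho> \<in> ring_hom R B" and central: "\<And>r y. [|r el R; y el B|] ==> \<rho> r *[B] y = y *[B] \<rho> r"
    and \<alpha>: "\<And>x. x \<in> V ==> \<alpha> x el B"
  shows "\<exists>H \<in> ring_hom A B. (\<forall>r\<in>carrier R. \<forall>f\<in>carrier A. H (r .[A] f) = \<rho> r *[B] H f) \<and> (\<forall>x\<in>V. H (mono [x]) = \<alpha> x)"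
proof -
  interpret B: ring B by fact
  interpret \<rho>: ring_hom_ring R B \<rho> by (rule ring_hom_ringI2[OF ring_axioms B \<rho>])
  define P where "P w = foldr (\<lambda>x y. \<alpha> x *[B] y) w \<one>[B]" for w
  have P_closed [simp]: "P w el B" if "w \<in> lists V" for w
    using that by (induction w) (auto simp: P_def \<alpha>)
  have P_app: "P (v @ w) = P v *[B] P w" if "v \<in> lists V" "w \<in> lists V" for v w
    using that(1)
  proof (induction v)
    case Nil then show ?case using that P_closed[of w] by (simp add: P_def)
  next
    case (Cons x v)
    then show ?case using P_closed[of v] P_closed[of w] that \<alpha>[of x] by (simp add: P_def B.m_assoc)
  qed
  define H where "H f = (\<Oplus>\<^bsub>B\<^esub>w\<in>supp f. \<rho> (f w) *[B] P w)" for f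
  \<comment> \<open>The supports of \<open>f\<close>, \<open>g\<close> and their sum differ, so the
    defining sum is allowed to run over any finite set of words that contains the support.\<close>
  have HW: "H f = (\<Oplus>\<^bsub>B\<^esub>w\<in>W. \<rho> (f w) *[B] P w)" if "f el A" "finite W" "supp f \<subseteq> W" "W \<subseteq> lists V" for f W
  proof -
    have "P w el B" if "w \<in> W" for w using that \<open>W \<subseteq> lists V\<close> P_closed by blast
    then show ?thesis unfolding H_def by (intro B.add.finprod_mono_neutral_cong_left) (use that in auto)
  qed
  have sl: "supp f \<subseteq> lists V" "finite (supp f)" if "f el A" for f using that by (auto simp: A_mem)
  have H_closed: "H f el B" if "f el A" for f
  proof -
    have "P w el B" if "w \<in> supp f" for w using that sl[OF \<open>f el A\<close>] P_closed by blast
    then show ?thesis unfolding H_def by (intro B.finsum_closed) (use that in auto)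
  qed
  have H_add: "H (f +[A] g) = H f +[B] H g" if f: "f el A" and g: "g el A" for f g
  proof -
    let ?W = "supp f \<union> supp g"
    have W: "finite ?W" "?W \<subseteq> lists V" using sl[OF f] sl[OF g] by auto
    then have Pc: "P w el B" if "w \<in> ?W" for w using that P_closed by blast
    have "H (f +[A] g) = (\<Oplus>\<^bsub>B\<^esub>w\<in>?W. \<rho> ((f +[A] g) w) *[B] P w)"
      by (rule HW) (use W f g in \<open>auto simp: A_ops A_add_closed\<close>)
    also have "\<dots> = (\<Oplus>\<^bsub>B\<^esub>w\<in>?W. \<rho> (f w) *[B] P w +[B] \<rho> (g w) *[B] P w)"
      by (rule B.finsum_cong') (use Pc f g in \<open>auto simp: A_ops B.l_distr\<close>)
    also have "\<dots> = (\<Oplus>\<^bsub>B\<^esub>w\<in>?W. \<rho> (f w) *[B] P w) +[B] (\<Oplus>\<^bsub>B\<^esub>w\<in>?W. \<rho> (g w) *[B] P w)"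
      by (rule B.finsum_addf) (use Pc f g in auto)
    also have "\<dots> = H f +[B] H g" using HW[OF f W(1) _ W(2)] HW[OF g W(1) _ W(2)] by simp
    finally show ?thesis .
  qed
  have H_mono: "H (r .[A] mono v) = \<rho> r *[B] P v" if r: "r el R" and v: "v \<in> lists V" for r v
  proof -
    have "H (r .[A] mono v) = (\<Oplus>\<^bsub>B\<^esub>w\<in>{v}. \<rho> ((r .[A] mono v) w) *[B] P w)"
    proof (rule HW)
      show "r .[A] mono v el A" using r v by simp
    qed (use r v in \<open>auto simp: A_ops mono_def split: if_splits\<close>)
    also have "\<dots> = \<rho> r *[B] P v" using r v by (simp add: A_ops mono_def)
    finally show ?thesis .
  qed
  have H_smult: "H (r .[A] f) = \<rho> r *[B] H f" if r: "r el R" and f: "f el A" for r f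
    using f by (induction f rule: A_induct)
      (use r in \<open>simp_all add: A_smult_facts H_mono B.m_assoc A_smult_add H_add H_closed B.r_distr\<close>)
  have H_mult: "H (f *[A] g) = H f *[B] H g" if f: "f el A" and g: "g el A" for f g
    using f
  proof (induction f rule: A_induct)
    case (mono r v)
    show ?case using g
    proof (induction g rule: A_induct)
      case (mono s w)
      have "H ((r .[A] mono v) *[A] (s .[A] mono w)) = H ((r \<otimes> s) .[A] mono (v @ w))"
        using mono \<open>r el R\<close> \<open>v \<in> lists V\<close> by (simp add: A_smult_left A_smult_right mono_mult A_smult_facts m_comm)
      also have "\<dots> = \<rho> r *[B] (\<rho> s *[B] P v) *[B] P w"
        using mono \<open>r el R\<close> \<open>v \<in> lists V\<close> by (subst H_mono) (auto simp: P_app B.m_assoc)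
      also have "\<dots> = H (r .[A] mono v) *[B] H (s .[A] mono w)"
        using mono \<open>r el R\<close> \<open>v \<in> lists V\<close> central[of s "P v"] by (simp add: H_mono B.m_assoc)
      finally show ?case .
    next
      case (add g h) then show ?case using \<open>r el R\<close> \<open>v \<in> lists V\<close> by (simp add: A_distr_right H_add A_mult_closed B.r_distr H_closed)
    qed
  next
    case (add f h) then show ?case using g by (simp add: A_distr_left H_add A_mult_closed B.l_distr H_closed)
  qed
  have H1: "H (mono v) = P v" if "v \<in> lists V" for v using H_mono[of \<one> v] that by (simp add: A_smult_facts)
  have "H \<in> ring_hom A B"
    by (rule ring_hom_memI) (use H1[of "[]"] in \<open>auto simp: H_closed H_mult H_add A_ops(4) P_def\<close>)
  moreover have "H (mono [x]) = \<alpha> x" if "x \<in> V" for x using H1[of "[x]"] that \<alpha> by (simp add: P_def)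
  ultimately show ?thesis using H_smult by blast
qed

lemma A_rev:
  "f el A ==> f \<circ> rev el A"
  "(f +[A] g) \<circ> rev = (f \<circ> rev) +[A] (g \<circ> rev)"
  "(r .[A] f) \<circ> rev = r .[A] (f \<circ> rev)"
  "mono v \<circ> rev = mono (rev v)"
proof -
  assume f: "f el A"
  have "supp (f \<circ> rev) \<subseteq> rev ` supp f" by (auto intro!: image_eqI[of _ rev "rev _"])
  then have "finite (supp (f \<circ> rev))" using f finite_subset by (auto simp: A_mem)
  then show "f \<circ> rev el A" using f by (auto simp: A_mem in_lists_conv_set)
next
  show "(f +[A] g) \<circ> rev = (f \<circ> rev) +[A] (g \<circ> rev)" "(r .[A] f) \<circ> rev = r .[A] (f \<circ> rev)"
    by (auto simp: A_ops)
  show "mono v \<circ> rev = mono (rev v)" by (auto simp: mono_def rev_swap)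
qed

lemma A_rev_mult:
  assumes f: "f el A" and g: "g el A"
  shows "(f *[A] g) \<circ> rev = (g \<circ> rev) *[A] (f \<circ> rev)"
  using f
proof (induction f rule: A_induct)
  case (mono r v)
  then have vr: "rev v \<in> lists V" by (auto simp: in_lists_conv_set)
  show ?case using g
  proof (induction g rule: A_induct)
    case (mono s w)
    then have "rev w \<in> lists V" by (auto simp: in_lists_conv_set)
    then show ?case using mono vr \<open>r el R\<close> \<open>v \<in> lists V\<close>
      by (simp add: A_smult_left A_smult_right mono_mult A_rev A_smult_facts m_comm)
  next
    case (add g h)
    have "r .[A] mono v el A" "r .[A] mono (rev v) el A" using mono vr by simp_all
    then show ?case using add f by (simp only: A_distr_right A_distr_left A_rev mono)
  qed
next
  case (add f h) then show ?case using g by (simp only: A_distr_right A_distr_left A_rev)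
qed

end

text \<open>Moves the ring axioms between records that share their ring operations but differ in the
  remaining fields, as a quotient ring and the algebra built on it do.\<close>

lemma ring_cong:
  assumes "ring A" "carrier B = carrier A" "monoid.mult B = monoid.mult A" "one B = one A" "ring.zero B = ring.zero A" "ring.add B = ring.add A"
  shows "ring B"
proof -
  interpret A: ring A by fact
  show ?thesis
  proof (rule ringI)
    show "abelian_group B"
      by (rule abelian_groupI) (use assms A.add.inv_closed A.l_neg in \<open>auto simp: A.a_ac\<close>)
    show "monoid B" by (rule monoidI) (simp_all add: assms A.m_assoc)
  qed (simp_all add: assms A.l_distr A.r_distr)
qed

section \<open>Clifford algebras as quotients: universal property, main involution, parity\<close>

section \<open>Clifford algebras\<close>

context quadratic_space begin

sublocale F: free_algebra R "carrier C" ..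

abbreviation "FA \<equiv> free_alg R (carrier C)"
abbreviation "CI \<equiv> Cl_ideal R C q"
abbreviation "cc \<equiv> Cl_class R C q"
abbreviation "CL \<equiv> Cl R C q"
abbreviation "inc \<equiv> Cl_incl R C q"
definition "rho r = r .[CL] \<one>[CL]"

lemma gen_closed [simp]: "x el C ==> gen R x el FA"
  by (simp add: F.gen_mono)

lemma Cl_relations_closed: "Cl_relations R C q \<subseteq> carrier FA"
  unfolding Cl_relations_def Let_def
  using F.RA.m_closed F.RA.one_closed by (auto intro!: F.AA.minus_closed)

lemma CI_ideal: "ideal CI FA"
  unfolding Cl_ideal_def by (rule F.RA.genideal_ideal[OF Cl_relations_closed])

sublocale CI: ideal CI FA by (rule CI_ideal)

lemma CL_ops: "carrier CL = carrier (FA Quot CI)" "monoid.mult CL = monoid.mult (FA Quot CI)" "one CL = one (FA Quot CI)"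
  "ring.zero CL = ring.zero (FA Quot CI)" "ring.add CL = ring.add (FA Quot CI)"
  "smult CL = (\<lambda>r A. cc (r .[FA] rep A))"
  by (simp_all add: Cl_def ring.defs module.defs)

lemma ring_CL: "ring CL"
  by (rule ring_cong[OF CI.quotient_is_ring]) (simp_all add: CL_ops)

sublocale CL: ring CL by (rule ring_CL)

lemma cc_hom: "cc \<in> ring_hom FA CL"
  using CI.rcos_ring_hom by (auto simp: ring_hom_def CL_ops Cl_class_def[abs_def])

lemma cc_simps:
  "f el FA ==> cc f el CL"
  "[|f el FA; g el FA|] ==> cc (f +[FA] g) = cc f +[CL] cc g"
  "[|f el FA; g el FA|] ==> cc (f *[FA] g) = cc f *[CL] cc g"
  "cc \<one>[FA] = \<one>[CL]"
  using cc_hom by (auto simp: ring_hom_def)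

lemma cc_add_hom: "cc \<in> add_hom FA CL" by (rule add_homI) (simp_all add: cc_simps)

lemma CL_cases: assumes "z el CL" obtains f where "f el FA" "z = cc f"
  using assms by (auto simp: CL_ops FactRing_def A_RCOSETS_def' Cl_class_def)

lemma cc_eq: "[|f el FA; g el FA|] ==> cc f = cc g \<longleftrightarrow> f -[FA] g \<in> CI"
proof -
  assume c: "f el FA" "g el FA"
  have "cc f = cc g \<longleftrightarrow> f \<in> cc g"
    unfolding Cl_class_def using CI.a_repr_independence'[of f g] CI.a_rcos_self[of f] c by (metis)
  also have "\<dots> \<longleftrightarrow> f -[FA] g \<in> CI"
    unfolding Cl_class_def using CI.a_rcos_module_minus[OF F.RA.ring_axioms, of g f] c by simp
  finally show ?thesis .
qed

lemma smult_cc: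
  assumes "r el R" "f el FA"
  shows "r .[CL] cc f = cc (r .[FA] f)"
proof -
  have "f \<in> cc f" unfolding Cl_class_def by (rule CI.a_rcos_self[OF assms(2)])
  then have r: "rep (cc f) \<in> cc f" unfolding rep_def by (rule someI[of "\<lambda>a. a \<in> cc f"])
  have rc: "rep (cc f) el FA" using r assms(2) CI.a_elemrcos_carrier unfolding Cl_class_def by blast
  have "rep (cc f) -[FA] f \<in> CI" using r rc assms CI.a_rcos_module_minus[OF F.RA.ring_axioms, of f "rep (cc f)"]
    unfolding Cl_class_def by simp
  then have "(r .[FA] \<one>[FA]) *[FA] (rep (cc f) -[FA] f) \<in> CI" using assms by (intro CI.I_l_closed) auto
  also have "(r .[FA] \<one>[FA]) *[FA] (rep (cc f) -[FA] f) = r .[FA] rep (cc f) -[FA] r .[FA] f"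
    using assms rc by (simp add: a_minus_def F.RA.r_distr F.RA.r_minus F.A_smult_left)
  finally show ?thesis using cc_eq assms rc by (simp add: CL_ops(6))
qed

lemma rho_cc: "r el R ==> rho r = cc (r .[FA] \<one>[FA])"
  by (simp add: rho_def cc_simps(4)[symmetric] smult_cc)

lemma rho_closed [simp, intro]: "r el R ==> rho r el CL"
  by (simp add: rho_cc cc_simps)

lemma inc_closed [simp, intro]: "x el C ==> inc x el CL"
  by (simp add: Cl_incl_def cc_simps)

lemma smult_rho: "[|r el R; z el CL|] ==> r .[CL] z = rho r *[CL] z"
  by (elim CL_cases) (simp add: rho_cc smult_cc cc_simps(3)[symmetric] F.A_smult_left)

lemma rho_central: "[|r el R; z el CL|] ==> rho r *[CL] z = z *[CL] rho r"
  by (elim CL_cases) (simp add: rho_cc cc_simps(3)[symmetric] F.A_smult_left F.A_smult_right)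

lemma rho_hom: "rho \<in> ring_hom R CL"
  by (rule ring_hom_memI)
    (simp_all add: rho_cc cc_simps(2,3)[symmetric] F.A_smult_facts F.A_smult_left F.A_smult_right R.m_comm, simp_all add: cc_simps)

lemma relation_CI: "a \<in> Cl_relations R C q ==> a \<in> CI"
  unfolding Cl_ideal_def using F.RA.genideal_self[OF Cl_relations_closed] by blast

lemma inc_add: "[|x el C; y el C|] ==> inc (x \<^bold>+ y) = inc x +[CL] inc y"
proof -
  assume c: "x el C" "y el C"
  have "gen R (x \<^bold>+ y) -[FA] gen R x -[FA] gen R y \<in> CI"
    by (rule relation_CI) (use c in \<open>auto simp: Cl_relations_def Let_def\<close>)
  then have "gen R (x \<^bold>+ y) -[FA] (gen R x +[FA] gen R y) \<in> CI"
    using c by (simp add: a_minus_def F.AA.minus_add F.AA.a_assoc)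
  then show ?thesis using c by (simp add: Cl_incl_def cc_eq cc_simps(2)[symmetric] del: F.AA.minus_closed)
qed

lemma inc_smult: "[|r el R; x el C|] ==> inc (r \<bullet> x) = rho r *[CL] inc x"
proof -
  assume c: "r el R" "x el C"
  have "gen R (r \<bullet> x) -[FA] (r .[FA] gen R x) \<in> CI"
    by (rule relation_CI) (use c in \<open>auto simp: Cl_relations_def Let_def\<close>)
  then show ?thesis using c by (simp add: smult_rho[symmetric]) (simp add: Cl_incl_def cc_eq smult_cc)
qed

lemma inc_sq: "x el C ==> inc x *[CL] inc x = rho (q x)"
proof -
  assume c: "x el C"
  have "(gen R x *[FA] gen R x) -[FA] (q x .[FA] \<one>[FA]) \<in> CI"
    by (rule relation_CI) (use c in \<open>auto simp: Cl_relations_def Let_def\<close>)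
  then show ?thesis using c by (simp add: Cl_incl_def rho_cc cc_simps(3)[symmetric] cc_eq)
qed

text \<open>Words grow by prepending a letter, so left multiplication by vectors, starting from
  scalars, reaches all monomials.\<close>

lemma CL_induct [consumes 1, case_names scalar vector add]:
  assumes "z el CL"
    and scalar: "\<And>r. r el R ==> P (rho r)"
    and vector: "\<And>x z. [|x el C; z el CL; P z|] ==> P (inc x *[CL] z)"
    and add: "\<And>z w. [|z el CL; w el CL; P z; P w|] ==> P (z +[CL] w)"
  shows "P z"
proof -
  obtain f where f: "f el FA" "z = cc f" using assms(1) by (rule CL_cases)
  have "P (cc f)" using f(1)
  proof (induction f rule: F.A_induct)
    case (mono r v)
    from mono(2) show ?case
    proof (induction v)
      case Nil then show ?case using scalar[of r] mono(1) by (simp add: rho_cc F.A_ops(4))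
    next
      case (Cons x v)
      have "r .[FA] F.mono (x # v) = gen R x *[FA] (r .[FA] F.mono v)"
        using Cons mono(1) by (simp add: F.gen_mono F.A_smult_right F.mono_mult)
      then show ?case using vector[of x "cc (r .[FA] F.mono v)"] Cons mono(1) by (simp add: cc_simps Cl_incl_def)
    qed
  next
    case (add f g) then show ?case using assms(4)[of "cc f" "cc g"] by (simp add: cc_simps)
  qed
  then show ?thesis using f by simp
qed

lemma CL_universal:
  assumes B: "ring B" and \<rho>: "\<rho> \<in> ring_hom R B" and central: "\<And>r y. [|r el R; y el B|] ==> \<rho> r *[B] y = y *[B] \<rho> r"
    and \<alpha>: "\<And>x. x el C ==> \<alpha> x el B"
      "\<And>x y. [|x el C; y el C|] ==> \<alpha> (x \<^bold>+ y) = \<alpha> x +[B] \<alpha> y"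
      "\<And>r x. [|r el R; x el C|] ==> \<alpha> (r \<bullet> x) = \<rho> r *[B] \<alpha> x"
      "\<And>x. x el C ==> \<alpha> x *[B] \<alpha> x = \<rho> (q x)"
  shows "\<exists>g \<in> ring_hom CL B. (\<forall>r\<in>carrier R. g (rho r) = \<rho> r) \<and> (\<forall>x\<in>carrier C. g (inc x) = \<alpha> x)"
proof -
  interpret B: ring B by fact
  obtain H where H0: "H \<in> ring_hom FA B" and H1: "(\<forall>r\<in>carrier R. \<forall>f\<in>carrier FA. H (r .[FA] f) = \<rho> r *[B] H f) \<and>
    (\<forall>x\<in>carrier C. H (F.mono [x]) = \<alpha> x)"
    using F.A_lift[OF B \<rho> central \<alpha>(1)] by (rule bexE)
  note H = H0 conjunct1[OF H1, rule_format] conjunct2[OF H1, rule_format, folded F.gen_mono]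
  interpret H: ring_hom_ring FA B H by (rule ring_hom_ringI2[OF F.RA.ring_axioms B H(1)])
  have \<rho>c: "\<rho> r el B" if "r el R" for r using \<rho> that by (auto simp: ring_hom_def)
  have Hm: "H (f -[FA] g) = H f -[B] H g" if "f el FA" "g el FA" for f g
    using that by (simp add: a_minus_def)
  have "Cl_relations R C q \<subseteq> a_kernel FA B H"
  proof
    fix a assume a: "a \<in> Cl_relations R C q"
    then have "H a = \<zero>[B]"
      unfolding Cl_relations_def Let_def
    proof (elim UnE CollectE exE conjE)
      fix x y assume "a = gen R (x \<^bold>+ y) -[FA] gen R x -[FA] gen R y" "x el C" "y el C"
      then show ?thesis using \<alpha> by (simp add: Hm H B.add_minus_minus_cancel)
    next
      fix r x assume "a = gen R (r \<bullet> x) -[FA] (r .[FA] gen R x)" "r el R" "x el C"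
      then show ?thesis using \<alpha> \<rho>c by (simp add: Hm H B.minus_self)
    next
      fix x assume "a = gen R x *[FA] gen R x -[FA] q x .[FA] \<one>[FA]" "x el C"
      then show ?thesis using \<alpha> \<rho>c by (simp add: Hm H B.minus_self)
    qed
    then show "a \<in> a_kernel FA B H" using subsetD[OF Cl_relations_closed a] unfolding a_kernel_def' by (intro CollectI conjI)
  qed
  then have sub: "CI \<subseteq> a_kernel FA B H"
    unfolding Cl_ideal_def by (rule F.RA.genideal_minimal[OF H.kernel_is_ideal])
  have HI: "H f = \<zero>[B]" if "f \<in> CI" for f using subsetD[OF sub that] unfolding a_kernel_def' by (simp only: mem_Collect_eq)
  define g where "g z = H (SOME f. f el FA \<and> z = cc f)" for z
  have g: "g (cc f) = H f" if f: "f el FA" for f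
  proof -
    let ?f = "SOME f'. f' el FA \<and> cc f = cc f'"
    have "?f el FA \<and> cc f = cc ?f" by (rule someI[of _ f]) (use f in simp)
    then have "H (?f -[FA] f) = \<zero>[B]" "?f el FA" using cc_eq[of ?f f] HI f by auto
    then have "H ?f -[B] H f = \<zero>[B]" using Hm f by simp
    then have "H ?f = H f" by (rule B.minus_eq_zeroD) (use f \<open>?f el FA\<close> in auto)
    then show ?thesis by (simp add: g_def)
  qed
  have "g \<in> ring_hom CL B"
  proof (rule ring_hom_memI)
    fix z assume "z el CL"
    then obtain f where f: "f el FA" "z = cc f" by (rule CL_cases)
    then show "g z el B" by (simp add: g)
    fix w assume "w el CL"
    then obtain f' where f': "f' el FA" "w = cc f'" by (rule CL_cases)
    show "g (z *[CL] w) = g z *[B] g w" using f f' by (simp add: cc_simps(3)[symmetric] g)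
    show "g (z +[CL] w) = g z +[B] g w" using f f' by (simp add: cc_simps(2)[symmetric] g)
  qed (simp add: cc_simps(4)[symmetric] g)
  moreover have "g (rho r) = \<rho> r" if "r el R" for r using that \<rho>c by (simp add: rho_cc g H)
  moreover have "g (inc x) = \<alpha> x" if "x el C" for x using that by (simp add: Cl_incl_def g H)
  ultimately show ?thesis by blast
qed

lemma CL_hom_eq:
  assumes g: "g \<in> ring_hom CL B" and h: "h \<in> ring_hom CL B"
    and rho: "\<And>r. r el R ==> g (rho r) = h (rho r)" and inc: "\<And>x. x el C ==> g (inc x) = h (inc x)"
    and z: "z el CL"
  shows "g z = h z"
  using z
proof (induction z rule: CL_induct)
  case (vector x z) then show ?case using ring_hom_mult[OF g] ring_hom_mult[OF h] inc by simp
next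
  case (add z w) then show ?case using ring_hom_add[OF g] ring_hom_add[OF h] by simp
qed (rule rho)

text \<open>The elements whose reversal lies in the ideal form an ideal again, because reversal is
  an antiautomorphism, and each generating relation is a combination of palindromic words.\<close>

lemma rev_CI: "f \<in> CI ==> f \<circ> rev \<in> CI"
proof -
  have CIc: "f \<in> CI ==> f el FA" for f using CI.a_subset by blast
  let ?J = "{f \<in> carrier FA. f \<circ> rev \<in> CI}"
  have neg: "(-[FA] f) \<circ> rev = -[FA] (f \<circ> rev)" if "f el FA" for f
    using add_hom_neg[OF F.AA.abelian_group_axioms F.AA.abelian_group_axioms, of "\<lambda>f. f \<circ> rev" f] that
    by (simp add: add_homI F.A_rev)
  have "ideal ?J FA"
  proof (rule idealI)
    show "ring FA" by (rule F.ring_A)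
    have "\<zero>[FA] \<circ> rev = \<zero>[FA]" by (auto simp: F.A_ops)
    then show "subgroup ?J (add_monoid FA)"
      by (intro subgroup.intro) (auto simp: F.A_rev neg a_inv_def[symmetric] CI.additive_subgroup_axioms additive_subgroup.zero_closed
        additive_subgroup.a_closed additive_subgroup.a_inv_closed)
  qed (auto simp: F.A_rev_mult F.A_rev intro: CI.I_l_closed CI.I_r_closed)
  moreover have "Cl_relations R C q \<subseteq> ?J"
  proof
    fix a assume a: "a \<in> Cl_relations R C q"
    have m: "(f -[FA] g) \<circ> rev = (f \<circ> rev) -[FA] (g \<circ> rev)" if "f el FA" "g el FA" for f g
      using that by (simp add: a_minus_def F.A_rev neg)
    have "a \<circ> rev = a" using a
      unfolding Cl_relations_def Let_def
      by (auto simp: m F.A_rev F.A_rev_mult F.gen_mono F.RA.m_closed F.A_ops(4) simp del: comp_apply)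
    then show "a \<in> ?J" using a Cl_relations_closed relation_CI by auto
  qed
  ultimately have "CI \<subseteq> ?J" unfolding Cl_ideal_def by (rule F.RA.genideal_minimal)
  then show "f \<in> CI ==> f \<circ> rev \<in> CI" by blast
qed

lemma Cl_inv_cc: "f el FA ==> Cl_inv (cc f) = cc (f \<circ> rev)"
proof -
  assume f: "f el FA"
  have rr: "(g \<circ> rev) \<circ> rev = g" for g :: "'c list => 'r" by auto
  have sub: "g \<circ> rev \<in> cc (h \<circ> rev)" if "g \<in> cc h" "h el FA" for g h
  proof -
    have "\<exists>a\<in>CI. g = a +[FA] h"
      using that(1) unfolding Cl_class_def a_r_coset_def' UN_iff singleton_iff .
    then obtain a where a: "a \<in> CI" "g = a +[FA] h" by (rule bexE)
    then show ?thesis unfolding Cl_class_def a_r_coset_def' using rev_CI[OF a(1)] by (auto simp: F.A_rev)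
  qed
  show ?thesis
  proof (rule subset_antisym)
    show "Cl_inv (cc f) \<subseteq> cc (f \<circ> rev)" unfolding Cl_inv_def using sub[OF _ f] by blast
    show "cc (f \<circ> rev) \<subseteq> Cl_inv (cc f)"
    proof
      fix g assume "g \<in> cc (f \<circ> rev)"
      from sub[OF this F.A_rev(1)[OF f]] have "g \<circ> rev \<in> cc f" by (simp only: rr)
      then show "g \<in> Cl_inv (cc f)" unfolding Cl_inv_def by (rule image_eqI[rotated]) (simp only: rr)
    qed
  qed
qed

lemma Cl_inv_simps:
  "z el CL ==> Cl_inv z el CL"
  "[|z el CL; w el CL|] ==> Cl_inv (z +[CL] w) = Cl_inv z +[CL] Cl_inv w"
  "[|z el CL; w el CL|] ==> Cl_inv (z *[CL] w) = Cl_inv w *[CL] Cl_inv z"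
  "r el R ==> Cl_inv (rho r) = rho r"
  "x el C ==> Cl_inv (inc x) = inc x"
proof -
  show "z el CL ==> Cl_inv z el CL" by (elim CL_cases) (simp add: Cl_inv_cc cc_simps F.A_rev)
  show "[|z el CL; w el CL|] ==> Cl_inv (z +[CL] w) = Cl_inv z +[CL] Cl_inv w"
    by (elim CL_cases) (simp add: Cl_inv_cc cc_simps(2)[symmetric] F.A_rev)
  show "[|z el CL; w el CL|] ==> Cl_inv (z *[CL] w) = Cl_inv w *[CL] Cl_inv z"
    by (elim CL_cases) (simp add: Cl_inv_cc cc_simps(3)[symmetric] F.A_rev F.A_rev_mult F.RA.m_closed)
  show "r el R ==> Cl_inv (rho r) = rho r"
    by (simp add: rho_cc Cl_inv_cc F.A_rev F.A_ops(4))
  show "x el C ==> Cl_inv (inc x) = inc x"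
    by (simp add: Cl_incl_def Cl_inv_cc F.A_rev F.gen_mono)
qed

text \<open>The two parts together exhaust the algebra; no directness of the sum is asserted at this
  stage, and parity is later recognized through the faithful representation
  \<open>alp\<close>.\<close>

definition "cl_even = {cc f | f. f el FA \<and> (\<forall>w. odd (length w) --> f w = \<zero>)}"
definition "cl_odd = {cc f | f. f el FA \<and> (\<forall>w. even (length w) --> f w = \<zero>)}"

lemma Cl_even_eq: "Cl_even R C q = CL\<lparr>carrier := cl_even\<rparr>"
  by (simp add: Cl_even_def cl_even_def)

lemma even_odd_decomposition:
  assumes "z el CL"
  shows "\<exists>u\<in>cl_even. \<exists>v\<in>cl_odd. z = u +[CL] v"
proof -
  obtain f where f: "f el FA" "z = cc f" using assms by (rule CL_cases)
  let ?f = "\<lambda>w. if even (length w) then f w else \<zero>" and ?g = "\<lambda>w. if even (length w) then \<zero> else f w"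
  have "finite (F.supp f)" using f(1) by (simp add: F.A_mem)
  then have fin: "finite (F.supp ?f)" "finite (F.supp ?g)" by (auto elim!: rev_finite_subset)
  have fg: "?f el FA" "?g el FA" using f(1) fin by (auto simp: F.A_mem)
  have "f = ?f +[FA] ?g" using f(1) by (auto simp: F.A_ops)
  then have "cc f = cc (?f +[FA] ?g)" by (rule arg_cong)
  then have "z = cc ?f +[CL] cc ?g" unfolding f(2) cc_simps(2)[OF fg] .
  moreover have "cc ?f \<in> cl_even" "cc ?g \<in> cl_odd" using fg unfolding cl_even_def cl_odd_def by auto
  ultimately show ?thesis by blast
qed

text \<open>Left multiplication by a vector exchanges the parities, so both predicates are proved
  simultaneously. A general element is split into its even and odd words, either of which may be
  absent, whence the assumptions on zero.\<close>

lemma cl_parity_induct: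
  assumes scalar: "\<And>r. r el R ==> P0 (rho r)"
    and z0: "P0 \<zero>[CL]" and z1: "P1 \<zero>[CL]"
    and v0: "\<And>x z. [|x el C; z el CL; P0 z|] ==> P1 (inc x *[CL] z)"
    and v1: "\<And>x z. [|x el C; z el CL; P1 z|] ==> P0 (inc x *[CL] z)"
    and a0: "\<And>z w. [|z el CL; w el CL; P0 z; P0 w|] ==> P0 (z +[CL] w)"
    and a1: "\<And>z w. [|z el CL; w el CL; P1 z; P1 w|] ==> P1 (z +[CL] w)"
  shows "z \<in> cl_even ==> P0 z" "z \<in> cl_odd ==> P1 z"
proof -
  let ?e = "\<lambda>f w. if even (length w) then f w else \<zero>" and ?o = "\<lambda>f w. if even (length w) then \<zero> else f w"
  have c0: "cc \<zero>[FA] = \<zero>[CL]" using add_hom_zero[OF F.AA.abelian_group_axioms CL.abelian_group_axioms cc_add_hom] .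
  have eo_closed: "?e f el FA" "?o f el FA" if "f el FA" for f
  proof -
    have "finite (F.supp f)" using that by (simp add: F.A_mem)
    then have "finite (F.supp (?e f))" "finite (F.supp (?o f))" by (auto elim!: rev_finite_subset)
    then show "?e f el FA" "?o f el FA" using that by (auto simp: F.A_mem)
  qed
  have m: "(even (length v) --> P0 (cc (r .[FA] F.mono v))) \<and> (odd (length v) --> P1 (cc (r .[FA] F.mono v)))"
    if "r el R" "v \<in> lists (carrier C)" for r v
    using that(2)
  proof (induction v)
    case Nil then show ?case using scalar[of r] that(1) by (simp add: rho_cc F.A_ops(4))
  next
    case (Cons x v)
    have "r .[FA] F.mono (x # v) = gen R x *[FA] (r .[FA] F.mono v)"
      using Cons that(1) by (simp add: F.gen_mono F.A_smult_right F.mono_mult)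
    then show ?case using v0[of x "cc (r .[FA] F.mono v)"] v1[of x "cc (r .[FA] F.mono v)"] Cons that(1)
      by (auto simp add: cc_simps Cl_incl_def)
  qed
  have main: "P0 (cc (?e f)) \<and> P1 (cc (?o f))" if "f el FA" for f
    using that
  proof (induction f rule: F.A_induct)
    case (mono r v)
    show ?case
    proof (cases "even (length v)")
      case True
      then have "?e (r .[FA] F.mono v) = r .[FA] F.mono v" "?o (r .[FA] F.mono v) = \<zero>[FA]"
        using mono by (auto simp: F.A_ops F.mono_def)
      then show ?thesis using m[OF mono] True z1 c0 by simp
    next
      case False
      then have "?o (r .[FA] F.mono v) = r .[FA] F.mono v" "?e (r .[FA] F.mono v) = \<zero>[FA]"
        using mono by (auto simp: F.A_ops F.mono_def)
      then show ?thesis using m[OF mono] False z0 c0 by simp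
    qed
  next
    case (add f g)
    have "?e (f +[FA] g) = ?e f +[FA] ?e g" "?o (f +[FA] g) = ?o f +[FA] ?o g"
      by (auto simp: F.A_ops)
    then show ?case using add eo_closed[of f] eo_closed[of g] a0 a1 by (simp add: cc_simps)
  qed
  show "z \<in> cl_even ==> P0 z"
  proof -
    assume "z \<in> cl_even"
    then obtain f where f: "f el FA" "z = cc f" "\<forall>w. odd (length w) --> f w = \<zero>" unfolding cl_even_def by blast
    then have "?e f = f" by auto
    then show ?thesis using main[OF f(1)] f(2) by simp
  qed
  show "z \<in> cl_odd ==> P1 z"
  proof -
    assume "z \<in> cl_odd"
    then obtain f where f: "f el FA" "z = cc f" "\<forall>w. even (length w) --> f w = \<zero>" unfolding cl_odd_def by blast
    then have "?o f = f" by auto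
    then show ?thesis using main[OF f(1)] f(2) by simp
  qed
qed

end

section \<open>Contractions in a ring with a Clifford map\<close>

section \<open>Representations of the Clifford algebra\<close>

text \<open>What the Clifford algebra and the endomorphism ring of two copies of \<open>C\<close>
  share: the Clifford relation and an involution \<open>\<Gamma>\<close> that changes the sign of
  vectors. The contraction argument is carried out once and used for both.\<close>

locale clifford_rep = quadratic_space R C q + BR: ring B
  for R :: "('r, 'z) ring_scheme" (structure) and C :: "('r, 'c) module" (structure) and q :: "'c => 'r"
    and B :: "('b, 'y) ring_scheme" +
  fixes \<rho> :: "'r => 'b" and \<alpha> :: "'c => 'b" and \<Gamma> :: "'b => 'b"
  assumes \<rho>_hom: "\<rho> \<in> ring_hom R B"
    and \<rho>_central: "[|r el R; z el B|] ==> \<rho> r *[B] z = z *[B] \<rho> r"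
    and \<alpha>_closed [simp, intro]: "x el C ==> \<alpha> x el B"
    and \<alpha>_add: "[|x el C; y el C|] ==> \<alpha> (x \<^bold>+ y) = \<alpha> x +[B] \<alpha> y"
    and \<alpha>_smult: "[|r el R; x el C|] ==> \<alpha> (r \<bullet> x) = \<rho> r *[B] \<alpha> x"
    and \<alpha>_sq: "x el C ==> \<alpha> x *[B] \<alpha> x = \<rho> (q x)"
    and \<Gamma>_hom: "\<Gamma> \<in> ring_hom B B"
    and \<Gamma>_\<Gamma>: "z el B ==> \<Gamma> (\<Gamma> z) = z"
    and \<Gamma>_\<rho>: "r el R ==> \<Gamma> (\<rho> r) = \<rho> r"
    and \<Gamma>_\<alpha>: "x el C ==> \<Gamma> (\<alpha> x) = -[B] \<alpha> x"
begin

abbreviation mult_B (infixl \<open>\<otimes>B\<close> 70) where "x \<otimes>B y \<equiv> x *[B] y"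
abbreviation add_B (infixl \<open>\<oplus>B\<close> 65) where "x \<oplus>B y \<equiv> x +[B] y"
abbreviation minus_B (infixl \<open>\<ominus>B\<close> 65) where "x \<ominus>B y \<equiv> x -[B] y"

lemma \<rho>_facts [simp]:
  "r el R ==> \<rho> r el B" "\<rho> \<one> = \<one>[B]" "\<rho> \<zero> = \<zero>[B]"
  "[|r el R; s el R|] ==> \<rho> (r \<otimes> s) = \<rho> r \<otimes>B \<rho> s"
  "[|r el R; s el R|] ==> \<rho> (r \<oplus> s) = \<rho> r \<oplus>B \<rho> s"
proof -
  interpret h: ring_hom_ring R B \<rho> by (rule ring_hom_ringI2[OF R.ring_axioms BR.ring_axioms \<rho>_hom])
  show "r el R ==> \<rho> r el B" "\<rho> \<one> = \<one>[B]" "\<rho> \<zero> = \<zero>[B]"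
    "[|r el R; s el R|] ==> \<rho> (r \<otimes> s) = \<rho> r \<otimes>B \<rho> s"
    "[|r el R; s el R|] ==> \<rho> (r \<oplus> s) = \<rho> r \<oplus>B \<rho> s" by simp_all
qed

lemma \<Gamma>_facts:
  "z el B ==> \<Gamma> z el B"
  "[|z el B; w el B|] ==> \<Gamma> (z \<otimes>B w) = \<Gamma> z \<otimes>B \<Gamma> w"
  "[|z el B; w el B|] ==> \<Gamma> (z \<oplus>B w) = \<Gamma> z \<oplus>B \<Gamma> w"
  "z el B ==> \<Gamma> (-[B] z) = -[B] \<Gamma> z"
proof -
  interpret h: ring_hom_ring B B \<Gamma> by (rule ring_hom_ringI2[OF BR.ring_axioms BR.ring_axioms \<Gamma>_hom])
  show "z el B ==> \<Gamma> z el B"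
    "[|z el B; w el B|] ==> \<Gamma> (z \<otimes>B w) = \<Gamma> z \<otimes>B \<Gamma> w"
    "[|z el B; w el B|] ==> \<Gamma> (z \<oplus>B w) = \<Gamma> z \<oplus>B \<Gamma> w"
    "z el B ==> \<Gamma> (-[B] z) = -[B] \<Gamma> z" by simp_all
qed

lemma \<rho>_assoc: "[|r el R; y el B; z el B|] ==> y \<otimes>B (\<rho> r \<otimes>B z) = \<rho> r \<otimes>B (y \<otimes>B z)"
  using \<rho>_central[of r y] by (simp add: BR.m_assoc[symmetric])

lemma anticomm:
  assumes "x el C" "y el C"
  shows "\<alpha> y \<otimes>B \<alpha> x = \<rho> (b x y) \<ominus>B \<alpha> x \<otimes>B \<alpha> y"
proof -
  have "\<rho> (q x) \<oplus>B \<rho> (q y) \<oplus>B \<rho> (b x y) = (\<alpha> x \<oplus>B \<alpha> y) \<otimes>B (\<alpha> x \<oplus>B \<alpha> y)"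
    using \<alpha>_sq[of "x \<^bold>+ y"] assms by (simp add: \<alpha>_add q_add)
  also have "\<dots> = \<rho> (q x) \<oplus>B \<rho> (q y) \<oplus>B (\<alpha> x \<otimes>B \<alpha> y \<oplus>B \<alpha> y \<otimes>B \<alpha> x)"
    using assms by (simp add: BR.l_distr BR.r_distr \<alpha>_sq BR.a_ac)
  finally have "\<rho> (b x y) = \<alpha> x \<otimes>B \<alpha> y \<oplus>B \<alpha> y \<otimes>B \<alpha> x"
    using assms by (simp add: BR.a_assoc)
  then have "\<alpha> y \<otimes>B \<alpha> x \<oplus>B \<alpha> x \<otimes>B \<alpha> y = \<rho> (b x y)" using assms by (simp add: BR.a_comm)
  then show ?thesis by (rule BR.add_solve) (use assms in auto)
qed

text \<open>Contraction by the functional \<open>b y\<close>: the twisted commutator with \<open>\<alpha> y\<close>.\<close>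

definition d where "d y z = \<alpha> y \<otimes>B z \<ominus>B \<Gamma> z \<otimes>B \<alpha> y"

lemma d_closed [simp, intro]: "[|y el C; z el B|] ==> d y z el B"
  by (simp add: d_def \<Gamma>_facts)

lemma d_add: "[|y el C; z el B; w el B|] ==> d y (z \<oplus>B w) = d y z \<oplus>B d y w"
proof -
  assume c: "y el C" "z el B" "w el B"
  have "a \<otimes>B (z \<oplus>B w) \<ominus>B (z' \<oplus>B w') \<otimes>B a = (a \<otimes>B z \<ominus>B z' \<otimes>B a) \<oplus>B (a \<otimes>B w \<ominus>B w' \<otimes>B a)"
    if "a el B" "z' el B" "w' el B" for a z' w'
    using that c by algebra
  then show ?thesis using c by (simp add: d_def \<Gamma>_facts)
qed

lemma d_add_left: "[|y el C; x el C; z el B|] ==> d (x \<^bold>+ y) z = d x z \<oplus>B d y z"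
proof -
  assume c: "y el C" "x el C" "z el B"
  have "(a \<oplus>B a') \<otimes>B z \<ominus>B z' \<otimes>B (a \<oplus>B a') = (a \<otimes>B z \<ominus>B z' \<otimes>B a) \<oplus>B (a' \<otimes>B z \<ominus>B z' \<otimes>B a')"
    if "a el B" "z' el B" "a' el B" for a z' a'
    using that c by algebra
  then show ?thesis using c by (simp add: d_def \<Gamma>_facts \<alpha>_add)
qed

lemma d_smult_left: "[|r el R; x el C; z el B|] ==> d (r \<bullet> x) z = \<rho> r \<otimes>B d x z"
  by (simp add: d_def \<alpha>_smult \<Gamma>_facts \<rho>_assoc BR.m_assoc BR.r_distr BR.minus_eq BR.r_minus)

lemma d_smult: "[|r el R; x el C; z el B|] ==> d x (\<rho> r \<otimes>B z) = \<rho> r \<otimes>B d x z"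
  by (simp add: d_def \<Gamma>_facts \<Gamma>_\<rho> \<rho>_assoc BR.m_assoc BR.r_distr BR.minus_eq BR.r_minus)

lemma d_zero: "y el C ==> d y \<zero>[B] = \<zero>[B]"
  using d_smult[of \<zero> y "\<zero>[B]"] by simp

lemma d_hom: "z el B ==> (\<lambda>y. d y z) \<in> add_hom C B"
  by (rule add_homI) (auto simp: d_add_left)

lemma d_rho: "[|r el R; y el C|] ==> d y (\<rho> r) = \<zero>[B]"
  by (simp add: d_def \<Gamma>_\<rho> \<rho>_central[of r "\<alpha> y"] BR.minus_self)

text \<open>The twisted Leibniz rule: the anticommutator of the two vectors gives the scalar term,
  and the sign of \<open>\<Gamma>\<close> on \<open>\<alpha> x\<close> lets the remaining terms form
  \<open>d y z\<close>.\<close>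

lemma d_\<alpha>:
  assumes "x el C" "y el C" "z el B"
  shows "d y (\<alpha> x \<otimes>B z) = \<rho> (b x y) \<otimes>B z \<ominus>B \<alpha> x \<otimes>B d y z"
proof -
  have "d y (\<alpha> x \<otimes>B z) = (\<alpha> y \<otimes>B \<alpha> x) \<otimes>B z \<ominus>B (-[B] \<alpha> x \<otimes>B \<Gamma> z) \<otimes>B \<alpha> y"
    using assms by (simp add: d_def \<Gamma>_facts \<Gamma>_\<alpha> BR.m_assoc)
  also have "\<dots> = (\<rho> (b x y) \<ominus>B \<alpha> x \<otimes>B \<alpha> y) \<otimes>B z \<ominus>B (-[B] \<alpha> x \<otimes>B \<Gamma> z) \<otimes>B \<alpha> y"
    by (simp only: anticomm[OF assms(1,2)])
  also have "\<dots> = \<rho> (b x y) \<otimes>B z \<ominus>B \<alpha> x \<otimes>B d y z"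
  proof -
    have 1: "(r \<ominus>B a) \<otimes>B z \<ominus>B -[B] w = r \<otimes>B z \<ominus>B (a \<otimes>B z \<ominus>B w)"
      if "r el B" "a el B" "w el B" for r a w
      using that assms(3) by (simp add: BR.minus_eq BR.l_distr BR.l_minus BR.minus_add BR.a_ac)
    have 2: "a \<otimes>B (u \<ominus>B v) = a \<otimes>B u \<ominus>B a \<otimes>B v"
      if "a el B" "u el B" "v el B" for a u v
      using that by (simp add: BR.minus_eq BR.r_distr BR.r_minus)
    have "(\<rho> (b x y) \<ominus>B \<alpha> x \<otimes>B \<alpha> y) \<otimes>B z \<ominus>B (-[B] \<alpha> x \<otimes>B \<Gamma> z) \<otimes>B \<alpha> y =
      \<rho> (b x y) \<otimes>B z \<ominus>B \<alpha> x \<otimes>B (\<alpha> y \<otimes>B z \<ominus>B \<Gamma> z \<otimes>B \<alpha> y)"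
      using assms by (simp add: 2 \<Gamma>_facts BR.m_assoc BR.l_minus 1)
    then show ?thesis using assms by (simp add: d_def \<Gamma>_facts)
  qed
  finally show ?thesis .
qed

text \<open>The mixed terms cancel because \<open>\<Gamma>\<close> is an involution that negates
  vectors; what remains is the commutator with the central square of
  \<open>\<alpha> y\<close>.\<close>

lemma d_d: "[|y el C; z el B|] ==> d y (d y z) = \<zero>[B]"
proof -
  assume c: "y el C" "z el B"
  have "d y (d y z) = \<alpha> y \<otimes>B (\<alpha> y \<otimes>B z \<ominus>B \<Gamma> z \<otimes>B \<alpha> y) \<ominus>B (-[B] \<alpha> y \<otimes>B \<Gamma> z \<oplus>B z \<otimes>B \<alpha> y) \<otimes>B \<alpha> y"
    using c by (simp add: d_def \<Gamma>_facts \<Gamma>_\<alpha> \<Gamma>_\<Gamma> BR.minus_eq BR.r_minus)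
  also have "\<dots> = (\<alpha> y \<otimes>B \<alpha> y) \<otimes>B z \<ominus>B z \<otimes>B (\<alpha> y \<otimes>B \<alpha> y)"
  proof -
    have "a \<otimes>B (a \<otimes>B z \<ominus>B z' \<otimes>B a) \<ominus>B (-[B] a \<otimes>B z' \<oplus>B z \<otimes>B a) \<otimes>B a = (a \<otimes>B a) \<otimes>B z \<ominus>B z \<otimes>B (a \<otimes>B a)"
      if "a el B" "z' el B" for a z'
      using that c(2) by algebra
    then show ?thesis using c by (simp add: \<Gamma>_facts)
  qed
  also have "\<dots> = \<zero>[B]" using c by (simp add: \<alpha>_sq \<rho>_central[of "q y" z] BR.minus_self)
  finally show ?thesis .
qed

lemma d_anticomm:
  assumes "x el C" "y el C" "z el B"
  shows "d x (d y z) = -[B] d y (d x z)"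
proof -
  have "d x (d y z) \<oplus>B d y (d x z) = \<zero>[B]"
    using d_d[of "x \<^bold>+ y" z] assms by (simp add: d_add_left d_add d_d BR.a_comm)
  then show ?thesis using assms by (simp add: BR.minus_equality)
qed

end

definition (in clifford_rep) subspace where
  "subspace N \<longleftrightarrow> N \<subseteq> carrier B \<and> \<zero>[B] \<in> N \<and> (\<forall>z\<in>N. \<forall>w\<in>N. z \<oplus>B w \<in> N) \<and> (\<forall>r\<in>carrier R. \<forall>z\<in>N. \<rho> r \<otimes>B z \<in> N)"

text \<open>Stands for the preimage of the localization of \<open>N\<close> at \<open>p\<close>,
  expressed without forming it.\<close>

definition (in clifford_rep) locally_in :: "'r set => 'b set => 'b set" where
  "locally_in p N = {z \<in> carrier B. \<exists>r\<in>carrier R. r \<notin> p \<and> \<rho> r \<otimes>B z \<in> N}"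

context clifford_rep begin

text \<open>The scalars carrying \<open>z\<close> into \<open>N\<close> satisfy the closure
  conditions of \<open>one_memI\<close>.\<close>

lemma local_global:
  assumes N: "subspace N" and z: "z el B" and loc: "\<And>p. primeideal p R ==> z \<in> locally_in p N"
  shows "z \<in> N"
proof -
  have "\<one> \<in> {r \<in> carrier R. \<rho> r \<otimes>B z \<in> N}"
  proof (rule R.one_memI)
    fix p assume "primeideal p R"
    from loc[OF this] show "\<exists>d\<in>{r \<in> carrier R. \<rho> r \<otimes>B z \<in> N}. d \<notin> p" unfolding locally_in_def by blast
  qed (use N z in \<open>auto simp: subspace_def BR.l_distr BR.m_assoc\<close>)
  then show ?thesis using z by simp
qed

lemma locally_in_closed:
  assumes N: "subspace N" and p: "primeideal p R"
  shows "N \<subseteq> locally_in p N"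
    "[|z \<in> locally_in p N; w \<in> locally_in p N|] ==> z \<oplus>B w \<in> locally_in p N"
    "[|r el R; r \<notin> p; z el B; \<rho> r \<otimes>B z \<in> locally_in p N|] ==> z \<in> locally_in p N"
    "[|x el C; \<And>z. z \<in> N ==> \<alpha> x \<otimes>B z \<in> N; z \<in> locally_in p N|] ==> \<alpha> x \<otimes>B z \<in> locally_in p N"
    "[|r el R; z \<in> locally_in p N|] ==> \<rho> r \<otimes>B z \<in> locally_in p N"
proof -
  interpret p: primeideal p R by fact
  have N': "N \<subseteq> carrier B" "\<And>z w. [|z \<in> N; w \<in> N|] ==> z \<oplus>B w \<in> N" "\<And>r z. [|r el R; z \<in> N|] ==> \<rho> r \<otimes>B z \<in> N"
    using N unfolding subspace_def by blast+
  have one_p: "\<one> \<notin> p" using p.I_notcarr p.one_imp_carrier by blast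
  show "N \<subseteq> locally_in p N"
  proof
    fix z assume z: "z \<in> N"
    then have "z el B" "\<rho> \<one> \<otimes>B z \<in> N" using N' by auto
    then show "z \<in> locally_in p N" unfolding locally_in_def using one_p by blast
  qed
  have prod: "r \<otimes> s \<notin> p" if "r el R" "s el R" "r \<notin> p" "s \<notin> p" for r s
    using p.I_prime[of r s] that by blast
  show "z \<oplus>B w \<in> locally_in p N" if zw: "z \<in> locally_in p N" "w \<in> locally_in p N"
  proof -
    obtain r where r: "z el B" "r el R" "r \<notin> p" "\<rho> r \<otimes>B z \<in> N" using zw(1) unfolding locally_in_def by blast
    obtain s where s: "w el B" "s el R" "s \<notin> p" "\<rho> s \<otimes>B w \<in> N" using zw(2) unfolding locally_in_def by blast
    have "\<rho> (r \<otimes> s) \<otimes>B (z \<oplus>B w) = \<rho> s \<otimes>B (\<rho> r \<otimes>B z) \<oplus>B \<rho> r \<otimes>B (\<rho> s \<otimes>B w)"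
      using r(1,2) s(1,2) \<rho>_assoc[of s "\<rho> r" z] by (simp add: BR.r_distr BR.m_assoc)
    also have "\<dots> \<in> N" using r s N' by blast
    finally show ?thesis unfolding locally_in_def using r s prod[of r s] by blast
  qed
  show "z \<in> locally_in p N" if z: "r el R" "r \<notin> p" "z el B" "\<rho> r \<otimes>B z \<in> locally_in p N"
  proof -
    obtain s where s: "s el R" "s \<notin> p" "\<rho> s \<otimes>B (\<rho> r \<otimes>B z) \<in> N" using z(4) unfolding locally_in_def by blast
    then have "\<rho> (s \<otimes> r) \<otimes>B z \<in> N" using z by (simp add: BR.m_assoc)
    then show ?thesis unfolding locally_in_def using z s prod[of s r] by blast
  qed
  show "\<alpha> x \<otimes>B z \<in> locally_in p N" if x: "x el C" "\<And>z. z \<in> N ==> \<alpha> x \<otimes>B z \<in> N" "z \<in> locally_in p N"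
  proof -
    obtain r where r: "z el B" "r el R" "r \<notin> p" "\<rho> r \<otimes>B z \<in> N" using x(3) unfolding locally_in_def by blast
    then have "\<rho> r \<otimes>B (\<alpha> x \<otimes>B z) \<in> N" using x(1) x(2)[OF r(4)] by (simp add: \<rho>_assoc)
    then show ?thesis unfolding locally_in_def using r x(1) by blast
  qed
  show "\<rho> s \<otimes>B z \<in> locally_in p N" if x: "s el R" "z \<in> locally_in p N" for s
  proof -
    obtain r where r: "z el B" "r el R" "r \<notin> p" "\<rho> r \<otimes>B z \<in> N" using x(2) unfolding locally_in_def by blast
    then have "\<rho> r \<otimes>B (\<rho> s \<otimes>B z) \<in> N" using x(1) N'(3)[OF x(1) r(4)] \<rho>_assoc[of r "\<rho> s" z] by simp
    then show ?thesis unfolding locally_in_def using r x(1) by (intro CollectI conjI bexI[of _ r]) auto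
  qed
qed

text \<open>The homotopy \<open>\<delta> = d\<^sub>i e\<^sub>i + e\<^sub>i d\<^sub>i\<close> reduces membership to the elements killed by all contractions.\<close>

lemma contraction_induct:
  fixes n :: nat
  assumes p: "primeideal p R" and fr: "is_frame n e f \<delta>" and \<delta>: "\<delta> \<notin> p" and N: "subspace N"
    and N_mult: "\<And>x z. [|x el C; z \<in> N|] ==> \<alpha> x \<otimes>B z \<in> N"
    and M: "M \<subseteq> carrier B" "\<And>x z. [|x el C; z \<in> M|] ==> \<alpha> x \<otimes>B z \<in> M" "\<And>x z. [|x el C; z \<in> M|] ==> d x z \<in> M"
    and base: "\<And>z. [|z \<in> M; \<And>i. i < n ==> d (f i) z = \<zero>[B]|] ==> z \<in> locally_in p N"
    and z: "z \<in> M"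
  shows "z \<in> locally_in p N"
proof -
  note c = frameD(1-3)[OF fr] and bef = frameD(4)[OF fr]
  \<comment> \<open>The induction runs over elements killed by the contractions with index at least
    \<open>k\<close>: for \<open>k = 0\<close> they are those of \<open>base\<close>, and for
    \<open>k = n\<close> the condition is empty.\<close>
  have "\<forall>z\<in>M. (\<forall>i. k \<le> i --> i < n --> d (f i) z = \<zero>[B]) --> z \<in> locally_in p N" if "k \<le> n" for k
    using that
  proof (induction k)
    case 0 then show ?case using base by blast
  next
    case (Suc k)
    show ?case
    proof (intro ballI impI)
      fix z assume z: "z \<in> M" and dz: "\<forall>i. Suc k \<le> i --> i < n --> d (f i) z = \<zero>[B]"
      have k: "e k el C" "f k el C" using c Suc.prems by auto
      have zB: "z el B" using z M(1) by blast
      \<comment> \<open>\<open>U\<close> and \<open>V\<close> are killed by one contraction more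
        than \<open>z\<close>, because contractions square to zero and anticommute; the Leibniz rule
        recovers \<open>\<delta>\<close> times \<open>z\<close> as \<open>U\<close> plus a vector
        times \<open>V\<close>.\<close>
      define U where "U = d (f k) (\<alpha> (e k) \<otimes>B z)"
      define V where "V = d (f k) z"
      have UV: "U \<in> M" "V \<in> M" unfolding U_def V_def using M(2,3) z k by blast+
      have "d (f i) U = \<zero>[B] \<and> d (f i) V = \<zero>[B]" if i: "k \<le> i" "i < n" for i
      proof (cases "i = k")
        case True then show ?thesis using d_d k zB by (simp add: U_def V_def)
      next
        case False
        then have "d (f i) z = \<zero>[B]" "f i el C" "b (e k) (f i) = \<zero>" using dz i c bef[of k i] by auto
        moreover from this have "d (f i) (\<alpha> (e k) \<otimes>B z) = \<zero>[B]" using k zB by (simp add: d_\<alpha> BR.minus_eq)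
        ultimately show ?thesis unfolding U_def V_def using k zB
          d_anticomm[of "f i" "f k" z] d_anticomm[of "f i" "f k" "\<alpha> (e k) \<otimes>B z"] by (simp add: d_zero)
      qed
      then have UV': "U \<in> locally_in p N" "V \<in> locally_in p N" using Suc UV by auto
      have "U = \<rho> \<delta> \<otimes>B z \<ominus>B \<alpha> (e k) \<otimes>B V"
        using k zB bef[of k k] Suc.prems by (simp add: U_def V_def d_\<alpha>)
      then have "\<rho> \<delta> \<otimes>B z = U \<oplus>B \<alpha> (e k) \<otimes>B V"
        using k zB c(1) M(1) UV by (simp add: BR.minus_eq BR.a_assoc BR.l_neg subset_iff)
      moreover have "\<alpha> (e k) \<otimes>B V \<in> locally_in p N"
        by (rule locally_in_closed(4)[OF N p k(1) N_mult[OF k(1)] UV'(2)])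
      ultimately have "\<rho> \<delta> \<otimes>B z \<in> locally_in p N" using locally_in_closed(2)[OF N p UV'(1)] by simp
      then show "z \<in> locally_in p N" by (rule locally_in_closed(3)[OF N p c(1) \<delta> zB])
    qed
  qed
  from this[of n] show ?thesis using z by auto
qed

text \<open>The vectors \<open>f i\<close> span only up to \<open>\<delta>\<close>: nondegeneracy
  yields an expansion of \<open>\<delta> \<bullet> x\<close> in the \<open>f i\<close>, dual to the
  one required of a frame. Contraction is linear in its vector as well as in its argument, so the
  factor \<open>\<delta>\<close> can be moved to \<open>z\<close>.\<close>

lemma d_all_zero:
  fixes n :: nat
  assumes fr: "is_frame n e f \<delta>" and nd: "\<And>x. [|x el C; \<And>y. y el C ==> b x y = \<zero>|] ==> x = \<zero>[C]"
    and z: "z el B" "\<And>i. i < n ==> d (f i) z = \<zero>[B]" and x: "x el C"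
  shows "d x (\<rho> \<delta> \<otimes>B z) = \<zero>[B]"
proof -
  note c = frameD(1-3)[OF fr]
  let ?s = "\<Oplus>\<^bsub>C\<^esub>i\<in>{..<n}. b x (e i) \<bullet> f i"
  have s: "?s el C" by (rule M.finsum_closed) (use x c in auto)
  have "\<delta> \<bullet> x \<^bold>- ?s = \<zero>[C]"
  proof (rule nd)
    fix y assume y: "y el C"
    have "b x (\<Oplus>\<^bsub>C\<^esub>i\<in>{..<n}. b y (f i) \<bullet> e i) = (\<Oplus>i\<in>{..<n}. b x (b y (f i) \<bullet> e i))"
      by (rule add_hom_finsum[OF C_ag R_ag b_add_hom(1)[OF x]]) (use y c in auto)
    also have "\<dots> = (\<Oplus>i\<in>{..<n}. b (b x (e i) \<bullet> f i) y)"
      by (rule R.finsum_cong') (use x y c in \<open>auto simp: b_smult_left b_smult_right b_sym[of y] R.m_comm\<close>)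
    also have "\<dots> = b ?s y"
      by (rule add_hom_finsum[OF C_ag R_ag b_add_hom(2)[OF y], symmetric]) (use x c in auto)
    finally have "\<delta> \<otimes> b x y = b ?s y"
      unfolding frameD(5)[OF fr y, symmetric] using x y c(1) by (simp add: b_smult_right)
    then show "b (\<delta> \<bullet> x \<^bold>- ?s) y = \<zero>" using x y c(1) s by (simp add: b_minus b_smult_left R.minus_self)
  qed (use x c s in auto)
  then have "\<delta> \<bullet> x = ?s" by (rule M.minus_eq_zeroD) (use x c s in auto)
  then have "\<rho> \<delta> \<otimes>B d x z = d ?s z" using d_smult_left[OF c(1) x z(1)] by simp
  also have "\<dots> = (\<Oplus>\<^bsub>B\<^esub>i\<in>{..<n}. d (b x (e i) \<bullet> f i) z)"
    by (rule add_hom_finsum[OF C_ag BR.abelian_group_axioms d_hom[OF z(1)]]) (use x c in auto)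
  also have "\<dots> = (\<Oplus>\<^bsub>B\<^esub>i\<in>{..<n}. \<zero>[B])"
    by (rule BR.finsum_cong') (use x c z in \<open>auto simp: d_smult_left\<close>)
  finally show ?thesis using d_smult[OF c(1) x z(1)] by simp
qed

end

section \<open>Endomorphism rings\<close>

context rmodule begin

abbreviation "EM \<equiv> End_alg R M"
definition "hom_scalar r = r .[EM] \<one>[EM]"

lemma End_ops [simp]:
  "x el M ==> (f *[EM] g) x = f (g x)" "x el M ==> \<one>[EM] x = x"
  "x el M ==> \<zero>[EM] x = \<zero>[M]" "x el M ==> (f +[EM] g) x = f x +[M] g x"
  "x el M ==> (r .[EM] f) x = r .[M] f x" "x el M ==> hom_scalar r x = r .[M] x"
  by (simp_all add: End_alg_def compose_def hom_scalar_def)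

lemma End_carrier: "carrier EM = lin_hom R M M" by (simp add: End_alg_def)

lemma End_apply:
  assumes "f el EM"
  shows "x el M ==> f x el M"
    "[|x el M; y el M|] ==> f (x +[M] y) = f x +[M] f y"
    "[|r el R; x el M|] ==> f (r .[M] x) = r .[M] f x"
  using lin_homD(1-3)[OF assms[unfolded End_carrier]] by simp_all

lemma End_eqI: "[|f el EM; g el EM; \<And>x. x el M ==> f x = g x|] ==> f = g"
  unfolding End_carrier by (rule lin_hom_eqI)

lemma End_closed:
  "[|f el EM; g el EM|] ==> f *[EM] g el EM" "\<one>[EM] el EM" "\<zero>[EM] el EM"
  "[|f el EM; g el EM|] ==> f +[EM] g el EM"
  "[|r el R; f el EM|] ==> r .[EM] f el EM"
proof -
  have ex: "f *[EM] g \<in> extensional (carrier M)" "\<one>[EM] \<in> extensional (carrier M)" "\<zero>[EM] \<in> extensional (carrier M)"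
    "f +[EM] g \<in> extensional (carrier M)" "r .[EM] f \<in> extensional (carrier M)" for f g r
    by (simp_all add: End_alg_def compose_def)
  show "[|f el EM; g el EM|] ==> f *[EM] g el EM" "\<one>[EM] el EM" "\<zero>[EM] el EM"
    "[|f el EM; g el EM|] ==> f +[EM] g el EM"
    "[|r el R; f el EM|] ==> r .[EM] f el EM"
    by (simp only: End_carrier, rule lin_homI, rule ex, simp_all add: End_carrier[symmetric] End_apply smult_r_distr smult_assoc1[symmetric] R.m_comm M.a_ac)+
qed

lemma ring_End: "ring EM"
proof (rule ringI)
  show "abelian_group EM"
  proof (rule abelian_groupI)
    fix f assume f: "f el EM"
    show "\<exists>g\<in>carrier EM. g +[EM] f = \<zero>[EM]"
      by (rule bexI[of _ "(\<ominus> \<one>) .[EM] f"], rule End_eqI)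
        (use f in \<open>simp_all add: End_closed End_apply smult_l_minus M.l_neg\<close>)
  qed (auto intro!: End_eqI simp: End_closed End_apply M.a_ac)
  show "monoid EM" by (rule monoidI) (auto intro!: End_eqI simp: End_closed End_apply)
qed (auto intro!: End_eqI simp: End_closed End_apply)

sublocale EM: ring EM by (rule ring_End)

lemma hom_scalar_closed [simp, intro]: "r el R ==> hom_scalar r el EM"
  by (simp add: hom_scalar_def End_closed)

lemma hom_scalar_hom: "hom_scalar \<in> ring_hom R EM"
  by (rule ring_hom_memI) (auto intro!: End_eqI simp: End_closed smult_assoc1 smult_l_distr)

lemma hom_scalar_central: "[|r el R; f el EM|] ==> hom_scalar r *[EM] f = f *[EM] hom_scalar r"
  by (rule End_eqI) (simp_all add: End_closed End_apply)

lemma smult_hom_scalar: "[|r el R; f el EM|] ==> r .[EM] f = hom_scalar r *[EM] f"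
  by (rule End_eqI) (simp_all add: End_closed End_apply)

end

lemma (in rmodule) direct_sum_module: "module R (direct_sum M M)"
proof (rule module.intro[OF R.cring_axioms])
  show "abelian_group (direct_sum M M)"
  proof (rule abelian_groupI)
    fix x assume "x el (direct_sum M M)"
    then show "\<exists>y\<in>carrier (direct_sum M M). y +[direct_sum M M] x = \<zero>[direct_sum M M]"
      by (intro bexI[of _ "(-[M] fst x, -[M] snd x)"]) (auto simp: direct_sum_def M.l_neg)
  qed (auto simp: direct_sum_def M.a_ac)
  show "module_axioms R (direct_sum M M)"
    by unfold_locales (auto simp: direct_sum_def smult_l_distr smult_r_distr smult_assoc1)
qed

lemma (in abelian_monoid) finsum_mem:
  assumes "finite I" "f \<in> I \<rightarrow> carrier G" "\<zero> \<in> N" "\<And>x y. [|x \<in> N; y \<in> N|] ==> x \<oplus> y \<in> N" "\<And>i. i \<in> I ==> f i \<in> N"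
  shows "finsum G f I \<in> N"
  using assms(1,2,5) by (induction I rule: finite_induct) (auto simp: assms(3,4))

section \<open>Ordered monomials in the vectors of a frame\<close>

section \<open>Normal forms in the Clifford algebra\<close>

context clifford_rep begin

text \<open>Combinations of products of the first \<open>j\<close> vectors, each used at most once
  and larger indices further left.\<close>

fun span :: "(nat => 'c) => nat => 'b set" where
  "span e 0 = \<rho> ` carrier R"
| "span e (Suc j) = (\<lambda>(z, w). z \<oplus>B \<alpha> (e j) \<otimes>B w) ` (span e j \<times> span e j)"

lemma span_subspace:
  assumes "\<forall>i<n. e i el C" "j \<le> n"
  shows "subspace (span e j)"
  using assms(2)
proof (induction j)
  case 0
  have "\<exists>t\<in>carrier R. \<rho> r \<oplus>B \<rho> s = \<rho> t" "\<exists>t\<in>carrier R. \<rho> r \<otimes>B \<rho> s = \<rho> t" if "r el R" "s el R" for r s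
    using that \<rho>_facts(4,5)[of r s] R.a_closed[of r s] R.m_closed[of r s] by metis+
  moreover have "\<zero>[B] = \<rho> \<zero>" by simp
  ultimately show ?case unfolding subspace_def by (auto simp del: \<rho>_facts(3-5) simp: image_iff)
next
  case (Suc j)
  then have N: "\<And>z. z \<in> span e j ==> z el B" "\<zero>[B] \<in> span e j" "\<And>z w. [|z \<in> span e j; w \<in> span e j|] ==> z \<oplus>B w \<in> span e j"
    "\<And>r z. [|r el R; z \<in> span e j|] ==> \<rho> r \<otimes>B z \<in> span e j"
    unfolding subspace_def by auto
  have e: "e j el C" using assms(1) Suc.prems by simp
  show ?case
    unfolding subspace_def
  proof (intro conjI ballI)
    show "span e (Suc j) \<subseteq> carrier B" using N(1) e by auto
    show "\<zero>[B] \<in> span e (Suc j)" using N(2) e by (auto intro!: image_eqI[of _ _ "(\<zero>[B], \<zero>[B])"])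
  next
    fix z z' assume "z \<in> span e (Suc j)" "z' \<in> span e (Suc j)"
    then obtain a w a' w' where a: "a \<in> span e j" "w \<in> span e j" "a' \<in> span e j" "w' \<in> span e j"
      "z = a \<oplus>B \<alpha> (e j) \<otimes>B w" "z' = a' \<oplus>B \<alpha> (e j) \<otimes>B w'" by auto
    have "z \<oplus>B z' = (a \<oplus>B a') \<oplus>B \<alpha> (e j) \<otimes>B (w \<oplus>B w')"
      using a N(1) e by (simp add: BR.r_distr BR.a_ac)
    then show "z \<oplus>B z' \<in> span e (Suc j)" using a N(3) by auto
  next
    fix r z assume r: "r el R" and "z \<in> span e (Suc j)"
    then obtain a w where a: "a \<in> span e j" "w \<in> span e j" "z = a \<oplus>B \<alpha> (e j) \<otimes>B w" by auto
    have "\<rho> r \<otimes>B z = \<rho> r \<otimes>B a \<oplus>B \<alpha> (e j) \<otimes>B (\<rho> r \<otimes>B w)"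
      using a N(1) e r by (simp add: BR.r_distr \<rho>_assoc)
    then show "\<rho> r \<otimes>B z \<in> span e (Suc j)" using a N(4)[OF r] by auto
  qed
qed

lemma span_facts:
  assumes e: "\<forall>i<n. e i el C" "j \<le> n"
  shows "z \<in> span e j ==> z el B" "\<zero>[B] \<in> span e j" "[|z \<in> span e j; w \<in> span e j|] ==> z \<oplus>B w \<in> span e j"
    "[|r el R; z \<in> span e j|] ==> \<rho> r \<otimes>B z \<in> span e j"
  using span_subspace[OF e] unfolding subspace_def by auto

lemma span_mult:
  assumes e: "\<forall>i<n. e i el C"
  shows "[|j \<le> n; i < j; z \<in> span e j|] ==> \<alpha> (e i) \<otimes>B z \<in> span e j"
proof (induction j arbitrary: z)
  case (Suc j)
  have j: "j \<le> n" using Suc.prems by simp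
  note N = span_facts[OF e j]
  have ec: "e i el C" "e j el C" "j \<le> n" using e Suc.prems by auto
  obtain a w where a: "a \<in> span e j" "w \<in> span e j" "z = a \<oplus>B \<alpha> (e j) \<otimes>B w" using Suc.prems by auto
  have aB: "a el B" "w el B" using a N(1) by blast+
  show ?case
  proof (cases "i = j")
    case True
    then have "\<alpha> (e i) \<otimes>B z = \<rho> (q (e j)) \<otimes>B w \<oplus>B \<alpha> (e j) \<otimes>B a"
      using a(3) aB ec by (simp add: BR.r_distr BR.m_assoc[symmetric] \<alpha>_sq BR.a_comm)
    then show ?thesis using a N(4) ec by auto
  next
    case False
    then have i: "i < j" using Suc.prems by simp
    have "\<alpha> (e i) \<otimes>B z = \<alpha> (e i) \<otimes>B a \<oplus>B (\<alpha> (e i) \<otimes>B \<alpha> (e j)) \<otimes>B w"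
      using a(3) aB ec by (simp add: BR.r_distr BR.m_assoc)
    \<comment> \<open>The sign is written as the scalar \<open>\<rho> (\<ominus> \<one>)\<close>,
      because \<open>span\<close> is known to be closed under scalars.\<close>
    also have "\<dots> = (\<alpha> (e i) \<otimes>B a \<oplus>B \<rho> (b (e j) (e i)) \<otimes>B w) \<oplus>B \<alpha> (e j) \<otimes>B (\<rho> (\<ominus> \<one>) \<otimes>B (\<alpha> (e i) \<otimes>B w))"
    proof -
      have "\<rho> (\<ominus> \<one>) \<oplus>B \<one>[B] = \<zero>[B]" using \<rho>_facts(5)[of "\<ominus> \<one>" \<one>] by (simp add: R.l_neg del: \<rho>_facts(5))
      then have "\<rho> (\<ominus> \<one>) = -[B] \<one>[B]" by (simp add: BR.minus_equality)
      then show ?thesis using aB ec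
        by (simp add: anticomm[of "e j" "e i"] BR.minus_eq BR.l_distr BR.l_minus BR.r_minus BR.m_assoc BR.a_assoc)
    qed
    finally show ?thesis using a N(3,4) Suc.IH[OF j i] ec by auto
  qed
qed simp

lemma span_mono:
  assumes e: "\<forall>i<n. e i el C" and z: "z \<in> \<rho> ` carrier R"
  shows "j \<le> n ==> z \<in> span e j"
proof (induction j)
  case 0 then show ?case using z by simp
next
  case (Suc j)
  then have "z \<in> span e j" "z el B" "\<zero>[B] \<in> span e j" "e j el C" using span_facts[OF e, of j] e by auto
  then show ?case by (auto intro!: image_eqI[of _ _ "(z, \<zero>[B])"])
qed

lemma d_span:
  assumes e: "\<forall>i<n. e i el C" and y: "y el C"
  shows "[|j \<le> n; \<forall>i<j. b (e i) y = \<zero>; z \<in> span e j|] ==> d y z = \<zero>[B]"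
proof (induction j arbitrary: z)
  case 0 then show ?case using y by (auto simp: d_rho)
next
  case (Suc j)
  obtain a w where a: "a \<in> span e j" "w \<in> span e j" "z = a \<oplus>B \<alpha> (e j) \<otimes>B w" using Suc.prems by auto
  have c: "a el B" "w el B" "e j el C" "d y a = \<zero>[B]" "d y w = \<zero>[B]" "b (e j) y = \<zero>"
    using a Suc e span_facts(1)[OF e, of j] by auto
  then show ?case using y by (simp add: a(3) d_add d_\<alpha> BR.minus_eq)
qed

text \<open>Contraction by \<open>f j\<close> isolates the coefficient of the last vector
  \<open>e j\<close> and shows that \<open>\<delta>\<close> kills it; up to \<open>\<delta>\<close>
  the element already lies in the smaller span.\<close>

lemma span_scalar:
  fixes n :: nat
  assumes p: "primeideal p R" and fr: "is_frame n e f \<delta>" and \<delta>: "\<delta> \<notin> p"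
  shows "[|j \<le> n; z \<in> span e j; \<forall>i<n. d (f i) z = \<zero>[B]|] ==> z \<in> locally_in p (\<rho> ` carrier R)"
proof (induction j arbitrary: z)
  note c = frameD(1-3)[OF fr]
  have ce: "\<forall>i<n. e i el C" using c(2) by blast
  note N0 = span_subspace[OF ce, of 0, simplified]
  {
    case 0 then show ?case using locally_in_closed(1)[OF N0 p] by auto
  next
    case (Suc j)
    note N = span_facts[OF ce, of j]
    obtain a w where a: "a \<in> span e j" "w \<in> span e j" "z = a \<oplus>B \<alpha> (e j) \<otimes>B w" using Suc.prems by auto
    have ec: "a el B" "w el B" "e j el C" "f j el C"
      using a Suc.prems c N(1) by auto
    have "b (e i) (f j) = \<zero>" if "i < j" for i using frameD(4)[OF fr, of i j] that Suc.prems by auto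
    then have da: "d (f j) a = \<zero>[B]" "d (f j) w = \<zero>[B]"
      using d_span[OF ce, of "f j" j] ec a Suc.prems by auto
    have "\<rho> \<delta> \<otimes>B w = d (f j) z"
      using ec da frameD(4)[OF fr, of j j] Suc.prems(1) c(1) by (simp add: a(3) d_add d_\<alpha> BR.minus_eq)
    then have w0: "\<rho> \<delta> \<otimes>B w = \<zero>[B]" using Suc.prems by simp
    have za: "\<rho> \<delta> \<otimes>B z = \<rho> \<delta> \<otimes>B a"
      using ec c(1) w0 \<rho>_assoc[of \<delta> "\<alpha> (e j)" w] by (simp add: a(3) BR.r_distr)
    have zB: "z el B" using ec a(3) by simp
    have "d (f i) (\<rho> \<delta> \<otimes>B z) = \<zero>[B]" if "i < n" for i
      using that Suc.prems(3) c zB by (simp add: d_smult)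
    then have "\<rho> \<delta> \<otimes>B z \<in> locally_in p (\<rho> ` carrier R)"
      using Suc.IH[of "\<rho> \<delta> \<otimes>B a"] N(4) c(1) a(1) Suc.prems(1) by (simp add: za)
    then show ?case by (rule locally_in_closed(3)[OF N0 p c(1) \<delta> zB])
  }
qed

end

section \<open>Faithfulness and surjectivity of the representation on two copies of
  \<open>C\<close>\<close>

section \<open>The representation on two copies of an octonion algebra\<close>

lemma (in quadratic_space) exists_grading:
  "\<exists>g \<in> ring_hom CL CL. (\<forall>r\<in>carrier R. g (rho r) = rho r) \<and> (\<forall>x\<in>carrier C. g (inc x) = -[CL] inc x)"
proof (rule CL_universal[OF ring_CL rho_hom rho_central])
  show "-[CL] inc (r \<bullet> x) = rho r *[CL] (-[CL] inc x)" if "r el R" "x el C" for r x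
    using that by (simp add: inc_smult CL.r_minus)
qed (simp_all add: inc_add inc_sq CL.minus_add CL.l_minus CL.r_minus)

definition (in quadratic_space) grading where
  "grading = (SOME g. g \<in> ring_hom CL CL \<and> (\<forall>r\<in>carrier R. g (rho r) = rho r) \<and> (\<forall>x\<in>carrier C. g (inc x) = -[CL] inc x))"

lemma (in quadratic_space) grading:
  "grading \<in> ring_hom CL CL" "r el R ==> grading (rho r) = rho r" "x el C ==> grading (inc x) = -[CL] inc x"
  "z el CL ==> grading (grading z) = z"
proof -
  have ex: "\<exists>g. g \<in> ring_hom CL CL \<and> (\<forall>r\<in>carrier R. g (rho r) = rho r) \<and> (\<forall>x\<in>carrier C. g (inc x) = -[CL] inc x)"
    using exists_grading by blast
  from someI_ex[OF ex]
  have g: "grading \<in> ring_hom CL CL" "\<And>r. r el R ==> grading (rho r) = rho r" "\<And>x. x el C ==> grading (inc x) = -[CL] inc x"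
    unfolding grading_def[symmetric] by blast+
  interpret g: ring_hom_ring CL CL grading by (rule ring_hom_ringI2[OF ring_CL ring_CL g(1)])
  have "(grading \<circ> grading) z = id z" if "z el CL"
    by (rule CL_hom_eq[OF ring_hom_trans[OF g(1) g(1)] _ _ _ that]) (simp_all add: g ring_hom_memI)
  then show "z el CL ==> grading (grading z) = z" by simp
  show "grading \<in> ring_hom CL CL" "r el R ==> grading (rho r) = rho r" "x el C ==> grading (inc x) = -[CL] inc x"
    by (simp_all add: g)
qed

lemma (in quadratic_space) clifford_rep_CL: "clifford_rep R C q CL rho inc grading"
  by unfold_locales (simp_all add: rho_hom rho_central inc_add inc_smult inc_sq grading)

context octonionic begin

abbreviation "D \<equiv> direct_sum C C"

lemma module_D: "module R D"
  by (rule rmodule.direct_sum_module[OF rmodule.intro[OF module_axioms]])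

sublocale D: rmodule R D by (rule rmodule.intro[OF module_D])

lemma D_simps [simp]:
  "(x, y) el D \<longleftrightarrow> x el C \<and> y el C"
  "(x, y) +[D] (x', y') = (x \<^bold>+ x', y \<^bold>+ y')" "r .[D] (x, y) = (r \<bullet> x, r \<bullet> y)" "\<zero>[D] = (\<zero>[C], \<zero>[C])"
  by (simp_all add: direct_sum_def)

lemma D_carrier: "p el D \<longleftrightarrow> fst p el C \<and> snd p el C" by (cases p) simp

definition al where "al x = (\<lambda>(a, y)\<in>carrier D. (cj x \<star> cj y, cj (x \<star> a)))"
text \<open>The matrix \<open>diag(1, -1)\<close>. Conjugation by it, \<open>Gm\<close> below,
  changes the sign of the off-diagonal blocks and plays the part of the grading
  automorphism.\<close>

definition gr where "gr = (\<lambda>(a, y)\<in>carrier D. (a, -[C] y))"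
definition Gm where "Gm T = gr *[D.EM] T *[D.EM] gr"

lemma al_apply [simp]: "[|a el C; y el C|] ==> al x (a, y) = (cj x \<star> cj y, cj (x \<star> a))"
  by (simp add: al_def)

lemma gr_apply [simp]: "[|a el C; y el C|] ==> gr (a, y) = (a, -[C] y)"
  by (simp add: gr_def)

lemma cj_zero [simp]: "cj \<zero>[C] = \<zero>[C]" using add_hom_zero[OF C_ag C_ag cj_hom] .

lemma al_closed [simp, intro]: "x el C ==> al x el D.EM"
  unfolding D.End_carrier
proof (rule lin_homI)
  assume x: "x el C"
  show "al x \<in> extensional (carrier D)" by (simp add: al_def)
  fix p assume p: "p el D"
  then obtain a y where a: "p = (a, y)" "a el C" "y el C" by (cases p) simp
  show "al x p el D" using a x by simp
  show "al x (r .[D] p) = r .[D] al x p" if "r el R" for r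
    using a x that by (simp add: cj_smult mult_smult_left mult_smult_right)
  fix p' assume p': "p' el D"
  then obtain a' y' where a': "p' = (a', y')" "a' el C" "y' el C" by (cases p') simp
  show "al x (p +[D] p') = al x p +[D] al x p'"
    using a a' x by (simp add: cj_add mult_add_left mult_add_right)
qed

lemma gr_closed: "gr el D.EM"
  unfolding D.End_carrier
proof (rule lin_homI)
  show "gr \<in> extensional (carrier D)" by (simp add: gr_def)
  fix p assume p: "p el D"
  then obtain a y where a: "p = (a, y)" "a el C" "y el C" by (cases p) simp
  show "gr p el D" using a by simp
  show "gr (r .[D] p) = r .[D] gr p" if "r el R" for r
    using a that by (simp add: smult_r_minus)
  fix p' assume p': "p' el D"
  then obtain a' y' where a': "p' = (a', y')" "a' el C" "y' el C" by (cases p') simp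
  show "gr (p +[D] p') = gr p +[D] gr p'"
    using a a' by (simp add: M.minus_add)
qed

lemma gr_gr: "gr *[D.EM] gr = \<one>[D.EM]"
  by (rule D.End_eqI) (auto simp: gr_closed D.End_closed)

lemma gr_cancel: "T el D.EM ==> gr *[D.EM] (gr *[D.EM] T) = T"
  using gr_gr gr_closed by (simp add: D.EM.m_assoc[symmetric])

lemma clifford_rep_End: "clifford_rep R C q D.EM D.hom_scalar al Gm"
proof (rule clifford_rep.intro[OF quadratic_space_axioms D.ring_End], rule clifford_rep_axioms.intro)
  show "D.hom_scalar \<in> ring_hom R D.EM" by (rule D.hom_scalar_hom)
  show "Gm \<in> ring_hom D.EM D.EM"
    by (rule ring_hom_memI) (simp_all add: Gm_def gr_closed D.EM.m_assoc gr_cancel gr_gr D.EM.l_distr D.EM.r_distr)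
next
  fix x y assume x: "x el C" and y: "y el C"
  show "al (x \<^bold>+ y) = al x +[D.EM] al y"
    by (rule D.End_eqI) (use x y in \<open>auto simp: D.End_closed cj_add mult_add_left\<close>)
next
  fix x assume x: "x el C"
  show "al x el D.EM" using x by simp
  show "al x *[D.EM] al x = D.hom_scalar (q x)"
    by (rule D.End_eqI) (use x in \<open>auto simp: D.End_closed cj_mult_cancel_left mult_cj_cancel_left cj_smult\<close>)
  show "Gm (al x) = -[D.EM] al x"
  proof (rule D.EM.minus_equality[symmetric])
    show "Gm (al x) +[D.EM] al x = \<zero>[D.EM]"
      by (rule D.End_eqI) (use x gr_closed in \<open>auto simp: Gm_def D.End_closed cj_neg mult_neg M.l_neg\<close>)
  qed (use x gr_closed in \<open>auto simp: Gm_def D.End_closed\<close>)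
next
  fix z assume z: "z el D.EM"
  show "Gm (Gm z) = z" using z by (simp add: Gm_def gr_closed D.EM.m_assoc gr_cancel gr_gr)
next
  fix r x assume r: "r el R" and x: "x el C"
  show "al (r \<bullet> x) = D.hom_scalar r *[D.EM] al x"
    by (rule D.End_eqI) (use x r in \<open>auto simp: D.End_closed cj_smult mult_smult_left\<close>)
next
  fix r z assume r: "r el R" and z: "z el D.EM"
  show "D.hom_scalar r *[D.EM] z = z *[D.EM] D.hom_scalar r" by (rule D.hom_scalar_central[OF r z])
next
  fix r assume r: "r el R"
  show "Gm (D.hom_scalar r) = D.hom_scalar r"
    using r gr_closed D.hom_scalar_central[of r gr] by (simp add: Gm_def D.EM.m_assoc gr_cancel)
qed

sublocale Cr: clifford_rep R C q CL rho inc grading by (rule clifford_rep_CL)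
sublocale Er: clifford_rep R C q D.EM D.hom_scalar al Gm by (rule clifford_rep_End)

end

context octonionic begin

lemma exists_rep: "\<exists>g \<in> ring_hom CL D.EM. (\<forall>r\<in>carrier R. g (rho r) = D.hom_scalar r) \<and> (\<forall>x\<in>carrier C. g (inc x) = al x)"
  by (rule CL_universal[OF D.ring_End D.hom_scalar_hom D.hom_scalar_central])
    (simp_all add: Er.\<alpha>_add Er.\<alpha>_smult Er.\<alpha>_sq)

lemma alg_hom_rho: "[|f \<in> alg_hom R CL D.EM; r el R|] ==> f (rho r) = D.hom_scalar r"
  unfolding rho_def D.hom_scalar_def alg_hom_def using ring_hom_one[of f CL D.EM] CL.one_closed by simp

definition alp where "alp = (THE f. f \<in> alg_hom R CL D.EM \<and> (\<forall>x\<in>carrier C. f (inc x) = al x))"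

lemma alp_alg_hom: "alp \<in> alg_hom R CL D.EM" and alp_inc: "x el C ==> alp (inc x) = al x"
proof -
  let ?P = "\<lambda>f. f \<in> alg_hom R CL D.EM \<and> (\<forall>x\<in>carrier C. f (inc x) = al x)"
  obtain g where g0: "g \<in> ring_hom CL D.EM" and g1: "(\<forall>r\<in>carrier R. g (rho r) = D.hom_scalar r) \<and> (\<forall>x\<in>carrier C. g (inc x) = al x)"
    using exists_rep by (rule bexE)
  note g = g0 conjunct1[OF g1, rule_format] conjunct2[OF g1, rule_format]
  let ?g = "restrict g (carrier CL)"
  have rg: "?g \<in> ring_hom CL D.EM"
    by (rule ring_hom_memI) (simp_all add: ring_hom_closed[OF g0] ring_hom_mult[OF g0] ring_hom_add[OF g0] ring_hom_one[OF g0])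
  have sm: "?g (r .[CL] z) = r .[D.EM] ?g z" if "r el R" "z el CL" for r z
    using that by (simp add: smult_rho D.smult_hom_scalar ring_hom_mult[OF g0] ring_hom_closed[OF g0] g(2))
  have 1: "?P ?g" using rg sm g(3) by (simp add: alg_hom_def)
  have "?P (THE f. ?P f)"
  proof (rule theI[of ?P ?g, OF 1])
    fix f assume f: "?P f"
    show "f = ?g"
    proof (rule extensionalityI[of _ "carrier CL"])
      show "f \<in> extensional (carrier CL)" using f by (simp add: alg_hom_def)
      fix z assume z: "z el CL"
      show "f z = ?g z"
        by (rule CL_hom_eq[OF _ rg _ _ z]) (use f g alg_hom_rho in \<open>simp_all add: alg_hom_def\<close>)
    qed simp
  qed
  then show "alp \<in> alg_hom R CL D.EM" "x el C ==> alp (inc x) = al x" unfolding alp_def by blast+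
qed

lemma alp_hom: "alp \<in> ring_hom CL D.EM"
  using alp_alg_hom by (simp add: alg_hom_def)

sublocale ap: ring_hom_ring CL D.EM alp
  by (rule ring_hom_ringI2[OF ring_CL D.ring_End alp_hom])

lemma alp_rho: "r el R ==> alp (rho r) = D.hom_scalar r"
  by (rule alg_hom_rho[OF alp_alg_hom])

text \<open>Both composites are homomorphisms that agree on scalars and vectors. The consequence
  \<open>alp_d\<close> makes the contractions on the two sides correspond.\<close>

lemma alp_grading: "z el CL ==> alp (grading z) = Gm (alp z)"
proof -
  assume z: "z el CL"
  have "(alp \<circ> grading) z = (Gm \<circ> alp) z"
    by (rule CL_hom_eq[OF ring_hom_trans[OF grading(1) alp_hom] ring_hom_trans[OF alp_hom Er.\<Gamma>_hom] _ _ z])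
      (simp_all add: grading alp_rho Er.\<Gamma>_\<rho> alp_inc Er.\<Gamma>_\<alpha>)
  then show ?thesis by simp
qed

lemma alp_d: "[|x el C; z el CL|] ==> alp (Cr.d x z) = Er.d x (alp z)"
  using ring_hom_closed[OF grading(1), of z] by (simp add: Cr.d_def Er.d_def alp_grading[symmetric] alp_inc CL.minus_eq D.EM.minus_eq)

text \<open>Evaluating at \<open>1\<close> in the first copy leaves a multiple of \<open>1\<close>,
  which the element of trace one detects.\<close>

lemma hom_scalar_zeroD: "[|r el R; D.hom_scalar r = \<zero>[D.EM]|] ==> r = \<zero>"
proof -
  assume r: "r el R" and z: "D.hom_scalar r = \<zero>[D.EM]"
  obtain y where y: "y el C" "tr y = \<one>" using exists_tr_one by blast
  have "D.hom_scalar r (\<one>[C], \<zero>[C]) = \<zero>[D]" unfolding z by (rule D.End_ops(3)) simp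
  then have "r \<bullet> \<one>[C] = \<zero>[C]" using D.End_ops(6)[of "(\<one>[C], \<zero>[C])" r] by simp
  then show ?thesis by (rule smult_one_zeroD[OF y r])
qed

text \<open>\<open>\<delta> \<bullet> x\<close> is a combination of the \<open>e i\<close>, and left
  multiplication by each \<open>e i\<close> preserves the span, so multiplication by an arbitrary
  vector does so up to \<open>\<delta>\<close>.\<close>

lemma locally_span:
  fixes n :: nat
  assumes p: "primeideal p R" and fr: "is_frame n e f \<delta>" and \<delta>: "\<delta> \<notin> p" and z: "z el CL"
  shows "z \<in> Cr.locally_in p (Cr.span e n)"
proof -
  note c = frameD(1-3)[OF fr]
  have ce: "\<forall>i<n. e i el C" using c(2) by blast
  note N = Cr.span_subspace[OF ce le_refl]
  let ?L = "Cr.locally_in p (Cr.span e n)"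
  note L = Cr.locally_in_closed[OF N p]
  show ?thesis using z
  proof (induction z rule: CL_induct)
    case (scalar r)
    then have "rho r \<in> Cr.span e n" using Cr.span_mono[OF ce _ le_refl] by blast
    then show ?case using L(1) by blast
  next
    case (add z w) then show ?case using L(2) by blast
  next
    case (vector x z)
    have ei: "inc (e i) *[CL] z \<in> ?L" if i: "i < n" for i
      by (rule L(4)) (use i c vector Cr.span_mult[OF ce le_refl i] in auto)
    have hom: "(\<lambda>y. inc y *[CL] z) \<in> add_hom C CL"
      by (rule add_homI) (use vector in \<open>auto simp: inc_add CL.l_distr\<close>)
    have "inc (\<delta> \<bullet> x) *[CL] z = (\<Oplus>\<^bsub>CL\<^esub>i\<in>{..<n}. inc (b x (f i) \<bullet> e i) *[CL] z)"
      unfolding frameD(5)[OF fr vector(1)]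
      by (rule add_hom_finsum[OF C_ag CL.abelian_group_axioms hom]) (use vector c in auto)
    also have "\<dots> \<in> ?L"
    proof (rule CL.finsum_mem)
      fix i assume "i \<in> {..<n}"
      then show "inc (b x (f i) \<bullet> e i) *[CL] z \<in> ?L"
        using L(5)[of "b x (f i)" "inc (e i) *[CL] z"] ei vector c by (simp add: inc_smult CL.m_assoc)
    next
      show "\<zero>[CL] \<in> ?L" using L(1) N by (auto simp: Cr.subspace_def)
    qed (use vector c L(2) in auto)
    finally have "rho \<delta> *[CL] (inc x *[CL] z) \<in> ?L" using vector c by (simp add: inc_smult CL.m_assoc)
    then show ?case by (rule L(3)[OF c(1) \<delta>, rotated]) (use vector in auto)
  qed
qed

text \<open>The kernel is stable under multiplication by vectors and under contractions, so the
  contraction argument applies with target zero. An element of the kernel killed by all contractions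
  is a scalar up to denominators, and a scalar that acts as zero vanishes.\<close>

lemma alp_zeroD:
  assumes z: "z el CL" and 0: "alp z = \<zero>[D.EM]"
  shows "z = \<zero>[CL]"
proof -
  have N: "Cr.subspace {\<zero>[CL]}" by (simp add: Cr.subspace_def)
  have "z \<in> {\<zero>[CL]}"
  proof (rule Cr.local_global[OF N z])
    fix p assume p: "primeideal p R"
    obtain n e f \<delta> where fr: "is_frame n e f \<delta>" and \<delta>: "\<delta> \<notin> p" using local_data[OF p] by blast
    note c = frameD(1-3)[OF fr]
    have ce: "\<forall>i<n. e i el C" using c(2) by blast
    note R0 = Cr.span_subspace[OF ce, of 0, simplified]
    note L = Cr.locally_in_closed[OF R0 p]
    show "z \<in> Cr.locally_in p {\<zero>[CL]}"
    proof (rule Cr.contraction_induct[OF p fr \<delta> N])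
      show "inc x *[CL] w \<in> {\<zero>[CL]}" if "x el C" "w \<in> {\<zero>[CL]}" for x w using that by simp
      show "{w \<in> carrier CL. alp w = \<zero>[D.EM]} \<subseteq> carrier CL" by blast
      show "inc x *[CL] w \<in> {w \<in> carrier CL. alp w = \<zero>[D.EM]}" if "x el C" "w \<in> {w \<in> carrier CL. alp w = \<zero>[D.EM]}" for x w
        using that by (simp add: alp_inc)
      show "Cr.d x w \<in> {w \<in> carrier CL. alp w = \<zero>[D.EM]}" if "x el C" "w \<in> {w \<in> carrier CL. alp w = \<zero>[D.EM]}" for x w
        using that by (simp add: alp_d Er.d_zero)
      show "z \<in> {w \<in> carrier CL. alp w = \<zero>[D.EM]}" using z 0 by simp
      fix w assume w: "w \<in> {w \<in> carrier CL. alp w = \<zero>[D.EM]}" and dw: "\<And>i. i < n ==> Cr.d (f i) w = \<zero>[CL]"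
      from w have wc: "w el CL" "alp w = \<zero>[D.EM]" by simp_all
      obtain r where r: "r el R" "r \<notin> p" "rho r *[CL] w \<in> Cr.span e n"
        using locally_span[OF p fr \<delta> wc(1)] unfolding Cr.locally_in_def by blast
      have "rho r *[CL] w \<in> Cr.locally_in p (rho ` carrier R)"
        by (rule Cr.span_scalar[OF p fr \<delta> le_refl r(3)]) (use dw r wc c in \<open>auto simp: Cr.d_smult\<close>)
      then have "w \<in> Cr.locally_in p (rho ` carrier R)" by (rule L(3)[OF r(1,2) wc(1)])
      then obtain s t where s: "s el R" "s \<notin> p" "t el R" "rho s *[CL] w = rho t"
        unfolding Cr.locally_in_def by blast
      have "D.hom_scalar t = alp (rho s *[CL] w)" using s by (simp add: alp_rho)
      also have "\<dots> = \<zero>[D.EM]" using s(1) wc by (simp add: alp_rho)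
      finally have "t = \<zero>" by (rule hom_scalar_zeroD[OF s(3)])
      then show "w \<in> Cr.locally_in p {\<zero>[CL]}" unfolding Cr.locally_in_def using s wc by auto
    qed
  qed
  then show ?thesis by simp
qed

lemma alp_inj: "[|z el CL; w el CL; alp z = alp w|] ==> z = w"
proof -
  assume c: "z el CL" "w el CL" "alp z = alp w"
  have "alp (z -[CL] w) = \<zero>[D.EM]" using c by (simp add: CL.minus_eq D.EM.r_neg)
  then have "z -[CL] w = \<zero>[CL]" using c by (intro alp_zeroD) auto
  then show ?thesis by (rule CL.minus_eq_zeroD) (use c in auto)
qed

lemma Gm_apply:
  assumes T: "T el D.EM" and a: "a el C"
  shows "Gm T (a, \<zero>[C]) = (fst (T (a, \<zero>[C])), -[C] snd (T (a, \<zero>[C])))"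
    "Gm T (\<zero>[C], a) = (-[C] fst (T (\<zero>[C], a)), snd (T (\<zero>[C], a)))"
proof -
  obtain t t' where t: "T (a, \<zero>[C]) = (t, t')" "t el C" "t' el C"
    using D.End_apply(1)[OF T, of "(a, \<zero>[C])"] a by (cases "T (a, \<zero>[C])") simp
  show "Gm T (a, \<zero>[C]) = (fst (T (a, \<zero>[C])), -[C] snd (T (a, \<zero>[C])))"
    using a t by (simp add: Gm_def M.minus_zero')
  obtain u u' where u: "T (\<zero>[C], a) = (u, u')" "u el C" "u' el C"
    using D.End_apply(1)[OF T, of "(\<zero>[C], a)"] a by (cases "T (\<zero>[C], a)") simp
  have "T (\<zero>[C], -[C] a) = T ((\<ominus> \<one>) .[D] (\<zero>[C], a))" using a by (simp add: smult_l_minus)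
  also have "\<dots> = (-[C] u, -[C] u')" using a u D.End_apply(3)[OF T, of "\<ominus> \<one>" "(\<zero>[C], a)"] by (simp add: smult_l_minus)
  finally show "Gm T (\<zero>[C], a) = (-[C] fst (T (\<zero>[C], a)), snd (T (\<zero>[C], a)))"
    using a u by (simp add: Gm_def)
qed

text \<open>Vanishing of the contractions means that \<open>al x\<close> intertwines
  \<open>T\<close> with \<open>Gm T\<close>. Compared blockwise at \<open>x = 1\<close> this
  expresses the second row of \<open>T\<close> by the first; for general \<open>x\<close> it makes
  the blocks of the first row right multiplications by \<open>m\<close> and \<open>c\<close>, and
  the two identities are what remains of it.\<close>

lemma centralizer_blocks:
  assumes T: "T el D.EM" and dT: "\<And>x. x el C ==> Er.d x T = \<zero>[D.EM]"
  obtains m c where "m el C" "c el C"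
    "\<forall>x\<in>carrier C. \<forall>y\<in>carrier C. (x \<star> y) \<star> m = x \<star> (y \<star> m)"
    "\<forall>x\<in>carrier C. \<forall>y\<in>carrier C. (x \<star> y) \<star> c = y \<star> (x \<star> c)"
    "\<And>a a'. [|a el C; a' el C|] ==> T (a, a') = (a \<star> m \<^bold>+ a' \<star> c, cj (-[C] (cj a \<star> c)) \<^bold>+ cj (cj a' \<star> m))"
proof -
  define p1 where "p1 a = fst (T (a, \<zero>[C]))" for a
  define p2 where "p2 a = snd (T (a, \<zero>[C]))" for a
  define q1 where "q1 a = fst (T (\<zero>[C], a))" for a
  define q2 where "q2 a = snd (T (\<zero>[C], a))" for a
  have T1: "T (a, \<zero>[C]) = (p1 a, p2 a)" and T2: "T (\<zero>[C], a) = (q1 a, q2 a)" for a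
    by (simp_all add: p1_def p2_def q1_def q2_def)
  have pc: "p1 a el C" "p2 a el C" "q1 a el C" "q2 a el C" if "a el C" for a
    using D.End_apply(1)[OF T, of "(a, \<zero>[C])"] D.End_apply(1)[OF T, of "(\<zero>[C], a)"] that by (simp_all add: T1 T2)
  have comm: "al x (T p) = Gm T (al x p)" if x: "x el C" and p: "p el D" for x p
  proof -
    have GT: "Gm T el D.EM" using Er.\<Gamma>_facts(1)[OF T] .
    have "al x *[D.EM] T = Gm T *[D.EM] al x"
      by (rule D.EM.minus_eq_zeroD) (use dT[OF x] x T GT in \<open>simp_all add: Er.d_def\<close>)
    from arg_cong[OF this, of "\<lambda>f. f p"] show ?thesis using p by simp
  qed
  have A: "cj x \<star> cj (p2 a) = -[C] q1 (cj (x \<star> a))" "cj (x \<star> p1 a) = q2 (cj (x \<star> a))"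
    if "x el C" "a el C" for x a
    using comm[OF that(1), of "(a, \<zero>[C])"] that pc[OF that(2)] Gm_apply(2)[OF T, of "cj (x \<star> a)"] by (simp_all add: T1 T2)
  have B: "cj x \<star> cj (q2 a) = p1 (cj x \<star> cj a)"
    if "x el C" "a el C" for x a
    using comm[OF that(1), of "(\<zero>[C], a)"] that pc[OF that(2)] Gm_apply(1)[OF T, of "cj x \<star> cj a"] by (simp_all add: T1 T2)
  have q2: "q2 a = cj (p1 (cj a))" if "a el C" for a
    using A(2)[of "\<one>[C]" "cj a"] that pc by simp
  have p1: "p1 (x \<star> a) = x \<star> p1 a" if "x el C" "a el C" for x a
    using B[of "cj x" "cj a"] that pc by (simp add: q2)
  have p2: "p2 a = cj (-[C] q1 (cj a))" if "a el C" for a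
    using arg_cong[OF A(1)[of "\<one>[C]" a], of cj] that pc by simp
  have q1: "q1 (y \<star> x) = x \<star> q1 y" if "x el C" "y el C" for x y
  proof -
    have "-[C] (x \<star> q1 y) = -[C] q1 (y \<star> x)"
      using A(1)[of "cj x" "cj y"] that pc by (simp add: p2 cj_mult mult_neg)
    then have "x \<star> q1 y = q1 (y \<star> x)" by (rule M.neg_inj) (use that pc in auto)
    then show ?thesis by simp
  qed
  have m: "p1 x = x \<star> p1 \<one>[C]" and c: "q1 x = x \<star> q1 \<one>[C]" if "x el C" for x
    using p1[of x "\<one>[C]"] q1[of x "\<one>[C]"] that by simp_all
  show thesis
  proof (rule that[of "p1 \<one>[C]" "q1 \<one>[C]"])
    show "p1 \<one>[C] el C" "q1 \<one>[C] el C" using pc by simp_all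
    show "\<forall>x\<in>carrier C. \<forall>y\<in>carrier C. (x \<star> y) \<star> p1 \<one>[C] = x \<star> (y \<star> p1 \<one>[C])"
      using p1 m[symmetric] by simp
    show "\<forall>x\<in>carrier C. \<forall>y\<in>carrier C. (x \<star> y) \<star> q1 \<one>[C] = y \<star> (x \<star> q1 \<one>[C])"
      using q1 c[symmetric] by simp
    fix a a' assume a: "a el C" "a' el C"
    have "T (a, a') = T (a, \<zero>[C]) +[D] T (\<zero>[C], a')"
      using D.End_apply(2)[OF T, of "(a, \<zero>[C])" "(\<zero>[C], a')"] a by simp
    then show "T (a, a') = (a \<star> p1 \<one>[C] \<^bold>+ a' \<star> q1 \<one>[C], cj (-[C] (cj a \<star> q1 \<one>[C])) \<^bold>+ cj (cj a' \<star> p1 \<one>[C]))"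
      using a by (simp add: T1 T2 q2 p2 m[symmetric] c[symmetric])
  qed
qed

lemma smult_eq_mult: "[|r el R; a el C; m el C; r \<bullet> m = s \<bullet> \<one>[C]; s el R|] ==> r \<bullet> (a \<star> m) = s \<bullet> a"
  using mult_smult_right[of r a m] mult_smult_right[of s a "\<one>[C]"] by simp

text \<open>The contraction argument is applied to the whole endomorphism ring with the image as
  target, which leaves the matrices of \<open>centralizer_blocks\<close>. A non-associative triple
  at the prime turns those into homotheties up to powers of \<open>a\<close>, and homotheties come
  from scalars.\<close>

lemma alp_surj:
  assumes T: "T el D.EM"
  shows "T \<in> alp ` carrier CL"
proof -
  have N: "Er.subspace (alp ` carrier CL)"
    unfolding Er.subspace_def
  proof (intro conjI ballI)
    show "\<zero>[D.EM] \<in> alp ` carrier CL" by (rule image_eqI[of _ _ "\<zero>[CL]"]) simp_all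
    fix z w assume "z \<in> alp ` carrier CL" "w \<in> alp ` carrier CL"
    then obtain x y where xy: "x el CL" "z = alp x" "y el CL" "w = alp y" by (elim imageE)
    show "z +[D.EM] w \<in> alp ` carrier CL" by (rule image_eqI[of _ _ "x +[CL] y"]) (simp_all add: xy)
  next
    fix r z assume r: "r el R" and "z \<in> alp ` carrier CL"
    then obtain x where x: "x el CL" "z = alp x" by (elim imageE)
    show "D.hom_scalar r *[D.EM] z \<in> alp ` carrier CL"
      by (rule image_eqI[of _ _ "rho r *[CL] x"]) (use x r in \<open>simp_all add: alp_rho\<close>)
  qed auto
  show ?thesis
  proof (rule Er.local_global[OF N T])
    fix p assume p: "primeideal p R"
    interpret p: primeideal p R by fact
    obtain n e f \<delta> u v w where fr: "is_frame n e f \<delta>" and \<delta>: "\<delta> \<notin> p" and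
      uvw: "u el C" "v el C" "w el C" "q (assoc u v w) \<notin> p" using local_data[OF p] by blast
    obtain y where y: "y el C" "tr y = \<one>" using exists_tr_one by blast
    define a where "a = q (assoc u v w)"
    have a: "a el R" "a \<otimes> a el R" "a \<otimes> a \<notin> p" using uvw p.I_prime[of a a] by (auto simp: a_def)
    then have a4: "(a \<otimes> a) \<otimes> (a \<otimes> a) \<notin> p" using p.I_prime by blast
    note c = frameD(1-3)[OF fr]
    note L = Er.locally_in_closed[OF N p]
    show "T \<in> Er.locally_in p (alp ` carrier CL)"
    proof (rule Er.contraction_induct[OF p fr \<delta> N _ subset_refl])
      show "al x *[D.EM] z \<in> alp ` carrier CL" if "x el C" "z \<in> alp ` carrier CL" for x z
      proof -
        from that(2) obtain z' where z: "z' el CL" "z = alp z'" by (elim imageE)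
        show ?thesis by (rule image_eqI[of _ _ "inc x *[CL] z'"]) (use z that(1) in \<open>simp_all add: alp_inc\<close>)
      qed
      show "T el D.EM" by (rule T)
      fix T assume T: "T el D.EM" and dT: "\<And>i. i < n ==> Er.d (f i) T = \<zero>[D.EM]"
      define U where "U = D.hom_scalar \<delta> *[D.EM] T"
      have U: "U el D.EM" using T c(1) by (simp add: U_def)
      have "Er.d x U = \<zero>[D.EM]" if "x el C" for x
        unfolding U_def by (rule Er.d_all_zero[OF fr nondegenerate T dT that])
      from centralizer_blocks[OF U this] obtain m c where mc: "m el C" "c el C"
        "\<forall>x\<in>carrier C. \<forall>y\<in>carrier C. (x \<star> y) \<star> m = x \<star> (y \<star> m)"
        "\<forall>x\<in>carrier C. \<forall>y\<in>carrier C. (x \<star> y) \<star> c = y \<star> (x \<star> c)"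
        and Um: "\<And>a a'. [|a el C; a' el C|] ==> U (a, a') = (a \<star> m \<^bold>+ a' \<star> c, cj (-[C] (cj a \<star> c)) \<^bold>+ cj (cj a' \<star> m))"
        by blast
      define s where "s = a \<otimes> a \<otimes> tr (y \<star> m)"
      have s: "s el R" using a y mc by (simp add: s_def)
      have sm: "(a \<otimes> a) \<bullet> m = s \<bullet> \<one>[C]" unfolding s_def by (rule nucleus_scalar[OF mc(1,3) uvw(1-3) y a_def])
      have sc: "((a \<otimes> a) \<otimes> (a \<otimes> a)) \<bullet> c = \<zero>[C]"
        using antinucleus_zero[OF mc(2,4) uvw(1-3) y a_def] a mc by (simp add: smult_assoc1)
      \<comment> \<open>\<open>m\<close> becomes a scalar after the square of \<open>a\<close>,
        while \<open>c\<close> is shown to vanish after the fourth power; \<open>k\<close> serves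
        both, and \<open>t\<close> is \<open>s\<close> rescaled accordingly.\<close>
      define k where "k = (a \<otimes> a) \<otimes> (a \<otimes> a)"
      define t where "t = a \<otimes> a \<otimes> s"
      have kt: "k el R" "k \<notin> p" "t el R" using a a4 s by (simp_all add: k_def t_def)
      have km: "k \<bullet> (x \<star> m) = t \<bullet> x" and kc: "k \<bullet> (x \<star> c) = \<zero>[C]" if x: "x el C" for x
      proof -
        show "k \<bullet> (x \<star> m) = t \<bullet> x"
          unfolding k_def t_def smult_assoc1[OF a(2) a(2) mult_closed[OF x mc(1)]] smult_assoc1[OF a(2) s x]
            smult_eq_mult[OF a(2) x mc(1) sm s] ..
        show "k \<bullet> (x \<star> c) = \<zero>[C]"
          using mult_smult_right[OF kt(1) x mc(2)] sc x by (simp add: k_def[symmetric])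
      qed
      have "D.hom_scalar k *[D.EM] U = D.hom_scalar t"
      proof (rule D.End_eqI)
        fix p assume "p el D"
        then obtain x x' where x: "p = (x, x')" "x el C" "x' el C" by (cases p) simp
        have "k \<bullet> cj (-[C] (cj x \<star> c)) = cj (-[C] (k \<bullet> (cj x \<star> c)))"
          using x mc kt by (simp add: cj_smult[symmetric] smult_r_minus)
        moreover have "k \<bullet> cj (cj x' \<star> m) = cj (k \<bullet> (cj x' \<star> m))"
          using x mc kt by (simp add: cj_smult)
        ultimately show "(D.hom_scalar k *[D.EM] U) p = D.hom_scalar t p"
          using x mc kt D.End_apply(1)[OF U, of p] by (simp add: Um smult_r_distr km kc cj_smult M.minus_zero')
      qed (use kt U in simp_all)
      then have "D.hom_scalar k *[D.EM] U = alp (rho t)" using alp_rho[OF kt(3)] by simp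
      then have "D.hom_scalar k *[D.EM] U \<in> alp ` carrier CL" using kt by blast
      then have "U \<in> Er.locally_in p (alp ` carrier CL)"
        unfolding Er.locally_in_def using U kt by blast
      then show "T \<in> Er.locally_in p (alp ` carrier CL)" unfolding U_def by (rule L(3)[OF c(1) \<delta> T])
    qed auto
  qed
qed

end

section \<open>Block-diagonal matrices, adjoints and triality\<close>

section \<open>Even elements, the involution and related triples\<close>

context octonionic begin

definition bd where "bd v w = (\<lambda>(a, y)\<in>carrier D. (v a, w y))"

lemma bd_apply [simp]: "[|a el C; y el C|] ==> bd v w (a, y) = (v a, w y)"
  by (simp add: bd_def)

lemma bd_closed:
  assumes v: "v \<in> lin_hom R C C" and w: "w \<in> lin_hom R C C"
  shows "bd v w el D.EM"
  unfolding D.End_carrier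
proof (rule lin_homI)
  note [simp] = lin_homD(1-3)[OF v] lin_homD(1-3)[OF w]
  show "bd v w \<in> extensional (carrier D)" by (simp add: bd_def)
  fix p assume p: "p el D"
  then obtain a y where a: "p = (a, y)" "a el C" "y el C" by (cases p) simp
  show "bd v w p el D" using a by simp
  show "bd v w (r .[D] p) = r .[D] bd v w p" if "r el R" for r
    using a that by simp
  fix p' assume p': "p' el D"
  then obtain a' y' where a': "p' = (a', y')" "a' el C" "y' el C" by (cases p') simp
  show "bd v w (p +[D] p') = bd v w p +[D] bd v w p'"
    using a a' by simp
qed

lemma bd_inj:
  assumes "v \<in> lin_hom R C C" "w \<in> lin_hom R C C" "v' \<in> lin_hom R C C" "w' \<in> lin_hom R C C" "bd v w = bd v' w'"
  shows "v = v'" "w = w'"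
proof -
  have 1: "bd v w (a, y) = bd v' w' (a, y)" for a y using assms(5) by simp
  have "v x = v' x" "w x = w' x" if "x el C" for x
    using 1[of x "\<zero>[C]"] 1[of "\<zero>[C]" x] that by simp_all
  then show "v = v'" "w = w'" using assms by (auto intro: lin_hom_eqI)
qed

lemma lin_hom_id: "(\<lambda>x\<in>carrier C. x) \<in> lin_hom R C C" by (rule lin_homI) auto

lemma lin_hom_comp: "[|v \<in> lin_hom R C C; w \<in> lin_hom R C C|] ==> compose (carrier C) v w \<in> lin_hom R C C"
  by (rule lin_homI) (auto simp: compose_def lin_homD)

lemma bd_mult:
  assumes "v \<in> lin_hom R C C" "w \<in> lin_hom R C C" "v' \<in> lin_hom R C C" "w' \<in> lin_hom R C C"
  shows "bd v w *[D.EM] bd v' w' = bd (compose (carrier C) v v') (compose (carrier C) w w')"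
proof (rule D.End_eqI[OF _ bd_closed[OF lin_hom_comp lin_hom_comp]])
  fix p assume "p el D"
  then show "(bd v w *[D.EM] bd v' w') p = bd (compose (carrier C) v v') (compose (carrier C) w w') p"
    by (cases p) (use assms in \<open>simp add: compose_def lin_homD\<close>)
qed (use assms in \<open>simp_all add: bd_closed\<close>)

lemma bd_id: "bd (\<lambda>x\<in>carrier C. x) (\<lambda>x\<in>carrier C. x) = \<one>[D.EM]"
  by (rule D.End_eqI) (auto simp: bd_closed lin_hom_id D.End_closed)

definition offdiag_zero where
  "offdiag_zero T \<longleftrightarrow> (\<forall>a\<in>carrier C. snd (T (a, \<zero>[C])) = \<zero>[C] \<and> fst (T (\<zero>[C], a)) = \<zero>[C])"
definition diag_zero where
  "diag_zero T \<longleftrightarrow> (\<forall>a\<in>carrier C. fst (T (a, \<zero>[C])) = \<zero>[C] \<and> snd (T (\<zero>[C], a)) = \<zero>[C])"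

lemma D_add: "fst (p +[D] p') = fst p \<^bold>+ fst p'" "snd (p +[D] p') = snd p \<^bold>+ snd p'"
  by (simp_all add: direct_sum_def)

lemma parity_alp: "z \<in> cl_even ==> offdiag_zero (alp z)" "z \<in> cl_odd ==> diag_zero (alp z)"
proof -
  have v: "al x p = (cj x \<star> cj (snd p), cj (x \<star> fst p))" if "p el D" for x p using that by (cases p) simp
  have f: "fst (alp z p) el C" "snd (alp z p) el C" if "z el CL" "p el D" for z p
    using D.End_apply(1)[OF ap.hom_closed[OF that(1)] that(2)] by (simp_all add: D_carrier)
  have E: "alp z p el D" if "z el CL" "p el D" for z p
    using D.End_apply(1)[OF ap.hom_closed[OF that(1)] that(2)] .
  note [simp] = f E
  show "z \<in> cl_even ==> offdiag_zero (alp z)"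
    by (rule cl_parity_induct(1)[of "\<lambda>z. offdiag_zero (alp z)" "\<lambda>z. diag_zero (alp z)"])
      (simp_all add: offdiag_zero_def diag_zero_def alp_rho alp_inc D_add v)
  show "z \<in> cl_odd ==> diag_zero (alp z)"
    by (rule cl_parity_induct(2)[of "\<lambda>z. offdiag_zero (alp z)" "\<lambda>z. diag_zero (alp z)"])
      (simp_all add: offdiag_zero_def diag_zero_def alp_rho alp_inc D_add v)
qed

lemma cl_even_subset: "cl_even \<subseteq> carrier CL" "cl_odd \<subseteq> carrier CL"
  by (auto simp: cl_even_def cl_odd_def cc_simps)

lemma diag_offdiag_zero:
  assumes "T el D.EM" "diag_zero T" "offdiag_zero T"
  shows "T = \<zero>[D.EM]"
proof (rule D.End_eqI)
  fix p assume "p el D"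
  then obtain a y where a: "p = (a, y)" "a el C" "y el C" by (cases p) simp
  have "T p = T (a, \<zero>[C]) +[D] T (\<zero>[C], y)"
    using D.End_apply(2)[OF assms(1), of "(a, \<zero>[C])" "(\<zero>[C], y)"] a by simp
  moreover have "T (a, \<zero>[C]) = (\<zero>[C], \<zero>[C])" "T (\<zero>[C], y) = (\<zero>[C], \<zero>[C])"
    using assms(2,3) a by (auto simp: diag_zero_def offdiag_zero_def prod_eq_iff)
  ultimately show "T p = \<zero>[D.EM] p" using a by simp
qed (simp_all add: assms)

text \<open>After subtraction of an even part, the odd remainder is mapped to a matrix that is both
  diagonal and off-diagonal, hence zero; faithfulness removes it.\<close>

lemma offdiag_zero_even:
  assumes z: "z el CL" "offdiag_zero (alp z)" shows "z \<in> cl_even"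
proof -
  obtain u v where uv: "u \<in> cl_even" "v \<in> cl_odd" "z = u +[CL] v" using even_odd_decomposition[OF z(1)] by blast
  have c: "u el CL" "v el CL" using uv cl_even_subset by blast+
  have "alp v = \<zero>[D.EM]"
  proof (rule diag_offdiag_zero[OF ap.hom_closed[OF c(2)] parity_alp(2)[OF uv(2)]])
    have *: "snd (alp z p) = snd (alp u p) \<^bold>+ snd (alp v p)" "fst (alp z p) = fst (alp u p) \<^bold>+ fst (alp v p)" if "p el D" for p
      using that c by (simp_all add: uv(3) D_add)
    have cl: "snd (alp v p) el C" "fst (alp v p) el C" if "p el D" for p
      using D.End_apply(1)[OF ap.hom_closed[OF c(2)] that] by (simp_all add: D_carrier)
    show "offdiag_zero (alp v)"
      using z(2) parity_alp(1)[OF uv(1)] *[of "(_, \<zero>[C])"] *[of "(\<zero>[C], _)"] cl by (simp add: offdiag_zero_def)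
  qed
  then have "v = \<zero>[CL]" by (rule alp_zeroD[OF c(2)])
  then show ?thesis using uv c by simp
qed

lemma even_iff: "z \<in> cl_even \<longleftrightarrow> z el CL \<and> (\<exists>v\<in>lin_hom R C C. \<exists>w\<in>lin_hom R C C. alp z = bd v w)"
proof (intro iffI conjI)
  assume z: "z \<in> cl_even"
  show zc: "z el CL" using z cl_even_subset by blast
  have T: "alp z el D.EM" using zc by simp
  let ?v = "\<lambda>a\<in>carrier C. fst (alp z (a, \<zero>[C]))" and ?w = "\<lambda>a\<in>carrier C. snd (alp z (\<zero>[C], a))"
  have o: "offdiag_zero (alp z)" by (rule parity_alp(1)[OF z])
  have cl: "snd (alp z p) el C" "fst (alp z p) el C" if "p el D" for p
    using D.End_apply(1)[OF T that] by (simp_all add: D_carrier)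
  have sm: "fst (r .[D] p) = r \<bullet> fst p" "snd (r .[D] p) = r \<bullet> snd p" for r p by (simp_all add: direct_sum_def)
  have v: "?v \<in> lin_hom R C C" and w: "?w \<in> lin_hom R C C"
  proof -
    have "alp z (x \<^bold>+ y, \<zero>[C]) = alp z (x, \<zero>[C]) +[D] alp z (y, \<zero>[C])"
      "alp z (\<zero>[C], x \<^bold>+ y) = alp z (\<zero>[C], x) +[D] alp z (\<zero>[C], y)" if "x el C" "y el C" for x y
      using D.End_apply(2)[OF T, of "(x, \<zero>[C])" "(y, \<zero>[C])"] D.End_apply(2)[OF T, of "(\<zero>[C], x)" "(\<zero>[C], y)"] that by simp_all
    moreover have "alp z (r \<bullet> x, \<zero>[C]) = r .[D] alp z (x, \<zero>[C])" "alp z (\<zero>[C], r \<bullet> x) = r .[D] alp z (\<zero>[C], x)"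
      if "r el R" "x el C" for r x
      using D.End_apply(3)[OF T that(1), of "(x, \<zero>[C])"] D.End_apply(3)[OF T that(1), of "(\<zero>[C], x)"] that by simp_all
    ultimately show "?v \<in> lin_hom R C C" "?w \<in> lin_hom R C C"
      using cl by (intro lin_homI; simp add: D_add sm)+
  qed
  have "alp z = bd ?v ?w"
  proof (rule D.End_eqI[OF T bd_closed[OF v w]])
    fix p assume "p el D"
    then obtain a y where a: "p = (a, y)" "a el C" "y el C" by (cases p) simp
    have "alp z p = alp z (a, \<zero>[C]) +[D] alp z (\<zero>[C], y)"
      using D.End_apply(2)[OF T, of "(a, \<zero>[C])" "(\<zero>[C], y)"] a by simp
    then show "alp z p = bd ?v ?w p" unfolding a(1) using a(2,3) o cl by (simp add: prod_eq_iff D_add offdiag_zero_def)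
  qed
  with v w show "\<exists>v\<in>lin_hom R C C. \<exists>w\<in>lin_hom R C C. alp z = bd v w" by blast
next
  assume "z el CL \<and> (\<exists>v\<in>lin_hom R C C. \<exists>w\<in>lin_hom R C C. alp z = bd v w)"
  then obtain v w where z: "z el CL" "v \<in> lin_hom R C C" "w \<in> lin_hom R C C" "alp z = bd v w" by blast
  have "v \<zero>[C] = \<zero>[C]" "w \<zero>[C] = \<zero>[C]" using add_hom_zero[OF C_ag C_ag lin_homD(4)] z by blast+
  then show "z \<in> cl_even" by (intro offdiag_zero_even[OF z(1)]) (simp add: z(4) offdiag_zero_def)
qed

lemma inc_inj: "inj_on inc (carrier C)"
proof (rule inj_onI)
  fix x y assume x: "x el C" and y: "y el C" and "inc x = inc y"
  then have "al x (\<one>[C], \<zero>[C]) = al y (\<one>[C], \<zero>[C])" using alp_inc by metis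
  then have "cj (cj x) = cj (cj y)" using x y by simp
  then show "x = y" using x y by simp
qed

lemma rho_inj: "[|r el R; s el R; rho r = rho s|] ==> r = s"
proof -
  assume rs: "r el R" "s el R" "rho r = rho s"
  have "D.hom_scalar (r \<ominus> s) = \<zero>[D.EM]"
  proof -
    interpret h: ring_hom_ring R D.EM D.hom_scalar by (rule ring_hom_ringI2[OF R.ring_axioms D.ring_End D.hom_scalar_hom])
    have "D.hom_scalar r = D.hom_scalar s" using rs by (metis alp_rho)
    then show ?thesis using rs by (simp add: R.minus_eq D.EM.r_neg)
  qed
  then have "r \<ominus> s = \<zero>" using rs by (intro hom_scalar_zeroD) auto
  then show ?thesis by (rule R.minus_eq_zeroD) (use rs in auto)
qed

text \<open>With respect to the form \<open>b \<oplus> b\<close> on \<open>C \<oplus> C\<close> every \<open>\<alpha> x\<close> is self-adjoint, so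
  the main involution corresponds to taking adjoints.\<close>

definition bD where "bD p p' = b (fst p) (fst p') \<oplus> b (snd p) (snd p')"

lemma bD_al:
  assumes x: "x el C" and p: "p el D" "p' el D"
  shows "bD (al x p) p' = bD p (al x p')"
proof -
  obtain a y where a: "p = (a, y)" "a el C" "y el C" using p(1) by (cases p) simp
  obtain a' y' where a': "p' = (a', y')" "a' el C" "y' el C" using p(2) by (cases p') simp
  have "b (cj x \<star> cj y) a' = b y (cj (x \<star> a'))"
    using a a' x b_adj_left[of "cj x" "cj y" a'] b_cj[of y "x \<star> a'"] by simp
  moreover have "b (cj (x \<star> a)) y' = b a (cj x \<star> cj y')"
    using a a' x b_adj_left[of x a "cj y'"] b_cj[of "x \<star> a" y'] by simp
  ultimately show ?thesis using a a' x by (simp add: bD_def R.a_comm)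
qed

text \<open>The pair \<open>p\<close>, \<open>p'\<close> stays variable because each vector moved
  across \<open>bD\<close> changes it; vectors are self-adjoint and \<open>Cl_inv\<close> reverses
  products, as adjoints do.\<close>

lemma bD_alp:
  assumes z: "z el CL"
  shows "[|p el D; p' el D|] ==> bD (alp z p) p' = bD p (alp (Cl_inv z) p')"
  using z
proof (induction z arbitrary: p p' rule: CL_induct)
  case (scalar r)
  have "b (fst p) (fst p') el R" "b (snd p) (snd p') el R" using scalar by (simp_all add: D_carrier)
  then show ?case using scalar by (cases p, cases p') (simp add: alp_rho Cl_inv_simps bD_def b_smult_left b_smult_right)
next
  case (vector x z)
  have 1: "alp z p el D" "al x p' el D" using vector D.End_apply(1)[OF ap.hom_closed] D.End_apply(1)[OF al_closed] by auto
  have "bD (alp (inc x *[CL] z) p) p' = bD (alp z p) (al x p')" using vector 1 by (simp add: alp_inc bD_al)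
  also have "\<dots> = bD p (alp (Cl_inv (inc x *[CL] z)) p')" using vector 1 by (simp add: Cl_inv_simps alp_inc)
  finally show ?case .
next
  case (add z w)
  have c: "alp v p el D" if "v el CL" "p el D" for v p using that D.End_apply(1)[OF ap.hom_closed] by auto
  have "bD (alp (z +[CL] w) p) p' = bD (alp z p) p' \<oplus> bD (alp w p) p'"
    using add.prems add.hyps c[of z p] c[of w p] by (simp add: bD_def D_add D_carrier b_add_left R.a_ac)
  also have "\<dots> = bD p (alp (Cl_inv z) p') \<oplus> bD p (alp (Cl_inv w) p')" using add by simp
  also have "\<dots> = bD p (alp (Cl_inv (z +[CL] w)) p')"
    using add.prems add.hyps c[of "Cl_inv z" p'] c[of "Cl_inv w" p'] by (simp add: Cl_inv_simps bD_def D_add D_carrier b_add_right R.a_ac)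
  finally show ?case .
qed

lemma bD_nondegenerate:
  assumes p: "p el D" "p' el D" and eq: "\<And>r. r el D ==> bD r p = bD r p'"
  shows "p = p'"
proof -
  obtain a y where a: "p = (a, y)" "a el C" "y el C" using p(1) by (cases p) simp
  obtain a' y' where a': "p' = (a', y')" "a' el C" "y' el C" using p(2) by (cases p') simp
  have "a = a'" by (rule eqI) (use a a' eq[of "(_, \<zero>[C])"] b_sym in \<open>simp_all add: bD_def\<close>)
  moreover have "y = y'" by (rule eqI) (use a a' eq[of "(\<zero>[C], _)"] b_sym in \<open>simp_all add: bD_def\<close>)
  ultimately show ?thesis using a a' by simp
qed

section \<open>Triality for isometries\<close>

definition Og where "Og = {t \<in> lin_hom R C C. bij_betw t (carrier C) (carrier C) \<and> (\<forall>x\<in>carrier C. q (t x) = q x)}"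

definition RTrel where "RTrel t1 t2 t3 \<longleftrightarrow> (\<forall>x\<in>carrier C. \<forall>y\<in>carrier C. t1 (x \<star> y) = cj (t2 (cj x)) \<star> cj (t3 (cj y)))"

definition RT where "RT = {(t1, t2, t3). t1 \<in> Og \<and> t2 \<in> Og \<and> t3 \<in> Og \<and> RTrel t1 t2 t3}"

lemma Og_facts:
  assumes "t \<in> Og"
  shows "t \<in> lin_hom R C C" "x el C ==> t x el C" "[|x el C; y el C|] ==> t (x \<^bold>+ y) = t x \<^bold>+ t y"
    "[|r el R; x el C|] ==> t (r \<bullet> x) = r \<bullet> t x" "[|x el C; y el C|] ==> t (x \<^bold>- y) = t x \<^bold>- t y"
    "x el C ==> q (t x) = q x" "bij_betw t (carrier C) (carrier C)"
    "[|x el C; y el C|] ==> b (t x) (t y) = b x y"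
proof -
  have t: "t \<in> lin_hom R C C" "\<And>x. x el C ==> q (t x) = q x" using assms by (auto simp: Og_def)
  note l = lin_homD[OF t(1)]
  show "[|x el C; y el C|] ==> b (t x) (t y) = b x y"
    using t(2)[of "x \<^bold>+ y"] t(2) l by (simp add: polar_def)
  show "[|x el C; y el C|] ==> t (x \<^bold>- y) = t x \<^bold>- t y" by (rule add_hom_minus[OF C_ag C_ag l(4)])
qed (use assms lin_homD in \<open>auto simp: Og_def\<close>)

text \<open>Setting \<open>y = 1\<close> and cancelling the image of \<open>1\<close> under
  \<open>G\<close> recovers \<open>B\<close> from \<open>A\<close>. Linearizing the cancellation
  rule at the images of \<open>y\<close> and \<open>1\<close> then produces
  \<open>B (x \<star> y)\<close>, and the trace term combines with the rest to the conjugate of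
  \<open>y\<close>.\<close>

lemma triality_right:
  assumes A: "A \<in> add_hom C C" and B: "B \<in> add_hom C C" and G: "G \<in> add_hom C C"
    and Gs: "\<And>r x. [|r el R; x el C|] ==> G (r \<bullet> x) = r \<bullet> G x"
    and Gb: "\<And>x y. [|x el C; y el C|] ==> b (G x) (G y) = b x y" and Gq: "q (G \<one>[C]) = \<one>"
    and rel: "\<And>x y. [|x el C; y el C|] ==> A (x \<star> y) = B x \<star> G y"
    and c: "x el C" "y el C"
  shows "B (x \<star> y) = A x \<star> cj (G (cj y))"
proof -
  note cl [simp] = add_hom_closed[OF A] add_hom_closed[OF B] add_hom_closed[OF G]
  have cancel: "A z \<star> cj (G \<one>[C]) = B z" if "z el C" for z
    using rel[of z "\<one>[C]"] that cj_mult_cancel_right[of "G \<one>[C]" "B z"] by (simp add: Gq)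
  have "(B x \<star> G y) \<star> cj (G \<one>[C]) \<^bold>+ (B x \<star> G \<one>[C]) \<star> cj (G y) = tr y \<bullet> B x"
    using cj_mult_lin_right[of "G y" "B x" "G \<one>[C]"] c by (simp add: Gb)
  then have "B (x \<star> y) \<^bold>+ A x \<star> cj (G y) = tr y \<bullet> B x"
    using rel[of x y, symmetric] rel[of x "\<one>[C]", symmetric] cancel[of "x \<star> y"] c by simp
  then have "B (x \<star> y) = tr y \<bullet> B x \<^bold>- A x \<star> cj (G y)"
    by (rule M.add_solve) (use c in auto)
  also have "\<dots> = A x \<star> cj (G (cj y))"
  proof -
    have "G (cj y) = tr y \<bullet> G \<one>[C] \<^bold>- G y"
      unfolding conjugate_def using c add_hom_minus[OF C_ag C_ag G, of "tr y \<bullet> \<one>[C]" y] by (simp add: Gs)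
    then have "A x \<star> cj (G (cj y)) = tr y \<bullet> (A x \<star> cj (G \<one>[C])) \<^bold>- A x \<star> cj (G y)"
      using c by (simp add: cj_minus cj_smult mult_minus mult_smult_right)
    then show ?thesis using c by (simp add: cancel)
  qed
  finally show ?thesis .
qed

text \<open>The mirror image of \<open>triality_right\<close>, cancelling the image of
  \<open>1\<close> under \<open>B\<close> on the left.\<close>

lemma triality_left:
  assumes A: "A \<in> add_hom C C" and B: "B \<in> add_hom C C" and G: "G \<in> add_hom C C"
    and Bs: "\<And>r x. [|r el R; x el C|] ==> B (r \<bullet> x) = r \<bullet> B x"
    and Bb: "\<And>x y. [|x el C; y el C|] ==> b (B x) (B y) = b x y" and Bq: "q (B \<one>[C]) = \<one>"
    and rel: "\<And>x y. [|x el C; y el C|] ==> A (x \<star> y) = B x \<star> G y"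
    and c: "x el C" "y el C"
  shows "G (x \<star> y) = cj (B (cj x)) \<star> A y"
proof -
  note cl [simp] = add_hom_closed[OF A] add_hom_closed[OF B] add_hom_closed[OF G]
  have cancel: "cj (B \<one>[C]) \<star> A z = G z" if "z el C" for z
    using rel[of "\<one>[C]" z] that cj_mult_cancel_left[of "B \<one>[C]" "G z"] by (simp add: Bq)
  have "cj (B \<one>[C]) \<star> (B x \<star> G y) \<^bold>+ cj (B x) \<star> (B \<one>[C] \<star> G y) = tr x \<bullet> G y"
    using cj_mult_lin_left[of "B \<one>[C]" "G y" "B x"] c by (simp add: Bb b_sym)
  then have "G (x \<star> y) \<^bold>+ cj (B x) \<star> A y = tr x \<bullet> G y"
    using rel[of x y, symmetric] rel[of "\<one>[C]" y, symmetric] cancel[of "x \<star> y"] c by simp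
  then have "G (x \<star> y) = tr x \<bullet> G y \<^bold>- cj (B x) \<star> A y"
    by (rule M.add_solve) (use c in auto)
  also have "\<dots> = cj (B (cj x)) \<star> A y"
  proof -
    have "B (cj x) = tr x \<bullet> B \<one>[C] \<^bold>- B x"
      unfolding conjugate_def using c add_hom_minus[OF C_ag C_ag B, of "tr x \<bullet> \<one>[C]" x] by (simp add: Bs)
    then have "cj (B (cj x)) \<star> A y = tr x \<bullet> (cj (B \<one>[C]) \<star> A y) \<^bold>- cj (B x) \<star> A y"
      using c by (simp add: cj_minus cj_smult mult_minus mult_smult_left)
    then show ?thesis using c by (simp add: cancel)
  qed
  finally show ?thesis .
qed

text \<open>The intertwining relation has one equation per off-diagonal block, \<open>I\<close> and
  \<open>II\<close>, and both are shifted forms of the defining relation: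
  \<open>triality_right\<close> leads to \<open>I\<close>, \<open>triality_left\<close> from there
  to \<open>II\<close>, and \<open>triality_right\<close> applied to \<open>I\<close> leads
  back.\<close>

lemma RTrel_iff:
  assumes t1: "t1 \<in> Og" and t2: "t2 \<in> Og" and t3: "t3 \<in> Og"
  shows "RTrel t1 t2 t3 \<longleftrightarrow> (\<forall>x\<in>carrier C. bd t3 t2 *[D.EM] al x = al (t1 x) *[D.EM] bd t3 t2)"
proof -
  note f1 = Og_facts[OF t1] and f2 = Og_facts[OF t2] and f3 = Og_facts[OF t3]
  let ?M = "\<lambda>x. cj (t2 (cj x))" and ?N = "\<lambda>x. cj (t3 (cj x))"
  have h: "t1 \<in> add_hom C C" "t2 \<in> add_hom C C" "t3 \<in> add_hom C C" "?M \<in> add_hom C C" "?N \<in> add_hom C C"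
    by (rule add_homI; simp add: f1 f2 f3 cj_add)+
  have inter: "(bd t3 t2 *[D.EM] al x) p = (t3 (cj x \<star> cj (snd p)), t2 (cj (x \<star> fst p)))"
    "(al (t1 x) *[D.EM] bd t3 t2) p = (cj (t1 x) \<star> cj (t2 (snd p)), cj (t1 x \<star> t3 (fst p)))" if "x el C" "p el D" for x p
    using that f2(2) f3(2) by (cases p; simp)+
  show ?thesis
  proof
    assume RT: "RTrel t1 t2 t3"
    have rel: "t1 (x \<star> y) = ?M x \<star> ?N y" if "x el C" "y el C" for x y
      using RT that by (simp add: RTrel_def)
    have I: "?M (x \<star> y) = t1 x \<star> t3 y" if "x el C" "y el C" for x y
      using triality_right[of t1 ?M ?N x y, OF h(1,4,5) _ _ _ rel that] that
      by (simp add: f3 cj_smult b_cj_cj q_one)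
    have II: "t3 (x \<star> y) = cj (t1 (cj x)) \<star> ?M y" if "x el C" "y el C" for x y
      using triality_left[of ?M t1 t3 x y, OF h(4,1,3) _ _ _ I that] that by (simp add: f1 q_one)
    show "\<forall>x\<in>carrier C. bd t3 t2 *[D.EM] al x = al (t1 x) *[D.EM] bd t3 t2"
    proof (intro ballI D.End_eqI)
      fix x p assume x: "x el C" and p: "p el D"
      have "t2 (cj (x \<star> fst p)) = cj (t1 x \<star> t3 (fst p))"
        using arg_cong[OF I[of x "fst p"], of cj] x p f2(2) by (simp add: D_carrier)
      moreover have "t3 (cj x \<star> cj (snd p)) = cj (t1 x) \<star> cj (t2 (snd p))"
        using II[of "cj x" "cj (snd p)"] x p by (simp add: D_carrier)
      ultimately show "(bd t3 t2 *[D.EM] al x) p = (al (t1 x) *[D.EM] bd t3 t2) p"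
        unfolding inter[OF x p] by simp
    qed (use f1 f2 f3 in \<open>simp_all add: bd_closed\<close>)
  next
    assume E: "\<forall>x\<in>carrier C. bd t3 t2 *[D.EM] al x = al (t1 x) *[D.EM] bd t3 t2"
    have I: "?M (x \<star> y) = t1 x \<star> t3 y" if c: "x el C" "y el C" for x y
    proof -
      have "t2 (cj (x \<star> y)) = cj (t1 x \<star> t3 y)"
        using arg_cong[OF bspec[OF E c(1)], of "\<lambda>f. f (y, \<zero>[C])"] inter[OF c(1), of "(y, \<zero>[C])"] c by simp
      then show ?thesis using c f1(2) f3(2) by simp
    qed
    have "t1 (x \<star> y) = ?M x \<star> ?N y" if "x el C" "y el C" for x y
      using triality_right[of ?M t1 t3 x y, OF h(4,1,3) _ _ _ I that] that by (simp add: f3 q_one)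
    then show "RTrel t1 t2 t3" by (simp add: RTrel_def)
  qed
qed

end

section \<open>Spin elements as lifts of related triples\<close>

section \<open>The spin group and related triples\<close>

context octonionic begin

text \<open>The groups and the map are formed over the base ring itself; interpreted for the base
  change of \<open>C\<close> to \<open>S\<close> they become the points over \<open>S\<close>, by
  \<open>points_eq\<close>.\<close>

definition SpinG where "SpinG = \<lparr>carrier = {u \<in> Units (Cl_even R C q).
       {u *[CL] inc x *[CL] inv\<^bsub>CL\<^esub> u | x. x el C} = inc ` carrier C \<and> u *[CL] Cl_inv u = \<one>[CL]},
     monoid.mult = monoid.mult CL, one = \<one>[CL]\<rparr>"
definition RTG where "RTG = \<lparr>carrier = RT,
     monoid.mult = (\<lambda>(t1, t2, t3) (t1', t2', t3'). (compose (carrier C) t1 t1', compose (carrier C) t2 t2', compose (carrier C) t3 t3')),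
     one = (\<lambda>x\<in>carrier C. x, \<lambda>x\<in>carrier C. x, \<lambda>x\<in>carrier C. x)\<rparr>"
definition U1 where "U1 u = (\<lambda>x\<in>carrier C. the_inv_into (carrier C) inc (u *[CL] inc x *[CL] inv\<^bsub>CL\<^esub> u))"
definition U2 where "U2 u = (THE w. w \<in> lin_hom R C C \<and> (\<exists>v \<in> lin_hom R C C. alp u = bd v w))"
definition U3 where "U3 u = (THE v. v \<in> lin_hom R C C \<and> (\<exists>w \<in> lin_hom R C C. alp u = bd v w))"
definition FF where "FF u = (U1 u, U2 u, U3 u)"

lemma U23:
  assumes "v \<in> lin_hom R C C" "w \<in> lin_hom R C C" "alp u = bd v w"
  shows "U2 u = w" "U3 u = v"
  unfolding U2_def U3_def using assms bd_inj by (auto intro!: the_equality)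

lemma Og_inverse:
  assumes t: "t \<in> Og"
  shows "\<exists>t'\<in>Og. compose (carrier C) t' t = (\<lambda>x\<in>carrier C. x) \<and> compose (carrier C) t t' = (\<lambda>x\<in>carrier C. x)"
proof -
  note f = Og_facts[OF t]
  note inj = bij_betw_imp_inj_on[OF f(7)] and im = bij_betw_imp_surj_on[OF f(7)]
  let ?g = "the_inv_into (carrier C) t"
  have g: "?g x el C" "t (?g x) = x" "?g (t x) = x" if "x el C" for x
    using the_inv_into_into[OF inj, of x "carrier C"] f_the_inv_into_f[OF inj, of x] the_inv_into_f_f[OF inj, of x] that im by auto
  have g_eqI: "?g x = y" if "y el C" "t y = x" for x y using g(3)[OF that(1)] that(2) by simp
  have l: "restrict ?g (carrier C) \<in> lin_hom R C C"
    by (rule lin_homI) (simp_all add: g g_eqI f)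
  have "restrict ?g (carrier C) \<in> Og"
    unfolding Og_def
  proof (intro CollectI conjI ballI l)
    show "bij_betw (restrict ?g (carrier C)) (carrier C) (carrier C)"
      by (rule bij_betw_byWitness[where f' = t]) (auto simp: g f)
    show "q (restrict ?g (carrier C) x) = q x" if "x el C" for x
      using f(6)[of "?g x"] that g by simp
  qed
  moreover have "compose (carrier C) (restrict ?g (carrier C)) t = (\<lambda>x\<in>carrier C. x)" "compose (carrier C) t (restrict ?g (carrier C)) = (\<lambda>x\<in>carrier C. x)"
    by (auto simp: compose_def g f intro!: restrict_ext)
  ultimately show ?thesis by blast
qed

lemma Og_id: "(\<lambda>x\<in>carrier C. x) \<in> Og"
  by (simp add: Og_def lin_hom_id bij_betw_def inj_on_def)

lemma Og_comp: "[|s \<in> Og; t \<in> Og|] ==> compose (carrier C) s t \<in> Og"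
  using bij_betw_compose[of t "carrier C" "carrier C" s "carrier C"] lin_hom_comp[of s t] by (auto simp: Og_def lin_homD compose_def)

lemma RTG_simps: "carrier RTG = RT" "(t1, t2, t3) *[RTG] (t1', t2', t3') = (compose (carrier C) t1 t1', compose (carrier C) t2 t2', compose (carrier C) t3 t3')"
  "\<one>[RTG] = (\<lambda>x\<in>carrier C. x, \<lambda>x\<in>carrier C. x, \<lambda>x\<in>carrier C. x)"
  by (simp_all add: RTG_def)

lemma RT_mult:
  assumes "(t1, t2, t3) \<in> RT" "(t1', t2', t3') \<in> RT"
  shows "(compose (carrier C) t1 t1', compose (carrier C) t2 t2', compose (carrier C) t3 t3') \<in> RT"
proof -
  have c: "t1 \<in> Og" "t2 \<in> Og" "t3 \<in> Og" "t1' \<in> Og" "t2' \<in> Og" "t3' \<in> Og" and r: "RTrel t1 t2 t3" "RTrel t1' t2' t3'"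
    using assms by (simp_all add: RT_def)
  note f = Og_facts(2)[OF c(2)] Og_facts(2)[OF c(3)] Og_facts(2)[OF c(5)] Og_facts(2)[OF c(6)]
  have "RTrel (compose (carrier C) t1 t1') (compose (carrier C) t2 t2') (compose (carrier C) t3 t3')"
    using r f by (simp add: RTrel_def compose_def)
  then show ?thesis using c by (simp add: RT_def Og_comp)
qed

lemma compose_id: "t \<in> Og ==> compose (carrier C) (\<lambda>x\<in>carrier C. x) t = t"
  by (rule lin_hom_eqI[OF lin_hom_comp[OF lin_hom_id]]) (auto simp: Og_facts compose_def)

lemma group_RTG: "group RTG"
proof (rule groupI)
  show "\<one>[RTG] el RTG" by (simp add: RTG_simps RT_def Og_id RTrel_def cj_mult)
  fix t assume t: "t el RTG"
  obtain t1 t2 t3 where tt: "t = (t1, t2, t3)" by (cases t)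
  have c: "t1 \<in> Og" "t2 \<in> Og" "t3 \<in> Og" and r: "RTrel t1 t2 t3" using t by (simp_all add: RTG_simps tt RT_def)
  show "\<one>[RTG] *[RTG] t = t" using c by (simp add: tt RTG_simps compose_id)
  obtain s1 where s1: "s1 \<in> Og" "compose (carrier C) s1 t1 = (\<lambda>x\<in>carrier C. x)" using Og_inverse[OF c(1)] by blast
  obtain s2 where s2: "s2 \<in> Og" "compose (carrier C) s2 t2 = (\<lambda>x\<in>carrier C. x)" "compose (carrier C) t2 s2 = (\<lambda>x\<in>carrier C. x)" using Og_inverse[OF c(2)] by blast
  obtain s3 where s3: "s3 \<in> Og" "compose (carrier C) s3 t3 = (\<lambda>x\<in>carrier C. x)" "compose (carrier C) t3 s3 = (\<lambda>x\<in>carrier C. x)" using Og_inverse[OF c(3)] by blast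
  have ap: "f (g x) = x" if "compose (carrier C) f g = (\<lambda>x\<in>carrier C. x)" "x el C" for f g x
    using fun_cong[OF that(1), of x] that(2) by (simp add: compose_def)
  have "RTrel s1 s2 s3"
    unfolding RTrel_def
  proof (intro ballI)
    fix x y assume x: "x el C" and y: "y el C"
    note f = Og_facts(2)[OF s2(1)] Og_facts(2)[OF s3(1)]
    let ?x = "cj (s2 (cj x))" and ?y = "cj (s3 (cj y))"
    have "t1 (?x \<star> ?y) = x \<star> y" using r x y f by (simp add: RTrel_def ap[OF s2(3)] ap[OF s3(3)])
    then have "s1 (x \<star> y) = s1 (t1 (?x \<star> ?y))" by simp
    then show "s1 (x \<star> y) = ?x \<star> ?y" using x y f by (simp add: ap[OF s1(2)])
  qed
  then have "(s1, s2, s3) el RTG" using s1 s2 s3 by (simp add: RTG_simps RT_def)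
  moreover have "(s1, s2, s3) *[RTG] t = \<one>[RTG]" using s1 s2 s3 by (simp add: tt RTG_simps)
  ultimately show "\<exists>s\<in>carrier RTG. s *[RTG] t = \<one>[RTG]" by blast
  fix s assume s: "s el RTG"
  show "t *[RTG] s el RTG" using t s by (cases t, cases s) (simp add: RTG_simps RT_mult)
  fix u assume u: "u el RTG"
  have as: "compose (carrier C) (compose (carrier C) f g) h = compose (carrier C) f (compose (carrier C) g h)" if "h \<in> Og" for f g h
    using Og_facts(2)[OF that] by (simp add: compose_def fun_eq_iff)
  show "t *[RTG] s *[RTG] u = t *[RTG] (s *[RTG] u)"
    using t s u by (cases t, cases s, cases u) (simp add: RTG_simps RT_def as)
qed

lemma Spin_inverse:
  assumes "u el SpinG"
  shows "\<exists>v\<in>cl_even. v *[CL] u = \<one>[CL] \<and> u *[CL] v = \<one>[CL] \<and> inv\<^bsub>CL\<^esub> u = v"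
proof -
  have "u \<in> Units (Cl_even R C q)" using assms by (simp add: SpinG_def)
  then obtain v where v: "u \<in> cl_even" "v \<in> cl_even" "v *[CL] u = \<one>[CL]" "u *[CL] v = \<one>[CL]"
    by (auto simp: Units_def Cl_even_eq)
  then have "v = inv\<^bsub>CL\<^esub> u" using cl_even_subset by (intro CL.inv_unique'[of u v]) auto
  then show ?thesis using v by blast
qed

text \<open>Conjugation gives an isometry \<open>t1\<close> because squares of vectors are central,
  and evenness gives the blocks \<open>t3\<close> and \<open>t2\<close>. Intertwining alone makes
  these two similitudes with a common factor \<open>k\<close>; the condition on the main involution,
  read as invariance of \<open>bD\<close>, forces \<open>k\<close> to be one.\<close>

lemma Spin_RT:
  assumes u: "u el SpinG"
  shows "u el CL" "FF u \<in> RT" "alp u = bd (U3 u) (U2 u)"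
proof -
  obtain v where v: "v \<in> cl_even" "v *[CL] u = \<one>[CL]" "u *[CL] v = \<one>[CL]" "inv\<^bsub>CL\<^esub> u = v"
    using Spin_inverse[OF u] by blast
  have ue: "u \<in> cl_even" and st: "{u *[CL] inc x *[CL] v | x. x el C} = inc ` carrier C" and us: "u *[CL] Cl_inv u = \<one>[CL]"
    using u v(4) by (auto simp: SpinG_def Units_def Cl_even_eq)
  show uc: "u el CL" using ue cl_even_subset by blast
  have vc: "v el CL" using v cl_even_subset by blast
  obtain t3 t2 where t: "t3 \<in> lin_hom R C C" "t2 \<in> lin_hom R C C" "alp u = bd t3 t2" using ue even_iff by blast
  obtain s3 s2 where s: "s3 \<in> lin_hom R C C" "s2 \<in> lin_hom R C C" "alp v = bd s3 s2" using v(1) even_iff by blast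
  have U: "U2 u = t2" "U3 u = t3" by (rule U23[OF t])+
  then show "alp u = bd (U3 u) (U2 u)" using t by simp
  note tl = lin_homD[OF t(1)] lin_homD[OF t(2)] and sl = lin_homD[OF s(1)] lin_homD[OF s(2)]
  have "bd (compose (carrier C) t3 s3) (compose (carrier C) t2 s2) = bd (\<lambda>x\<in>carrier C. x) (\<lambda>x\<in>carrier C. x)"
    "bd (compose (carrier C) s3 t3) (compose (carrier C) s2 t2) = bd (\<lambda>x\<in>carrier C. x) (\<lambda>x\<in>carrier C. x)"
    using ap.hom_mult[OF uc vc] ap.hom_mult[OF vc uc] t s v by (simp_all add: bd_mult bd_id)
  note eq = this
  note comp = bd_inj(1)[OF lin_hom_comp[OF t(1) s(1)] lin_hom_comp[OF t(2) s(2)] lin_hom_id lin_hom_id eq(1)]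
    bd_inj(2)[OF lin_hom_comp[OF t(1) s(1)] lin_hom_comp[OF t(2) s(2)] lin_hom_id lin_hom_id eq(1)]
    bd_inj(1)[OF lin_hom_comp[OF s(1) t(1)] lin_hom_comp[OF s(2) t(2)] lin_hom_id lin_hom_id eq(2)]
    bd_inj(2)[OF lin_hom_comp[OF s(1) t(1)] lin_hom_comp[OF s(2) t(2)] lin_hom_id lin_hom_id eq(2)]
  have ap: "f (g x) = x" if "compose (carrier C) f g = (\<lambda>x\<in>carrier C. x)" "x el C" for f g x
    using fun_cong[OF that(1), of x] that(2) by (simp add: compose_def)
  have bij: "bij_betw t3 (carrier C) (carrier C)" "bij_betw t2 (carrier C) (carrier C)"
    by (rule bij_betw_byWitness[of _ s3], use tl sl ap[OF comp(1)] ap[OF comp(3)] in auto)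
       (rule bij_betw_byWitness[of _ s2], use tl sl ap[OF comp(2)] ap[OF comp(4)] in auto)
  define t1 where "t1 = U1 u"
  have t1: "t1 x el C" "inc (t1 x) = u *[CL] inc x *[CL] v" if "x el C" for x
  proof -
    have m: "u *[CL] inc x *[CL] v \<in> inc ` carrier C" using st that by blast
    show "t1 x el C" "inc (t1 x) = u *[CL] inc x *[CL] v"
      using the_inv_into_into[OF inc_inj m subset_refl] f_the_inv_into_f[OF inc_inj m] that v by (simp_all add: t1_def U1_def)
  qed
  have inc_eq: "x = y" if "inc x = inc y" "x el C" "y el C" for x y using inj_onD[OF inc_inj that(1)] that by simp
  have cancel: "v *[CL] (u *[CL] z) = z" "u *[CL] (v *[CL] z) = z" if "z el CL" for z
    using that uc vc v(2,3) by (simp_all add: CL.m_assoc[symmetric])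
  have t1l: "t1 \<in> lin_hom R C C"
  proof (rule lin_homI)
    show "t1 \<in> extensional (carrier C)" by (simp add: t1_def U1_def)
    fix x y assume "x el C" "y el C"
    then show "t1 (x \<^bold>+ y) = t1 x \<^bold>+ t1 y"
      by (intro inc_eq) (use uc vc in \<open>simp_all add: t1 inc_add CL.l_distr CL.r_distr\<close>)
  next
    fix r x assume r: "r el R" "x el C"
    then have "u *[CL] (rho r *[CL] inc x) = rho r *[CL] (u *[CL] inc x)" using Cr.\<rho>_assoc uc by simp
    then show "t1 (r \<bullet> x) = r \<bullet> t1 x"
      by (intro inc_eq) (use uc vc r in \<open>simp_all add: t1 inc_smult CL.m_assoc\<close>)
  qed (rule t1)
  have t1q: "q (t1 x) = q x" if x: "x el C" for x
  proof (rule rho_inj)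
    have "rho (q (t1 x)) = (u *[CL] inc x *[CL] v) *[CL] (u *[CL] inc x *[CL] v)"
      using inc_sq[of "t1 x"] t1 x by simp
    also have "\<dots> = u *[CL] ((inc x *[CL] inc x) *[CL] v)" using x uc vc by (simp add: CL.m_assoc cancel)
    also have "\<dots> = rho (q x)" using x uc vc by (simp add: inc_sq rho_central cancel)
    finally show "rho (q (t1 x)) = rho (q x)" .
  qed (use x t1 in auto)
  have "t1 ` carrier C = carrier C"
  proof
    show "carrier C \<subseteq> t1 ` carrier C"
    proof
      fix y assume y: "y el C"
      then obtain x where "x el C" "inc y = u *[CL] inc x *[CL] v" using st by blast
      then show "y \<in> t1 ` carrier C" using inc_eq[of y "t1 x"] y t1 by auto
    qed
  qed (use t1 in auto)
  moreover have "inj_on t1 (carrier C)"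
  proof (rule inj_onI)
    fix x y assume xy: "x el C" "y el C" "t1 x = t1 y"
    then have "v *[CL] ((u *[CL] inc x *[CL] v) *[CL] u) = v *[CL] ((u *[CL] inc y *[CL] v) *[CL] u)" using t1(2) by metis
    then show "x = y" using xy uc vc v by (intro inc_eq) (simp_all add: CL.m_assoc cancel)
  qed
  ultimately have t1O: "t1 \<in> Og" using t1l t1q by (simp add: Og_def bij_betw_def)
  have inter: "bd t3 t2 *[D.EM] al x = al (t1 x) *[D.EM] bd t3 t2" if x: "x el C" for x
  proof -
    have "inc (t1 x) *[CL] u = u *[CL] inc x" using x uc vc t1 v by (simp add: CL.m_assoc)
    then have "alp (inc (t1 x)) *[D.EM] alp u = alp u *[D.EM] alp (inc x)"
      using x uc t1(1) ap.hom_mult[of "inc (t1 x)" u] ap.hom_mult[of u "inc x"] by simp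
    then show ?thesis unfolding alp_inc[OF x] alp_inc[OF t1(1)[OF x]] t(3) by simp
  qed
  have qq: "q (t2 (cj (x \<star> a))) = q x \<otimes> q (t3 a)" if x: "x el C" "a el C" for x a
  proof -
    have "t2 (cj (x \<star> a)) = cj (t1 x \<star> t3 a)"
      using arg_cong[OF inter[OF x(1)], of "\<lambda>f. f (a, \<zero>[C])"] x tl t1 by simp
    then show ?thesis using x t1 tl by (simp add: multiplicative t1q)
  qed
  \<comment> \<open>The common multiplier of both blocks, read off at \<open>1\<close>; an element
    of trace one detects it below.\<close>
  define k where "k = q (t3 \<one>[C])"
  have k: "k el R" using tl by (simp add: k_def)
  have q2: "q (t2 x) = q x \<otimes> k" if "x el C" for x using qq[of "cj x" "\<one>[C]"] that by (simp add: k_def)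
  have q3: "q (t3 x) = q x \<otimes> k" if "x el C" for x
    using qq[of "\<one>[C]" x] that q2[of "cj x"] tl by (simp add: q_one)
  have "Cl_inv u = v"
    using arg_cong[OF us, of "\<lambda>z. v *[CL] z"] Cl_inv_simps(1)[OF uc] vc by (simp add: cancel)
  then have bD: "bD (alp u p) (alp u p') = bD p p'" if "p el D" "p' el D" for p p'
  proof -
    have "alp v (alp u p') = (alp (v *[CL] u)) p'" using that uc vc by simp
    then have "alp v (alp u p') = p'" using that v by simp
    moreover have "alp u p' el D" using D.End_apply(1)[OF ap.hom_closed[OF uc] that(2)] .
    ultimately show ?thesis using that bD_alp[OF uc that(1), of "alp u p'"] \<open>Cl_inv u = v\<close> by simp
  qed
  obtain y where y: "y el C" "tr y = \<one>" using exists_tr_one by blast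
  have z: "t3 \<zero>[C] = \<zero>[C]" "t2 \<zero>[C] = \<zero>[C]" using add_hom_zero[OF C_ag C_ag] tl(4) lin_homD(4)[OF t(2)] by blast+
  have "b (t3 y) (t3 \<one>[C]) = \<one>"
    using bD[of "(y, \<zero>[C])" "(\<one>[C], \<zero>[C])"] y tl by (simp add: t z bD_def)
  moreover have "b (t3 y) (t3 \<one>[C]) = tr y \<otimes> k"
  proof -
    have g: "r \<otimes> k \<ominus> r' \<otimes> k \<ominus> r'' \<otimes> k = (r \<ominus> r' \<ominus> r'') \<otimes> k" if "r el R" "r' el R" "r'' el R" for r r' r''
      using that k by algebra
    have "b (t3 y) (t3 \<one>[C]) = q (t3 (y \<^bold>+ \<one>[C])) \<ominus> q (t3 y) \<ominus> q (t3 \<one>[C])" using y tl by (simp add: polar_def)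
    also have "\<dots> = tr y \<otimes> k" using y by (simp add: q3 g polar_def)
    finally show ?thesis .
  qed
  ultimately have "k = \<one>" using k y by simp
  then have "t2 \<in> Og" "t3 \<in> Og" using q2 q3 bij t by (simp_all add: Og_def)
  then show "FF u \<in> RT" using t1O RTrel_iff[of t1 t2 t3] inter by (simp add: FF_def RT_def U t1_def[symmetric])
qed

text \<open>Faithfulness of \<open>alp\<close> reduces each Spin condition to matrices: the inverse
  is the lift of the inverse blocks, the action on vectors is \<open>RTrel_iff\<close>, and
  invariance of the nondegenerate \<open>bD\<close> under isometries gives the condition on the main
  involution.\<close>

lemma RT_Spin:
  assumes u: "u el CL" and t: "(t1, t2, t3) \<in> RT" and au: "alp u = bd t3 t2"
  shows "u el SpinG" "FF u = (t1, t2, t3)"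
proof -
  have o: "t1 \<in> Og" "t2 \<in> Og" "t3 \<in> Og" and r: "RTrel t1 t2 t3" using t by (simp_all add: RT_def)
  note f1 = Og_facts[OF o(1)] and f2 = Og_facts[OF o(2)] and f3 = Og_facts[OF o(3)]
  obtain s2 where s2: "s2 \<in> Og" "compose (carrier C) s2 t2 = (\<lambda>x\<in>carrier C. x)" "compose (carrier C) t2 s2 = (\<lambda>x\<in>carrier C. x)" using Og_inverse[OF o(2)] by blast
  obtain s3 where s3: "s3 \<in> Og" "compose (carrier C) s3 t3 = (\<lambda>x\<in>carrier C. x)" "compose (carrier C) t3 s3 = (\<lambda>x\<in>carrier C. x)" using Og_inverse[OF o(3)] by blast
  note g = Og_facts(1)[OF s2(1)] Og_facts(1)[OF s3(1)]
  obtain v where v: "v el CL" "alp v = bd s3 s2" using alp_surj[OF bd_closed[OF g(2,1)]] by (metis imageE)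
  have "alp (u *[CL] v) = alp \<one>[CL]" "alp (v *[CL] u) = alp \<one>[CL]"
    using u v au f2(1) f3(1) g s2 s3 by (simp_all add: bd_mult bd_id)
  then have uv: "u *[CL] v = \<one>[CL]" "v *[CL] u = \<one>[CL]" using alp_inj u v by auto
  have even: "u \<in> cl_even" "v \<in> cl_even" using even_iff u v au f2(1) f3(1) g by blast+
  have inv: "inv\<^bsub>CL\<^esub> u = v" using CL.inv_unique'[of u v] u v uv by simp
  have conj: "u *[CL] inc x *[CL] v = inc (t1 x)" if x: "x el C" for x
  proof -
    have "u *[CL] inc x = inc (t1 x) *[CL] u"
    proof (rule alp_inj)
      show "alp (u *[CL] inc x) = alp (inc (t1 x) *[CL] u)"
        using RTrel_iff[OF o] r x u f1(2)[OF x] by (simp add: au alp_inc)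
    qed (use x u f1(2)[OF x] in auto)
    then show ?thesis using x u v(1) uv f1(2)[OF x] by (simp add: CL.m_assoc)
  qed
  have "{u *[CL] inc x *[CL] inv\<^bsub>CL\<^esub> u | x. x el C} = inc ` (t1 ` carrier C)"
    unfolding inv using conj by (force simp: image_iff)
  also have "\<dots> = inc ` carrier C" using bij_betw_imp_surj_on[OF f1(7)] by simp
  finally have st: "{u *[CL] inc x *[CL] inv\<^bsub>CL\<^esub> u | x. x el C} = inc ` carrier C" .
  have su: "Cl_inv u el CL" using Cl_inv_simps(1)[OF u] .
  have "Cl_inv u *[CL] u = \<one>[CL]"
  proof (rule alp_inj)
    show "alp (Cl_inv u *[CL] u) = alp \<one>[CL]"
    proof (rule D.End_eqI)
      fix p assume p: "p el D"
      have up: "alp u p' el D" if "p' el D" for p' using D.End_apply(1)[OF ap.hom_closed[OF u] that] .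
      have "bD p' (alp (Cl_inv u) (alp u p)) = bD p' p" if p': "p' el D" for p'
      proof -
        have "bD p' (alp (Cl_inv u) (alp u p)) = bD (alp u p') (alp u p)" using bD_alp[OF u p' up[OF p]] by simp
        also have "\<dots> = bD p' p" using p p' by (cases p, cases p') (simp add: au bD_def f2 f3)
        finally show ?thesis .
      qed
      then have "alp (Cl_inv u) (alp u p) = p"
        using D.End_apply(1)[OF ap.hom_closed[OF su] up[OF p]] p by (intro bD_nondegenerate) auto
      then show "alp (Cl_inv u *[CL] u) p = alp \<one>[CL] p" using su u p by simp
    qed (use su u in auto)
  qed (use su u in auto)
  \<comment> \<open>So far \<open>Cl_inv u\<close> is a left inverse; identifying it with
    \<open>v\<close> gives the required order of factors.\<close>
  then have "Cl_inv u = v"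
    using CL.m_assoc[OF su u v(1)] uv su v(1) by simp
  then have us: "u *[CL] Cl_inv u = \<one>[CL]" using uv by simp
  have "u \<in> Units (Cl_even R C q)" using even uv by (auto simp: Units_def Cl_even_eq)
  with st us show "u el SpinG" by (simp add: SpinG_def)
  have "U1 u = t1"
  proof (rule extensionalityI[of _ "carrier C"])
    show "t1 \<in> extensional (carrier C)" using lin_homD(5)[OF f1(1)] .
    fix x assume x: "x el C"
    show "U1 u x = t1 x" using x f1(2)[OF x] the_inv_into_f_f[OF inc_inj, of "t1 x"] by (simp add: U1_def inv conj)
  qed (simp add: U1_def)
  then show "FF u = (t1, t2, t3)" using U23[OF f3(1) f2(1) au] by (simp add: FF_def)
qed

text \<open>Closure is deduced from that of related triples through \<open>RT_Spin\<close>; inverses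
  in \<open>SpinG\<close> are obtained from those of triples in the same spirit below.\<close>

lemma Spin_mult:
  assumes u: "u el SpinG" and w: "w el SpinG"
  shows "u *[SpinG] w el SpinG" "FF (u *[SpinG] w) = FF u *[RTG] FF w"
proof -
  note f = Spin_RT[OF u] and g = Spin_RT[OF w]
  have r: "(compose (carrier C) (U1 u) (U1 w), compose (carrier C) (U2 u) (U2 w), compose (carrier C) (U3 u) (U3 w)) \<in> RT"
    using RT_mult f(2) g(2) unfolding FF_def by blast
  have l: "U2 u \<in> lin_hom R C C" "U2 w \<in> lin_hom R C C" "U3 u \<in> lin_hom R C C" "U3 w \<in> lin_hom R C C"
    using f(2) g(2) Og_facts(1) unfolding FF_def RT_def by auto
  have a: "alp (u *[CL] w) = bd (compose (carrier C) (U3 u) (U3 w)) (compose (carrier C) (U2 u) (U2 w))"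
    using f(1,3) g(1,3) l by (simp add: bd_mult)
  have uw: "u *[CL] w el CL" using f(1) g(1) by simp
  show "u *[SpinG] w el SpinG" using RT_Spin(1)[OF uw r a] by (simp add: SpinG_def)
  show "FF (u *[SpinG] w) = FF u *[RTG] FF w" using RT_Spin(2)[OF uw r a] by (simp add: SpinG_def FF_def RTG_simps)
qed

lemma FF_bij: "bij_betw FF (carrier SpinG) RT"
proof (rule bij_betw_imageI)
  show "inj_on FF (carrier SpinG)"
  proof (rule inj_onI)
    fix u w assume u: "u el SpinG" and w: "w el SpinG" and eq: "FF u = FF w"
    show "u = w" by (rule alp_inj) (use Spin_RT(1,3)[OF u] Spin_RT(1,3)[OF w] eq in \<open>simp_all add: FF_def\<close>)
  qed
  show "FF ` carrier SpinG = RT"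
  proof
    show "RT \<subseteq> FF ` carrier SpinG"
    proof
      fix t assume t: "t \<in> RT"
      obtain t1 t2 t3 where tt: "t = (t1, t2, t3)" by (cases t)
      have "t2 \<in> lin_hom R C C" "t3 \<in> lin_hom R C C" using t Og_facts(1) by (auto simp: tt RT_def)
      then obtain u where u: "u el CL" "alp u = bd t3 t2" using alp_surj[OF bd_closed] by (metis imageE)
      show "t \<in> FF ` carrier SpinG" using RT_Spin[OF u(1) t[unfolded tt] u(2)] tt by (intro image_eqI) auto
    qed
  qed (use Spin_RT(2) in blast)
qed

lemma group_SpinG: "group SpinG"
proof -
  interpret RTG: group RTG by (rule group_RTG)
  have c: "u el CL" if "u el SpinG" for u using Spin_RT(1)[OF that] .
  have m: "monoid.mult SpinG = monoid.mult CL" "\<one>[SpinG] = \<one>[CL]" by (simp_all add: SpinG_def)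
  have id: "((\<lambda>x\<in>carrier C. x), (\<lambda>x\<in>carrier C. x), (\<lambda>x\<in>carrier C. x)) \<in> RT"
    using RTG.one_closed by (simp add: RTG_simps)
  have one: "\<one>[CL] el SpinG" "FF \<one>[CL] = \<one>[RTG]"
    using RT_Spin[OF CL.one_closed id] by (simp_all add: bd_id RTG_simps)
  show ?thesis
  proof (rule groupI)
    show "\<one>[SpinG] el SpinG" using one m by simp
    fix u assume u: "u el SpinG"
    show "\<one>[SpinG] *[SpinG] u = u" using c[OF u] by (simp add: m)
    have "FF u el RTG" using Spin_RT(2)[OF u] by (simp add: RTG_simps)
    note iv = RTG.inv_closed[OF this] RTG.l_inv[OF this]
    have "inv\<^bsub>RTG\<^esub> FF u \<in> FF ` carrier SpinG" using iv(1) unfolding bij_betw_imp_surj_on[OF FF_bij] RTG_simps(1) .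
    then obtain w where w0: "inv\<^bsub>RTG\<^esub> FF u = FF w" and w1: "w el SpinG" by (rule imageE)
    have w: "w el SpinG" "FF w *[RTG] FF u = \<one>[RTG]" using w1 iv(2) unfolding w0 by simp_all
    have "w *[SpinG] u = \<one>[CL]"
      by (rule inj_onD[OF bij_betw_imp_inj_on[OF FF_bij]]) (use Spin_mult[OF w(1) u] w one in simp_all)
    then show "\<exists>w\<in>carrier SpinG. w *[SpinG] u = \<one>[SpinG]" unfolding m(2) using w(1) by (rule bexI)
    fix w assume w: "w el SpinG"
    show "u *[SpinG] w el SpinG" by (rule Spin_mult(1)[OF u w])
    fix x assume x: "x el SpinG"
    show "u *[SpinG] w *[SpinG] x = u *[SpinG] (w *[SpinG] x)"
      unfolding m by (rule CL.m_assoc[OF c[OF u] c[OF w] c[OF x]])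
  qed
qed

lemma FF_iso: "FF \<in> iso SpinG RTG"
  by (rule isoI) (use Spin_mult FF_bij Spin_RT(2) in \<open>auto simp: hom_def RTG_simps\<close>)

end

section \<open>Change of scalars for isometries, Clifford algebras and triples\<close>

section \<open>Functoriality\<close>

context octonionic_extension begin

text \<open>Both sides are linear in each argument, so the vectors coming from \<open>C\<close>
  suffice; coordinates and functoriality both test the relation there.\<close>

lemma RTrel_ii:
  assumes l: "t1 \<in> lin_hom S T T" "t2 \<in> lin_hom S T T" "t3 \<in> lin_hom S T T"
    and eq: "\<And>x y. [|x el C; y el C|] ==> t1 (ii x *[T] ii y) = CT.cj (t2 (CT.cj (ii x))) *[T] CT.cj (t3 (CT.cj (ii y)))"
  shows "OT.RTrel t1 t2 t3"
  unfolding OT.RTrel_def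
proof (intro ballI)
  note sm = lin_homD(1-3)[OF l(1)] lin_homD(1-3)[OF l(2)] lin_homD(1-3)[OF l(3)] CT.cj_add CT.cj_smult T_simps
  have 1: "t1 (x *[T] ii y) = CT.cj (t2 (CT.cj x)) *[T] CT.cj (t3 (CT.cj (ii y)))" if "x el T" "y el C" for x y
    using that(1) by (induction x rule: E.T_induct') (use that(2) eq in \<open>simp_all add: sm\<close>)
  fix x y assume x: "x el T" and y: "y el T"
  show "t1 (x *[T] y) = CT.cj (t2 (CT.cj x)) *[T] CT.cj (t3 (CT.cj y))"
    using y by (induction y rule: E.T_induct') (use x 1 in \<open>simp_all add: sm\<close>)
qed

lemma points_eq: "Spin_points R C q S = OT.SpinG" "RT_points R C q S = OT.RTG" "F_map R C q S = OT.FF"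
proof -
  have al: "alpha R C q S = OT.al" by (rule ext) (simp add: alpha_def OT.al_def)
  have alp: "alpha' R C q S = OT.alp" by (simp add: alpha'_def OT.alp_def al)
  have bd: "block_diag R C S v w = OT.bd v w" for v w by (simp add: block_diag_def OT.bd_def)
  show "Spin_points R C q S = OT.SpinG" by (simp add: Spin_points_def OT.SpinG_def)
  have "O_points R C q S = OT.Og" by (simp add: O_points_def OT.Og_def)
  then show "RT_points R C q S = OT.RTG" by (simp add: RT_points_def OT.RTG_def OT.RT_def OT.RTrel_def)
  show "F_map R C q S = OT.FF"
    by (rule ext) (simp add: F_map_def OT.FF_def u1_def u2_def u3_def OT.U1_def OT.U2_def OT.U3_def alp bd)
qed

end

locale octonionic_map = A: octonionic_extension R C q S + B: octonionic_extension R C q V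
  for R :: "('r, 'z) ring_scheme" (structure) and C :: "('r, 'c) module" (structure) and q :: "'c => 'r"
    and S :: "('r, 's) module" and V :: "('r, 't) module" +
  fixes h :: "'s => 't"
  assumes h: "h \<in> alg_hom R S V"

context octonionic_map begin

abbreviation "H \<equiv> base_change_map R C S V h"
abbreviation "EMap \<equiv> End_map R C S V h"
abbreviation "CMap \<equiv> Cl_map R C q S V h"

lemma h_facts [simp]:
  "s el S ==> h s el V" "[|s el S; t el S|] ==> h (s +[S] t) = h s +[V] h t"
  "[|s el S; t el S|] ==> h (s *[S] t) = h s *[V] h t" "h \<one>[S] = \<one>[V]" "r el R ==> h (A.hS r) = B.hS r"
  using h A.S.one_closed by (auto simp: alg_hom_def ring_hom_def A.E.hS_def B.E.hS_def)

lemma H_add_hom: "H \<in> add_hom A.T B.T"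
  and H_smult: "[|s el S; z el A.T|] ==> H (s .[A.T] z) = h s .[B.T] H z"
  and H_ii: "x el C ==> H (A.ii x) = B.ii x"
  using base_change_map_facts[OF A.module_axioms A.S.algebra_axioms B.S.algebra_axioms h]
  by (auto simp: A.E.ii_def B.E.ii_def A.S.one_closed)

lemma H_closed [simp, intro]: "z el A.T ==> H z el B.T"
  by (rule add_hom_closed[OF H_add_hom])

lemma H_add: "[|z el A.T; w el A.T|] ==> H (z +[A.T] w) = H z +[B.T] H w"
  by (rule add_hom_add[OF H_add_hom])

lemmas T_lin = A.T_simps B.T_simps H_add H_smult H_ii A.E.Tm.smult_closed B.E.Tm.smult_closed

lemma H_mult:
  assumes "z el A.T" "w el A.T"
  shows "H (z *[A.T] w) = H z *[B.T] H w"
  using assms(1)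
proof (induction z rule: A.E.T_induct')
  case (smult x s)
  have "H (A.ii x *[A.T] w) = B.ii x *[B.T] H w" using assms(2)
    by (induction w rule: A.E.T_induct') (use smult in \<open>simp_all add: T_lin A.E.ii_mult[symmetric] B.E.ii_mult[symmetric] A.mult_closed\<close>)
  then show ?case using smult assms(2) by (simp add: T_lin)
qed (use assms in \<open>simp add: T_lin\<close>)

lemma H_one: "H \<one>[A.T] = \<one>[B.T]"
  by (simp add: A.E.ii_one B.E.ii_one H_ii A.one_closed)

lemma B_H:
  assumes "z el A.T" "w el A.T"
  shows "B.B (H z) (H w) = h (A.B z w)"
  using assms(1)
proof (induction z rule: A.E.T_induct')
  case (smult x s)
  have "B.B (B.ii x) (H w) = h (A.B (A.ii x) w)" using assms(2)
    by (induction w rule: A.E.T_induct') (use smult in \<open>simp_all add: T_lin A.B_ii B.B_ii\<close>)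
  then show ?case using smult assms(2) by (simp add: T_lin)
qed (use assms in \<open>simp add: T_lin\<close>)

lemma QS_H: "z el A.T ==> B.QS (H z) = h (A.QS z)"
proof (induction z rule: A.E.T_induct')
  case (add z w) then show ?case by (simp add: H_add A.Q.q_add B.Q.q_add B_H)
qed (simp add: T_lin A.Q.q_smult B.Q.q_smult A.QS_facts B.QS_facts)

lemma cj_H: "z el A.T ==> B.CT.cj (H z) = H (A.CT.cj z)"
  using add_hom_minus[OF A.Q.C_ag B.Q.C_ag H_add_hom, of "A.B z \<one>[A.T] .[A.T] \<one>[A.T]" z] B_H[of z "\<one>[A.T]"]
  by (simp add: conjugate_def H_smult H_one)

text \<open>The image of \<open>H\<close> contains the vectors coming from \<open>C\<close>, which
  generate over \<open>V\<close>; this is the uniqueness behind \<open>End_map\<close>.\<close>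

lemma lin_hom_H_eqI:
  assumes t: "t \<in> lin_hom V B.T B.T" and t': "t' \<in> lin_hom V B.T B.T" and eq: "\<And>z. z el A.T ==> t (H z) = t' (H z)"
  shows "t = t'"
proof (rule lin_hom_eqI[OF t t'])
  have eq': "t (B.ii x) = t' (B.ii x)" if "x el C" for x using eq[of "A.ii x"] that by (simp add: H_ii)
  fix y assume "y el B.T"
  then show "t y = t' y"
    by (induction y rule: B.E.T_induct') (simp_all add: lin_homD[OF t] lin_homD[OF t'] eq')
qed

text \<open>Both modules are base changes of \<open>C\<close>, so a dual pair of \<open>C\<close>
  lives over either ring: the images of its vectors under \<open>t\<close> are pushed forward by
  \<open>H\<close> and recombined with coordinates over \<open>V\<close>.\<close>

lemma End_map_exists:
  assumes t: "t \<in> lin_hom S A.T A.T"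
  shows "\<exists>t'\<in>lin_hom V B.T B.T. \<forall>z\<in>carrier A.T. t' (H z) = H (t z)"
proof -
  obtain n e f where d: "A.dual_pair n e f" using A.dual by blast
  note c = A.dual_pairD(1,2)[OF d]
  note tl = lin_homD[OF t]
  let ?t = "\<lambda>y\<in>carrier B.T. \<Oplus>\<^bsub>B.T\<^esub>k\<in>{..<n}. B.B y (B.ii (f k)) .[B.T] H (t (A.ii (e k)))"
  have cl: "(\<lambda>k. B.B y (B.ii (f k)) .[B.T] H (t (A.ii (e k)))) \<in> {..<n} \<rightarrow> carrier B.T" if "y el B.T" for y
    using that c tl by auto
  have "?t \<in> lin_hom V B.T B.T"
  proof (rule lin_homI)
    fix y assume y: "y el B.T"
    show "?t y el B.T" using B.E.T.finsum_closed[OF cl[OF y]] y by simp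
    fix y' assume y': "y' el B.T"
    have "?t (y +[B.T] y') = (\<Oplus>\<^bsub>B.T\<^esub>k\<in>{..<n}. B.B y (B.ii (f k)) .[B.T] H (t (A.ii (e k))) +[B.T] B.B y' (B.ii (f k)) .[B.T] H (t (A.ii (e k))))"
      using y y' by (simp, intro B.E.T.finsum_cong') (use cl c tl in \<open>auto simp: B.Q.b_add_left B.E.Tm.smult_l_distr\<close>)
    also have "\<dots> = ?t y +[B.T] ?t y'" using B.E.T.finsum_addf[OF cl[OF y] cl[OF y']] y y' by simp
    finally show "?t (y +[B.T] y') = ?t y +[B.T] ?t y'" .
  next
    fix r y assume r: "r el V" and y: "y el B.T"
    have "?t (r .[B.T] y) = (\<Oplus>\<^bsub>B.T\<^esub>k\<in>{..<n}. r .[B.T] (B.B y (B.ii (f k)) .[B.T] H (t (A.ii (e k)))))"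
      using r y by (simp, intro B.E.T.finsum_cong') (use cl c tl in \<open>auto simp: B.Q.b_smult_left B.E.Tm.smult_assoc1\<close>)
    also have "\<dots> = r .[B.T] ?t y" using B.E.Tm.finsum_smult_ldistr[OF _ r cl[OF y]] y by simp
    finally show "?t (r .[B.T] y) = r .[B.T] ?t y" .
  qed simp
  moreover have "?t (H z) = H (t z)" if z: "z el A.T" for z
  proof -
    have cl2: "(\<lambda>k. A.B z (A.ii (f k)) .[A.T] A.ii (e k)) \<in> {..<n} \<rightarrow> carrier A.T" using z c by auto
    have "H (t z) = H (t (\<Oplus>\<^bsub>A.T\<^esub>k\<in>{..<n}. A.B z (A.ii (f k)) .[A.T] A.ii (e k)))"
      using A.Q.dual_pairD(3)[OF A.dual_pair_T[OF d] z] by simp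
    also have "\<dots> = H (\<Oplus>\<^bsub>A.T\<^esub>k\<in>{..<n}. t (A.B z (A.ii (f k)) .[A.T] A.ii (e k)))"
      using add_hom_finsum[OF A.Q.C_ag A.Q.C_ag tl(4) _ cl2] by simp
    also have "\<dots> = (\<Oplus>\<^bsub>B.T\<^esub>k\<in>{..<n}. H (t (A.B z (A.ii (f k)) .[A.T] A.ii (e k))))"
      by (rule add_hom_finsum[OF A.Q.C_ag B.Q.C_ag H_add_hom]) (use z c tl in auto)
    also have "\<dots> = ?t (H z)"
      using z c tl by (simp, intro B.E.T.finsum_cong') (auto simp: H_smult B_H[symmetric] H_ii)
    finally show ?thesis by simp
  qed
  ultimately show ?thesis by blast
qed

lemma End_map_eqI:
  assumes "t' \<in> lin_hom V B.T B.T" "\<And>z. z el A.T ==> t' (H z) = H (t z)"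
  shows "EMap t = t'"
  unfolding End_map_def by (rule the_equality) (use assms lin_hom_H_eqI in \<open>auto\<close>)

lemma End_map:
  assumes t: "t \<in> lin_hom S A.T A.T"
  shows "EMap t \<in> lin_hom V B.T B.T" "z el A.T ==> EMap t (H z) = H (t z)"
proof -
  obtain t' where t': "t' \<in> lin_hom V B.T B.T" "\<forall>z\<in>carrier A.T. t' (H z) = H (t z)" using End_map_exists[OF t] by blast
  then have "EMap t = t'" by (intro End_map_eqI) auto
  with t' show "EMap t \<in> lin_hom V B.T B.T" "z el A.T ==> EMap t (H z) = H (t z)" by simp_all
qed

lemma End_map_id: "EMap (\<lambda>x\<in>carrier A.T. x) = (\<lambda>x\<in>carrier B.T. x)"
  by (rule End_map_eqI) (auto simp: B.OT.lin_hom_id)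

lemma End_map_comp:
  assumes s: "s \<in> lin_hom S A.T A.T" and t: "t \<in> lin_hom S A.T A.T"
  shows "EMap (compose (carrier A.T) s t) = compose (carrier B.T) (EMap s) (EMap t)"
  by (rule End_map_eqI[OF B.OT.lin_hom_comp[OF End_map(1)[OF s] End_map(1)[OF t]]])
    (use s t in \<open>simp add: compose_def End_map lin_homD\<close>)

lemma End_map_Og:
  assumes t: "t \<in> A.OT.Og"
  shows "EMap t \<in> B.OT.Og"
proof -
  note f = A.OT.Og_facts[OF t]
  note m = End_map[OF f(1)] and l = lin_homD[OF End_map(1)[OF f(1)]]
  obtain s where s: "s \<in> A.OT.Og" "compose (carrier A.T) s t = (\<lambda>x\<in>carrier A.T. x)" "compose (carrier A.T) t s = (\<lambda>x\<in>carrier A.T. x)"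
    using A.OT.Og_inverse[OF t] by blast
  note sl = A.OT.Og_facts(1)[OF s(1)]
  have c: "compose (carrier B.T) (EMap s) (EMap t) = (\<lambda>x\<in>carrier B.T. x)" "compose (carrier B.T) (EMap t) (EMap s) = (\<lambda>x\<in>carrier B.T. x)"
    using End_map_comp[OF sl f(1)] End_map_comp[OF f(1) sl] s End_map_id by simp_all
  have ap: "f (g x) = x" if "compose (carrier B.T) f g = (\<lambda>x\<in>carrier B.T. x)" "x el B.T" for f g x
    using fun_cong[OF that(1), of x] that(2) by (simp add: compose_def)
  have "bij_betw (EMap t) (carrier B.T) (carrier B.T)"
    by (rule bij_betw_byWitness[of _ "EMap s"]) (use l lin_homD[OF End_map(1)[OF sl]] ap[OF c(1)] ap[OF c(2)] in auto)
  moreover have "B.QS (EMap t y) = B.QS y" if y: "y el B.T" for y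
  proof (rule B.E.quadratic_form_unique[OF _ B.QS_facts(2) _ y])
    show "quadratic_form V B.T (\<lambda>y. B.QS (EMap t y))"
      by (rule B.E.Tm.quadratic_formI[where B = "\<lambda>x y. B.B (EMap t x) (EMap t y)"])
        (simp_all add: l B.Q.q_smult B.Q.b_add_right B.Q.b_smult_right, simp add: polar_def l)
    show "B.QS (EMap t (B.ii x)) = B.QS (B.ii x)" if "x el C" for x
      using that m(2)[of "A.ii x"] by (simp add: H_ii[symmetric] QS_H f)
  qed
  ultimately show ?thesis using m(1) by (simp add: B.OT.Og_def)
qed

lemma End_map_RT:
  assumes t: "(t1, t2, t3) \<in> A.OT.RT"
  shows "(EMap t1, EMap t2, EMap t3) \<in> B.OT.RT"
proof -
  have o: "t1 \<in> A.OT.Og" "t2 \<in> A.OT.Og" "t3 \<in> A.OT.Og" and r: "A.OT.RTrel t1 t2 t3" using t by (simp_all add: A.OT.RT_def)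
  note m1 = End_map[OF A.OT.Og_facts(1)[OF o(1)]] and m2 = End_map[OF A.OT.Og_facts(1)[OF o(2)]] and m3 = End_map[OF A.OT.Og_facts(1)[OF o(3)]]
  note f = A.OT.Og_facts(2)[OF o(1)] A.OT.Og_facts(2)[OF o(2)] A.OT.Og_facts(2)[OF o(3)]
  have "B.OT.RTrel (EMap t1) (EMap t2) (EMap t3)"
  proof (rule B.RTrel_ii[OF m1(1) m2(1) m3(1)])
    fix x y assume c: "x el C" "y el C"
    then have xy: "A.ii x el A.T" "A.ii y el A.T" by simp_all
    have "t1 (A.ii x *[A.T] A.ii y) = A.CT.cj (t2 (A.CT.cj (A.ii x))) *[A.T] A.CT.cj (t3 (A.CT.cj (A.ii y)))"
      using r xy by (simp add: A.OT.RTrel_def)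
    from arg_cong[OF this, of H] show "EMap t1 (B.ii x *[B.T] B.ii y) =
      B.CT.cj (EMap t2 (B.CT.cj (B.ii x))) *[B.T] B.CT.cj (EMap t3 (B.CT.cj (B.ii y)))"
      using xy f m1(2)[of "A.ii x *[A.T] A.ii y"] by (simp add: H_ii[OF c(1), symmetric] H_ii[OF c(2), symmetric] H_mult cj_H m2 m3)
  qed
  then show ?thesis using o by (simp add: B.OT.RT_def End_map_Og)
qed

text \<open>The scalars enter through \<open>h\<close> followed by the structure map of the target,
  which \<open>CL_universal\<close> admits because it asks only for a central ring
  homomorphism.\<close>

lemma Cl_map: "CMap \<in> ring_hom A.Q.CL B.Q.CL" "s el S ==> CMap (A.Q.rho s) = B.Q.rho (h s)"
  "x el A.T ==> CMap (A.Q.inc x) = B.Q.inc (H x)"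
proof -
  let ?P = "\<lambda>g. g \<in> ring_hom A.Q.CL B.Q.CL \<inter> extensional (carrier A.Q.CL) \<and> (\<forall>s\<in>carrier S. g (A.Q.rho s) = B.Q.rho (h s)) \<and>
    (\<forall>x\<in>carrier A.T. g (A.Q.inc x) = B.Q.inc (H x))"
  have hh: "h \<in> ring_hom S V" using h by (simp add: alg_hom_def)
  have "\<exists>g\<in>ring_hom A.Q.CL B.Q.CL. (\<forall>s\<in>carrier S. g (A.Q.rho s) = (B.Q.rho \<circ> h) s) \<and> (\<forall>x\<in>carrier A.T. g (A.Q.inc x) = B.Q.inc (H x))"
    by (rule A.Q.CL_universal[OF B.Q.ring_CL ring_hom_trans[OF hh B.Q.rho_hom]])
      (simp_all add: B.Q.rho_central B.Q.inc_add B.Q.inc_smult B.Q.inc_sq H_add H_smult QS_H)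
  then obtain g where g: "g \<in> ring_hom A.Q.CL B.Q.CL" and g': "(\<forall>s\<in>carrier S. g (A.Q.rho s) = (B.Q.rho \<circ> h) s) \<and> (\<forall>x\<in>carrier A.T. g (A.Q.inc x) = B.Q.inc (H x))"
    by (rule bexE)
  let ?g = "restrict g (carrier A.Q.CL)"
  have rg: "?g \<in> ring_hom A.Q.CL B.Q.CL"
    by (rule ring_hom_memI) (simp_all add: ring_hom_closed[OF g] ring_hom_mult[OF g] ring_hom_add[OF g] ring_hom_one[OF g])
  have P: "?P ?g" using rg g' by simp
  have "?P (THE g. ?P g)"
  proof (rule theI[of ?P ?g, OF P])
    fix f assume f: "?P f"
    show "f = ?g"
    proof (rule extensionalityI[of _ "carrier A.Q.CL"])
      fix z assume z: "z el A.Q.CL"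
      show "f z = ?g z" by (rule A.Q.CL_hom_eq[OF _ rg _ _ z]) (use f P in simp_all)
    qed (use f in simp_all)
  qed
  then have "?P CMap" by (simp add: Cl_map_def A.Q.rho_def B.Q.rho_def)
  then show "CMap \<in> ring_hom A.Q.CL B.Q.CL" "s el S ==> CMap (A.Q.rho s) = B.Q.rho (h s)"
    "x el A.T ==> CMap (A.Q.inc x) = B.Q.inc (H x)" by blast+
qed

abbreviation "H2 p \<equiv> (H (fst p), H (snd p))"

lemma alp_natural:
  assumes "z el A.Q.CL"
  shows "p el A.OT.D ==> B.OT.alp (CMap z) (H2 p) = H2 (A.OT.alp z p)"
  using assms
proof (induction z arbitrary: p rule: A.Q.CL_induct)
  case (scalar r)
  then show ?case by (cases p) (simp add: Cl_map(2) A.OT.alp_rho B.OT.alp_rho H_smult)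
next
  case (vector x z)
  note Z = ring_hom_closed[OF Cl_map(1) vector(2)]
  have "A.OT.alp z p el A.OT.D" using A.OT.D.End_apply(1)[OF A.OT.ap.hom_closed[OF vector(2)] vector.prems] .
  then obtain a y where a: "A.OT.alp z p = (a, y)" "a el A.T" "y el A.T" by (cases "A.OT.alp z p") simp
  have "H2 p el B.OT.D" using vector.prems by (simp add: A.OT.D_carrier)
  then have "B.OT.alp (CMap (A.Q.inc x *[A.Q.CL] z)) (H2 p) = B.OT.al (H x) (B.OT.alp (CMap z) (H2 p))"
    using vector Z by (simp add: ring_hom_mult[OF Cl_map(1)] Cl_map(3) B.OT.alp_inc)
  also have "\<dots> = H2 (A.OT.alp (A.Q.inc x *[A.Q.CL] z) p)"
    using vector a by (simp add: A.OT.alp_inc cj_H H_mult[symmetric])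
  finally show ?case .
next
  case (add z w)
  have c: "A.OT.alp v p el A.OT.D" if "v el A.Q.CL" for v using A.OT.D.End_apply(1)[OF A.OT.ap.hom_closed[OF that] add.prems] .
  have "H2 p el B.OT.D" using add.prems by (simp add: A.OT.D_carrier)
  then show ?case using add c[of z] c[of w] ring_hom_closed[OF Cl_map(1)]
    by (simp add: ring_hom_add[OF Cl_map(1)] A.OT.D_add A.OT.D_carrier H_add)
qed

text \<open>The matrix of \<open>CMap u\<close> and the extended blocks agree on vectors coming from
  \<open>A.T\<close>, hence everywhere by linearity. \<open>RT_Spin\<close> then gives membership in
  the spin group and the value of the map together.\<close>

lemma Spin_map:
  assumes u: "u el A.OT.SpinG" and t: "A.OT.FF u = (t1, t2, t3)"
  shows "CMap u el B.OT.SpinG" "B.OT.FF (CMap u) = (EMap t1, EMap t2, EMap t3)"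
proof -
  note U = A.OT.Spin_RT[OF u]
  have RT: "(t1, t2, t3) \<in> A.OT.RT" and au: "A.OT.alp u = A.OT.bd t3 t2" using U(2,3) t by (simp_all add: A.OT.FF_def)
  have l: "t2 \<in> lin_hom S A.T A.T" "t3 \<in> lin_hom S A.T A.T" using RT A.OT.Og_facts(1) by (auto simp: A.OT.RT_def)
  note m2 = End_map[OF l(1)] and m3 = End_map[OF l(2)]
  note gu = ring_hom_closed[OF Cl_map(1) U(1)]
  let ?a = "B.OT.alp (CMap u)" and ?b = "B.OT.bd (EMap t3) (EMap t2)"
  have ac: "?a el B.OT.D.EM" using gu by simp
  have bc: "?b el B.OT.D.EM" by (rule B.OT.bd_closed[OF m3(1) m2(1)])
  have eq: "?a (H x, H y) = ?b (H x, H y)" if "x el A.T" "y el A.T" for x y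
    using alp_natural[OF U(1), of "(x, y)"] that m2 m3 by (simp add: au)
  have H0: "H \<zero>[A.T] = \<zero>[B.T]" by (rule add_hom_zero[OF A.Q.C_ag B.Q.C_ag H_add_hom])
  note aD = B.OT.D.End_apply[OF ac] and bD = B.OT.D.End_apply[OF bc]
  have e1: "?a (x, \<zero>[B.T]) = ?b (x, \<zero>[B.T])" if "x el B.T" for x
    using that
  proof (induction x rule: B.E.T_induct')
    case (smult x s)
    then show ?case using aD(3)[of s "(B.ii x, \<zero>[B.T])"] bD(3)[of s "(B.ii x, \<zero>[B.T])"] eq[of "A.ii x" "\<zero>[A.T]"]
      by (simp add: H0 H_ii del: B.OT.bd_apply)
  next
    case (add z w)
    then show ?case using aD(2)[of "(z, \<zero>[B.T])" "(w, \<zero>[B.T])"] bD(2)[of "(z, \<zero>[B.T])" "(w, \<zero>[B.T])"]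
      by (simp del: B.OT.bd_apply)
  qed
  have e2: "?a (\<zero>[B.T], x) = ?b (\<zero>[B.T], x)" if "x el B.T" for x
    using that
  proof (induction x rule: B.E.T_induct')
    case (smult x s)
    then show ?case using aD(3)[of s "(\<zero>[B.T], B.ii x)"] bD(3)[of s "(\<zero>[B.T], B.ii x)"] eq[of "\<zero>[A.T]" "A.ii x"]
      by (simp add: H0 H_ii del: B.OT.bd_apply)
  next
    case (add z w)
    then show ?case using aD(2)[of "(\<zero>[B.T], z)" "(\<zero>[B.T], w)"] bD(2)[of "(\<zero>[B.T], z)" "(\<zero>[B.T], w)"]
      by (simp del: B.OT.bd_apply)
  qed
  have "?a = ?b"
  proof (rule B.OT.D.End_eqI[OF ac bc])
    fix p assume "p el B.OT.D"
    then obtain x y where p: "p = (x, y)" "x el B.T" "y el B.T" by (cases p) simp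
    show "?a p = ?b p"
      using aD(2)[of "(x, \<zero>[B.T])" "(\<zero>[B.T], y)"] bD(2)[of "(x, \<zero>[B.T])" "(\<zero>[B.T], y)"] e1[OF p(2)] e2[OF p(3)] p
      by (simp del: B.OT.bd_apply)
  qed
  then show "CMap u el B.OT.SpinG" "B.OT.FF (CMap u) = (EMap t1, EMap t2, EMap t3)"
    using B.OT.RT_Spin[OF gu End_map_RT[OF RT]] by simp_all
qed

end

section \<open>Polynomial equations for related triples\<close>

section \<open>Coordinates for related triples\<close>

text \<open>Entry \<open>(i, j)\<close> of the \<open>k\<close>-th matrix becomes one variable,
  since the coordinate algebra has its variables indexed by natural numbers.\<close>

definition enc :: "nat => nat => nat => nat" where
  "enc k i j = prod_encode (k, prod_encode (i, j))"

lemma enc_inject [simp]: "enc k i j = enc k' i' j' \<longleftrightarrow> k = k' \<and> i = i' \<and> j = j'"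
  by (auto simp: enc_def)

context octonionic_extension begin

definition cf where "cf n f a k x i = (\<Oplus>\<^bsub>S\<^esub>j\<in>{..<n}. B x (ii (f j)) *[S] a (enc k i j))"

text \<open>The endomorphism described by the \<open>k\<close>-th matrix of \<open>a\<close> in the
  dual pair. The \<open>e i\<close> are generators rather than a basis, so distinct matrices may
  describe the same endomorphism; \<open>RTpts\<close> below selects one.\<close>

definition tm where "tm n e f a k = (\<lambda>x\<in>carrier T. \<Oplus>\<^bsub>T\<^esub>i\<in>{..<n}. cf n f a k x i .[T] ii (e i))"

context
  fixes n :: nat and e f
  assumes d: "dual_pair n e f"
begin

lemma ef [simp]: "i < n ==> e i el C" "i < n ==> f i el C"
  using dual_pairD[OF d] by auto

lemma expand: "z el T ==> (\<Oplus>\<^bsub>T\<^esub>i\<in>{..<n}. B z (ii (f i)) .[T] ii (e i)) = z"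
  using Q.dual_pairD(3)[OF dual_pair_T[OF d]] by simp

lemma cf_closed [simp]: "[|\<forall>v. a v el S; x el T|] ==> cf n f a k x i el S"
  unfolding cf_def by (rule S.finsum_closed) auto

lemma cf_lin:
  assumes a: "\<forall>v. a v el S" and x: "x el T"
  shows "y el T ==> cf n f a k (x +[T] y) i = cf n f a k x i +[S] cf n f a k y i"
    "r el S ==> cf n f a k (r .[T] x) i = r *[S] cf n f a k x i"
proof -
  have cl: "(\<lambda>j. B z (ii (f j)) *[S] a (enc k i j)) \<in> {..<n} \<rightarrow> carrier S" if "z el T" for z using that a by auto
  show "cf n f a k (x +[T] y) i = cf n f a k x i +[S] cf n f a k y i" if y: "y el T"
  proof -
    have "cf n f a k (x +[T] y) i = (\<Oplus>\<^bsub>S\<^esub>j\<in>{..<n}. B x (ii (f j)) *[S] a (enc k i j) +[S] B y (ii (f j)) *[S] a (enc k i j))"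
      unfolding cf_def by (rule S.finsum_cong') (use x y a cl[OF x] cl[OF y] in \<open>auto simp: Q.b_add_left S.l_distr\<close>)
    then show ?thesis unfolding cf_def using S.finsum_addf[OF cl[OF x] cl[OF y]] by simp
  qed
  show "cf n f a k (r .[T] x) i = r *[S] cf n f a k x i" if r: "r el S"
  proof -
    have "cf n f a k (r .[T] x) i = (\<Oplus>\<^bsub>S\<^esub>j\<in>{..<n}. r *[S] (B x (ii (f j)) *[S] a (enc k i j)))"
      unfolding cf_def by (rule S.finsum_cong') (use x r a cl[OF x] in \<open>auto simp: Q.b_smult_left S.m_assoc\<close>)
    then show ?thesis unfolding cf_def using S.finsum_rdistr[OF _ r cl[OF x]] by simp
  qed
qed

lemma tm_apply: "x el T ==> tm n e f a k x = (\<Oplus>\<^bsub>T\<^esub>i\<in>{..<n}. cf n f a k x i .[T] ii (e i))"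
  by (simp add: tm_def)

lemma tm_lin_hom:
  assumes a: "\<forall>v. a v el S"
  shows "tm n e f a k \<in> lin_hom S T T"
proof (rule lin_homI)
  show "tm n e f a k \<in> extensional (carrier T)" by (simp add: tm_def)
  have cl: "(\<lambda>i. cf n f a k x i .[T] ii (e i)) \<in> {..<n} \<rightarrow> carrier T" if "x el T" for x using that a by auto
  fix x assume x: "x el T"
  show "tm n e f a k x el T" unfolding tm_apply[OF x] by (rule E.T.finsum_closed[OF cl[OF x]])
  show "tm n e f a k (r .[T] x) = r .[T] tm n e f a k x" if r: "r el S" for r
  proof -
    have "tm n e f a k (r .[T] x) = (\<Oplus>\<^bsub>T\<^esub>i\<in>{..<n}. r .[T] (cf n f a k x i .[T] ii (e i)))"
      using r x by (simp add: tm_apply) (rule E.T.finsum_cong', use a r x in \<open>auto simp: cf_lin E.Tm.smult_assoc1\<close>)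
    then show ?thesis using E.Tm.finsum_smult_ldistr[OF _ r cl[OF x]] x by (simp add: tm_apply)
  qed
  fix y assume y: "y el T"
  have "tm n e f a k (x +[T] y) = (\<Oplus>\<^bsub>T\<^esub>i\<in>{..<n}. cf n f a k x i .[T] ii (e i) +[T] cf n f a k y i .[T] ii (e i))"
    using x y by (simp add: tm_apply) (rule E.T.finsum_cong', use a x y in \<open>auto simp: cf_lin E.Tm.smult_l_distr\<close>)
  then show "tm n e f a k (x +[T] y) = tm n e f a k x +[T] tm n e f a k y"
    using E.T.finsum_addf[OF cl[OF x] cl[OF y]] x y by (simp add: tm_apply)
qed

lemma functional_tm:
  assumes a: "\<forall>v. a v el S" and x: "x el T"
    and \<Phi>: "\<Phi> \<in> add_hom T S" "\<And>r z. [|r el S; z el T|] ==> \<Phi> (r .[T] z) = r *[S] \<Phi> z"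
  shows "\<Phi> (tm n e f a k x) = (\<Oplus>\<^bsub>S\<^esub>i\<in>{..<n}. cf n f a k x i *[S] \<Phi> (ii (e i)))"
proof -
  have "\<Phi> (tm n e f a k x) = (\<Oplus>\<^bsub>S\<^esub>i\<in>{..<n}. \<Phi> (cf n f a k x i .[T] ii (e i)))"
    unfolding tm_apply[OF x] by (rule add_hom_finsum[OF Q.C_ag Q.R_ag \<Phi>(1)]) (use a x in auto)
  also have "\<dots> = (\<Oplus>\<^bsub>S\<^esub>i\<in>{..<n}. cf n f a k x i *[S] \<Phi> (ii (e i)))"
    by (rule S.finsum_cong') (use a x \<Phi>(2) add_hom_closed[OF \<Phi>(1)] in auto)
  finally show ?thesis .
qed

lemma tm_coordinates:
  assumes t: "t \<in> lin_hom S T T" and a: "\<forall>v. a v el S"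
    and eq: "\<And>i j. [|i < n; j < n|] ==> a (enc k i j) = B (t (ii (e j))) (ii (f i))"
  shows "tm n e f a k = t"
proof (rule lin_hom_eqI[OF tm_lin_hom[OF a] t])
  fix x assume x: "x el T"
  note tl = lin_homD[OF t]
  have "cf n f a k x i = B (t x) (ii (f i))" if i: "i < n" for i
  proof -
    have "(\<lambda>z. B (t z) (ii (f i))) \<in> add_hom T S"
      by (rule add_homI) (use i tl in \<open>auto simp: Q.b_add_left\<close>)
    then have "B (t (\<Oplus>\<^bsub>T\<^esub>j\<in>{..<n}. B x (ii (f j)) .[T] ii (e j))) (ii (f i)) =
      (\<Oplus>\<^bsub>S\<^esub>j\<in>{..<n}. B (t (B x (ii (f j)) .[T] ii (e j))) (ii (f i)))"
      by (rule add_hom_finsum[OF Q.C_ag Q.R_ag]) (use x in auto)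
    also have "\<dots> = cf n f a k x i"
      unfolding cf_def by (rule S.finsum_cong') (use i x tl a eq in \<open>auto simp: Q.b_smult_left\<close>)
    finally show ?thesis using expand[OF x] by simp
  qed
  then have "tm n e f a k x = (\<Oplus>\<^bsub>T\<^esub>i\<in>{..<n}. B (t x) (ii (f i)) .[T] ii (e i))"
    unfolding tm_apply[OF x] by (intro E.T.finsum_cong') (use tl x in auto)
  then show "tm n e f a k x = t x" using expand[of "t x"] tl x by simp
qed

lemma B_ii_eqI:
  assumes "y el T" "y' el T" "\<And>x. x el C ==> B y (ii x) = B y' (ii x)"
  shows "y = y'"
proof (rule CT.eqI[OF assms(1,2)])
  fix z assume "z el T"
  then show "B y z = B y' z"
    by (induction z rule: E.T_induct') (use assms in \<open>simp_all add: Q.b_add_right Q.b_smult_right\<close>)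
qed

text \<open>The first equation says that the adjoint of \<open>t\<close>, expanded in the dual pair,
  is a right inverse, which captures surjectivity without inverting anything. The second expresses
  preservation of \<open>q\<close> through a product with a conjugate, which is visibly polynomial
  in the matrix entries.\<close>

lemma Og_equations:
  assumes t: "t \<in> OT.Og" and x: "x el C" and y: "y el C"
  shows "(\<Oplus>\<^bsub>S\<^esub>l\<in>{..<n}. B (t (ii (f l))) (ii x) *[S] B (t (ii (e l))) (ii y)) = hS (b x y)"
    "B (t (ii x) *[T] CT.cj (t (ii x))) (ii y) = hS (q x \<otimes> tr y)"
proof -
  note g = OT.Og_facts[OF t]
  have "ii x \<in> t ` carrier T" unfolding bij_betw_imp_surj_on[OF g(7)] using x by simp
  then obtain x' where x': "ii x = t x'" "x' el T" by (rule imageE)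
  have "(\<lambda>z. B (t z) (ii y)) \<in> add_hom T S"
    by (rule add_homI) (use y g in \<open>auto simp: Q.b_add_left\<close>)
  then have "B (t (\<Oplus>\<^bsub>T\<^esub>l\<in>{..<n}. B x' (ii (f l)) .[T] ii (e l))) (ii y) = (\<Oplus>\<^bsub>S\<^esub>l\<in>{..<n}. B (t (B x' (ii (f l)) .[T] ii (e l))) (ii y))"
    by (rule add_hom_finsum[OF Q.C_ag Q.R_ag]) (use x' in auto)
  also have "\<dots> = (\<Oplus>\<^bsub>S\<^esub>l\<in>{..<n}. B (t (ii (f l))) (ii x) *[S] B (t (ii (e l))) (ii y))"
    by (rule S.finsum_cong') (use x' y g in \<open>auto simp: Q.b_smult_left Q.b_sym[of x']\<close>)
  finally show "(\<Oplus>\<^bsub>S\<^esub>l\<in>{..<n}. B (t (ii (f l))) (ii x) *[S] B (t (ii (e l))) (ii y)) = hS (b x y)"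
    using expand[OF x'(2)] x y by (simp add: B_ii x'(1)[symmetric])
  have "B (t (ii x) *[T] CT.cj (t (ii x))) (ii y) = QS (t (ii x)) *[S] B \<one>[T] (ii y)"
    using CT.b_adj_right[of "t (ii x)" "CT.cj (t (ii x))" "ii y"] CT.b_mult_right_same[of "t (ii x)" "\<one>[T]" "ii y"] x y g(2)
    by (simp add: S.m_comm)
  then show "B (t (ii x) *[T] CT.cj (t (ii x))) (ii y) = hS (q x \<otimes> tr y)"
    using x y g by (simp add: QS_facts E.ii_one B_ii hS_simps b_sym[of y])
qed

text \<open>Preservation of the form gives injectivity; the first family of equations exhibits a
  preimage of every vector of \<open>C\<close>, and these generate.\<close>

lemma Og_from_equations:
  assumes t: "t \<in> lin_hom S T T" and y: "y el C" "tr y = \<one>"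
    and s: "\<And>x y. [|x el C; y el C|] ==> (\<Oplus>\<^bsub>S\<^esub>l\<in>{..<n}. B (t (ii (f l))) (ii x) *[S] B (t (ii (e l))) (ii y)) = hS (b x y)"
    and qq: "\<And>x. x el C ==> B (t (ii x) *[T] CT.cj (t (ii x))) (ii y) = hS (q x \<otimes> tr y)"
  shows "t \<in> OT.Og"
proof -
  note tl = lin_homD[OF t]
  have q1: "QS (t (ii x)) = QS (ii x)" if x: "x el C" for x
  proof -
    have "B (t (ii x) *[T] CT.cj (t (ii x))) (ii y) = QS (t (ii x)) *[S] B \<one>[T] (ii y)"
      using CT.b_adj_right[of "t (ii x)" "CT.cj (t (ii x))" "ii y"] CT.b_mult_right_same[of "t (ii x)" "\<one>[T]" "ii y"] x y tl
      by (simp add: S.m_comm)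
    then show ?thesis using qq[OF x] x y tl by (simp add: QS_facts E.ii_one B_ii hS_simps b_sym[of "\<one>[C]"])
  qed
  have qt: "QS (t z) = QS z" if z: "z el T" for z
  proof (rule E.quadratic_form_unique[OF _ QS_facts(2) q1 z])
    show "quadratic_form S T (\<lambda>y. QS (t y))"
      by (rule E.Tm.quadratic_formI[where B = "\<lambda>x y. B (t x) (t y)"])
        (simp_all add: tl Q.q_smult Q.b_add_right Q.b_smult_right, simp add: polar_def tl)
  qed
  have bt: "B (t z) (t w) = B z w" if "z el T" "w el T" for z w
    using qt[of "z +[T] w"] qt that tl by (simp add: polar_def)
  have inj: "inj_on t (carrier T)"
  proof (rule inj_onI)
    fix z w assume zw: "z el T" "w el T" "t z = t w"
    show "z = w" by (rule CT.eqI[OF zw(1,2)]) (use bt zw in metis)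
  qed
  have "z \<in> t ` carrier T" if "z el T" for z
    using that
  proof (induction z rule: E.T_induct')
    case (smult x r)
    let ?w = "\<Oplus>\<^bsub>T\<^esub>l\<in>{..<n}. B (t (ii (f l))) (ii x) .[T] ii (e l)"
    have w: "?w el T" by (rule E.T.finsum_closed) (use smult tl in auto)
    have "t ?w = ii x"
    proof (rule B_ii_eqI)
      fix y assume y: "y el C"
      have "(\<lambda>z. B (t z) (ii y)) \<in> add_hom T S"
        by (rule add_homI) (use y tl in \<open>auto simp: Q.b_add_left\<close>)
      then have "B (t ?w) (ii y) = (\<Oplus>\<^bsub>S\<^esub>l\<in>{..<n}. B (t (B (t (ii (f l))) (ii x) .[T] ii (e l))) (ii y))"
        by (rule add_hom_finsum[OF Q.C_ag Q.R_ag]) (use smult tl in auto)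
      also have "\<dots> = (\<Oplus>\<^bsub>S\<^esub>l\<in>{..<n}. B (t (ii (f l))) (ii x) *[S] B (t (ii (e l))) (ii y))"
        by (rule S.finsum_cong') (use smult y tl in \<open>auto simp: Q.b_smult_left\<close>)
      finally show "B (t ?w) (ii y) = B (ii x) (ii y)" using s smult y by (simp add: B_ii)
    qed (use w tl smult in auto)
    then show ?case using smult w tl by (intro image_eqI[of _ _ "r .[T] ?w"]) auto
  next
    case (add z w)
    then obtain z' w' where "z' el T" "z = t z'" "w' el T" "w = t w'" by (elim imageE)
    then show ?case by (intro image_eqI[of _ _ "z' +[T] w'"]) (simp_all add: tl)
  qed
  then have "t ` carrier T = carrier T" using tl by blast
  then show ?thesis using t inj qt by (simp add: OT.Og_def bij_betw_def)
qed

end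

end

context octonionic_extension begin

context
  fixes n :: nat and e f
  assumes d: "dual_pair n e f"
begin

lemma cj_ii: "x el C ==> CT.cj (ii x) = ii (cj x)"
  using add_hom_minus[OF C_ag Q.C_ag E.ii_hom, of "tr x \<bullet> \<one>[C]" x] B_ii[of x "\<one>[C]"]
  by (simp add: conjugate_def E.ii_smult E.ii_one)

lemma cf_ii: "[|\<forall>v. a v el S; x el C|] ==> cf n f a k (ii x) i = (\<Oplus>\<^bsub>S\<^esub>j\<in>{..<n}. hS (b x (f j)) *[S] a (enc k i j))"
  unfolding cf_def by (rule S.finsum_cong') (auto simp: B_ii ef[OF d])

lemma B_tm_ii:
  assumes "\<forall>v. a v el S" "x el C" "y el C"
  shows "B (tm n e f a k (ii x)) (ii y) = (\<Oplus>\<^bsub>S\<^esub>i\<in>{..<n}. cf n f a k (ii x) i *[S] hS (b (e i) y))"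
proof -
  have "B (tm n e f a k (ii x)) (ii y) = (\<Oplus>\<^bsub>S\<^esub>i\<in>{..<n}. cf n f a k (ii x) i *[S] B (ii (e i)) (ii y))"
    by (rule functional_tm[OF d, of a "ii x" "\<lambda>z. B z (ii y)"]) (use assms in \<open>auto intro!: add_homI simp: Q.b_add_left Q.b_smult_left\<close>)
  also have "\<dots> = (\<Oplus>\<^bsub>S\<^esub>i\<in>{..<n}. cf n f a k (ii x) i *[S] hS (b (e i) y))"
    by (rule S.finsum_cong') (use assms cf_closed[OF d] ef[OF d] in \<open>auto simp: B_ii\<close>)
  finally show ?thesis .
qed

text \<open>Displays a bilinear expression in two of the endomorphisms as a polynomial in matrix
  entries with coefficients from \<open>R\<close>.\<close>

lemma bilinear_tm:
  assumes a: "\<forall>v. a v el S" and c: "x el C" "y el C"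
    and l: "\<And>w. w el T ==> (\<lambda>z. \<beta> z w) \<in> add_hom T S" "\<And>w. w el T ==> \<beta> w \<in> add_hom T S"
      "\<And>r z w. [|r el S; z el T; w el T|] ==> \<beta> (r .[T] z) w = r *[S] \<beta> z w"
      "\<And>r z w. [|r el S; z el T; w el T|] ==> \<beta> z (r .[T] w) = r *[S] \<beta> z w"
    and \<beta>: "\<And>i j. [|i < n; j < n|] ==> \<beta> (ii (e i)) (ii (e j)) = hS (\<beta>0 i j)"
  shows "\<beta> (tm n e f a k (ii x)) (tm n e f a k' (ii y)) =
    (\<Oplus>\<^bsub>S\<^esub>i\<in>{..<n}. cf n f a k (ii x) i *[S] (\<Oplus>\<^bsub>S\<^esub>j\<in>{..<n}. cf n f a k' (ii y) j *[S] hS (\<beta>0 i j)))"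
proof -
  note t = lin_homD(1)[OF tm_lin_hom[OF d a]] and cc = cf_closed[OF d a] and ef' = ef[OF d]
  have hc: "hS (\<beta>0 i j) el S" if "i < n" "j < n" for i j
    using \<beta>[OF that, symmetric] add_hom_closed[OF l(2)] that ef' by simp
  have 1: "\<beta> (ii (e i)) (tm n e f a k' (ii y)) = (\<Oplus>\<^bsub>S\<^esub>j\<in>{..<n}. cf n f a k' (ii y) j *[S] hS (\<beta>0 i j))" if i: "i < n" for i
  proof -
    have "\<beta> (ii (e i)) (tm n e f a k' (ii y)) = (\<Oplus>\<^bsub>S\<^esub>j\<in>{..<n}. cf n f a k' (ii y) j *[S] \<beta> (ii (e i)) (ii (e j)))"
      by (rule functional_tm[OF d a]) (use c i l ef' in auto)
    also have "\<dots> = (\<Oplus>\<^bsub>S\<^esub>j\<in>{..<n}. cf n f a k' (ii y) j *[S] hS (\<beta>0 i j))"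
      by (rule S.finsum_cong') (use c i \<beta> cc hc in auto)
    finally show ?thesis .
  qed
  have "\<beta> (tm n e f a k (ii x)) (tm n e f a k' (ii y)) = (\<Oplus>\<^bsub>S\<^esub>i\<in>{..<n}. cf n f a k (ii x) i *[S] \<beta> (ii (e i)) (tm n e f a k' (ii y)))"
    by (rule functional_tm[OF d a, of "ii x" "\<lambda>z. \<beta> z (tm n e f a k' (ii y))"]) (use c l t in auto)
  also have "\<dots> = (\<Oplus>\<^bsub>S\<^esub>i\<in>{..<n}. cf n f a k (ii x) i *[S] (\<Oplus>\<^bsub>S\<^esub>j\<in>{..<n}. cf n f a k' (ii y) j *[S] hS (\<beta>0 i j)))"
    by (rule S.finsum_cong') (use c cc hc 1 in \<open>auto intro!: S.finsum_closed S.m_closed\<close>)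
  finally show ?thesis .
qed

lemma mult_tm_ii:
  assumes a: "\<forall>v. a v el S" and c: "x el C" "y el C" "z el C"
  shows "B (tm n e f a k (ii x) *[T] CT.cj (tm n e f a k' (ii y))) (ii z) =
    (\<Oplus>\<^bsub>S\<^esub>i\<in>{..<n}. cf n f a k (ii x) i *[S] (\<Oplus>\<^bsub>S\<^esub>j\<in>{..<n}. cf n f a k' (ii y) j *[S] hS (b (e i \<star> cj (e j)) z)))"
    "B (CT.cj (tm n e f a k (ii x)) *[T] CT.cj (tm n e f a k' (ii y))) (ii z) =
    (\<Oplus>\<^bsub>S\<^esub>i\<in>{..<n}. cf n f a k (ii x) i *[S] (\<Oplus>\<^bsub>S\<^esub>j\<in>{..<n}. cf n f a k' (ii y) j *[S] hS (b (cj (e i) \<star> cj (e j)) z)))"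
proof -
  note sm = T_simps CT.cj_add CT.cj_smult
  show "B (tm n e f a k (ii x) *[T] CT.cj (tm n e f a k' (ii y))) (ii z) =
    (\<Oplus>\<^bsub>S\<^esub>i\<in>{..<n}. cf n f a k (ii x) i *[S] (\<Oplus>\<^bsub>S\<^esub>j\<in>{..<n}. cf n f a k' (ii y) j *[S] hS (b (e i \<star> cj (e j)) z)))"
    by (rule bilinear_tm[OF a c(1,2), of "\<lambda>u w. B (u *[T] CT.cj w) (ii z)"])
      (use c in \<open>auto intro!: add_homI simp: sm cj_ii E.ii_mult[symmetric] B_ii ef[OF d]\<close>)
  show "B (CT.cj (tm n e f a k (ii x)) *[T] CT.cj (tm n e f a k' (ii y))) (ii z) =
    (\<Oplus>\<^bsub>S\<^esub>i\<in>{..<n}. cf n f a k (ii x) i *[S] (\<Oplus>\<^bsub>S\<^esub>j\<in>{..<n}. cf n f a k' (ii y) j *[S] hS (b (cj (e i) \<star> cj (e j)) z)))"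
    by (rule bilinear_tm[OF a c(1,2), of "\<lambda>u w. B (CT.cj u *[T] CT.cj w) (ii z)"])
      (use c in \<open>auto intro!: add_homI simp: sm cj_ii E.ii_mult[symmetric] B_ii ef[OF d]\<close>)
qed

definition triple where "triple a = (tm n e f a 0, tm n e f a 1, tm n e f a 2)"

text \<open>Besides the triple being related, each matrix has to be the canonical one of its
  endomorphism and the remaining variables are zero; these normalizations make \<open>triple\<close>
  injective.\<close>

definition RTpts where "RTpts = {a. (\<forall>v. a v el S) \<and> triple a \<in> OT.RT \<and>
  (\<forall>k<3. \<forall>i<n. \<forall>j<n. a (enc k i j) = B (tm n e f a k (ii (e j))) (ii (f i))) \<and>
  (\<forall>v. (\<nexists>k i j. k < 3 \<and> i < n \<and> j < n \<and> v = enc k i j) --> a v = \<zero>[S])}"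

text \<open>Membership in the form of polynomial equations in the values of \<open>a\<close>.
  \<open>RTptsD\<close> shows that all points satisfy them, and this pair of lemmas is what the
  coordinate ring needs. The element \<open>y\<close> of trace one lets one scalar equation per
  vector stand for preservation of \<open>q\<close>.\<close>

lemma RTptsI:
  assumes a: "\<forall>v. a v el S" and y: "y el C" "tr y = \<one>"
    and 1: "\<And>k i j. [|k < 3; i < n; j < n|] ==> B (tm n e f a k (ii (e j))) (ii (f i)) = a (enc k i j)"
    and 2: "\<And>v. \<nexists>k i j. k < 3 \<and> i < n \<and> j < n \<and> v = enc k i j ==> a v = \<zero>[S]"
    and 3: "\<And>k x z. [|k < 3; x el C; z el C|] ==>
      (\<Oplus>\<^bsub>S\<^esub>l\<in>{..<n}. B (tm n e f a k (ii (f l))) (ii x) *[S] B (tm n e f a k (ii (e l))) (ii z)) = hS (b x z)"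
    and 4: "\<And>k x. [|k < 3; x el C|] ==>
      B (tm n e f a k (ii x) *[T] CT.cj (tm n e f a k (ii x))) (ii y) = hS (q x \<otimes> tr y)"
    and 5: "\<And>x w z. [|x el C; w el C; z el C|] ==> B (tm n e f a 0 (ii (x \<star> w))) (ii z) =
      B (CT.cj (tm n e f a 1 (ii (cj x))) *[T] CT.cj (tm n e f a 2 (ii (cj w)))) (ii z)"
  shows "a \<in> RTpts"
proof -
  note l = tm_lin_hom[OF d a]
  have O: "tm n e f a k \<in> OT.Og" if "k < 3" for k
    by (rule Og_from_equations[OF d l y]) (use 3 4 that in auto)
  have "OT.RTrel (tm n e f a 0) (tm n e f a 1) (tm n e f a 2)"
  proof (rule RTrel_ii[OF l l l])
    fix x w assume x: "x el C" "w el C"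
    note lc = lin_homD(1)[OF l]
    show "tm n e f a 0 (ii x *[T] ii w) = CT.cj (tm n e f a 1 (CT.cj (ii x))) *[T] CT.cj (tm n e f a 2 (CT.cj (ii w)))"
      by (rule B_ii_eqI[OF d]) (use x lc 5 in \<open>simp_all add: cj_ii E.ii_mult[symmetric]\<close>)
  qed
  then show ?thesis using a 1 2 O by (simp add: RTpts_def triple_def OT.RT_def)
qed

lemma RTptsD:
  assumes a: "a \<in> RTpts"
  shows "\<forall>v. a v el S"
    and "[|k < 3; i < n; j < n|] ==> B (tm n e f a k (ii (e j))) (ii (f i)) = a (enc k i j)"
    and "\<nexists>k i j. k < 3 \<and> i < n \<and> j < n \<and> v = enc k i j ==> a v = \<zero>[S]"
    and "[|k < 3; x el C; z el C|] ==>
      (\<Oplus>\<^bsub>S\<^esub>l\<in>{..<n}. B (tm n e f a k (ii (f l))) (ii x) *[S] B (tm n e f a k (ii (e l))) (ii z)) = hS (b x z)"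
    and "[|k < 3; x el C; y el C|] ==>
      B (tm n e f a k (ii x) *[T] CT.cj (tm n e f a k (ii x))) (ii y) = hS (q x \<otimes> tr y)"
    and "[|x el C; w el C; z el C|] ==> B (tm n e f a 0 (ii (x \<star> w))) (ii z) =
      B (CT.cj (tm n e f a 1 (ii (cj x))) *[T] CT.cj (tm n e f a 2 (ii (cj w)))) (ii z)"
proof -
  have o: "tm n e f a 0 \<in> OT.Og" "tm n e f a 1 \<in> OT.Og" "tm n e f a 2 \<in> OT.Og" and r: "OT.RTrel (tm n e f a 0) (tm n e f a 1) (tm n e f a 2)"
    using a by (simp_all add: RTpts_def triple_def OT.RT_def)
  have O: "tm n e f a k \<in> OT.Og" if "k < 3" for k
    using o that by (cases "k = 0"; cases "k = 1") (auto simp: numeral_3_eq_3 numeral_2_eq_2 less_Suc_eq)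
  show "\<forall>v. a v el S" "[|k < 3; i < n; j < n|] ==> B (tm n e f a k (ii (e j))) (ii (f i)) = a (enc k i j)"
    "\<nexists>k i j. k < 3 \<and> i < n \<and> j < n \<and> v = enc k i j ==> a v = \<zero>[S]"
    using a by (simp_all add: RTpts_def)
  show "[|k < 3; x el C; z el C|] ==>
      (\<Oplus>\<^bsub>S\<^esub>l\<in>{..<n}. B (tm n e f a k (ii (f l))) (ii x) *[S] B (tm n e f a k (ii (e l))) (ii z)) = hS (b x z)"
    by (rule Og_equations(1)[OF d O])
  show "[|k < 3; x el C; y el C|] ==>
      B (tm n e f a k (ii x) *[T] CT.cj (tm n e f a k (ii x))) (ii y) = hS (q x \<otimes> tr y)"
    by (rule Og_equations(2)[OF d O])
  show "[|x el C; w el C; z el C|] ==> B (tm n e f a 0 (ii (x \<star> w))) (ii z) =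
      B (CT.cj (tm n e f a 1 (ii (cj x))) *[T] CT.cj (tm n e f a 2 (ii (cj w)))) (ii z)"
    using r by (simp add: OT.RTrel_def E.ii_mult cj_ii)
qed

lemma triple_bij: "bij_betw triple RTpts OT.RT"
proof (rule bij_betw_imageI)
  show "inj_on triple RTpts"
  proof (rule inj_onI)
    fix a a' assume a: "a \<in> RTpts" "a' \<in> RTpts" and eq: "triple a = triple a'"
    have t: "tm n e f a k = tm n e f a' k" if "k < 3" for k
      using eq that by (cases "k = 0"; cases "k = 1") (auto simp: triple_def numeral_3_eq_3 numeral_2_eq_2 less_Suc_eq)
    show "a = a'"
    proof
      fix v show "a v = a' v"
      proof (cases "\<exists>k i j. k < 3 \<and> i < n \<and> j < n \<and> v = enc k i j")
        case True
        then obtain k i j where v: "k < 3" "i < n" "j < n" "v = enc k i j" by blast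
        show ?thesis using RTptsD(2)[OF a(1) v(1-3)] RTptsD(2)[OF a(2) v(1-3)] t v by simp
      next
        case False
        then show ?thesis using RTptsD(3)[OF a(1)] RTptsD(3)[OF a(2)] by simp
      qed
    qed
  qed
  show "triple ` RTpts = OT.RT"
  proof
    show "OT.RT \<subseteq> triple ` RTpts"
    proof
      fix t assume t: "t \<in> OT.RT"
      obtain t0 t1 t2 where tt: "t = (t0, t1, t2)" by (cases t)
      define s where "s k = (if k = 0 then t0 else if k = 1 then t1 else t2)" for k :: nat
      have sl: "s k \<in> lin_hom S T T" for k using t OT.Og_facts(1) by (auto simp: tt OT.RT_def s_def)
      \<comment> \<open>Every number encodes some \<open>k\<close>, \<open>i\<close> and
        \<open>j\<close>, so the canonical matrix entries and the default zero determine all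
        variables.\<close>
      define a where "a v = (case prod_decode v of (k, ij) => case prod_decode ij of (i, j) =>
        if k < 3 \<and> i < n \<and> j < n then B (s k (ii (e j))) (ii (f i)) else \<zero>[S])" for v
      have ae: "a (enc k i j) = (if k < 3 \<and> i < n \<and> j < n then B (s k (ii (e j))) (ii (f i)) else \<zero>[S])" for k i j
        by (simp add: a_def enc_def)
      have ex: "\<exists>k i j. v = enc k i j" for v unfolding enc_def by (metis prod_decode_inverse surj_pair)
      have ac: "\<forall>v. a v el S"
      proof
        fix v
        obtain k i j where "v = enc k i j" using ex by blast
        then show "a v el S" using ef[OF d] lin_homD(1)[OF sl] by (simp add: ae)
      qed
      have ts: "tm n e f a k = s k" if "k < 3" for k
        by (rule tm_coordinates[OF d sl ac]) (simp add: ae that)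
      have tr: "triple a = t" using ts[of 0] ts[of 1] ts[of 2] by (simp add: triple_def s_def tt)
      have "a v = \<zero>[S]" if "\<nexists>k i j. k < 3 \<and> i < n \<and> j < n \<and> v = enc k i j" for v
      proof -
        obtain k i j where "v = enc k i j" using ex by blast
        then show ?thesis using that by (auto simp: ae)
      qed
      then have "a \<in> RTpts" unfolding RTpts_def using ac tr t ts by (simp add: ae)
      then show "t \<in> triple ` RTpts" using tr by blast
    qed
  qed (auto simp: RTpts_def)
qed

end

end

context octonionic_map begin

lemma triple_natural:
  assumes d: "A.dual_pair n e f" and a: "\<forall>v. a v el S" and a': "\<And>v. a' v = h (a v)"
  shows "EMap (A.tm n e f a k) = B.tm n e f a' k"
proof (rule End_map_eqI)
  note ef = A.dual_pairD(1,2)[OF d]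
  have a'c: "\<forall>v. a' v el V" using a a' by simp
  then show "B.tm n e f a' k \<in> lin_hom V B.T B.T" by (rule B.tm_lin_hom[OF d])
  fix z assume z: "z el A.T"
  have hh: "h \<in> add_hom S V" by (rule add_homI) simp_all
  have "B.cf n f a' k (H z) i = h (A.cf n f a k z i)" for i
  proof -
    have "h (A.cf n f a k z i) = (\<Oplus>\<^bsub>V\<^esub>j\<in>{..<n}. h (A.B z (A.ii (f j)) *[S] a (enc k i j)))"
      unfolding A.cf_def by (rule add_hom_finsum[OF A.Q.R_ag B.Q.R_ag hh]) (use a z ef in auto)
    also have "\<dots> = B.cf n f a' k (H z) i"
      unfolding B.cf_def by (rule B.S.finsum_cong') (use a z ef a'c in \<open>auto simp: a' B_H[symmetric] H_ii\<close>)
    finally show ?thesis by simp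
  qed
  then have "B.tm n e f a' k (H z) = (\<Oplus>\<^bsub>B.T\<^esub>i\<in>{..<n}. h (A.cf n f a k z i) .[B.T] B.ii (e i))"
    using z by (simp add: B.tm_apply[OF d])
  also have "\<dots> = (\<Oplus>\<^bsub>B.T\<^esub>i\<in>{..<n}. H (A.cf n f a k z i .[A.T] A.ii (e i)))"
    by (rule B.E.T.finsum_cong') (use a z ef A.cf_closed[OF d a z] in \<open>auto simp: H_smult H_ii\<close>)
  also have "\<dots> = H (A.tm n e f a k z)"
    unfolding A.tm_apply[OF d z] by (rule add_hom_finsum[OF A.Q.C_ag B.Q.C_ag H_add_hom, symmetric]) (use a z ef A.cf_closed[OF d a z] in auto)
  finally show "B.tm n e f a' k (H z) = H (A.tm n e f a k z)" .
qed

end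

section \<open>Coordinate rings\<close>

text \<open>
  The coordinate ring of a family of sets of points in the affine spaces \<open>S\<^sup>N\<close> is the free
  algebra modulo all elements vanishing on all these points; it is commutative since the rings
  \<open>S\<close> are.
\<close>

locale point_family = free_algebra R "UNIV :: nat set"
  for R :: "('r, 'z) ring_scheme" (structure) +
  fixes Pts :: "('r, 's) module => (nat => 's) set"
  assumes Pts_closed: "[|algebra R S; a \<in> Pts S|] ==> \<forall>v. a v el S"
begin

text \<open>Substitution of the point \<open>a\<close> for the variables; by \<open>A_hom_eq\<close>
  the chosen homomorphism is the only one on the carrier.\<close>

definition ev :: "('r, 's) module => (nat => 's) => (nat list => 'r) => 's" where
  "ev S a = (SOME H. H \<in> ring_hom A S \<and> (\<forall>r\<in>carrier R. \<forall>f\<in>carrier A. H (r .[A] f) = r .[S] H f) \<and> (\<forall>v. H (mono [v]) = a v))"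

lemma ev:
  assumes S: "algebra R S" and a: "\<forall>v. a v el S"
  shows "ev S a \<in> ring_hom A S" "[|r el R; f el A|] ==> ev S a (r .[A] f) = r .[S] ev S a f" "ev S a (mono [v]) = a v"
proof -
  interpret S: algebra R S by (rule S)
  let ?\<rho> = "\<lambda>r. r .[S] \<one>[S]"
  have \<rho>: "?\<rho> \<in> ring_hom R S"
    by (rule ring_hom_memI) (auto simp: S.smult_l_distr S.smult_assoc1 S.smult_assoc2)
  obtain H where H: "H \<in> ring_hom A S" and H': "(\<forall>r\<in>carrier R. \<forall>f\<in>carrier A. H (r .[A] f) = ?\<rho> r *[S] H f) \<and> (\<forall>x\<in>UNIV. H (mono [x]) = a x)"
    using A_lift[OF S.ring_axioms \<rho>, of a] a by (auto simp: S.m_comm)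
  have "H \<in> ring_hom A S \<and> (\<forall>r\<in>carrier R. \<forall>f\<in>carrier A. H (r .[A] f) = r .[S] H f) \<and> (\<forall>v. H (mono [v]) = a v)"
    using H H' ring_hom_closed[OF H] by (simp add: S.smult_assoc2)
  from someI[where P = "\<lambda>H. H \<in> ring_hom A S \<and> (\<forall>r\<in>carrier R. \<forall>f\<in>carrier A. H (r .[A] f) = r .[S] H f) \<and> (\<forall>v. H (mono [v]) = a v)", OF this]
  show "ev S a \<in> ring_hom A S" "[|r el R; f el A|] ==> ev S a (r .[A] f) = r .[S] ev S a f" "ev S a (mono [v]) = a v"
    unfolding ev_def by blast+
qed

lemma ev_ring_hom: "[|algebra R S; \<forall>v. a v el S|] ==> ring_hom_ring A S (ev S a)"
  by (rule ring_hom_ringI2[OF ring_A _ ev(1)]) (simp_all add: algebra_def cring_def)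

lemma A_hom_eq:
  assumes S: "algebra R S" and H: "H \<in> ring_hom A S" and K: "K \<in> ring_hom A S"
    and Hs: "\<And>r f. [|r el R; f el A|] ==> H (r .[A] f) = r .[S] H f"
    and Ks: "\<And>r f. [|r el R; f el A|] ==> K (r .[A] f) = r .[S] K f"
    and eq: "\<And>v. H (mono [v]) = K (mono [v])" and f: "f el A"
  shows "H f = K f"
proof -
  have m: "H (mono w) = K (mono w)" for w
  proof (induction w)
    case Nil show ?case using ring_hom_one[OF H] ring_hom_one[OF K] by (simp add: A_ops(4))
  next
    case (Cons x w)
    have "mono (x # w) = mono [x] *[A] mono w" by (simp add: mono_mult)
    then show ?case using Cons eq ring_hom_mult[OF H, of "mono [x]" "mono w"] ring_hom_mult[OF K, of "mono [x]" "mono w"] by simp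
  qed
  show ?thesis using f
    by (induction f rule: A_induct) (simp_all add: Hs Ks m ring_hom_add[OF H] ring_hom_add[OF K])
qed

definition I where "I = {f \<in> carrier A. \<forall>S a. algebra R S --> a \<in> Pts S --> ev S a f = \<zero>[S]}"

lemma I_mem: "f \<in> I \<longleftrightarrow> f el A \<and> (\<forall>S a. algebra R S --> a \<in> Pts S --> ev S a f = \<zero>[S])"
  by (simp add: I_def)

lemma ideal_I: "ideal I A"
proof (rule idealI)
  show "ring A" by (rule ring_A)
  have h: "ring_hom_ring A S (ev S a)" if "algebra R S" "a \<in> Pts S" for S a
    using ev_ring_hom[OF that(1)] Pts_closed[OF that] by simp
  note hz = ring_hom_ring.axioms(2)[OF h]
  show "subgroup I (add_monoid A)"
  proof (rule subgroup.intro)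
    show "I \<subseteq> carrier (add_monoid A)" by (auto simp: I_mem)
    show "\<one>[add_monoid A] \<in> I"
    proof -
      have "ev S a \<zero>[A] = \<zero>[S]" if "algebra R S" "a \<in> Pts S" for S a
      proof -
        interpret h: ring_hom_ring A S "ev S a" by (rule h[OF that])
        show ?thesis by simp
      qed
      then show ?thesis by (simp add: I_mem)
    qed
    fix x y assume xy: "x \<in> I" "y \<in> I"
    have "ev S a (x +[A] y) = \<zero>[S]" if "algebra R S" "a \<in> Pts S" for S a
    proof -
      interpret h: ring_hom_ring A S "ev S a" by (rule h[OF that])
      show ?thesis using xy that by (simp add: I_mem)
    qed
    then show "x *[add_monoid A] y \<in> I" using xy by (simp add: I_mem AA.a_closed)
  next
    fix x assume x: "x \<in> I"
    have "ev S a (-[A] x) = \<zero>[S]" if "algebra R S" "a \<in> Pts S" for S a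
    proof -
      interpret h: ring_hom_ring A S "ev S a" by (rule h[OF that])
      show ?thesis using x that by (simp add: I_mem h.S.minus_zero')
    qed
    then show "inv\<^bsub>add_monoid A\<^esub> x \<in> I" using x by (simp add: I_mem a_inv_def[symmetric])
  qed
  fix f g assume f: "f \<in> I" and g: "g el A"
  have z: "ev S a (g *[A] f) = \<zero>[S]" "ev S a (f *[A] g) = \<zero>[S]" if "algebra R S" "a \<in> Pts S" for S a
  proof -
    interpret h: ring_hom_ring A S "ev S a" by (rule h[OF that])
    show "ev S a (g *[A] f) = \<zero>[S]" "ev S a (f *[A] g) = \<zero>[S]" using f g that by (simp_all add: I_mem)
  qed
  show "g *[A] f \<in> I" "f *[A] g \<in> I" using f g z by (simp_all add: I_mem A_mult_closed)
qed

sublocale I: ideal I A by (rule ideal_I)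

definition cl where "cl f = I +>\<^bsub>A\<^esub> f"

definition CR :: "('r, (nat list => 'r) set) module" where
  "CR = \<lparr>carrier = carrier (A Quot I), monoid.mult = monoid.mult (A Quot I), one = \<one>[A Quot I], ring.zero = \<zero>[A Quot I],
     ring.add = ring.add (A Quot I), smult = (\<lambda>r z. cl (r .[A] \<one>[A]) *[A Quot I] z)\<rparr>"

lemma ring_CR: "ring CR"
  by (rule ring_cong[OF I.quotient_is_ring]) (simp_all add: CR_def)

sublocale CR: ring CR by (rule ring_CR)

lemma cl_hom: "cl \<in> ring_hom A CR"
  using I.rcos_ring_hom by (auto simp: ring_hom_def CR_def cl_def[abs_def])

lemma CR_cases: assumes "z el CR" obtains f where "f el A" "z = cl f"
  using assms by (auto simp: CR_def FactRing_def A_RCOSETS_def' cl_def)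

lemma cl_simps:
  "f el A ==> cl f el CR"
  "[|f el A; g el A|] ==> cl (f +[A] g) = cl f +[CR] cl g"
  "[|f el A; g el A|] ==> cl (f *[A] g) = cl f *[CR] cl g"
  "cl \<one>[A] = \<one>[CR]"
  using cl_hom by (auto simp: ring_hom_def)

lemma cl_eq: "[|f el A; g el A|] ==> cl f = cl g \<longleftrightarrow> f -[A] g \<in> I"
proof -
  assume c: "f el A" "g el A"
  have "cl f = cl g \<longleftrightarrow> f \<in> cl g"
    unfolding cl_def using I.a_repr_independence'[of f g] I.a_rcos_self[of f] c by (metis)
  also have "\<dots> \<longleftrightarrow> f -[A] g \<in> I"
    unfolding cl_def using I.a_rcos_module_minus[OF ring_A, of g f] c by simp
  finally show ?thesis .
qed

lemma smult_cl: "[|r el R; f el A|] ==> r .[CR] cl f = cl (r .[A] f)"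
proof -
  assume c: "r el R" "f el A"
  have "r .[CR] cl f = cl (r .[A] \<one>[A]) *[CR] cl f" by (simp add: CR_def)
  also have "\<dots> = cl ((r .[A] \<one>[A]) *[A] f)" using c cl_simps(3) by simp
  finally show ?thesis using c by (simp add: A_smult_left)
qed

lemma ev_eq:
  assumes S: "algebra R S" and a: "a \<in> Pts S" and f: "f el A" "g el A" "cl f = cl g"
  shows "ev S a f = ev S a g"
proof -
  interpret h: ring_hom_ring A S "ev S a" using ev_ring_hom[OF S] Pts_closed[OF S a] by simp
  have "ev S a (f -[A] g) = \<zero>[S]" using cl_eq[OF f(1,2)] f(3) S a by (simp add: I_mem)
  then have "ev S a f -[S] ev S a g = \<zero>[S]" using f by (simp add: a_minus_def)
  then show ?thesis by (rule h.S.minus_eq_zeroD) (use f in auto)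
qed

lemma cl_eqI:
  assumes f: "f el A" "g el A" and eq: "\<And>S a. [|algebra R S; a \<in> Pts S|] ==> ev S a f = ev S a g"
  shows "cl f = cl g"
proof -
  have "ev S a (f -[A] g) = \<zero>[S]" if "algebra R S" "a \<in> Pts S" for S a
  proof -
    interpret h: ring_hom_ring A S "ev S a" using ev_ring_hom[OF that(1)] Pts_closed[OF that] by simp
    show ?thesis using f eq[OF that] by (simp add: a_minus_def h.S.r_neg)
  qed
  then show ?thesis using f cl_eq by (simp add: I_mem)
qed

lemma algebra_CR: "algebra R CR"
proof (rule algebraI)
  show "cring R" by (rule cring_axioms)
  show "cring CR"
  proof (rule cringI)
    show "abelian_group CR" by (rule CR.abelian_group_axioms)
    show "comm_monoid CR"
    proof (rule CR.monoid_comm_monoidI)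
      fix z w assume "z el CR" "w el CR"
      then obtain f g where f: "f el A" "z = cl f" and g: "g el A" "w = cl g" by (elim CR_cases)
      have "cl (f *[A] g) = cl (g *[A] f)"
      proof (rule cl_eqI)
        fix S a assume S: "algebra R S" and a: "a \<in> Pts S"
        interpret S: algebra R S by (rule S)
        show "ev S a (f *[A] g) = ev S a (g *[A] f)"
          using ev(1)[OF S Pts_closed[OF S a]] f g by (simp add: ring_hom_mult ring_hom_closed S.m_comm)
      qed (use f g in \<open>auto simp: A_mult_closed\<close>)
      then show "z *[CR] w = w *[CR] z" using f g by (simp add: cl_simps)
    qed
  qed (rule CR.l_distr)
next
  fix r z assume r: "r el R" and "z el CR"
  then obtain f where f: "f el A" "z = cl f" by (elim CR_cases)
  show "r .[CR] z el CR" using r f by (simp add: smult_cl cl_simps)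
  fix s assume s: "s el R"
  show "(r \<oplus> s) .[CR] z = r .[CR] z +[CR] s .[CR] z"
    using r s f by (simp add: smult_cl cl_simps(2)[symmetric] A_smult_facts)
  show "(r \<otimes> s) .[CR] z = r .[CR] (s .[CR] z)"
    using r s f by (simp add: smult_cl A_smult_facts)
next
  fix r z w assume r: "r el R" and "z el CR" "w el CR"
  then obtain f g where f: "f el A" "z = cl f" and g: "g el A" "w = cl g" by (elim CR_cases)
  show "r .[CR] (z +[CR] w) = r .[CR] z +[CR] r .[CR] w"
    using r f g by (simp add: smult_cl cl_simps(2)[symmetric] A_smult_add A_add_closed)
  show "(r .[CR] z) *[CR] w = r .[CR] (z *[CR] w)"
    using r f g by (simp add: smult_cl cl_simps(3)[symmetric] A_smult_left A_mult_closed)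
next
  fix z assume "z el CR"
  then show "\<one> .[CR] z = z" by (elim CR_cases) (simp add: smult_cl A_smult_facts)
qed

definition pt where "pt \<phi> v = \<phi> (cl (mono [v]))"

lemma alg_hom_cl:
  assumes "\<phi> \<in> alg_hom R CR S"
  shows "\<phi> \<circ> cl \<in> ring_hom A S" "[|r el R; f el A|] ==> (\<phi> \<circ> cl) (r .[A] f) = r .[S] (\<phi> \<circ> cl) f"
    "\<forall>v. pt \<phi> v el S"
proof -
  have \<phi>: "\<phi> \<in> ring_hom CR S" using assms by (simp add: alg_hom_def)
  show "\<phi> \<circ> cl \<in> ring_hom A S" by (rule ring_hom_trans[OF cl_hom \<phi>])
  show "[|r el R; f el A|] ==> (\<phi> \<circ> cl) (r .[A] f) = r .[S] (\<phi> \<circ> cl) f"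
    using assms by (simp add: alg_hom_def smult_cl[symmetric] cl_simps)
  show "\<forall>v. pt \<phi> v el S" using ring_hom_closed[OF \<phi>] by (simp add: pt_def cl_simps)
qed

lemma alg_hom_ev:
  assumes S: "algebra R S" and \<phi>: "\<phi> \<in> alg_hom R CR S" and f: "f el A"
  shows "\<phi> (cl f) = ev S (pt \<phi>) f"
proof -
  note e = ev[OF S alg_hom_cl(3)[OF \<phi>]]
  have "(\<phi> \<circ> cl) f = ev S (pt \<phi>) f"
    by (rule A_hom_eq[OF S alg_hom_cl(1)[OF \<phi>] e(1) alg_hom_cl(2)[OF \<phi>] e(2) _ f]) (simp_all only: e(3) comp_apply, simp only: pt_def)
  then show ?thesis by simp
qed

text \<open>A point yields a homomorphism because evaluation there kills \<open>I\<close>. That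
  every homomorphism from \<open>CR\<close> yields a point is the assumption \<open>closed\<close>;
  this is where the point sets have to be cut out by polynomial equations.\<close>

lemma pt_bij:
  assumes S: "algebra R S" and closed: "\<And>\<phi>. \<phi> \<in> alg_hom R CR S ==> pt \<phi> \<in> Pts S"
  shows "bij_betw pt (alg_hom R CR S) (Pts S)"
proof (rule bij_betw_imageI)
  show "inj_on pt (alg_hom R CR S)"
  proof (rule inj_onI)
    fix \<phi> \<psi> assume \<phi>: "\<phi> \<in> alg_hom R CR S" and \<psi>: "\<psi> \<in> alg_hom R CR S" and eq: "pt \<phi> = pt \<psi>"
    show "\<phi> = \<psi>"
    proof (rule extensionalityI[of _ "carrier CR"])
      fix z assume "z el CR"
      then obtain f where f: "f el A" "z = cl f" by (rule CR_cases)
      show "\<phi> z = \<psi> z" using alg_hom_ev[OF S \<phi> f(1)] alg_hom_ev[OF S \<psi> f(1)] eq f(2) by simp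
    qed (use \<phi> \<psi> in \<open>simp_all add: alg_hom_def\<close>)
  qed
  show "pt ` alg_hom R CR S = Pts S"
  proof
    show "Pts S \<subseteq> pt ` alg_hom R CR S"
    proof
      fix a assume a: "a \<in> Pts S"
      note e = ev[OF S Pts_closed[OF S a]]
      define \<phi> where "\<phi> = (\<lambda>z\<in>carrier CR. ev S a (SOME f. f el A \<and> z = cl f))"
      have \<phi>: "\<phi> (cl f) = ev S a f" if f: "f el A" for f
      proof -
        let ?f = "SOME g. g el A \<and> cl f = cl g"
        have "?f el A \<and> cl f = cl ?f" by (rule someI[of _ f]) (use f in simp)
        then have "ev S a f = ev S a ?f" using ev_eq[OF S a f, of ?f] by blast
        then show ?thesis using f by (simp add: \<phi>_def cl_simps)
      qed
      have "\<phi> \<in> ring_hom CR S"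
      proof (rule ring_hom_memI)
        fix z assume "z el CR"
        then obtain f where f: "f el A" "z = cl f" by (rule CR_cases)
        show "\<phi> z el S" using f ring_hom_closed[OF e(1)] by (simp add: \<phi>)
        fix w assume "w el CR"
        then obtain g where g: "g el A" "w = cl g" by (rule CR_cases)
        show "\<phi> (z *[CR] w) = \<phi> z *[S] \<phi> w" using f g ring_hom_mult[OF e(1)] by (simp add: cl_simps(3)[symmetric] \<phi> A_mult_closed)
        show "\<phi> (z +[CR] w) = \<phi> z +[S] \<phi> w" using f g ring_hom_add[OF e(1)] by (simp add: cl_simps(2)[symmetric] \<phi> A_add_closed)
      qed (use ring_hom_one[OF e(1)] in \<open>simp add: cl_simps(4)[symmetric] \<phi>\<close>)
      moreover have "\<phi> (r .[CR] z) = r .[S] \<phi> z" if "r el R" "z el CR" for r z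
        using that(2,1) by (elim CR_cases) (simp add: smult_cl \<phi> e(2))
      ultimately have "\<phi> \<in> alg_hom R CR S" by (simp add: alg_hom_def) (simp add: \<phi>_def)
      moreover have "pt \<phi> = a" by (rule ext) (simp add: pt_def \<phi> e(3))
      ultimately show "a \<in> pt ` alg_hom R CR S" by blast
    qed
  qed (use closed in blast)
qed

text \<open>One element of the free algebra represents the whole family: a polynomial over
  \<open>R\<close> that is independent of \<open>S\<close>.\<close>

definition pol :: "(('r, 's) module => (nat => 's) => 's) => bool" where
  "pol p \<longleftrightarrow> (\<exists>f\<in>carrier A. \<forall>S a. algebra R S --> (\<forall>v. a v el S) --> p S a = ev S a f)"

lemma polI: "[|f el A; \<And>S a. [|algebra R S; \<forall>v. a v el S|] ==> p S a = ev S a f|] ==> pol p"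
  unfolding pol_def by blast

lemma polE: assumes "pol p" obtains f where "f el A" "\<And>S a. [|algebra R S; \<forall>v. a v el S|] ==> p S a = ev S a f"
  using assms unfolding pol_def by blast

lemma pol_closed: "[|pol p; algebra R S; \<forall>v. a v el S|] ==> p S a el S"
  by (elim polE) (simp add: ring_hom_closed[OF ev(1)])

lemma pol_const: "r el R ==> pol (\<lambda>S a. r .[S] \<one>[S])"
  by (rule polI[of "r .[A] \<one>[A]"]) (simp_all add: ev(2) ring_hom_one[OF ev(1)])

lemma pol_var: "pol (\<lambda>S a. a v)"
  by (rule polI[of "mono [v]"]) (simp_all add: ev(3))

lemma pol_zero: "pol (\<lambda>S a. \<zero>[S])"
proof (rule polI[of "\<zero>[A]"])
  fix S :: "('r, 's) module" and a :: "nat => 's" assume "algebra R S" "\<forall>v. a v el S"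
  from ev_ring_hom[OF this] interpret h: ring_hom_ring A S "ev S a" .
  show "\<zero>[S] = ev S a \<zero>[A]" by simp
qed simp

lemma pol_add: "[|pol p; pol p'|] ==> pol (\<lambda>S a. p S a +[S] p' S a)"
proof (elim polE)
  fix f g assume f: "f el A" "\<And>S a. [|algebra R S; \<forall>v. a v el S|] ==> p S a = ev S a f"
    and g: "g el A" "\<And>S a. [|algebra R S; \<forall>v. a v el S|] ==> p' S a = ev S a g"
  show ?thesis by (rule polI[of "f +[A] g"]) (simp_all add: f g ring_hom_add[OF ev(1)] A_add_closed)
qed

lemma pol_mult: "[|pol p; pol p'|] ==> pol (\<lambda>S a. p S a *[S] p' S a)"
proof (elim polE)
  fix f g assume f: "f el A" "\<And>S a. [|algebra R S; \<forall>v. a v el S|] ==> p S a = ev S a f"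
    and g: "g el A" "\<And>S a. [|algebra R S; \<forall>v. a v el S|] ==> p' S a = ev S a g"
  show ?thesis by (rule polI[of "f *[A] g"]) (simp_all add: f g ring_hom_mult[OF ev(1)] A_mult_closed)
qed

lemma pol_cong:
  assumes "pol p" "\<And>S a. [|algebra R S; \<forall>v. a v el S|] ==> p' S a = p S a"
  shows "pol p'"
  using assms(1) by (elim polE) (rule polI, auto simp: assms(2))

lemma pol_sum:
  assumes p: "\<And>i. i < m ==> pol (p i)"
  shows "pol (\<lambda>S a. \<Oplus>\<^bsub>S\<^esub>i\<in>{..<m::nat}. p i S a)"
  using p
proof (induction m)
  case 0
  show ?case
  proof (rule pol_cong[OF pol_zero])
    fix S :: "('r, 's) module" assume "algebra R S"
    then interpret S: algebra R S .
    show "(\<Oplus>\<^bsub>S\<^esub>i\<in>{..<0::nat}. p i S a) = \<zero>[S]" for a :: "nat => 's" by simp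
  qed
next
  case (Suc m)
  have "pol (\<lambda>S a. p m S a +[S] (\<Oplus>\<^bsub>S\<^esub>i\<in>{..<m}. p i S a))" by (rule pol_add) (use Suc in auto)
  then show ?case
  proof (rule pol_cong)
    fix S :: "('r, 's) module" and a :: "nat => 's" assume S: "algebra R S" and a: "\<forall>v. a v el S"
    then interpret S: algebra R S by simp
    show "(\<Oplus>\<^bsub>S\<^esub>i\<in>{..<Suc m}. p i S a) = p m S a +[S] (\<Oplus>\<^bsub>S\<^esub>i\<in>{..<m}. p i S a)"
      using pol_closed[OF _ S a] Suc.prems by (subst lessThan_Suc, subst S.finsum_insert) auto
  qed
qed

text \<open>Polynomials that agree on all points have the same class in \<open>CR\<close>, so they
  agree at the tuple of every homomorphism from \<open>CR\<close>, even before that tuple is known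
  to be a point.\<close>

lemma pol_eq:
  assumes p: "pol p" and p': "pol p'" and S: "algebra R S" and \<phi>: "\<phi> \<in> alg_hom R CR S"
    and eq: "\<And>S a. [|algebra R S; a \<in> Pts S|] ==> p S a = p' S a"
  shows "p S (pt \<phi>) = p' S (pt \<phi>)"
proof -
  obtain f where f: "f el A" "\<And>S a. [|algebra R S; \<forall>v. a v el S|] ==> p S a = ev S a f" using p by (rule polE) blast
  obtain g where g: "g el A" "\<And>S a. [|algebra R S; \<forall>v. a v el S|] ==> p' S a = ev S a g" using p' by (rule polE) blast
  have "cl f = cl g"
    by (rule cl_eqI) (use f g eq Pts_closed in \<open>auto simp: f(2)[symmetric] g(2)[symmetric]\<close>)
  then show ?thesis using alg_hom_ev[OF S \<phi> f(1)] alg_hom_ev[OF S \<phi> g(1)] f(2)[OF S alg_hom_cl(3)[OF \<phi>]] g(2)[OF S alg_hom_cl(3)[OF \<phi>]] by simp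
qed

end

section \<open>Functoriality, representability and transport along natural bijections\<close>

section \<open>The group schemes\<close>

lemma alg_hom_compose:
  assumes S: "algebra R S" and h: "h \<in> alg_hom R S T" and k: "k \<in> alg_hom R T U"
  shows "compose (carrier S) k h \<in> alg_hom R S U"
proof -
  interpret S: algebra R S by (rule S)
  have hh: "h \<in> ring_hom S T" "\<And>r x. [|r el R; x el S|] ==> h (r .[S] x) = r .[T] h x"
    and kk: "k \<in> ring_hom T U" "\<And>r x. [|r el R; x el T|] ==> k (r .[T] x) = r .[U] k x"
    using h k by (simp_all add: alg_hom_def)
  have "compose (carrier S) k h \<in> ring_hom S U"
    using ring_hom_closed[OF hh(1)] by (intro ring_hom_memI)
      (simp_all add: compose_def ring_hom_closed[OF kk(1)] ring_hom_mult[OF hh(1)] ring_hom_mult[OF kk(1)]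
        ring_hom_add[OF hh(1)] ring_hom_add[OF kk(1)] ring_hom_one[OF hh(1)] ring_hom_one[OF kk(1)])
  then show ?thesis using ring_hom_closed[OF hh(1)] by (simp add: alg_hom_def) (simp add: compose_def hh kk)
qed

lemma alg_hom_id: "algebra R S ==> (\<lambda>s\<in>carrier S. s) \<in> alg_hom R S S"
proof -
  assume "algebra R S"
  then interpret S: algebra R S .
  have "(\<lambda>s\<in>carrier S. s) \<in> ring_hom S S" by (rule ring_hom_memI) simp_all
  then show ?thesis by (simp add: alg_hom_def)
qed

lemma base_change_map_comp:
  assumes M: "module R M" and S: "algebra R S" and T: "algebra R T" and U: "algebra R U"
    and h: "h \<in> alg_hom R S T" and k: "k \<in> alg_hom R T U" and z: "z el (base_change R M S)"
  shows "base_change_map R M S U (compose (carrier S) k h) z = base_change_map R M T U k (base_change_map R M S T h z)"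
proof -
  interpret scalar_extension R M S using M S by (simp add: scalar_extension_def)
  note H = base_change_map_facts[OF M S T h] and K = base_change_map_facts[OF M T U k]
    and KH = base_change_map_facts[OF M S U alg_hom_compose[OF S h k]]
  have hc: "h s el T" if "s el S" for s using h that by (auto simp: alg_hom_def ring_hom_def)
  define g where "g = compose (carrier S) k h"
  have g: "g s = k (h s)" if "s el S" for s using that by (simp add: g_def compose_def)
  note KH = KH[folded g_def]
  show ?thesis unfolding g_def[symmetric] using z
    by (induction z rule: T_induct)
      (simp_all add: H(2) K(2) KH(2) hc g add_hom_add[OF H(1)] add_hom_add[OF K(1)] add_hom_add[OF KH(1)] add_hom_closed[OF H(1)])
qed

context octonionic_extension begin

lemma hS_eq: "hS r = r .[S] \<one>[S]"
  by (simp add: E.hS_def)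

lemma point_groups:
  "group (Spin_points R C q S)" "group (RT_points R C q S)" "F_map R C q S \<in> iso (Spin_points R C q S) (RT_points R C q S)"
  "carrier (RT_points R C q S) = OT.RT"
  unfolding points_eq using OT.group_SpinG OT.group_RTG OT.FF_iso OT.RTG_simps(1) by blast+

lemma RT_lin: "(t1, t2, t3) \<in> OT.RT ==> t1 \<in> lin_hom S T T \<and> t2 \<in> lin_hom S T T \<and> t3 \<in> lin_hom S T T"
  using OT.Og_facts(1) by (auto simp: OT.RT_def)

lemma End_map_identity:
  assumes t: "t \<in> lin_hom S T T"
  shows "End_map R C S S (\<lambda>s\<in>carrier S. s) t = t"
proof -
  define g where "g = (\<lambda>s\<in>carrier S. s)"
  have g: "g s = s" if "s el S" for s using that by (simp add: g_def)
  note H = base_change_map_facts[OF module_axioms S.algebra_axioms S.algebra_axioms alg_hom_id[OF S.algebra_axioms], folded g_def]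
  have id: "base_change_map R C S S g z = z" if "z el T" for z
    using that by (induction z rule: E.T_induct) (simp_all add: H(2) g add_hom_add[OF H(1)])
  show ?thesis unfolding End_map_def g_def[symmetric]
    by (rule the_equality) (use t id lin_homD(1)[OF t] lin_hom_eqI[OF _ t] in auto)
qed

end

context octonionic_map begin

lemma RT_action: "(\<lambda>(t1, t2, t3). (EMap t1, EMap t2, EMap t3)) \<in> hom (RT_points R C q S) (RT_points R C q V)"
proof (rule homI)
  fix t assume t: "t el (RT_points R C q S)"
  obtain t1 t2 t3 where tt: "t = (t1, t2, t3)" by (cases t)
  show "(case t of (t1, t2, t3) => (EMap t1, EMap t2, EMap t3)) el (RT_points R C q V)"
    using t End_map_RT[of t1 t2 t3] by (simp add: A.point_groups B.point_groups tt)
  fix s assume s: "s el (RT_points R C q S)"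
  obtain s1 s2 s3 where ss: "s = (s1, s2, s3)" by (cases s)
  show "(case t *[RT_points R C q S] s of (t1, t2, t3) => (EMap t1, EMap t2, EMap t3)) =
    (case t of (t1, t2, t3) => (EMap t1, EMap t2, EMap t3)) *[RT_points R C q V] (case s of (t1, t2, t3) => (EMap t1, EMap t2, EMap t3))"
    using t s A.RT_lin[of t1 t2 t3] A.RT_lin[of s1 s2 s3]
    by (simp add: A.point_groups tt ss) (simp add: A.points_eq B.points_eq A.OT.RTG_simps B.OT.RTG_simps End_map_comp)
qed

lemma Spin_action: "CMap \<in> hom (Spin_points R C q S) (Spin_points R C q V)"
  and F_natural: "u el (Spin_points R C q S) ==>
    F_map R C q V (CMap u) = (case F_map R C q S u of (t1, t2, t3) => (EMap t1, EMap t2, EMap t3))"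
proof -
  note m = Spin_map[OF _ A.OT.FF_def]
  have mu: "monoid.mult A.OT.SpinG = monoid.mult A.Q.CL" "monoid.mult B.OT.SpinG = monoid.mult B.Q.CL"
    by (simp_all add: A.OT.SpinG_def B.OT.SpinG_def)
  show "CMap \<in> hom (Spin_points R C q S) (Spin_points R C q V)"
    unfolding A.points_eq B.points_eq
    by (rule homI) (simp_all add: m(1) mu ring_hom_mult[OF Cl_map(1)] A.OT.Spin_RT(1))
  show "u el (Spin_points R C q S) ==>
    F_map R C q V (CMap u) = (case F_map R C q S u of (t1, t2, t3) => (EMap t1, EMap t2, EMap t3))"
    unfolding A.points_eq B.points_eq by (simp add: m(2)) (simp add: A.OT.FF_def)
qed

end

context octonionic begin

lemma extI: "algebra R S ==> octonionic_extension R C q S"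
  by (rule octonionic_extension.intro[OF octonionic_axioms])

lemma mapI: "[|algebra R S; algebra R T; h \<in> alg_hom R S T|] ==> octonionic_map R C q S T h"
  by (rule octonionic_map.intro[OF extI extI octonionic_map_axioms.intro])

lemma RT'_simps: "points (RT' R C q) = RT_points R C q"
  "action (RT' R C q) S T h = (\<lambda>(t1, t2, t3). (End_map R C S T h t1, End_map R C S T h t2, End_map R C S T h t3))"
  by (simp_all add: RT'_def)

lemma RT'_functor: "is_group_functor R (RT' R C q :: ('r, 's, _) group_functor)"
  unfolding is_group_functor_def RT'_simps
proof (intro conjI allI impI ballI)
  fix S :: "('r, 's) module" assume S: "algebra R S"
  show "group (RT_points R C q S)" by (rule octonionic_extension.point_groups(2)[OF extI[OF S]])
  fix g assume g: "g el (RT_points R C q S)"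
  obtain t1 t2 t3 where t: "g = (t1, t2, t3)" by (cases g)
  note E = extI[OF S]
  show "(case g of (t1, t2, t3) => (End_map R C S S (\<lambda>s\<in>carrier S. s) t1, End_map R C S S (\<lambda>s\<in>carrier S. s) t2, End_map R C S S (\<lambda>s\<in>carrier S. s) t3)) = g"
    using octonionic_extension.RT_lin[OF E] g octonionic_extension.End_map_identity[OF E]
    by (simp add: t octonionic_extension.point_groups(4)[OF E])
next
  fix S T :: "('r, 's) module" and h assume "algebra R S \<and> algebra R T" and h: "h \<in> alg_hom R S T"
  then show "(\<lambda>(t1, t2, t3). (End_map R C S T h t1, End_map R C S T h t2, End_map R C S T h t3)) \<in> hom (RT_points R C q S) (RT_points R C q T)"
    by (intro octonionic_map.RT_action[OF mapI]) auto
next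
  fix S T U :: "('r, 's) module" and h k g
  assume alg: "algebra R S \<and> algebra R T \<and> algebra R U" and h: "h \<in> alg_hom R S T" and k: "k \<in> alg_hom R T U"
    and g: "g el (RT_points R C q S)"
  have S: "algebra R S" and T: "algebra R T" and U: "algebra R U" using alg by auto
  obtain t1 t2 t3 where t: "g = (t1, t2, t3)" by (cases g)
  note ST = mapI[OF S T h] and TU = mapI[OF T U k] and SU = mapI[OF S U alg_hom_compose[OF S h k]]
  have eq: "End_map R C S U (compose (carrier S) k h) t = End_map R C T U k (End_map R C S T h t)"
    if t: "t \<in> lin_hom S (base_change R C S) (base_change R C S)" for t
  proof (rule octonionic_map.End_map_eqI[OF SU])
    note a = octonionic_map.End_map[OF ST t] and b = octonionic_map.End_map[OF TU octonionic_map.End_map(1)[OF ST t]]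
    show "End_map R C T U k (End_map R C S T h t) \<in> lin_hom U (base_change R C U) (base_change R C U)" by (rule b(1))
    fix z assume z: "z el (base_change R C S)"
    note comp = base_change_map_comp[OF module_axioms S T U h k]
    have Hz: "base_change_map R C S T h z el (base_change R C T)"
      by (rule octonionic_map.H_closed[OF ST z])
    show "End_map R C T U k (End_map R C S T h t) (base_change_map R C S U (compose (carrier S) k h) z) =
      base_change_map R C S U (compose (carrier S) k h) (t z)"
      unfolding comp[OF z] comp[OF lin_homD(1)[OF t z]] b(2)[OF Hz] a(2)[OF z] ..
  qed
  have "t1 \<in> lin_hom S (base_change R C S) (base_change R C S) \<and> t2 \<in> lin_hom S (base_change R C S) (base_change R C S) \<and>
    t3 \<in> lin_hom S (base_change R C S) (base_change R C S)"
    by (rule octonionic_extension.RT_lin[OF extI[OF S]]) (use g in \<open>simp add: t octonionic_extension.point_groups(4)[OF extI[OF S]]\<close>)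
  then show "(case g of (t1, t2, t3) => (End_map R C S U (compose (carrier S) k h) t1, End_map R C S U (compose (carrier S) k h) t2, End_map R C S U (compose (carrier S) k h) t3)) =
    (case case g of (t1, t2, t3) => (End_map R C S T h t1, End_map R C S T h t2, End_map R C S T h t3) of
      (t1, t2, t3) => (End_map R C T U k t1, End_map R C T U k t2, End_map R C T U k t3))"
    by (simp add: t eq)
qed

abbreviation "tmS S \<equiv> octonionic_extension.tm R C q S"
abbreviation "cfS S \<equiv> octonionic_extension.cf R C q S"
abbreviation "iiS S \<equiv> scalar_extension.ii R C S"
abbreviation "BS S \<equiv> polar S (base_change R C S) (base_change_form R C q S)"
abbreviation "cjS S \<equiv> conjugate S (base_change R C S) (base_change_form R C q S)"

text \<open>Both sides of each equation in \<open>RTptsI\<close> are shown to be polynomial;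
  \<open>pol_eq\<close> then carries the equations from points to arbitrary homomorphisms, which
  discharges the assumption of \<open>pt_bij\<close>. One dual pair and one element of trace one
  over \<open>R\<close> are fixed for all \<open>S\<close>, and this makes the coordinates
  natural.\<close>

lemma RT'_affine: "affine_group_scheme TYPE((nat list => 'r) set) R (RT' R C q :: ('r, 's, _) group_functor)"
proof -
  obtain n e f where d: "dual_pair n e f" using dual by blast
  note ef = dual_pairD(1,2)[OF d]
  obtain y where y: "y el C" "tr y = \<one>" using exists_tr_one by blast
  note D = octonionic_extension.RTptsD[OF extI d]
  interpret P: point_family R "\<lambda>S :: ('r, 's) module. octonionic_extension.RTpts R C q S n e f"
    by unfold_locales (rule D(1))
  note hSe = octonionic_extension.hS_eq[OF extI]
  have hS: "P.pol (\<lambda>S a. scalar_extension.hS S r)" if "r el R" for r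
    by (rule P.pol_cong[OF P.pol_const[OF that]]) (rule hSe)
  have cf: "P.pol (\<lambda>S a. cfS S n f a k (iiS S x) i)" if "x el C" for x k i
  proof (rule P.pol_cong)
    show "P.pol (\<lambda>S a. \<Oplus>\<^bsub>S\<^esub>j\<in>{..<n}. scalar_extension.hS S (b x (f j)) *[S] a (enc k i j))"
      by (intro P.pol_sum P.pol_mult hS P.pol_var) (use that ef in auto)
  qed (rule octonionic_extension.cf_ii[OF extI d _ that])
  have lin: "P.pol (\<lambda>S a. BS S (tmS S n e f a k (iiS S x)) (iiS S z))" if "x el C" "z el C" for x z k
  proof (rule P.pol_cong)
    show "P.pol (\<lambda>S a. \<Oplus>\<^bsub>S\<^esub>i\<in>{..<n}. cfS S n f a k (iiS S x) i *[S] scalar_extension.hS S (b (e i) z))"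
      by (intro P.pol_sum P.pol_mult hS cf) (use that ef in auto)
  qed (rule octonionic_extension.B_tm_ii[OF extI d _ that])
  have mul1: "P.pol (\<lambda>S a. BS S (tmS S n e f a k (iiS S x) *[base_change R C S] cjS S (tmS S n e f a k' (iiS S w))) (iiS S z))"
    if "x el C" "w el C" "z el C" for x w z k k'
  proof (rule P.pol_cong)
    show "P.pol (\<lambda>S a. \<Oplus>\<^bsub>S\<^esub>i\<in>{..<n}. cfS S n f a k (iiS S x) i *[S]
      (\<Oplus>\<^bsub>S\<^esub>j\<in>{..<n}. cfS S n f a k' (iiS S w) j *[S] scalar_extension.hS S (b (e i \<star> cj (e j)) z)))"
      by (intro P.pol_sum P.pol_mult hS cf) (use that ef in auto)
  qed (rule octonionic_extension.mult_tm_ii(1)[OF extI d _ that])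
  have mul2: "P.pol (\<lambda>S a. BS S (cjS S (tmS S n e f a k (iiS S x)) *[base_change R C S] cjS S (tmS S n e f a k' (iiS S w))) (iiS S z))"
    if "x el C" "w el C" "z el C" for x w z k k'
  proof (rule P.pol_cong)
    show "P.pol (\<lambda>S a. \<Oplus>\<^bsub>S\<^esub>i\<in>{..<n}. cfS S n f a k (iiS S x) i *[S]
      (\<Oplus>\<^bsub>S\<^esub>j\<in>{..<n}. cfS S n f a k' (iiS S w) j *[S] scalar_extension.hS S (b (cj (e i) \<star> cj (e j)) z)))"
      by (intro P.pol_sum P.pol_mult hS cf) (use that ef in auto)
  qed (rule octonionic_extension.mult_tm_ii(2)[OF extI d _ that])
  have closed: "P.pt \<phi> \<in> octonionic_extension.RTpts R C q S n e f" if S: "algebra R S" and \<phi>: "\<phi> \<in> alg_hom R P.CR S" for S :: "('r, 's) module" and \<phi>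
  proof (rule octonionic_extension.RTptsI[OF extI[OF S] d P.alg_hom_cl(3)[OF \<phi>] y])
    note eq = P.pol_eq[OF _ _ S \<phi>]
    show "BS S (tmS S n e f (P.pt \<phi>) k (iiS S (e j))) (iiS S (f i)) = P.pt \<phi> (enc k i j)" if "k < 3" "i < n" "j < n" for k i j
      by (rule eq[OF lin P.pol_var]) (use that ef D(2) in auto)
    show "P.pt \<phi> v = \<zero>[S]" if "\<nexists>k i j. k < 3 \<and> i < n \<and> j < n \<and> v = enc k i j" for v
      by (rule eq[OF P.pol_var P.pol_zero]) (rule D(3)[OF _ _ that])
    show "(\<Oplus>\<^bsub>S\<^esub>l\<in>{..<n}. BS S (tmS S n e f (P.pt \<phi>) k (iiS S (f l))) (iiS S x) *[S] BS S (tmS S n e f (P.pt \<phi>) k (iiS S (e l))) (iiS S z)) =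
      scalar_extension.hS S (b x z)" if "k < 3" "x el C" "z el C" for k x z
    proof (rule eq)
      show "P.pol (\<lambda>S a. \<Oplus>\<^bsub>S\<^esub>l\<in>{..<n}. BS S (tmS S n e f a k (iiS S (f l))) (iiS S x) *[S] BS S (tmS S n e f a k (iiS S (e l))) (iiS S z))"
        by (intro P.pol_sum P.pol_mult lin) (use that ef in auto)
    qed (rule hS, use that in simp, rule D(4)[OF _ _ that])
    show "BS S (tmS S n e f (P.pt \<phi>) k (iiS S x) *[base_change R C S] cjS S (tmS S n e f (P.pt \<phi>) k (iiS S x))) (iiS S y) =
      scalar_extension.hS S (q x \<otimes> tr y)" if "k < 3" "x el C" for k x
      by (rule eq[OF mul1 hS]) (use that y D(5)[OF _ _ that y(1)] in auto)
    show "BS S (tmS S n e f (P.pt \<phi>) 0 (iiS S (x \<star> w))) (iiS S z) =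
      BS S (cjS S (tmS S n e f (P.pt \<phi>) 1 (iiS S (cj x))) *[base_change R C S] cjS S (tmS S n e f (P.pt \<phi>) 2 (iiS S (cj w)))) (iiS S z)"
      if "x el C" "w el C" "z el C" for x w z
      by (rule eq[OF lin mul2]) (use that D(6)[OF _ _ that] in auto)
  qed
  define \<theta> where "\<theta> S \<phi> = octonionic_extension.triple R C q S n e f (P.pt \<phi>)" for S :: "('r, 's) module" and \<phi>
  have "bij_betw (\<theta> S) (alg_hom R P.CR S) (carrier (points (RT' R C q) S))" if S: "algebra R S" for S :: "('r, 's) module"
    unfolding \<theta>_def RT'_simps octonionic_extension.point_groups(4)[OF extI[OF S]]
    using bij_betw_trans[OF P.pt_bij[OF S closed[OF S]] octonionic_extension.triple_bij[OF extI[OF S] d]]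
    by (simp add: comp_def)
  moreover have "\<theta> T (compose (carrier P.CR) h \<phi>) = action (RT' R C q) S T h (\<theta> S \<phi>)"
    if S: "algebra R S" and T: "algebra R T" and h: "h \<in> alg_hom R S T" and \<phi>: "\<phi> \<in> alg_hom R P.CR S" for S T :: "('r, 's) module" and h \<phi>
  proof -
    have "P.pt (compose (carrier P.CR) h \<phi>) v = h (P.pt \<phi> v)" for v by (simp add: P.pt_def compose_def P.cl_simps)
    note nat = octonionic_map.triple_natural[OF mapI[OF S T h] d P.alg_hom_cl(3)[OF \<phi>] this]
    show ?thesis
      unfolding \<theta>_def RT'_simps octonionic_extension.triple_def[OF extI[OF S] d] octonionic_extension.triple_def[OF extI[OF T] d]
      by (simp add: nat)
  qed
  ultimately show ?thesis
    unfolding affine_group_scheme_def using RT'_functor P.algebra_CR by blast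
qed

end

text \<open>Functoriality and representability are transported from \<open>H\<close> to
  \<open>G\<close>. The identity and composition laws of \<open>G\<close> are checked after applying
  the injective natural map \<open>F\<close>, and the representing ring of \<open>H\<close>
  represents \<open>G\<close> through the inverse bijections.\<close>

lemma affine_group_scheme_isoI:
  assumes H: "affine_group_scheme (ty :: 'a itself) R (H :: ('r, 's, 'h) group_functor)"
    and grp: "\<And>S. algebra R S ==> group (points G S)"
    and hom: "\<And>S T h. [|algebra R S; algebra R T; h \<in> alg_hom R S T|] ==> action G S T h \<in> hom (points G S) (points G T)"
    and iso: "\<And>S. algebra R S ==> F S \<in> iso (points G S) (points H S)"
    and nat: "\<And>S T h g. [|algebra R S; algebra R T; h \<in> alg_hom R S T; g el (points G S)|]
      ==> F T (action G S T h g) = action H S T h (F S g)"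
  shows "affine_group_scheme_iso ty R G H F"
proof -
  have H1: "\<And>S g. [|algebra R S; g el (points H S)|] ==> action H S S (\<lambda>s\<in>carrier S. s) g = g"
    and H2: "\<And>S T U h k g. [|algebra R S; algebra R T; algebra R U; h \<in> alg_hom R S T; k \<in> alg_hom R T U; g el (points H S)|] ==>
      action H S U (compose (carrier S) k h) g = action H T U k (action H S T h g)"
    using H unfolding affine_group_scheme_def is_group_functor_def by blast+
  have F: "F S g el (points H S)" if "algebra R S" "g el (points G S)" for S g
    using iso[OF that(1)] that(2) by (auto simp: iso_def hom_def)
  have inj: "g = g'" if "algebra R S" "F S g = F S g'" "g el (points G S)" "g' el (points G S)" for S g g'
    using iso[OF that(1)] that by (auto simp: iso_def bij_betw_def inj_on_def)
  have closed: "action G S T h g el (points G T)" if "algebra R S" "algebra R T" "h \<in> alg_hom R S T" "g el (points G S)" for S T h g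
    using hom_in_carrier[OF hom[OF that(1-3)] that(4)] .
  have "is_group_functor R G"
    unfolding is_group_functor_def
  proof (intro conjI allI impI ballI)
    fix S :: "('r, 's) module" and g assume S: "algebra R S" and g: "g el (points G S)"
    note id = alg_hom_id[OF S]
    show "action G S S (\<lambda>s\<in>carrier S. s) g = g"
      by (rule inj[OF S _ closed[OF S S id g] g]) (simp only: nat[OF S S id g] H1[OF S F[OF S g]])
  next
    fix S T U :: "('r, 's) module" and h k g assume alg: "algebra R S \<and> algebra R T \<and> algebra R U" and h: "h \<in> alg_hom R S T" and k: "k \<in> alg_hom R T U"
      and g: "g el (points G S)"
    have S: "algebra R S" and T: "algebra R T" and U: "algebra R U" using alg by auto
    note kh = alg_hom_compose[OF S h k] and hg = closed[OF S T h g]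
    show "action G S U (compose (carrier S) k h) g = action G T U k (action G S T h g)"
      by (rule inj[OF U _ closed[OF S U kh g] closed[OF T U k hg]])
        (simp only: nat[OF S U kh g] nat[OF T U k hg] nat[OF S T h g] H2[OF S T U h k F[OF S g]])
  qed (use grp hom in auto)
  moreover have "\<exists>(A :: ('r, 'a) module) \<theta>. algebra R A \<and>
        (\<forall>S. algebra R S --> bij_betw (\<theta> S) (alg_hom R A S) (carrier (points G S))) \<and>
        (\<forall>S T. algebra R S \<and> algebra R T -->
           (\<forall>h \<in> alg_hom R S T. \<forall>\<phi> \<in> alg_hom R A S. \<theta> T (compose (carrier A) h \<phi>) = action G S T h (\<theta> S \<phi>)))"
  proof -
    obtain A :: "('r, 'a) module" and \<theta> where A: "algebra R A" and
      bij: "\<And>S. algebra R S ==> bij_betw (\<theta> S) (alg_hom R A S) (carrier (points H S))" and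
      \<theta>: "\<And>S T h \<phi>. [|algebra R S; algebra R T; h \<in> alg_hom R S T; \<phi> \<in> alg_hom R A S|] ==> \<theta> T (compose (carrier A) h \<phi>) = action H S T h (\<theta> S \<phi>)"
      using H unfolding affine_group_scheme_def by blast
    define \<eta> where "\<eta> S \<phi> = inv_into (carrier (points G S)) (F S) (\<theta> S \<phi>)" for S \<phi>
    have bF: "bij_betw (F S) (carrier (points G S)) (carrier (points H S))" if "algebra R S" for S
      using iso[OF that] by (simp add: iso_def)
    have \<eta>bij: "bij_betw (\<eta> S) (alg_hom R A S) (carrier (points G S))" if S: "algebra R S" for S
      using bij_betw_trans[OF bij[OF S] bij_betw_inv_into[OF bF[OF S]]] by (simp add: comp_def \<eta>_def[abs_def])
    have F\<eta>: "F S (\<eta> S \<phi>) = \<theta> S \<phi>" if S: "algebra R S" and \<phi>: "\<phi> \<in> alg_hom R A S" for S \<phi>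
      unfolding \<eta>_def by (rule bij_betw_inv_into_right[OF bF[OF S] bij_betwE[OF bij[OF S], rule_format, OF \<phi>]])
    have "\<eta> T (compose (carrier A) h \<phi>) = action G S T h (\<eta> S \<phi>)"
      if S: "algebra R S" and T: "algebra R T" and h: "h \<in> alg_hom R S T" and \<phi>: "\<phi> \<in> alg_hom R A S" for S T h \<phi>
    proof -
      note c = bij_betwE[OF \<eta>bij[OF S], rule_format, OF \<phi>] and h\<phi> = alg_hom_compose[OF A \<phi> h]
      show ?thesis
        by (rule inj[OF T _ bij_betwE[OF \<eta>bij[OF T], rule_format, OF h\<phi>] closed[OF S T h c]])
          (simp only: F\<eta>[OF T h\<phi>] nat[OF S T h c] F\<eta>[OF S \<phi>] \<theta>[OF S T h \<phi>])
    qed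
    then show ?thesis using A \<eta>bij by blast
  qed
  ultimately have "affine_group_scheme ty R G" unfolding affine_group_scheme_def by blast
  then show ?thesis unfolding affine_group_scheme_iso_def using H iso nat by blast
qed

theorem theorem3p12:
  fixes R :: "'r ring" and C :: "('r, 'c) module" and q :: "'c \<Rightarrow> 'r"
  assumes "octonion_algebra R C q"
  shows "affine_group_scheme_iso TYPE((nat list \<Rightarrow> 'r) set) R
    (Spin R C q :: ('r, 's, _) group_functor) (RT' R C q) (F_map R C q)"
proof -
  have o: "octonionic R C q" by (rule octonion_algebra.octonionic[OF assms])
  note ext = octonionic.extI[OF o] and map = octonionic.mapI[OF o]
  show ?thesis
  proof (rule affine_group_scheme_isoI[OF octonionic.RT'_affine[OF o]])
    fix S :: "('r, 's) module" assume S: "algebra R S"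
    show "group (points (Spin R C q) S)" using octonionic_extension.point_groups(1)[OF ext[OF S]] by (simp add: Spin_def)
    show "F_map R C q S \<in> iso (points (Spin R C q) S) (points (RT' R C q) S)"
      using octonionic_extension.point_groups(3)[OF ext[OF S]] by (simp add: Spin_def RT'_def)
  next
    fix S T :: "('r, 's) module" and h assume S: "algebra R S" and T: "algebra R T" and h: "h \<in> alg_hom R S T"
    show "action (Spin R C q) S T h \<in> hom (points (Spin R C q) S) (points (Spin R C q) T)"
      using octonionic_map.Spin_action[OF map[OF S T h]] by (simp add: Spin_def)
    fix g assume g: "g el (points (Spin R C q) S)"
    show "F_map R C q T (action (Spin R C q) S T h g) = action (RT' R C q) S T h (F_map R C q S g)"
      using octonionic_map.F_natural[OF map[OF S T h]] g by (simp add: Spin_def RT'_def)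
  qed
qed

end
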